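(* Let $\mathcal{C}$ be a semisimple monoidal category (abelian, over an algebraically closed field $k$, with finite dimensional Hom-spaces) with finitely many simple objects up to isomorphism. Then there exist a weak bialgebra $H$ over $k$ and a monoidal equivalence $\mathcal{C}\cong \mathrm{Rep}(H)$. Moreover, $H$ can be chosen so that its base is commutative.
   Context: Conventions: $k$ is an algebraically closed field; categories are $k$-linear abelian, and semisimple with finite dimensional Hom-spaces; functors (including the tensor product bifunctor, in each variable) are $k$-linear. A monoidal category has a tensor product, associativity isomorphisms and a unit object $\mathbf{1}$ with unit isomorphisms satisfying the pentagon and triangle axioms; rigidity and simplicity of $\mathbf{1}$ are not assumed. A weak bialgebra over $k$ is a finite dimensional vector space $H$ with an associative unital algebra structure $(H,m,1)$ and a coassociative counital coalgebra structure $(H,\Delta,\varepsilon)$ such that: (i) $\Delta(gh)=\Delta(g)\Delta(h)$ for all $g,h\in H$ (but $\Delta(1)=1\otimes 1$ is not required), and $(\Delta\otimes \mathrm{id})\Delta(1)=(\Delta(1)\otimes 1)(1\otimes\Delta(1))=(1\otimes\Delta(1))(\Delta(1)\otimes 1)$; (ii) $\varepsilon(fgh)=\varepsilon(fg^{(1)})\varepsilon(g^{(2)}h)=\varepsilon(fg^{(2)})\varepsilon(g^{(1)}h)$ for all $f,g,h\in H$, where $\Delta(g)=g^{(1)}\otimes g^{(2)}$ (Sweedler notation). The base of $H$ is the subalgebra $H_t=\varepsilon_t(H)$, where $\varepsilon_t(h)=\varepsilon(1^{(1)}h)1^{(2)}$. $\mathrm{Rep}(H)$ is the category of finite dimensional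 left $H$-modules. It is monoidal with $V\otimes W:=\Delta(1)(V\otimes_k W)$ (with $H$ acting through $\Delta$), associativity inherited from vector spaces, and unit object $H_t$ with action $h\cdot z=\varepsilon_t(hz)$. *)

theory Defs
  imports
    "HOL-Computational_Algebra.Polynomial"
    "HOL-Library.Function_Algebras"
    "HOL-Library.Nat_Bijection"
begin

section \<open>Linear categories\<close>

text \<open>
  Hom-sets, composition and the vector space operations are indexed by the objects involved. In
  particular the sets \<open>hom C X Y\<close> need not be disjoint, and all operations are only meaningful on
  objects in \<open>obj C\<close> and on morphisms in the appropriate hom-sets. \<open>cmp C X Y Z g f\<close> is the
  composite of \<open>f : X \<rightarrow> Y\<close> and \<open>g : Y \<rightarrow> Z\<close>.
\<close>

record ('o, 'm, 'k) lin_cat =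
  obj :: "'o set"
  hom :: "'o \<Rightarrow> 'o \<Rightarrow> 'm set"
  ident :: "'o \<Rightarrow> 'm"
  cmp :: "'o \<Rightarrow> 'o \<Rightarrow> 'o \<Rightarrow> 'm \<Rightarrow> 'm \<Rightarrow> 'm"
  hzero :: "'o \<Rightarrow> 'o \<Rightarrow> 'm"
  hadd :: "'o \<Rightarrow> 'o \<Rightarrow> 'm \<Rightarrow> 'm \<Rightarrow> 'm"
  hscale :: "'o \<Rightarrow> 'o \<Rightarrow> 'k \<Rightarrow> 'm \<Rightarrow> 'm"

locale vspace_on =
  fixes S :: "'m set" and zero :: 'm and add :: "'m \<Rightarrow> 'm \<Rightarrow> 'm"
    and scale :: "'k::field \<Rightarrow> 'm \<Rightarrow> 'm"
  assumes zero_in: "zero \<in> S"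
    and add_in: "\<And>x y. \<lbrakk>x \<in> S; y \<in> S\<rbrakk> \<Longrightarrow> add x y \<in> S"
    and scale_in: "\<And>a x. x \<in> S \<Longrightarrow> scale a x \<in> S"
    and add_assoc: "\<And>x y z. \<lbrakk>x \<in> S; y \<in> S; z \<in> S\<rbrakk> \<Longrightarrow> add (add x y) z = add x (add y z)"
    and add_commute: "\<And>x y. \<lbrakk>x \<in> S; y \<in> S\<rbrakk> \<Longrightarrow> add x y = add y x"
    and add_zero: "\<And>x. x \<in> S \<Longrightarrow> add zero x = x"
    and add_inverse: "\<And>x. x \<in> S \<Longrightarrow> \<exists>y\<in>S. add x y = zero"
    and scale_add_right: "\<And>a x y. \<lbrakk>x \<in> S; y \<in> S\<rbrakk> \<Longrightarrow> scale a (add x y) = add (scale a x) (scale a y)"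
    and scale_add_left: "\<And>a b x. x \<in> S \<Longrightarrow> scale (a + b) x = add (scale a x) (scale b x)"
    and scale_scale: "\<And>a b x. x \<in> S \<Longrightarrow> scale a (scale b x) = scale (a * b) x"
    and scale_one: "\<And>x. x \<in> S \<Longrightarrow> scale 1 x = x"

locale linear_category =
  fixes C :: "('o, 'm, 'k::field, 'z) lin_cat_scheme"
  assumes ident_in: "\<And>X. X \<in> obj C \<Longrightarrow> ident C X \<in> hom C X X"
    and cmp_in: "\<And>X Y Z f g. \<lbrakk>X \<in> obj C; Y \<in> obj C; Z \<in> obj C; f \<in> hom C X Y; g \<in> hom C Y Z\<rbrakk>
      \<Longrightarrow> cmp C X Y Z g f \<in> hom C X Z"
    and cmp_assoc: "\<And>W X Y Z f g h.
      \<lbrakk>W \<in> obj C; X \<in> obj C; Y \<in> obj C; Z \<in> obj C; f \<in> hom C W X; g \<in> hom C X Y; h \<in> hom C Y Z\<rbrakk>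
      \<Longrightarrow> cmp C W X Z (cmp C X Y Z h g) f = cmp C W Y Z h (cmp C W X Y g f)"
    and ident_left: "\<And>X Y f. \<lbrakk>X \<in> obj C; Y \<in> obj C; f \<in> hom C X Y\<rbrakk> \<Longrightarrow> cmp C X Y Y (ident C Y) f = f"
    and ident_right: "\<And>X Y f. \<lbrakk>X \<in> obj C; Y \<in> obj C; f \<in> hom C X Y\<rbrakk> \<Longrightarrow> cmp C X X Y f (ident C X) = f"
    and hom_vspace: "\<And>X Y. \<lbrakk>X \<in> obj C; Y \<in> obj C\<rbrakk>
      \<Longrightarrow> vspace_on (hom C X Y) (hzero C X Y) (hadd C X Y) (hscale C X Y)"
    and cmp_add_left: "\<And>X Y Z f g g'.
      \<lbrakk>X \<in> obj C; Y \<in> obj C; Z \<in> obj C; f \<in> hom C X Y; g \<in> hom C Y Z; g' \<in> hom C Y Z\<rbrakk>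
      \<Longrightarrow> cmp C X Y Z (hadd C Y Z g g') f = hadd C X Z (cmp C X Y Z g f) (cmp C X Y Z g' f)"
    and cmp_add_right: "\<And>X Y Z f f' g.
      \<lbrakk>X \<in> obj C; Y \<in> obj C; Z \<in> obj C; f \<in> hom C X Y; f' \<in> hom C X Y; g \<in> hom C Y Z\<rbrakk>
      \<Longrightarrow> cmp C X Y Z g (hadd C X Y f f') = hadd C X Z (cmp C X Y Z g f) (cmp C X Y Z g f')"
    and cmp_scale_left: "\<And>X Y Z f g a.
      \<lbrakk>X \<in> obj C; Y \<in> obj C; Z \<in> obj C; f \<in> hom C X Y; g \<in> hom C Y Z\<rbrakk>
      \<Longrightarrow> cmp C X Y Z (hscale C Y Z a g) f = hscale C X Z a (cmp C X Y Z g f)"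
    and cmp_scale_right: "\<And>X Y Z f g a.
      \<lbrakk>X \<in> obj C; Y \<in> obj C; Z \<in> obj C; f \<in> hom C X Y; g \<in> hom C Y Z\<rbrakk>
      \<Longrightarrow> cmp C X Y Z g (hscale C X Y a f) = hscale C X Z a (cmp C X Y Z g f)"

definition is_iso :: "('o, 'm, 'k, 'z) lin_cat_scheme \<Rightarrow> 'o \<Rightarrow> 'o \<Rightarrow> 'm \<Rightarrow> bool" where
  "is_iso C X Y f \<longleftrightarrow> f \<in> hom C X Y \<and>
     (\<exists>g\<in>hom C Y X. cmp C X Y X g f = ident C X \<and> cmp C Y X Y f g = ident C Y)"

definition isomorphic :: "('o, 'm, 'k, 'z) lin_cat_scheme \<Rightarrow> 'o \<Rightarrow> 'o \<Rightarrow> bool" where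
  "isomorphic C X Y \<longleftrightarrow> (\<exists>f. is_iso C X Y f)"

definition is_mono :: "('o, 'm, 'k, 'z) lin_cat_scheme \<Rightarrow> 'o \<Rightarrow> 'o \<Rightarrow> 'm \<Rightarrow> bool" where
  "is_mono C X Y f \<longleftrightarrow> f \<in> hom C X Y \<and>
     (\<forall>Z\<in>obj C. \<forall>g\<in>hom C Z X. \<forall>h\<in>hom C Z X. cmp C Z X Y f g = cmp C Z X Y f h \<longrightarrow> g = h)"

definition is_epi :: "('o, 'm, 'k, 'z) lin_cat_scheme \<Rightarrow> 'o \<Rightarrow> 'o \<Rightarrow> 'm \<Rightarrow> bool" where
  "is_epi C X Y f \<longleftrightarrow> f \<in> hom C X Y \<and>
     (\<forall>Z\<in>obj C. \<forall>g\<in>hom C Y Z. \<forall>h\<in>hom C Y Z. cmp C X Y Z g f = cmp C X Y Z h f \<longrightarrow> g = h)"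

definition is_kernel :: "('o, 'm, 'k, 'z) lin_cat_scheme \<Rightarrow> 'o \<Rightarrow> 'o \<Rightarrow> 'm \<Rightarrow> 'o \<Rightarrow> 'm \<Rightarrow> bool" where
  "is_kernel C X Y f K i \<longleftrightarrow> K \<in> obj C \<and> i \<in> hom C K X \<and> cmp C K X Y f i = hzero C K Y \<and>
     (\<forall>Z\<in>obj C. \<forall>g\<in>hom C Z X. cmp C Z X Y f g = hzero C Z Y \<longrightarrow>
        (\<exists>!u. u \<in> hom C Z K \<and> cmp C Z K X i u = g))"

definition is_cokernel :: "('o, 'm, 'k, 'z) lin_cat_scheme \<Rightarrow> 'o \<Rightarrow> 'o \<Rightarrow> 'm \<Rightarrow> 'o \<Rightarrow> 'm \<Rightarrow> bool" where
  "is_cokernel C X Y f Q p \<longleftrightarrow> Q \<in> obj C \<and> p \<in> hom C Y Q \<and> cmp C X Y Q p f = hzero C X Q \<and>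
     (\<forall>Z\<in>obj C. \<forall>g\<in>hom C Y Z. cmp C X Y Z g f = hzero C X Z \<longrightarrow>
        (\<exists>!u. u \<in> hom C Q Z \<and> cmp C Y Q Z u p = g))"

primrec hom_sum :: "('o, 'm, 'k, 'z) lin_cat_scheme \<Rightarrow> 'o \<Rightarrow> 'o \<Rightarrow> (nat \<Rightarrow> 'm) \<Rightarrow> nat \<Rightarrow> 'm" where
  "hom_sum C X Y f 0 = hzero C X Y"
| "hom_sum C X Y f (Suc n) = hadd C X Y (hom_sum C X Y f n) (f n)"

text \<open>
  \<open>X\<close> is the direct sum of \<open>S 0, \<dots>, S (n - 1)\<close> with inclusions \<open>i\<close> and projections \<open>p\<close>.
  For \<open>n = 0\<close> this says that \<open>X\<close> is a zero object.
\<close>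

definition direct_sum ::
  "('o, 'm, 'k, 'z) lin_cat_scheme \<Rightarrow> nat \<Rightarrow> (nat \<Rightarrow> 'o) \<Rightarrow> 'o \<Rightarrow> (nat \<Rightarrow> 'm) \<Rightarrow> (nat \<Rightarrow> 'm) \<Rightarrow> bool" where
  "direct_sum C n S X i p \<longleftrightarrow> X \<in> obj C \<and>
     (\<forall>j<n. S j \<in> obj C \<and> i j \<in> hom C (S j) X \<and> p j \<in> hom C X (S j)) \<and>
     (\<forall>j<n. \<forall>l<n. cmp C (S j) X (S l) (p l) (i j) =
        (if j = l then ident C (S j) else hzero C (S j) (S l))) \<and>
     hom_sum C X X (\<lambda>j. cmp C X (S j) X (i j) (p j)) n = ident C X"

locale abelian_category = linear_category +
  assumes direct_sum_ex: "\<And>n (S :: nat \<Rightarrow> _). (\<forall>j<n. S j \<in> obj C) \<Longrightarrow> \<exists>X i p. direct_sum C n S X i p"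
    and kernel_ex: "\<And>X Y f. \<lbrakk>X \<in> obj C; Y \<in> obj C; f \<in> hom C X Y\<rbrakk> \<Longrightarrow> \<exists>K i. is_kernel C X Y f K i"
    and cokernel_ex: "\<And>X Y f. \<lbrakk>X \<in> obj C; Y \<in> obj C; f \<in> hom C X Y\<rbrakk> \<Longrightarrow> \<exists>Q p. is_cokernel C X Y f Q p"
    and mono_is_kernel: "\<And>X Y f. \<lbrakk>X \<in> obj C; Y \<in> obj C; is_mono C X Y f\<rbrakk>
      \<Longrightarrow> \<exists>Z\<in>obj C. \<exists>g\<in>hom C Y Z. is_kernel C Y Z g X f"
    and epi_is_cokernel: "\<And>X Y f. \<lbrakk>X \<in> obj C; Y \<in> obj C; is_epi C X Y f\<rbrakk>
      \<Longrightarrow> \<exists>Z\<in>obj C. \<exists>g\<in>hom C Z X. is_cokernel C Z X g Y f"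

definition is_zero_obj :: "('o, 'm, 'k, 'z) lin_cat_scheme \<Rightarrow> 'o \<Rightarrow> bool" where
  "is_zero_obj C X \<longleftrightarrow> X \<in> obj C \<and> ident C X = hzero C X X"

definition is_simple :: "('o, 'm, 'k, 'z) lin_cat_scheme \<Rightarrow> 'o \<Rightarrow> bool" where
  "is_simple C X \<longleftrightarrow> X \<in> obj C \<and> \<not> is_zero_obj C X \<and>
     (\<forall>Y\<in>obj C. \<forall>f. is_mono C Y X f \<longrightarrow> is_zero_obj C Y \<or> is_iso C Y X f)"

definition semisimple :: "('o, 'm, 'k, 'z) lin_cat_scheme \<Rightarrow> bool" where
  "semisimple C \<longleftrightarrow>
     (\<forall>X\<in>obj C. \<exists>n S i p. (\<forall>j<n. is_simple C (S j)) \<and> direct_sum C n S X i p)"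

definition finite_dim_homs :: "('o, 'm, 'k, 'z) lin_cat_scheme \<Rightarrow> bool" where
  "finite_dim_homs C \<longleftrightarrow>
     (\<forall>X\<in>obj C. \<forall>Y\<in>obj C. \<exists>n b. (\<forall>j<n. b j \<in> hom C X Y) \<and>
        (\<forall>f\<in>hom C X Y. \<exists>c. f = hom_sum C X Y (\<lambda>j. hscale C X Y (c j) (b j)) n))"

definition finitely_many_simples :: "('o, 'm, 'k, 'z) lin_cat_scheme \<Rightarrow> bool" where
  "finitely_many_simples C \<longleftrightarrow>
     (\<exists>R. finite R \<and> (\<forall>S\<in>R. is_simple C S) \<and> (\<forall>X. is_simple C X \<longrightarrow> (\<exists>S\<in>R. isomorphic C X S)))"


section \<open>Monoidal categories\<close>

text \<open>
  For \<open>f : X \<rightarrow> X'\<close> and \<open>g : Y \<rightarrow> Y'\<close>, the morphism \<open>tmor C X X' Y Y' f g\<close> is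
  \<open>f \<otimes> g : X \<otimes> Y \<rightarrow> X' \<otimes> Y'\<close>.
\<close>

record ('o, 'm, 'k) mon_cat = "('o, 'm, 'k) lin_cat" +
  tobj :: "'o \<Rightarrow> 'o \<Rightarrow> 'o"
  tmor :: "'o \<Rightarrow> 'o \<Rightarrow> 'o \<Rightarrow> 'o \<Rightarrow> 'm \<Rightarrow> 'm \<Rightarrow> 'm"
  unit_obj :: 'o
  associator :: "'o \<Rightarrow> 'o \<Rightarrow> 'o \<Rightarrow> 'm"
  lunit :: "'o \<Rightarrow> 'm"
  runit :: "'o \<Rightarrow> 'm"

locale monoidal_category = linear_category C
  for C :: "('o, 'm, 'k::field, 'z) mon_cat_scheme" +
  assumes tobj_in: "\<And>X Y. \<lbrakk>X \<in> obj C; Y \<in> obj C\<rbrakk> \<Longrightarrow> tobj C X Y \<in> obj C"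
    and tmor_in: "\<And>X X' Y Y' f g.
      \<lbrakk>X \<in> obj C; X' \<in> obj C; Y \<in> obj C; Y' \<in> obj C; f \<in> hom C X X'; g \<in> hom C Y Y'\<rbrakk>
      \<Longrightarrow> tmor C X X' Y Y' f g \<in> hom C (tobj C X Y) (tobj C X' Y')"
    and tmor_ident: "\<And>X Y. \<lbrakk>X \<in> obj C; Y \<in> obj C\<rbrakk>
      \<Longrightarrow> tmor C X X Y Y (ident C X) (ident C Y) = ident C (tobj C X Y)"
    and tmor_cmp: "\<And>X X' X'' Y Y' Y'' f f' g g'.
      \<lbrakk>X \<in> obj C; X' \<in> obj C; X'' \<in> obj C; Y \<in> obj C; Y' \<in> obj C; Y'' \<in> obj C;
       f \<in> hom C X X'; f' \<in> hom C X' X''; g \<in> hom C Y Y'; g' \<in> hom C Y' Y''\<rbrakk>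
      \<Longrightarrow> tmor C X X'' Y Y'' (cmp C X X' X'' f' f) (cmp C Y Y' Y'' g' g)
        = cmp C (tobj C X Y) (tobj C X' Y') (tobj C X'' Y'')
            (tmor C X' X'' Y' Y'' f' g') (tmor C X X' Y Y' f g)"
    and tmor_add_left: "\<And>X X' Y Y' f f' g.
      \<lbrakk>X \<in> obj C; X' \<in> obj C; Y \<in> obj C; Y' \<in> obj C; f \<in> hom C X X'; f' \<in> hom C X X'; g \<in> hom C Y Y'\<rbrakk>
      \<Longrightarrow> tmor C X X' Y Y' (hadd C X X' f f') g
        = hadd C (tobj C X Y) (tobj C X' Y') (tmor C X X' Y Y' f g) (tmor C X X' Y Y' f' g)"
    and tmor_add_right: "\<And>X X' Y Y' f g g'.
      \<lbrakk>X \<in> obj C; X' \<in> obj C; Y \<in> obj C; Y' \<in> obj C; f \<in> hom C X X'; g \<in> hom C Y Y'; g' \<in> hom C Y Y'\<rbrakk>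
      \<Longrightarrow> tmor C X X' Y Y' f (hadd C Y Y' g g')
        = hadd C (tobj C X Y) (tobj C X' Y') (tmor C X X' Y Y' f g) (tmor C X X' Y Y' f g')"
    and tmor_scale_left: "\<And>X X' Y Y' a f g.
      \<lbrakk>X \<in> obj C; X' \<in> obj C; Y \<in> obj C; Y' \<in> obj C; f \<in> hom C X X'; g \<in> hom C Y Y'\<rbrakk>
      \<Longrightarrow> tmor C X X' Y Y' (hscale C X X' a f) g
        = hscale C (tobj C X Y) (tobj C X' Y') a (tmor C X X' Y Y' f g)"
    and tmor_scale_right: "\<And>X X' Y Y' a f g.
      \<lbrakk>X \<in> obj C; X' \<in> obj C; Y \<in> obj C; Y' \<in> obj C; f \<in> hom C X X'; g \<in> hom C Y Y'\<rbrakk>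
      \<Longrightarrow> tmor C X X' Y Y' f (hscale C Y Y' a g)
        = hscale C (tobj C X Y) (tobj C X' Y') a (tmor C X X' Y Y' f g)"
    and unit_obj_in: "unit_obj C \<in> obj C"
    and associator_iso: "\<And>X Y Z. \<lbrakk>X \<in> obj C; Y \<in> obj C; Z \<in> obj C\<rbrakk>
      \<Longrightarrow> is_iso C (tobj C (tobj C X Y) Z) (tobj C X (tobj C Y Z)) (associator C X Y Z)"
    and lunit_iso: "\<And>X. X \<in> obj C \<Longrightarrow> is_iso C (tobj C (unit_obj C) X) X (lunit C X)"
    and runit_iso: "\<And>X. X \<in> obj C \<Longrightarrow> is_iso C (tobj C X (unit_obj C)) X (runit C X)"
    and associator_natural: "\<And>X X' Y Y' Z Z' f g h.
      \<lbrakk>X \<in> obj C; X' \<in> obj C; Y \<in> obj C; Y' \<in> obj C; Z \<in> obj C; Z' \<in> obj C;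
       f \<in> hom C X X'; g \<in> hom C Y Y'; h \<in> hom C Z Z'\<rbrakk>
      \<Longrightarrow> cmp C (tobj C (tobj C X Y) Z) (tobj C (tobj C X' Y') Z') (tobj C X' (tobj C Y' Z'))
            (associator C X' Y' Z')
            (tmor C (tobj C X Y) (tobj C X' Y') Z Z' (tmor C X X' Y Y' f g) h)
        = cmp C (tobj C (tobj C X Y) Z) (tobj C X (tobj C Y Z)) (tobj C X' (tobj C Y' Z'))
            (tmor C X X' (tobj C Y Z) (tobj C Y' Z') f (tmor C Y Y' Z Z' g h))
            (associator C X Y Z)"
    and lunit_natural: "\<And>X Y f. \<lbrakk>X \<in> obj C; Y \<in> obj C; f \<in> hom C X Y\<rbrakk>
      \<Longrightarrow> cmp C (tobj C (unit_obj C) X) (tobj C (unit_obj C) Y) Y (lunit C Y)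
            (tmor C (unit_obj C) (unit_obj C) X Y (ident C (unit_obj C)) f)
        = cmp C (tobj C (unit_obj C) X) X Y f (lunit C X)"
    and runit_natural: "\<And>X Y f. \<lbrakk>X \<in> obj C; Y \<in> obj C; f \<in> hom C X Y\<rbrakk>
      \<Longrightarrow> cmp C (tobj C X (unit_obj C)) (tobj C Y (unit_obj C)) Y (runit C Y)
            (tmor C X Y (unit_obj C) (unit_obj C) f (ident C (unit_obj C)))
        = cmp C (tobj C X (unit_obj C)) X Y f (runit C X)"
    and pentagon: "\<And>W X Y Z. \<lbrakk>W \<in> obj C; X \<in> obj C; Y \<in> obj C; Z \<in> obj C\<rbrakk>
      \<Longrightarrow> cmp C (tobj C (tobj C (tobj C W X) Y) Z) (tobj C (tobj C W X) (tobj C Y Z))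
            (tobj C W (tobj C X (tobj C Y Z)))
            (associator C W X (tobj C Y Z))
            (associator C (tobj C W X) Y Z)
        = cmp C (tobj C (tobj C (tobj C W X) Y) Z) (tobj C W (tobj C (tobj C X Y) Z))
            (tobj C W (tobj C X (tobj C Y Z)))
            (tmor C W W (tobj C (tobj C X Y) Z) (tobj C X (tobj C Y Z)) (ident C W) (associator C X Y Z))
            (cmp C (tobj C (tobj C (tobj C W X) Y) Z) (tobj C (tobj C W (tobj C X Y)) Z)
               (tobj C W (tobj C (tobj C X Y) Z))
               (associator C W (tobj C X Y) Z)
               (tmor C (tobj C (tobj C W X) Y) (tobj C W (tobj C X Y)) Z Z (associator C W X Y) (ident C Z)))"
    and triangle: "\<And>X Y. \<lbrakk>X \<in> obj C; Y \<in> obj C\<rbrakk>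
      \<Longrightarrow> cmp C (tobj C (tobj C X (unit_obj C)) Y) (tobj C X (tobj C (unit_obj C) Y)) (tobj C X Y)
            (tmor C X X (tobj C (unit_obj C) Y) Y (ident C X) (lunit C Y))
            (associator C X (unit_obj C) Y)
        = tmor C (tobj C X (unit_obj C)) X Y Y (runit C X) (ident C Y)"

locale linear_functor = C: linear_category C + D: linear_category D
  for C :: "('o, 'm, 'k::field, 'z) lin_cat_scheme" and D :: "('p, 'n, 'k, 'y) lin_cat_scheme" +
  fixes Fo :: "'o \<Rightarrow> 'p" and Fm :: "'o \<Rightarrow> 'o \<Rightarrow> 'm \<Rightarrow> 'n"
  assumes Fo_in: "\<And>X. X \<in> obj C \<Longrightarrow> Fo X \<in> obj D"
    and Fm_in: "\<And>X Y f. \<lbrakk>X \<in> obj C; Y \<in> obj C; f \<in> hom C X Y\<rbrakk> \<Longrightarrow> Fm X Y f \<in> hom D (Fo X) (Fo Y)"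
    and Fm_ident: "\<And>X. X \<in> obj C \<Longrightarrow> Fm X X (ident C X) = ident D (Fo X)"
    and Fm_cmp: "\<And>X Y Z f g. \<lbrakk>X \<in> obj C; Y \<in> obj C; Z \<in> obj C; f \<in> hom C X Y; g \<in> hom C Y Z\<rbrakk>
      \<Longrightarrow> Fm X Z (cmp C X Y Z g f) = cmp D (Fo X) (Fo Y) (Fo Z) (Fm Y Z g) (Fm X Y f)"
    and Fm_add: "\<And>X Y f g. \<lbrakk>X \<in> obj C; Y \<in> obj C; f \<in> hom C X Y; g \<in> hom C X Y\<rbrakk>
      \<Longrightarrow> Fm X Y (hadd C X Y f g) = hadd D (Fo X) (Fo Y) (Fm X Y f) (Fm X Y g)"
    and Fm_scale: "\<And>X Y a f. \<lbrakk>X \<in> obj C; Y \<in> obj C; f \<in> hom C X Y\<rbrakk>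
      \<Longrightarrow> Fm X Y (hscale C X Y a f) = hscale D (Fo X) (Fo Y) a (Fm X Y f)"

definition natural_iso ::
  "('o, 'm, 'k, 'z) lin_cat_scheme \<Rightarrow> ('p, 'n, 'k, 'y) lin_cat_scheme
    \<Rightarrow> ('o \<Rightarrow> 'p) \<Rightarrow> ('o \<Rightarrow> 'o \<Rightarrow> 'm \<Rightarrow> 'n) \<Rightarrow> ('o \<Rightarrow> 'p) \<Rightarrow> ('o \<Rightarrow> 'o \<Rightarrow> 'm \<Rightarrow> 'n)
    \<Rightarrow> ('o \<Rightarrow> 'n) \<Rightarrow> bool" where
  "natural_iso C D Fo Fm Go Gm \<eta> \<longleftrightarrow>
     (\<forall>X\<in>obj C. is_iso D (Fo X) (Go X) (\<eta> X)) \<and>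
     (\<forall>X\<in>obj C. \<forall>Y\<in>obj C. \<forall>f\<in>hom C X Y.
        cmp D (Fo X) (Fo Y) (Go Y) (\<eta> Y) (Fm X Y f) = cmp D (Fo X) (Go X) (Go Y) (Gm X Y f) (\<eta> X))"

definition is_equivalence ::
  "('o, 'm, 'k::field, 'z) lin_cat_scheme \<Rightarrow> ('p, 'n, 'k, 'y) lin_cat_scheme
    \<Rightarrow> ('o \<Rightarrow> 'p) \<Rightarrow> ('o \<Rightarrow> 'o \<Rightarrow> 'm \<Rightarrow> 'n) \<Rightarrow> bool" where
  "is_equivalence C D Fo Fm \<longleftrightarrow> linear_functor C D Fo Fm \<and>
     (\<exists>Go Gm \<eta> \<theta>. linear_functor D C Go Gm \<and>
        natural_iso C C (\<lambda>X. X) (\<lambda>X Y f. f)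
          (\<lambda>X. Go (Fo X)) (\<lambda>X Y f. Gm (Fo X) (Fo Y) (Fm X Y f)) \<eta> \<and>
        natural_iso D D (\<lambda>V. Fo (Go V)) (\<lambda>V W f. Fm (Go V) (Go W) (Gm V W f))
          (\<lambda>V. V) (\<lambda>V W f. f) \<theta>)"

text \<open>
  Strong monoidal functors: \<open>J X Y : F X \<otimes> F Y \<rightarrow> F (X \<otimes> Y)\<close> and \<open>\<phi> : \<one> \<rightarrow> F \<one>\<close> are isomorphisms.
\<close>

locale monoidal_functor = C: monoidal_category C + D: monoidal_category D + linear_functor C D Fo Fm
  for C :: "('o, 'm, 'k::field, 'z) mon_cat_scheme" and D :: "('p, 'n, 'k, 'y) mon_cat_scheme"
    and Fo :: "'o \<Rightarrow> 'p" and Fm :: "'o \<Rightarrow> 'o \<Rightarrow> 'm \<Rightarrow> 'n" +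
  fixes J :: "'o \<Rightarrow> 'o \<Rightarrow> 'n" and \<phi> :: 'n
  assumes J_iso: "\<And>X Y. \<lbrakk>X \<in> obj C; Y \<in> obj C\<rbrakk>
      \<Longrightarrow> is_iso D (tobj D (Fo X) (Fo Y)) (Fo (tobj C X Y)) (J X Y)"
    and J_natural: "\<And>X X' Y Y' f g.
      \<lbrakk>X \<in> obj C; X' \<in> obj C; Y \<in> obj C; Y' \<in> obj C; f \<in> hom C X X'; g \<in> hom C Y Y'\<rbrakk>
      \<Longrightarrow> cmp D (tobj D (Fo X) (Fo Y)) (tobj D (Fo X') (Fo Y')) (Fo (tobj C X' Y'))
            (J X' Y') (tmor D (Fo X) (Fo X') (Fo Y) (Fo Y') (Fm X X' f) (Fm Y Y' g))
        = cmp D (tobj D (Fo X) (Fo Y)) (Fo (tobj C X Y)) (Fo (tobj C X' Y'))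
            (Fm (tobj C X Y) (tobj C X' Y') (tmor C X X' Y Y' f g)) (J X Y)"
    and \<phi>_iso: "is_iso D (unit_obj D) (Fo (unit_obj C)) \<phi>"
    and J_associator: "\<And>X Y Z. \<lbrakk>X \<in> obj C; Y \<in> obj C; Z \<in> obj C\<rbrakk>
      \<Longrightarrow> cmp D (tobj D (tobj D (Fo X) (Fo Y)) (Fo Z)) (Fo (tobj C (tobj C X Y) Z))
            (Fo (tobj C X (tobj C Y Z)))
            (Fm (tobj C (tobj C X Y) Z) (tobj C X (tobj C Y Z)) (associator C X Y Z))
            (cmp D (tobj D (tobj D (Fo X) (Fo Y)) (Fo Z)) (tobj D (Fo (tobj C X Y)) (Fo Z))
               (Fo (tobj C (tobj C X Y) Z))
               (J (tobj C X Y) Z)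
               (tmor D (tobj D (Fo X) (Fo Y)) (Fo (tobj C X Y)) (Fo Z) (Fo Z) (J X Y) (ident D (Fo Z))))
        = cmp D (tobj D (tobj D (Fo X) (Fo Y)) (Fo Z)) (tobj D (Fo X) (Fo (tobj C Y Z)))
            (Fo (tobj C X (tobj C Y Z)))
            (J X (tobj C Y Z))
            (cmp D (tobj D (tobj D (Fo X) (Fo Y)) (Fo Z)) (tobj D (Fo X) (tobj D (Fo Y) (Fo Z)))
               (tobj D (Fo X) (Fo (tobj C Y Z)))
               (tmor D (Fo X) (Fo X) (tobj D (Fo Y) (Fo Z)) (Fo (tobj C Y Z)) (ident D (Fo X)) (J Y Z))
               (associator D (Fo X) (Fo Y) (Fo Z)))"
    and J_lunit: "\<And>X. X \<in> obj C
      \<Longrightarrow> cmp D (tobj D (unit_obj D) (Fo X)) (Fo (tobj C (unit_obj C) X)) (Fo X)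
            (Fm (tobj C (unit_obj C) X) X (lunit C X))
            (cmp D (tobj D (unit_obj D) (Fo X)) (tobj D (Fo (unit_obj C)) (Fo X))
               (Fo (tobj C (unit_obj C) X))
               (J (unit_obj C) X)
               (tmor D (unit_obj D) (Fo (unit_obj C)) (Fo X) (Fo X) \<phi> (ident D (Fo X))))
        = lunit D (Fo X)"
    and J_runit: "\<And>X. X \<in> obj C
      \<Longrightarrow> cmp D (tobj D (Fo X) (unit_obj D)) (Fo (tobj C X (unit_obj C))) (Fo X)
            (Fm (tobj C X (unit_obj C)) X (runit C X))
            (cmp D (tobj D (Fo X) (unit_obj D)) (tobj D (Fo X) (Fo (unit_obj C)))
               (Fo (tobj C X (unit_obj C)))
               (J X (unit_obj C))
               (tmor D (Fo X) (Fo X) (unit_obj D) (Fo (unit_obj C)) (ident D (Fo X)) \<phi>))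
        = runit D (Fo X)"

definition monoidally_equivalent ::
  "('o, 'm, 'k::field, 'z) mon_cat_scheme \<Rightarrow> ('p, 'n, 'k, 'y) mon_cat_scheme \<Rightarrow> bool" where
  "monoidally_equivalent C D \<longleftrightarrow>
     (\<exists>Fo Fm J \<phi>. monoidal_functor C D Fo Fm J \<phi> \<and> is_equivalence C D Fo Fm)"


section \<open>Finite dimensional vector spaces and their tensor products\<close>

text \<open>
  Finite dimensional vector spaces are realised as finite dimensional subspaces of the sequence
  space \<open>nat \<Rightarrow> 'k\<close>; every finite dimensional vector space is isomorphic to one of these. Identifying
  \<open>nat \<times> nat\<close> with \<open>nat\<close>, the tensor product of two such subspaces is again one: the bilinear map
  \<open>tens\<close> sends pairs of bases of \<open>V\<close> and \<open>W\<close> to linearly independent families.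
\<close>

type_synonym 'k seq = "nat \<Rightarrow> 'k"

definition vscale :: "'k::field \<Rightarrow> 'k seq \<Rightarrow> 'k seq" where
  "vscale c v = (\<lambda>i. c * v i)"

global_interpretation vec: vector_space vscale
  by unfold_locales (auto simp: vscale_def fun_eq_iff algebra_simps)

definition fin_dim :: "'k::field seq set \<Rightarrow> bool" where
  "fin_dim V \<longleftrightarrow> (\<exists>B. finite B \<and> vec.span B = V)"

definition lin_on :: "'k::field seq set \<Rightarrow> 'k seq set \<Rightarrow> ('k seq \<Rightarrow> 'k seq) \<Rightarrow> bool" where
  "lin_on V W f \<longleftrightarrow> (\<forall>x\<in>V. f x \<in> W) \<and> (\<forall>x\<in>V. \<forall>y\<in>V. f (x + y) = f x + f y) \<and>
     (\<forall>a. \<forall>x\<in>V. f (vscale a x) = vscale a (f x))"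

definition bilin_on ::
  "'k::field seq set \<Rightarrow> 'k seq set \<Rightarrow> 'k seq set \<Rightarrow> ('k seq \<Rightarrow> 'k seq \<Rightarrow> 'k seq) \<Rightarrow> bool" where
  "bilin_on U V W b \<longleftrightarrow> (\<forall>u\<in>U. lin_on V W (b u)) \<and> (\<forall>v\<in>V. lin_on U W (\<lambda>u. b u v))"

definition tens :: "'k::field seq \<Rightarrow> 'k seq \<Rightarrow> 'k seq" where
  "tens v w = (\<lambda>n. v (fst (prod_decode n)) * w (snd (prod_decode n)))"

definition tens_space :: "'k::field seq set \<Rightarrow> 'k seq set \<Rightarrow> 'k seq set" where
  "tens_space V W = vec.span {tens v w |v w. v \<in> V \<and> w \<in> W}"

text \<open>
  The value at \<open>t \<in> V \<otimes> W\<close> of the linear map on \<open>V \<otimes> W\<close> induced by a bilinear map \<open>b\<close> on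
  \<open>V \<times> W\<close>; in Sweedler notation this is \<open>b t\<^sup>(\<^sup>1\<^sup>) t\<^sup>(\<^sup>2\<^sup>)\<close>. The value is determined uniquely: see
  \<open>tens_lift_sum\<close> below.
\<close>

definition tens_lift ::
  "'k::field seq set \<Rightarrow> 'k seq set \<Rightarrow> ('k seq \<Rightarrow> 'k seq \<Rightarrow> 'c::comm_monoid_add) \<Rightarrow> 'k seq \<Rightarrow> 'c" where
  "tens_lift V W b t = (THE y. \<exists>(n::nat) v w. (\<forall>i<n. v i \<in> V \<and> w i \<in> W) \<and>
     t = (\<Sum>i<n. tens (v i) (w i)) \<and> y = (\<Sum>i<n. b (v i) (w i)))"

lemma tens_add_left: "tens (u + v) w = tens u w + tens v w"
  by (simp add: tens_def fun_eq_iff algebra_simps)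
lemma tens_add_right: "tens u (v + w) = tens u v + tens u w"
  by (simp add: tens_def fun_eq_iff algebra_simps)
lemma tens_vscale: "tens (vscale c u) w = tens u (vscale c w)"
  by (simp add: tens_def vscale_def fun_eq_iff algebra_simps)

lemma fun_sum_apply: "(\<Sum>i\<in>A. f i) x = (\<Sum>i\<in>A. f i x)"
  for f :: "'i \<Rightarrow> 'x \<Rightarrow> 'c::comm_monoid_add"
  by (induction A rule: infinite_finite_induct) auto

lemma tens_relation:
  fixes b :: "'k::field seq \<Rightarrow> 'k seq \<Rightarrow> 'c::ab_group_add"
  assumes V: "vec.subspace V" and W: "vec.subspace W"
    and addl: "\<And>u v w. \<lbrakk>u \<in> V; v \<in> V; w \<in> W\<rbrakk> \<Longrightarrow> b (u + v) w = b u w + b v w"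
    and addr: "\<And>u v w. \<lbrakk>u \<in> V; v \<in> W; w \<in> W\<rbrakk> \<Longrightarrow> b u (v + w) = b u v + b u w"
    and bal: "\<And>c v w. \<lbrakk>v \<in> V; w \<in> W\<rbrakk> \<Longrightarrow> b (vscale c v) w = b v (vscale c w)"
    and "\<forall>i<(n::nat). v i \<in> V \<and> w i \<in> W"
    and "(\<Sum>i<n. tens (v i) (w i)) = 0"
  shows "(\<Sum>i<n. b (v i) (w i)) = 0"
  using assms(6,7)
proof (induction n arbitrary: v)
  case 0
  then show ?case by simp
next
  case (Suc n)
  have vn: "v n \<in> V" and wn: "w n \<in> W" using Suc.prems by auto
  have b0: "b 0 y = 0" if "y \<in> W" for y
    using addl[of 0 0 y] that vec.subspace_0[OF V] by simp
  have b0r: "b x 0 = 0" if "x \<in> V" for x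
    using addr[of x 0 0] that vec.subspace_0[OF W] by simp
  show ?case
  proof (cases "v n = 0")
    case True
    then have "tens (v n) (w n) = 0" by (simp add: tens_def fun_eq_iff)
    then show ?thesis using Suc.IH[of v] Suc.prems True b0[OF wn] by simp
  next
    case False
    then obtain a where a: "v n a \<noteq> 0" by (auto simp: fun_eq_iff)
    define c where "c i = - (v i a / v n a)" for i
    have eq: "(\<Sum>i<n. v i x * w i y) + v n x * w n y = 0" for x y
    proof -
      have "(\<Sum>i<Suc n. tens (v i) (w i)) (prod_encode (x, y)) = 0"
        unfolding Suc.prems(2) by simp
      then show ?thesis by (simp add: fun_sum_apply tens_def)
    qed
    have wn_eq: "w n = (\<Sum>i<n. vscale (c i) (w i))"
    proof
      fix y
      have "v n a * w n y = - (\<Sum>i<n. v i a * w i y)" using eq[of a y] by (simp add: eq_neg_iff_add_eq_0 add.commute)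
      then have "w n y = - (\<Sum>i<n. v i a * w i y) / v n a" using a by (simp add: field_simps)
      also have "\<dots> = (\<Sum>i<n. c i * w i y)"
        by (simp add: c_def sum_negf sum_divide_distrib)
      finally show "w n y = (\<Sum>i<n. vscale (c i) (w i)) y" by (simp add: fun_sum_apply vscale_def)
    qed
    define v' where "v' i = v i + vscale (c i) (v n)" for i
    have wi: "w i \<in> W" and vi: "v i \<in> V" if "i < n" for i using Suc.prems that by auto
    have sV: "vscale (c i) (v n) \<in> V" for i using vn V by (simp add: vec.subspace_scale)
    have v'V: "\<forall>i<n. v' i \<in> V \<and> w i \<in> W"
      using vi wi sV V by (auto simp: v'_def intro: vec.subspace_add)
    have tsum: "tens x (\<Sum>i\<in>A. f i) = (\<Sum>i\<in>A. tens x (f i))" for x and A :: "nat set" and f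
      by (simp add: tens_def fun_eq_iff fun_sum_apply sum_distrib_left)
    have "(\<Sum>i<n. tens (v' i) (w i)) = (\<Sum>i<n. tens (v i) (w i)) + tens (v n) (w n)"
      by (subst wn_eq) (simp add: v'_def tens_add_left tens_vscale sum.distrib tsum)
    then have "(\<Sum>i<n. b (v' i) (w i)) = 0" using Suc.IH[OF v'V] Suc.prems by simp
    moreover have "b (v' i) (w i) = b (v i) (w i) + b (v n) (vscale (c i) (w i))" if "i < n" for i
      using that vi wi sV vn by (simp add: v'_def addl bal)
    moreover have "b (v n) (\<Sum>i<m. vscale (c i) (w i)) = (\<Sum>i<m. b (v n) (vscale (c i) (w i)))
        \<and> (\<Sum>i<m. vscale (c i) (w i)) \<in> W" if "m \<le> n" for m
      using that
    proof (induction m)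
      case 0
      then show ?case using b0r[OF vn] vec.subspace_0[OF W] by (simp add: zero_fun_def)
    next
      case (Suc m)
      then have wm: "vscale (c m) (w m) \<in> W" using wi W by (simp add: vec.subspace_scale)
      have IH: "b (v n) (\<Sum>i<m. vscale (c i) (w i)) = (\<Sum>i<m. b (v n) (vscale (c i) (w i)))"
        "(\<Sum>i<m. vscale (c i) (w i)) \<in> W" using Suc by auto
      show ?case
        unfolding sum.lessThan_Suc using addr[OF vn IH(2) wm] IH(1) vec.subspace_add[OF W IH(2) wm] by metis
    qed
    ultimately have "0 = (\<Sum>i<n. b (v i) (w i)) + b (v n) (\<Sum>i<n. vscale (c i) (w i))"
      by (simp add: sum.distrib)
    then show ?thesis using wn_eq by simp
  qed
qed

lemma tens_lift_sum:
  fixes b :: "'k::field seq \<Rightarrow> 'k seq \<Rightarrow> 'c::ab_group_add"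
  assumes V: "vec.subspace V" and W: "vec.subspace W"
    and addl: "\<And>u v w. \<lbrakk>u \<in> V; v \<in> V; w \<in> W\<rbrakk> \<Longrightarrow> b (u + v) w = b u w + b v w"
    and addr: "\<And>u v w. \<lbrakk>u \<in> V; v \<in> W; w \<in> W\<rbrakk> \<Longrightarrow> b u (v + w) = b u v + b u w"
    and bal: "\<And>c v w. \<lbrakk>v \<in> V; w \<in> W\<rbrakk> \<Longrightarrow> b (vscale c v) w = b v (vscale c w)"
    and vw: "\<forall>i<(n::nat). v i \<in> V \<and> w i \<in> W"
  shows "tens_lift V W b (\<Sum>i<n. tens (v i) (w i)) = (\<Sum>i<n. b (v i) (w i))"
  unfolding tens_lift_def
proof (rule the_equality)
  show "\<exists>m v' w'. (\<forall>i<m. v' i \<in> V \<and> w' i \<in> W) \<and>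
     (\<Sum>i<n. tens (v i) (w i)) = (\<Sum>i<(m::nat). tens (v' i) (w' i)) \<and>
     (\<Sum>i<n. b (v i) (w i)) = (\<Sum>i<m. b (v' i) (w' i))"
    using vw by blast
next
  fix y assume "\<exists>m v' w'. (\<forall>i<m. v' i \<in> V \<and> w' i \<in> W) \<and>
     (\<Sum>i<n. tens (v i) (w i)) = (\<Sum>i<(m::nat). tens (v' i) (w' i)) \<and>
     y = (\<Sum>i<m. b (v' i) (w' i))"
  then obtain m v' w' where m: "\<forall>i<m. v' i \<in> V \<and> w' i \<in> W"
    "(\<Sum>i<n. tens (v i) (w i)) = (\<Sum>i<(m::nat). tens (v' i) (w' i))"
    "y = (\<Sum>i<m. b (v' i) (w' i))" by blast
  define x where "x i = (if i < n then v i else vscale (-1) (v' (i - n)))" for i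
  define z where "z i = (if i < n then w i else w' (i - n))" for i
  have split: "(\<Sum>i<n + m. g i) = (\<Sum>i<n. g i) + (\<Sum>i<m. g (n + i))" for g :: "nat \<Rightarrow> 'd::ab_group_add"
    by (induction m) (simp_all add: add.assoc)
  have xz: "\<forall>i<n+m. x i \<in> V \<and> z i \<in> W"
    using vw m(1) V by (auto simp: x_def z_def vec.subspace_neg vec.subspace_scale)
  have "tens (vscale (-1) p) q = - tens p q" for p q :: "'k seq"
    by (simp add: tens_def vscale_def fun_eq_iff)
  then have "(\<Sum>i<n + m. tens (x i) (z i)) = 0"
    unfolding split using m(2) by (simp add: x_def z_def sum_negf)
  then have *: "(\<Sum>i<n + m. b (x i) (z i)) = 0"
    using tens_relation[of V W b "n + m" x z] V W addl addr bal xz by blast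
  have "b (vscale (-1) p) q = - b p q" if "p \<in> V" "q \<in> W" for p q
  proof -
    have "vscale (-1) p \<in> V" using vec.subspace_scale[OF V that(1)] .
    then have "b (p + vscale (-1) p) q = b p q + b (vscale (-1) p) q" using addl that by blast
    moreover have "p + vscale (-1) p = 0" by (simp add: vscale_def fun_eq_iff)
    moreover have "b 0 q = 0" using addl[of 0 0 q] that vec.subspace_0[OF V] by simp
    ultimately show ?thesis by (simp add: eq_neg_iff_add_eq_0 add.commute)
  qed
  then have "(\<Sum>i<m. b (x (n + i)) (z (n + i))) = - y"
    using m by (simp add: x_def z_def sum_negf)
  with * show "y = (\<Sum>i<n. b (v i) (w i))" unfolding split by (simp add: x_def z_def)
qed

definition reassoc :: "'k seq \<Rightarrow> 'k seq" where
  "reassoc t = (\<lambda>n. case prod_decode n of (i, m) \<Rightarrow> case prod_decode m of (j, l) \<Rightarrow>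
     t (prod_encode (prod_encode (i, j), l)))"

lemma reassoc_tens: "reassoc (tens (tens u v) w) = tens u (tens v w)"
  by (auto simp: reassoc_def tens_def fun_eq_iff split: prod.splits)

text \<open>The product of \<open>x, y \<in> A \<otimes> B\<close> for algebras \<open>A\<close>, \<open>B\<close> with products \<open>mA\<close>, \<open>mB\<close>.\<close>

definition tens_mult ::
  "'k::field seq set \<Rightarrow> ('k seq \<Rightarrow> 'k seq \<Rightarrow> 'k seq) \<Rightarrow> 'k seq set \<Rightarrow> ('k seq \<Rightarrow> 'k seq \<Rightarrow> 'k seq)
    \<Rightarrow> 'k seq \<Rightarrow> 'k seq \<Rightarrow> 'k seq" where
  "tens_mult A mA B mB x y =
     tens_lift A B (\<lambda>a b. tens_lift A B (\<lambda>a' b'. tens (mA a a') (mB b b')) y) x"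


section \<open>Weak bialgebras\<close>

record 'k wbialg =
  carr :: "'k seq set"
  mult :: "'k seq \<Rightarrow> 'k seq \<Rightarrow> 'k seq"
  one :: "'k seq"
  comult :: "'k seq \<Rightarrow> 'k seq"
  counit :: "'k seq \<Rightarrow> 'k"

definition mult2 :: "'k::field wbialg \<Rightarrow> 'k seq \<Rightarrow> 'k seq \<Rightarrow> 'k seq" where
  "mult2 H = tens_mult (carr H) (mult H) (carr H) (mult H)"

text \<open>Triple tensor products are bracketed to the right, as \<open>H \<otimes> (H \<otimes> H)\<close>.\<close>

definition mult3 :: "'k::field wbialg \<Rightarrow> 'k seq \<Rightarrow> 'k seq \<Rightarrow> 'k seq" where
  "mult3 H = tens_mult (carr H) (mult H) (tens_space (carr H) (carr H)) (mult2 H)"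

definition comult_left :: "'k::field wbialg \<Rightarrow> 'k seq \<Rightarrow> 'k seq" where
  "comult_left H h = reassoc (tens_lift (carr H) (carr H) (\<lambda>a b. tens (comult H a) b) (comult H h))"

definition comult_right :: "'k::field wbialg \<Rightarrow> 'k seq \<Rightarrow> 'k seq" where
  "comult_right H h = tens_lift (carr H) (carr H) (\<lambda>a b. tens a (comult H b)) (comult H h)"

locale weak_bialgebra =
  fixes H :: "'k::field wbialg"
  assumes carr_fin_dim: "fin_dim (carr H)"
    and mult_bilin: "bilin_on (carr H) (carr H) (carr H) (mult H)"
    and mult_assoc: "\<And>x y z. \<lbrakk>x \<in> carr H; y \<in> carr H; z \<in> carr H\<rbrakk>
      \<Longrightarrow> mult H (mult H x y) z = mult H x (mult H y z)"
    and one_in: "one H \<in> carr H"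
    and one_left: "\<And>x. x \<in> carr H \<Longrightarrow> mult H (one H) x = x"
    and one_right: "\<And>x. x \<in> carr H \<Longrightarrow> mult H x (one H) = x"
    and comult_lin: "lin_on (carr H) (tens_space (carr H) (carr H)) (comult H)"
    and counit_add: "\<And>x y. \<lbrakk>x \<in> carr H; y \<in> carr H\<rbrakk> \<Longrightarrow> counit H (x + y) = counit H x + counit H y"
    and counit_scale: "\<And>a x. x \<in> carr H \<Longrightarrow> counit H (vscale a x) = a * counit H x"
    and coassoc: "\<And>h. h \<in> carr H \<Longrightarrow> comult_left H h = comult_right H h"
    and counit_left: "\<And>h. h \<in> carr H \<Longrightarrow>
      tens_lift (carr H) (carr H) (\<lambda>a b. vscale (counit H a) b) (comult H h) = h"
    and counit_right: "\<And>h. h \<in> carr H \<Longrightarrow>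
      tens_lift (carr H) (carr H) (\<lambda>a b. vscale (counit H b) a) (comult H h) = h"
    and comult_mult: "\<And>g h. \<lbrakk>g \<in> carr H; h \<in> carr H\<rbrakk>
      \<Longrightarrow> comult H (mult H g h) = mult2 H (comult H g) (comult H h)"
    and comult_one: "comult_left H (one H) =
      mult3 H (reassoc (tens (comult H (one H)) (one H))) (tens (one H) (comult H (one H)))"
    and comult_one': "comult_left H (one H) =
      mult3 H (tens (one H) (comult H (one H))) (reassoc (tens (comult H (one H)) (one H)))"
    and counit_mult: "\<And>f g h. \<lbrakk>f \<in> carr H; g \<in> carr H; h \<in> carr H\<rbrakk>
      \<Longrightarrow> counit H (mult H (mult H f g) h) =
        tens_lift (carr H) (carr H) (\<lambda>a b. counit H (mult H f a) * counit H (mult H b h)) (comult H g)"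
    and counit_mult': "\<And>f g h. \<lbrakk>f \<in> carr H; g \<in> carr H; h \<in> carr H\<rbrakk>
      \<Longrightarrow> counit H (mult H (mult H f g) h) =
        tens_lift (carr H) (carr H) (\<lambda>a b. counit H (mult H f b) * counit H (mult H a h)) (comult H g)"

definition eps_t :: "'k::field wbialg \<Rightarrow> 'k seq \<Rightarrow> 'k seq" where
  "eps_t H h = tens_lift (carr H) (carr H) (\<lambda>a b. vscale (counit H (mult H a h)) b) (comult H (one H))"

definition base :: "'k::field wbialg \<Rightarrow> 'k seq set" where
  "base H = eps_t H ` carr H"

definition commutative_base :: "'k::field wbialg \<Rightarrow> bool" where
  "commutative_base H \<longleftrightarrow> (\<forall>x\<in>base H. \<forall>y\<in>base H. mult H x y = mult H y x)"


section \<open>The representation category\<close>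

record 'k hmod =
  mcarr :: "'k seq set"
  act :: "'k seq \<Rightarrow> 'k seq \<Rightarrow> 'k seq"

definition is_hmod :: "'k::field wbialg \<Rightarrow> 'k hmod \<Rightarrow> bool" where
  "is_hmod H V \<longleftrightarrow> fin_dim (mcarr V) \<and> bilin_on (carr H) (mcarr V) (mcarr V) (act V) \<and>
     (\<forall>v\<in>mcarr V. act V (one H) v = v) \<and>
     (\<forall>g\<in>carr H. \<forall>h\<in>carr H. \<forall>v\<in>mcarr V. act V (mult H g h) v = act V g (act V h v))"

text \<open>
  Maps between modules are required to vanish outside the carrier of their domain, so that a
  morphism is determined by its values on the carrier and the hom-spaces carry the pointwise
  operations.
\<close>

definition zero_ext :: "'k::zero seq set \<Rightarrow> ('k seq \<Rightarrow> 'k seq) \<Rightarrow> 'k seq \<Rightarrow> 'k seq" where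
  "zero_ext V f = (\<lambda>x. if x \<in> V then f x else 0)"

definition hmod_hom :: "'k::field wbialg \<Rightarrow> 'k hmod \<Rightarrow> 'k hmod \<Rightarrow> ('k seq \<Rightarrow> 'k seq) set" where
  "hmod_hom H V W = {f. lin_on (mcarr V) (mcarr W) f \<and> (\<forall>x. x \<notin> mcarr V \<longrightarrow> f x = 0) \<and>
     (\<forall>h\<in>carr H. \<forall>v\<in>mcarr V. f (act V h v) = act W h (f v))}"

text \<open>The action of \<open>x \<in> H \<otimes> H\<close> on \<open>t \<in> V \<otimes> W\<close>, the full tensor product over the field.\<close>

definition act2 :: "'k::field wbialg \<Rightarrow> 'k hmod \<Rightarrow> 'k hmod \<Rightarrow> 'k seq \<Rightarrow> 'k seq \<Rightarrow> 'k seq" where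
  "act2 H V W x t = tens_lift (carr H) (carr H)
     (\<lambda>a b. tens_lift (mcarr V) (mcarr W) (\<lambda>v w. tens (act V a v) (act W b w)) t) x"

definition hmod_tensor :: "'k::field wbialg \<Rightarrow> 'k hmod \<Rightarrow> 'k hmod \<Rightarrow> 'k hmod" where
  "hmod_tensor H V W =
     \<lparr>mcarr = act2 H V W (comult H (one H)) ` tens_space (mcarr V) (mcarr W),
      act = (\<lambda>h. act2 H V W (comult H h))\<rparr>"

definition hmod_unit :: "'k::field wbialg \<Rightarrow> 'k hmod" where
  "hmod_unit H = \<lparr>mcarr = base H, act = (\<lambda>h z. eps_t H (mult H h z))\<rparr>"

text \<open>
  The unit isomorphisms are the restrictions of \<open>\<epsilon> \<otimes> id\<close> and \<open>id \<otimes> \<epsilon>\<close> to the submodules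
  \<open>\<Delta>(1)(H\<^sub>t \<otimes> V)\<close> and \<open>\<Delta>(1)(V \<otimes> H\<^sub>t)\<close>. The first one is also the action map \<open>z \<otimes> v \<mapsto> z v\<close>, since
  \<open>\<epsilon>(\<epsilon>\<^sub>t(1\<^sup>(\<^sup>1\<^sup>) z)) 1\<^sup>(\<^sup>2\<^sup>) v = \<epsilon>(1\<^sup>(\<^sup>1\<^sup>) z) 1\<^sup>(\<^sup>2\<^sup>) v = \<epsilon>\<^sub>t(z) v = z v\<close> for \<open>z\<close> in the base.
\<close>

definition Rep :: "'k::field wbialg \<Rightarrow> ('k hmod, 'k seq \<Rightarrow> 'k seq, 'k) mon_cat" where
  "Rep H =
     \<lparr>obj = {V. is_hmod H V},
      hom = hmod_hom H,
      ident = (\<lambda>V. zero_ext (mcarr V) (\<lambda>v. v)),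
      cmp = (\<lambda>U V W g f. g \<circ> f),
      hzero = (\<lambda>V W v. 0),
      hadd = (\<lambda>V W f g v. f v + g v),
      hscale = (\<lambda>V W a f v. vscale a (f v)),
      tobj = hmod_tensor H,
      tmor = (\<lambda>V V' W W' f g. zero_ext (mcarr (hmod_tensor H V W))
        (tens_lift (mcarr V) (mcarr W) (\<lambda>v w. tens (f v) (g w)))),
      unit_obj = hmod_unit H,
      associator = (\<lambda>U V W. zero_ext (mcarr (hmod_tensor H (hmod_tensor H U V) W)) reassoc),
      lunit = (\<lambda>V. zero_ext (mcarr (hmod_tensor H (hmod_unit H) V))
        (tens_lift (base H) (mcarr V) (\<lambda>z v. vscale (counit H z) v))),
      runit = (\<lambda>V. zero_ext (mcarr (hmod_tensor H V (hmod_unit H)))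
        (tens_lift (mcarr V) (base H) (\<lambda>v z. vscale (counit H z) v)))\<rparr>"

end

theory Submission
  imports Defs
begin

text \<open>The category is realised inside the bimodules over the commutative algebra \<open>R = k\<^sup>n\<close>, where \<open>n\<close>
  is the number of simple objects \<open>S\<^sub>i\<close> up to isomorphism. Tensoring with \<open>X\<close> on the left is an
  endofunctor of \<open>C\<close>, and an endofunctor of a split semisimple category is given by a matrix of
  vector spaces:

  \<open>F(X) = \<Oplus>\<^sub>i\<^sub>j Hom(S\<^sub>i, X \<otimes> S\<^sub>j)\<close>.

  The index \<open>i\<close> gives a left and \<open>j\<close> a right action of \<open>R\<close>, composition of endofunctors becomes the
  tensor product over \<open>R\<close>, and so \<open>F(X \<otimes> Y) \<cong> F(X) \<otimes>\<^sub>R F(Y)\<close> coherently and \<open>F(\<one>) \<cong> R\<close>.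

  Forgetting the \<open>R\<close>-actions leaves a functor to vector spaces which is both monoidal and
  comonoidal. Its monoidal structure \<open>\<pi> : F(X) \<otimes> F(Y) \<rightarrow> F(X \<otimes> Y)\<close> is the canonical surjection onto
  the tensor product over \<open>R\<close>. As \<open>R\<close> is separable, the surjection has a natural section \<open>\<iota>\<close>, with
  \<open>\<pi> \<iota> = id\<close> and \<open>\<iota> \<pi> (x \<otimes> y) = \<Sum>\<^sub>i x e\<^sub>i \<otimes> e\<^sub>i y\<close> for the idempotents \<open>e\<^sub>i\<close> of \<open>R\<close>. In degree
  zero there are a unit \<open>\<eta>\<close> in \<open>F(\<one>)\<close> and a linear form \<open>\<lambda>\<close> on \<open>F(\<one>)\<close>. The locale
  \<open>frobenius_fibre_functor\<close> records the properties of these data, and \<open>frobenius_fibre_functor_split\<close>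
  establishes them for the functor above: \<open>assoc_pc\<close> is the coherence of composition, a consequence
  of the pentagon, and \<open>lunit_pc\<close> is the coherence of the left unit, a consequence of Kelly's lemma
  \<open>lunit_tensor\<close>. Algebraic closure enters only in \<open>schur_scalar\<close>, which makes the blocks of \<open>R\<close>
  one-dimensional.

  The weak bialgebra is reconstructed from such a functor. Let \<open>H\<close> be the algebra of natural
  endomorphisms of \<open>F\<close>, that is, the product of the matrix algebras \<open>End(F(S\<^sub>s))\<close>. As each
  \<open>F(S\<^sub>s)\<close> is nonzero, \<open>F\<close> is an equivalence of linear categories from \<open>C\<close> to \<open>Rep(H)\<close>
  (\<open>Fm_faithful\<close>, \<open>Fm_full\<close>, \<open>Md_ess_surj\<close>). Put \<open>\<Delta>(h) = \<iota> h \<pi>\<close>, a natural endomorphism of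
  \<open>F(X) \<otimes> F(Y)\<close> and hence an element of \<open>H \<otimes> H\<close>, and \<open>\<epsilon>(h) = \<lambda>(h \<eta>)\<close>. Elements of \<open>H\<close>, \<open>H \<otimes> H\<close>
  and \<open>H \<otimes> H \<otimes> H\<close> are determined by their actions on the spaces \<open>F(X)\<close> and their tensor products,
  so every axiom of a weak bialgebra is an identity between composites of \<open>\<pi>\<close>, \<open>\<iota>\<close>, \<open>\<eta>\<close>, \<open>\<lambda>\<close> and
  the action. For instance \<open>\<Delta>\<close> is multiplicative because \<open>\<pi> \<iota> = id\<close>, and \<open>\<Delta>(1) = \<iota> \<pi>\<close> is the
  separability idempotent, which differs from \<open>1 \<otimes> 1\<close> unless \<open>n \<le> 1\<close>.

  Since \<open>\<Delta>(1) = \<iota> \<pi>\<close>, the tensor product \<open>\<Delta>(1) (F(X) \<otimes> F(Y))\<close> of modules is the image of \<open>\<iota>\<close> and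
  thus a copy of \<open>F(X \<otimes> Y)\<close>; this makes \<open>F\<close> a monoidal equivalence. As every module is isomorphic
  to some \<open>F(X)\<close>, the structure isomorphisms of \<open>Rep(H)\<close> are isomorphisms because those of \<open>C\<close>
  are. The base of \<open>H\<close> is the image of \<open>F(\<one>)\<close> acting through the left unit constraint
  (\<open>base_Z\<close>); it acts on every \<open>F(Y)\<close> by linear combinations of the commuting idempotents of the
  left \<open>R\<close>-action, and is therefore commutative.\<close>

section \<open>Linear maps on spaces of sequences\<close>

text \<open>Vectors are functions, but almost all arguments treat them as elements of a vector space. Pointwise
  evaluation of sums is therefore switched off and invoked by name where coordinates matter.\<close>

declare plus_fun_apply [simp del] zero_fun_apply [simp del]

lemmas fun_apply = plus_fun_apply zero_fun_apply

lemma lin_onI: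
  assumes "\<And>x. x \<in> V \<Longrightarrow> f x \<in> W" "\<And>x y. \<lbrakk>x \<in> V; y \<in> V\<rbrakk> \<Longrightarrow> f (x + y) = f x + f y"
    "\<And>a x. x \<in> V \<Longrightarrow> f (vscale a x) = vscale a (f x)"
  shows "lin_on V W f"
  using assms by (auto simp: lin_on_def)

lemma lin_on_in: "lin_on V W f \<Longrightarrow> x \<in> V \<Longrightarrow> f x \<in> W"
  and lin_on_add: "lin_on V W f \<Longrightarrow> x \<in> V \<Longrightarrow> y \<in> V \<Longrightarrow> f (x + y) = f x + f y"
  and lin_on_scale: "lin_on V W f \<Longrightarrow> x \<in> V \<Longrightarrow> f (vscale a x) = vscale a (f x)"
  by (auto simp: lin_on_def)

lemma vscale_0 [simp]: "vscale 0 x = 0" "vscale c 0 = 0"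
  and vscale_1 [simp]: "vscale 1 x = x"
  and vscale_vscale [simp]: "vscale a (vscale b x) = vscale (a * b) x"
  and vscale_add: "vscale c (x + y) = vscale c x + vscale c y"
  and vscale_add_left: "vscale (c + d) x = vscale c x + vscale d x"
  by (auto simp: vscale_def fun_eq_iff fun_apply algebra_simps)

lemma vscale_sum: "vscale c (\<Sum>i\<in>I. f i) = (\<Sum>i\<in>I. vscale c (f i))"
  by (simp add: vscale_def fun_eq_iff fun_apply fun_sum_apply sum_distrib_left)

lemma lin_on_0: "lin_on V W f \<Longrightarrow> 0 \<in> V \<Longrightarrow> f 0 = 0"
  using lin_on_scale[of V W f 0 0] by simp

lemma lin_on_sum:
  assumes "lin_on V W f" "vec.subspace V" "\<And>i. i \<in> I \<Longrightarrow> g i \<in> V"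
  shows "f (\<Sum>i\<in>I. g i) = (\<Sum>i\<in>I. f (g i))"
  using assms(3)
proof (induction I rule: infinite_finite_induct)
  case (insert x F)
  then have "g x \<in> V" "sum g F \<in> V" using assms(2) by (auto intro: vec.subspace_sum)
  then have "f (g x + sum g F) = f (g x) + f (sum g F)" using lin_on_add[OF assms(1)] by blast
  moreover have "f (sum g F) = (\<Sum>i\<in>F. f (g i))" using insert by blast
  ultimately show ?case by (simp only: sum.insert[OF insert.hyps(1,2)])
qed (auto simp: lin_on_0[OF assms(1) vec.subspace_0[OF assms(2)]])

lemma lin_on_cmp: "lin_on U V f \<Longrightarrow> lin_on V W g \<Longrightarrow> lin_on U W (\<lambda>x. g (f x))"
  by (auto simp: lin_on_def)

lemma lin_on_subset: "lin_on V W f \<Longrightarrow> V' \<subseteq> V \<Longrightarrow> W \<subseteq> W' \<Longrightarrow> lin_on V' W' f"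
  unfolding lin_on_def by blast

lemma lin_on_id [simp]: "lin_on V V (\<lambda>x. x)"
  by (simp add: lin_on_def)

lemma lin_on_cong: "lin_on V W f \<Longrightarrow> vec.subspace V \<Longrightarrow> (\<And>x. x \<in> V \<Longrightarrow> f x = g x) \<Longrightarrow> lin_on V W g"
  unfolding lin_on_def by (simp add: vec.subspace_add vec.subspace_scale)

lemma lin_on_sumI:
  assumes "\<And>i. i \<in> I \<Longrightarrow> lin_on V W (f i)" "vec.subspace W"
  shows "lin_on V W (\<lambda>x. \<Sum>i\<in>I. f i x)"
proof (rule lin_onI)
  fix x y a assume x: "x \<in> V"
  show "(\<Sum>i\<in>I. f i x) \<in> W" using assms x lin_on_in by (blast intro: vec.subspace_sum)
  have "(\<Sum>i\<in>I. f i (vscale a x)) = (\<Sum>i\<in>I. vscale a (f i x))"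
    using lin_on_scale[OF assms(1) x] by (rule sum.cong[OF refl])
  then show "(\<Sum>i\<in>I. f i (vscale a x)) = vscale a (\<Sum>i\<in>I. f i x)" by (simp add: vscale_sum)
  assume y: "y \<in> V"
  have "(\<Sum>i\<in>I. f i (x + y)) = (\<Sum>i\<in>I. f i x + f i y)"
    using lin_on_add[OF assms(1) x y] by (rule sum.cong[OF refl])
  then show "(\<Sum>i\<in>I. f i (x + y)) = (\<Sum>i\<in>I. f i x) + (\<Sum>i\<in>I. f i y)" by (simp add: sum.distrib)
qed

lemma fin_dim_subspace: "fin_dim V \<Longrightarrow> vec.subspace V"
  unfolding fin_dim_def using vec.subspace_span by force

lemma fin_dim_image:
  assumes "lin_on V W f" "fin_dim V"
  shows "fin_dim (f ` V)"
proof -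
  obtain B where B: "finite B" "vec.span B = V" using assms(2) by (auto simp: fin_dim_def)
  note sV = fin_dim_subspace[OF assms(2)]
  have BV: "B \<subseteq> V" using B vec.span_superset by blast
  have "f ` V \<subseteq> vec.span (f ` B)"
  proof
    fix y assume "y \<in> f ` V"
    then obtain x where x: "x \<in> V" "y = f x" by auto
    from x(1) have "x \<in> V \<and> f x \<in> vec.span (f ` B)" unfolding B(2)[symmetric]
    proof (induction x rule: vec.span_induct_alt)
      case base
      then show ?case using lin_on_0[OF assms(1)] vec.subspace_0[OF sV] B(2) by (simp add: vec.span_zero)
    next
      case (step c x y)
      then have xy: "x \<in> V" "y \<in> V" "vscale c x \<in> V" using BV B(2) sV vec.subspace_scale by auto
      have "f (vscale c x + y) = vscale c (f x) + f y"
        using xy lin_on_add[OF assms(1)] lin_on_scale[OF assms(1)] by simp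
      then show ?case using step xy sV B(2)
        by (auto intro!: vec.span_add vec.span_scale simp: vec.span_base)
    qed
    then show "y \<in> vec.span (f ` B)" using x by simp
  qed
  moreover have "vec.span (f ` B) \<subseteq> f ` V"
  proof (rule vec.span_minimal)
    show "f ` B \<subseteq> f ` V" using BV by auto
    show "vec.subspace (f ` V)"
      unfolding vec.subspace_def
    proof (safe)
      show "0 \<in> f ` V" using lin_on_0[OF assms(1)] vec.subspace_0[OF sV] by (metis image_eqI)
    next
      fix x y assume "x \<in> V" "y \<in> V"
      then show "f x + f y \<in> f ` V"
        using lin_on_add[OF assms(1)] vec.subspace_add[OF sV] by (metis image_eqI)
    next
      fix c x assume "x \<in> V"
      then show "vscale c (f x) \<in> f ` V"
        using lin_on_scale[OF assms(1)] vec.subspace_scale[OF sV] by (metis image_eqI)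
    qed
  qed
  ultimately have "vec.span (f ` B) = f ` V" by auto
  then show ?thesis using B(1) unfolding fin_dim_def by (metis finite_imageI)
qed

text \<open>The coordinate subspaces: every space whose basis matters below is of this form, with the basis
  vectors \<open>uv i\<close>.\<close>

definition csp :: "nat set \<Rightarrow> 'k::field seq set" where
  "csp B = {v. \<forall>n. n \<notin> B \<longrightarrow> v n = 0}"

definition uv :: "nat \<Rightarrow> 'k::field seq" where
  "uv i = (\<lambda>n. if n = i then 1 else 0)"

lemma subspace_csp [simp]: "vec.subspace (csp B)"
  by (auto simp: vec.subspace_def csp_def vscale_def fun_apply)

lemma subspace_UNIV [simp]: "vec.subspace UNIV"
  by (auto simp: vec.subspace_def)

lemma uv_in_csp [simp]: "i \<in> B \<Longrightarrow> uv i \<in> csp B"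
  by (auto simp: csp_def uv_def)

lemma csp_expand:
  assumes "finite B" "v \<in> csp B"
  shows "v = (\<Sum>i\<in>B. vscale (v i) (uv i))"
proof
  fix n
  have "(\<Sum>i\<in>B. vscale (v i) (uv i)) n = (\<Sum>i\<in>B. if n = i then v i else 0)"
    by (auto simp: fun_sum_apply vscale_def uv_def intro!: sum.cong)
  then show "v n = (\<Sum>i\<in>B. vscale (v i) (uv i)) n"
    using assms by (auto simp: csp_def)
qed

lemma fin_dim_csp: assumes "finite B" shows "fin_dim (csp B :: 'k::field seq set)"
  unfolding fin_dim_def
proof (intro exI conjI)
  show "finite (uv ` B)" using assms by simp
  show "vec.span (uv ` B) = (csp B :: 'k seq set)"
  proof
    show "vec.span (uv ` B) \<subseteq> (csp B :: 'k seq set)" by (rule vec.span_minimal) auto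
    show "(csp B :: 'k seq set) \<subseteq> vec.span (uv ` B)"
    proof
      fix v :: "'k seq" assume "v \<in> csp B"
      then have "v = (\<Sum>i\<in>B. vscale (v i) (uv i))" by (rule csp_expand[OF assms])
      moreover have "(\<Sum>i\<in>B. vscale (v i) (uv i)) \<in> vec.span (uv ` B)"
        by (intro vec.span_sum vec.span_scale vec.span_base) auto
      ultimately show "v \<in> vec.span (uv ` B)" by (rule ssubst[where P = "\<lambda>x. x \<in> vec.span (uv ` B)"])
    qed
  qed
qed

lemma csp_lin_eq:
  assumes "finite B" "v \<in> csp B" "lin_on (csp B) U f" "lin_on (csp B) U' g"
    "\<And>i. i \<in> B \<Longrightarrow> f (uv i) = g (uv i)"
  shows "f v = g v"
proof -
  have mem: "vscale c (uv i) \<in> csp B" if "i \<in> B" for i c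
    using that subspace_csp uv_in_csp vec.subspace_scale by blast
  have "h v = (\<Sum>i\<in>B. vscale (v i) (h (uv i)))" if "lin_on (csp B) Z h" for h Z
  proof -
    have "h v = h (\<Sum>i\<in>B. vscale (v i) (uv i))" using csp_expand[OF assms(1,2)] by (rule arg_cong)
    also have "\<dots> = (\<Sum>i\<in>B. h (vscale (v i) (uv i)))"
      by (rule lin_on_sum[OF that subspace_csp mem])
    also have "\<dots> = (\<Sum>i\<in>B. vscale (v i) (h (uv i)))"
      by (intro sum.cong) (auto intro: lin_on_scale[OF that])
    finally show ?thesis .
  qed
  then show ?thesis using assms(3-5) by (metis (no_types, lifting) sum.cong)
qed

section \<open>Maps out of tensor products\<close>

text \<open>Additivity is enough to compare two maps on a tensor product, because every tensor is a sum
  of pure tensors without scalar coefficients.\<close>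

definition addon :: "'k seq set \<Rightarrow> ('k::field seq \<Rightarrow> 'c::ab_group_add) \<Rightarrow> bool" where
  "addon V f \<longleftrightarrow> (\<forall>x\<in>V. \<forall>y\<in>V. f (x + y) = f x + f y)"

lemma lin_on_addon: "lin_on V W f \<Longrightarrow> addon V f"
  by (simp add: lin_on_def addon_def)

text \<open>The condition for a map on \<open>V \<times> W\<close> to factor through the tensor product. Being balanced replaces
  compatibility with scalars, so that values may lie in any abelian group; this covers both
  vector-valued and scalar-valued maps.\<close>

definition bil :: "'k seq set \<Rightarrow> 'k seq set \<Rightarrow> ('k::field seq \<Rightarrow> 'k seq \<Rightarrow> 'c::ab_group_add) \<Rightarrow> bool" where
  "bil V W b \<longleftrightarrow> vec.subspace V \<and> vec.subspace W \<and>
     (\<forall>u\<in>V. \<forall>v\<in>V. \<forall>w\<in>W. b (u + v) w = b u w + b v w) \<and>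
     (\<forall>u\<in>V. \<forall>v\<in>W. \<forall>w\<in>W. b u (v + w) = b u v + b u w) \<and>
     (\<forall>c. \<forall>v\<in>V. \<forall>w\<in>W. b (vscale c v) w = b v (vscale c w))"

lemma bilI:
  assumes "vec.subspace V" "vec.subspace W"
    "\<And>u v w. \<lbrakk>u \<in> V; v \<in> V; w \<in> W\<rbrakk> \<Longrightarrow> b (u + v) w = b u w + b v w"
    "\<And>u v w. \<lbrakk>u \<in> V; v \<in> W; w \<in> W\<rbrakk> \<Longrightarrow> b u (v + w) = b u v + b u w"
    "\<And>c v w. \<lbrakk>v \<in> V; w \<in> W\<rbrakk> \<Longrightarrow> b (vscale c v) w = b v (vscale c w)"
  shows "bil V W b"
  using assms by (simp add: bil_def)

lemma subspace_tens_space [simp]: "vec.subspace (tens_space V W)"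
  by (simp add: tens_space_def)

lemma tens_in [simp]: "v \<in> V \<Longrightarrow> w \<in> W \<Longrightarrow> tens v w \<in> tens_space V W"
  unfolding tens_space_def by (rule vec.span_base) auto

lemma tens_scale_left: "tens (vscale c v) w = vscale c (tens v w)"
  and tens_scale_right: "tens v (vscale c w) = vscale c (tens v w)"
  and tens_0 [simp]: "tens 0 w = 0" "tens v 0 = 0"
  by (auto simp: tens_def vscale_def fun_eq_iff fun_apply)

lemma tens_sum_left: "tens (\<Sum>i\<in>I. f i) w = (\<Sum>i\<in>I. tens (f i) w)"
  and tens_sum_right: "tens v (\<Sum>i\<in>I. f i) = (\<Sum>i\<in>I. tens v (f i))"
  by (auto simp: tens_def fun_eq_iff fun_apply fun_sum_apply sum_distrib_left sum_distrib_right)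

lemma tens_space_mono: "V \<subseteq> V' \<Longrightarrow> W \<subseteq> W' \<Longrightarrow> tens_space V W \<subseteq> tens_space V' W'"
  unfolding tens_space_def by (rule vec.span_mono) auto

lemma tens_space_rep:
  assumes "vec.subspace V" "t \<in> tens_space V W"
  obtains n :: nat and v w where "\<And>i. i < n \<Longrightarrow> v i \<in> V" "\<And>i. i < n \<Longrightarrow> w i \<in> W"
    "t = (\<Sum>i<n. tens (v i) (w i))"
proof -
  from assms(2) have "\<exists>n v w. (\<forall>i<(n::nat). v i \<in> V \<and> w i \<in> W) \<and> t = (\<Sum>i<n. tens (v i) (w i))"
    unfolding tens_space_def
  proof (induction t rule: vec.span_induct_alt)
    case base
    show ?case by (rule exI[of _ 0]) auto
  next
    case (step c x y)
    then obtain n v w v0 w0 where *: "\<forall>i<(n::nat). v i \<in> V \<and> w i \<in> W" "y = (\<Sum>i<n. tens (v i) (w i))"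
      "v0 \<in> V" "w0 \<in> W" "x = tens v0 w0" by blast
    have "vscale c v0 \<in> V" using * assms(1) by (simp add: vec.subspace_scale)
    then show ?case using *
      by (intro exI[of _ "Suc n"] exI[of _ "v(n := vscale c v0)"] exI[of _ "w(n := w0)"])
        (auto simp: less_Suc_eq tens_scale_left add.commute)
  qed
  then show ?thesis using that by blast
qed

lemma tens_induct [consumes 2, case_names tens add]:
  assumes "t \<in> tens_space V W" "vec.subspace V"
    and tens: "\<And>v w. \<lbrakk>v \<in> V; w \<in> W\<rbrakk> \<Longrightarrow> P (tens v w)"
    and add: "\<And>s t. \<lbrakk>s \<in> tens_space V W; t \<in> tens_space V W; P s; P t\<rbrakk> \<Longrightarrow> P (s + t)"
    and W: "vec.subspace W"
  shows "P t"
proof -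
  obtain n :: nat and v w where nvw: "\<And>i. i < n \<Longrightarrow> v i \<in> V" "\<And>i. i < n \<Longrightarrow> w i \<in> W"
    "t = (\<Sum>i<n. tens (v i) (w i))" using tens_space_rep[OF assms(2,1)] by metis
  have "P 0" using tens[of 0 0] vec.subspace_0[OF assms(2)] vec.subspace_0[OF W] by simp
  have "m \<le> n \<Longrightarrow> P (\<Sum>i<m. tens (v i) (w i))" for m
  proof (induction m)
    case (Suc m)
    have "(\<Sum>i<m. tens (v i) (w i)) \<in> tens_space V W"
      using nvw Suc.prems by (intro vec.subspace_sum) auto
    then show ?case using Suc nvw tens add by simp
  qed (use \<open>P 0\<close> in simp)
  then show ?thesis using nvw(3) by simp
qed

lemma tens_eqI:
  assumes "t \<in> tens_space V W" "vec.subspace V" "vec.subspace W"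
    "addon (tens_space V W) f" "addon (tens_space V W) g"
    "\<And>v w. \<lbrakk>v \<in> V; w \<in> W\<rbrakk> \<Longrightarrow> f (tens v w) = g (tens v w)"
  shows "f t = g t"
  using assms(1,2)
proof (induction t rule: tens_induct)
  case (add s t)
  then show ?case using assms(4,5) by (simp add: addon_def)
qed (use assms in auto)

lemma tens_lift_sum':
  assumes "bil V W b" "\<And>i. i < n \<Longrightarrow> v i \<in> V" "\<And>i. i < n \<Longrightarrow> w i \<in> W"
  shows "tens_lift V W b (\<Sum>i<(n::nat). tens (v i) (w i)) = (\<Sum>i<n. b (v i) (w i))"
  by (rule tens_lift_sum) (use assms in \<open>auto simp: bil_def\<close>)

lemma tens_lift_tens [simp]:
  assumes "bil V W b" "v \<in> V" "w \<in> W"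
  shows "tens_lift V W b (tens v w) = b v w"
  using tens_lift_sum'[OF assms(1), of 1 "\<lambda>_. v" "\<lambda>_. w"] assms by simp

lemma tens_lift_add:
  assumes "bil V W b" "s \<in> tens_space V W" "t \<in> tens_space V W"
  shows "tens_lift V W b (s + t) = tens_lift V W b s + tens_lift V W b t"
proof -
  have V: "vec.subspace V" "vec.subspace W" using assms(1) by (auto simp: bil_def)
  obtain n :: nat and v w where n: "\<And>i. i < n \<Longrightarrow> v i \<in> V" "\<And>i. i < n \<Longrightarrow> w i \<in> W"
    "s = (\<Sum>i<n. tens (v i) (w i))" using tens_space_rep[OF V(1) assms(2)] by metis
  obtain m :: nat and v' w' where m: "\<And>i. i < m \<Longrightarrow> v' i \<in> V" "\<And>i. i < m \<Longrightarrow> w' i \<in> W"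
    "t = (\<Sum>i<m. tens (v' i) (w' i))" using tens_space_rep[OF V(1) assms(3)] by metis
  define x where "x i = (if i < n then v i else v' (i - n))" for i
  define z where "z i = (if i < n then w i else w' (i - n))" for i
  have split: "(\<Sum>i<n + m. g i) = (\<Sum>i<n. g i) + (\<Sum>i<m. g (n + i))" for g :: "nat \<Rightarrow> 'd::ab_group_add"
    by (induction m) (simp_all add: add.assoc)
  have "s + t = (\<Sum>i<n + m. tens (x i) (z i))" unfolding split by (simp add: n(3) m(3) x_def z_def)
  moreover have "tens_lift V W b (\<Sum>i<n + m. tens (x i) (z i)) = (\<Sum>i<n+m. b (x i) (z i))"
    by (rule tens_lift_sum'[OF assms(1)]) (use n m in \<open>auto simp: x_def z_def\<close>)
  ultimately show ?thesis unfolding split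
    using tens_lift_sum'[OF assms(1), of n v w] tens_lift_sum'[OF assms(1), of m v' w'] n m
    by (simp add: x_def z_def)
qed

lemma bilin_on_bil:
  assumes "bilin_on V W U b" "vec.subspace V" "vec.subspace W"
  shows "bil V W b"
  using assms by (auto simp: bilin_on_def lin_on_def bil_def)

lemma lin_tens_lift:
  assumes "bilin_on V W U b" "vec.subspace V" "vec.subspace W" "vec.subspace U"
  shows "lin_on (tens_space V W) U (tens_lift V W b)"
proof -
  note b = bilin_on_bil[OF assms(1-3)]
  have *: "tens_lift V W b t \<in> U \<and> tens_lift V W b (vscale a t) = vscale a (tens_lift V W b t)"
    if "t \<in> tens_space V W" for t a
    using that assms(2)
  proof (induction t rule: tens_induct)
    case (tens v w)
    then have "vscale a v \<in> V" using assms by (simp add: vec.subspace_scale)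
    then show ?case using tens b assms(1) tens_lift_tens[of V W b "vscale a v" w]
      by (simp add: bilin_on_def lin_on_def tens_scale_left[symmetric])
  next
    case (add s t)
    then have "vscale a s \<in> tens_space V W" "vscale a t \<in> tens_space V W"
      using subspace_tens_space vec.subspace_scale by blast+
    with add show ?case using assms(4)
      by (simp add: tens_lift_add[OF b] vscale_add vec.subspace_add)
  qed (use assms in auto)
  show ?thesis by (rule lin_onI) (use * tens_lift_add[OF b] in auto)
qed

text \<open>An element of \<open>V \<otimes> W\<close> is also an element of every larger tensor product, and a lift can be computed in
  either. This is what allows submodules such as \<open>\<Delta>(1) (V \<otimes> W)\<close> to be treated inside the full tensor
  product.\<close>

lemma tens_lift_restrict:
  assumes "t \<in> tens_space V W" "bil V' W' b" "vec.subspace V" "vec.subspace W" "V \<subseteq> V'" "W \<subseteq> W'"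
    "\<And>v w. \<lbrakk>v \<in> V; w \<in> W\<rbrakk> \<Longrightarrow> b' v w = b v w"
  shows "tens_lift V W b' t = tens_lift V' W' b t"
proof -
  obtain n :: nat and v w where n: "\<And>i. i < n \<Longrightarrow> v i \<in> V" "\<And>i. i < n \<Longrightarrow> w i \<in> W"
    "t = (\<Sum>i<n. tens (v i) (w i))" using tens_space_rep[OF assms(3,1)] by metis
  have b': "bil V W b'"
    by (rule bilI) (use assms in \<open>auto simp: bil_def subset_iff vec.subspace_add vec.subspace_scale\<close>)
  have "(\<Sum>i<n. b' (v i) (w i)) = (\<Sum>i<n. b (v i) (w i))"
    by (rule sum.cong) (use n assms(7) in auto)
  moreover have "v i \<in> V'" "w i \<in> W'" if "i < n" for i using that n assms(5,6) by auto
  ultimately show ?thesis unfolding n(3)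
    using tens_lift_sum'[OF b', of n v w] tens_lift_sum'[OF assms(2), of n v w] n(1,2) by simp
qed

abbreviation tmap where
  "tmap V W f g \<equiv> tens_lift V W (\<lambda>v w. tens (f v) (g w))"

lemma bilin_tens:
  assumes "lin_on V V' f" "lin_on W W' g"
  shows "bilin_on V W (tens_space V' W') (\<lambda>v w. tens (f v) (g w))"
  using assms
  by (auto simp: bilin_on_def lin_on_def tens_add_left tens_add_right tens_scale_left tens_scale_right)

lemma bil_tens:
  assumes "lin_on V V' f" "lin_on W W' g" "vec.subspace V" "vec.subspace W"
  shows "bil V W (\<lambda>v w. tens (f v) (g w))"
  using bilin_on_bil[OF bilin_tens[OF assms(1,2)]] assms by blast

lemma tmap_lin:
  assumes "lin_on V V' f" "lin_on W W' g" "vec.subspace V" "vec.subspace W"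
  shows "lin_on (tens_space V W) (tens_space V' W') (tmap V W f g)"
  by (rule lin_tens_lift[OF bilin_tens[OF assms(1,2)]]) (use assms in auto)

lemma tmap_tens:
  assumes "lin_on V V' f" "lin_on W W' g" "vec.subspace V" "vec.subspace W" "v \<in> V" "w \<in> W"
  shows "tmap V W f g (tens v w) = tens (f v) (g w)"
  by (rule tens_lift_tens[OF bil_tens[OF assms(1-4)] assms(5,6)])

lemma lin_tens_eq:
  assumes "t \<in> tens_space V W" "vec.subspace V" "vec.subspace W"
    "lin_on (tens_space V W) U f" "lin_on (tens_space V W) U' g"
    "\<And>v w. \<lbrakk>v \<in> V; w \<in> W\<rbrakk> \<Longrightarrow> f (tens v w) = g (tens v w)"
  shows "f t = g t"
  using tens_eqI assms lin_on_addon by blast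

lemma tmap_cmp:
  assumes "lin_on V V' f" "lin_on W W' g" "lin_on V' V'' f'" "lin_on W' W'' g'"
    "vec.subspace V" "vec.subspace W" "vec.subspace V'" "vec.subspace W'" "t \<in> tens_space V W"
  shows "tmap V' W' f' g' (tmap V W f g t) = tmap V W (\<lambda>x. f' (f x)) (\<lambda>x. g' (g x)) t"
proof (rule lin_tens_eq[OF assms(9,5,6)])
  show "lin_on (tens_space V W) (tens_space V'' W'') (\<lambda>t. tmap V' W' f' g' (tmap V W f g t))"
    using lin_on_cmp[OF tmap_lin tmap_lin] assms by blast
  show "lin_on (tens_space V W) (tens_space V'' W'') (tmap V W (\<lambda>x. f' (f x)) (\<lambda>x. g' (g x)))"
    using tmap_lin lin_on_cmp assms by blast
  fix v w assume "v \<in> V" "w \<in> W"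
  then show "tmap V' W' f' g' (tmap V W f g (tens v w)) = tmap V W (\<lambda>x. f' (f x)) (\<lambda>x. g' (g x)) (tens v w)"
    by (simp add: tmap_tens[OF assms(1,2,5,6)] tmap_tens[OF assms(3,4,7,8)]
      lin_on_in[OF assms(1)] lin_on_in[OF assms(2)]
      tmap_tens[OF lin_on_cmp[OF assms(1,3)] lin_on_cmp[OF assms(2,4)] assms(5,6)])
qed

lemma tmap_id:
  assumes "vec.subspace V" "vec.subspace W" "t \<in> tens_space V W"
    "\<And>v. v \<in> V \<Longrightarrow> f v = v" "\<And>w. w \<in> W \<Longrightarrow> g w = w"
  shows "tmap V W f g t = t"
proof -
  have l: "lin_on V V f" "lin_on W W g"
    using lin_on_cong[OF lin_on_id assms(1)] lin_on_cong[OF lin_on_id assms(2)] assms(4,5) by metis+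
  show ?thesis
    by (rule lin_tens_eq[OF assms(3,1,2) tmap_lin[OF l assms(1,2)] lin_on_id])
      (use assms tmap_tens[OF l assms(1,2)] in auto)
qed

lemma tmap_restrict:
  assumes "t \<in> tens_space V W" "lin_on V' V'' f" "lin_on W' W'' g" "vec.subspace V" "vec.subspace W"
    "vec.subspace V'" "vec.subspace W'" "V \<subseteq> V'" "W \<subseteq> W'"
    "\<And>v. v \<in> V \<Longrightarrow> f' v = f v" "\<And>w. w \<in> W \<Longrightarrow> g' w = g w"
  shows "tmap V W f' g' t = tmap V' W' f g t"
  by (rule tens_lift_restrict[OF assms(1) bil_tens[OF assms(2,3,6,7)] assms(4,5,8,9)])
    (use assms in auto)

text \<open>Under the pairing of indices, the tensor product of coordinate spaces is again a coordinate space;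
  so its elements can be defined and compared entry by entry.\<close>

lemma tens_space_csp:
  fixes A B :: "nat set"
  assumes "finite A" "finite B"
  shows "tens_space (csp A) (csp B) = (csp (prod_encode ` (A \<times> B)) :: 'k::field seq set)"
proof
  show "tens_space (csp A) (csp B) \<subseteq> (csp (prod_encode ` (A \<times> B)) :: 'k seq set)"
    unfolding tens_space_def
  proof (rule vec.span_minimal)
    show "{tens v w |v w. v \<in> csp A \<and> w \<in> csp B} \<subseteq> (csp (prod_encode ` (A \<times> B)) :: 'k seq set)"
    proof safe
      fix v w :: "'k seq" assume vw: "v \<in> csp A" "w \<in> csp B"
      have "tens v w n = 0" if "n \<notin> prod_encode ` (A \<times> B)" for n
      proof -
        obtain a b where "prod_decode n = (a, b)" by fastforce
        moreover from this have "n = prod_encode (a, b)" using prod_decode_inverse[of n] by simp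
        ultimately show ?thesis using that vw by (auto simp: tens_def csp_def)
      qed
      then show "tens v w \<in> csp (prod_encode ` (A \<times> B))" by (simp add: csp_def)
    qed
  qed simp
  show "(csp (prod_encode ` (A \<times> B)) :: 'k seq set) \<subseteq> tens_space (csp A) (csp B)"
  proof
    fix v :: "'k seq" assume v: "v \<in> csp (prod_encode ` (A \<times> B))"
    have uvt: "uv (prod_encode (a, b)) = tens (uv a) (uv b :: 'k seq)" for a b
      by (force simp: fun_eq_iff uv_def tens_def)
    have "v = (\<Sum>i\<in>prod_encode ` (A \<times> B). vscale (v i) (uv i))"
      by (rule csp_expand) (use assms v in auto)
    moreover have "(\<Sum>i\<in>prod_encode ` (A \<times> B). vscale (v i) (uv i)) \<in> tens_space (csp A) (csp B)"
      by (intro vec.subspace_sum vec.subspace_scale) (auto simp: uvt)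
    ultimately show "v \<in> tens_space (csp A) (csp B)"
      by (rule ssubst[where P = "\<lambda>x. x \<in> tens_space (csp A) (csp B)"])
  qed
qed

lemma uv_prod: "uv (prod_encode (a, b)) = tens (uv a) (uv b)"
  by (force simp: fun_eq_iff uv_def tens_def)

lemma tens_apply [simp]: "tens v w (prod_encode (a, b)) = v a * w b"
  by (simp add: tens_def)

lemma seq_eqI:
  assumes "\<And>a b. x (prod_encode (a, b)) = y (prod_encode (a, b))"
  shows "x = y"
proof
  fix n show "x n = y n" using assms[of "fst (prod_decode n)" "snd (prod_decode n)"] by simp
qed

section \<open>Tensor products of actions\<close>

text \<open>The action of \<open>A \<otimes> B\<close> on \<open>V \<otimes> W\<close>. The action of \<open>H \<otimes> H\<close> on a tensor product of modules and the
  multiplications of \<open>H \<otimes> H\<close> and \<open>H \<otimes> H \<otimes> H\<close> are all instances.\<close>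

definition actt ::
  "'k seq set \<Rightarrow> 'k seq set \<Rightarrow> 'k seq set \<Rightarrow> 'k seq set \<Rightarrow> ('k::field seq \<Rightarrow> 'k seq \<Rightarrow> 'k seq) \<Rightarrow>
   ('k seq \<Rightarrow> 'k seq \<Rightarrow> 'k seq) \<Rightarrow> 'k seq \<Rightarrow> 'k seq \<Rightarrow> 'k seq" where
  "actt A B V W \<alpha> \<beta> x t = tens_lift A B (\<lambda>a b. tmap V W (\<alpha> a) (\<beta> b) t) x"

lemma act2_actt: "act2 H V W = actt (carr H) (carr H) (mcarr V) (mcarr W) (act V) (act W)"
  by (simp add: fun_eq_iff act2_def actt_def)

lemma tens_mult_actt: "tens_mult A mA B mB = actt A B A B mA mB"
  by (simp add: fun_eq_iff tens_mult_def actt_def)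

lemma bilin_on_lin: "bilin_on A V W b \<Longrightarrow> a \<in> A \<Longrightarrow> lin_on V W (b a)"
  and bilin_on_lin': "bilin_on A V W b \<Longrightarrow> v \<in> V \<Longrightarrow> lin_on A W (\<lambda>a. b a v)"
  by (auto simp: bilin_on_def)

lemma bilin_on_in: "bilin_on A V W b \<Longrightarrow> a \<in> A \<Longrightarrow> v \<in> V \<Longrightarrow> b a v \<in> W"
  using bilin_on_lin lin_on_in by blast

context
  fixes A B V W :: "'k::field seq set" and \<alpha> \<beta> and V' W' :: "'k seq set"
  assumes \<alpha>: "bilin_on A V V' \<alpha>" and \<beta>: "bilin_on B W W' \<beta>"
    and sub: "vec.subspace A" "vec.subspace B" "vec.subspace V" "vec.subspace W"
begin

lemma tmap_bilin:
  assumes t: "t \<in> tens_space V W"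
  shows "bilin_on A B (tens_space V' W') (\<lambda>a b. tmap V W (\<alpha> a) (\<beta> b) t)"
  unfolding bilin_on_def
proof (intro conjI ballI)
  note l = bilin_on_lin[OF \<alpha>] bilin_on_lin[OF \<beta>]
  have mem: "tmap V W (\<alpha> a) (\<beta> b) t \<in> tens_space V' W'" if "a \<in> A" "b \<in> B" for a b
    using lin_on_in[OF tmap_lin[OF l(1)[OF that(1)] l(2)[OF that(2)] sub(3,4)] t] .
  have tt: "tmap V W (\<alpha> a) (\<beta> b) (tens v w) = tens (\<alpha> a v) (\<beta> b w)"
    if "a \<in> A" "b \<in> B" "v \<in> V" "w \<in> W" for a b v w
    using tmap_tens[OF l(1)[OF that(1)] l(2)[OF that(2)] sub(3,4) that(3,4)] .
  have ad: "tmap V W (\<alpha> a) (\<beta> b) (s + t) = tmap V W (\<alpha> a) (\<beta> b) s + tmap V W (\<alpha> a) (\<beta> b) t"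
    if "a \<in> A" "b \<in> B" "s \<in> tens_space V W" "t \<in> tens_space V W" for a b s t
    using lin_on_add[OF tmap_lin[OF l(1)[OF that(1)] l(2)[OF that(2)] sub(3,4)] that(3,4)] .
  note cl = vec.subspace_add[OF sub(1)] vec.subspace_add[OF sub(2)] vec.subspace_scale[OF sub(1)] vec.subspace_scale[OF sub(2)]
  have \<alpha>1: "\<alpha> (x + y) v = \<alpha> x v + \<alpha> y v" "\<alpha> (vscale c x) v = vscale c (\<alpha> x v)"
    if "x \<in> A" "y \<in> A" "v \<in> V" for x y v c
    using bilin_on_lin'[OF \<alpha> that(3)] that lin_on_add lin_on_scale by fastforce+
  have \<beta>1: "\<beta> (x + y) v = \<beta> x v + \<beta> y v" "\<beta> (vscale c x) v = vscale c (\<beta> x v)"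
    if "x \<in> B" "y \<in> B" "v \<in> W" for x y v c
    using bilin_on_lin'[OF \<beta> that(3)] that lin_on_add lin_on_scale by fastforce+
  fix a assume a: "a \<in> A"
  show "lin_on B (tens_space V' W') (\<lambda>b. tmap V W (\<alpha> a) (\<beta> b) t)"
  proof (rule lin_onI)
    fix x y assume xy: "x \<in> B" "y \<in> B"
    from t sub(3) show "tmap V W (\<alpha> a) (\<beta> (x + y)) t = tmap V W (\<alpha> a) (\<beta> x) t + tmap V W (\<alpha> a) (\<beta> y) t"
      by (induction t rule: tens_induct)
        (use xy a sub in \<open>simp_all add: tt ad cl \<beta>1 tens_add_right add_ac\<close>)
  next
    fix c x assume x: "x \<in> B"
    from t sub(3) show "tmap V W (\<alpha> a) (\<beta> (vscale c x)) t = vscale c (tmap V W (\<alpha> a) (\<beta> x) t)"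
      by (induction t rule: tens_induct)
        (use x a sub in \<open>simp_all add: tt ad cl \<beta>1 tens_scale_right vscale_add add_ac\<close>)
  qed (use a mem in auto)
next
  note l = bilin_on_lin[OF \<alpha>] bilin_on_lin[OF \<beta>]
  have mem: "tmap V W (\<alpha> a) (\<beta> b) t \<in> tens_space V' W'" if "a \<in> A" "b \<in> B" for a b
    using lin_on_in[OF tmap_lin[OF l(1)[OF that(1)] l(2)[OF that(2)] sub(3,4)] t] .
  have tt: "tmap V W (\<alpha> a) (\<beta> b) (tens v w) = tens (\<alpha> a v) (\<beta> b w)"
    if "a \<in> A" "b \<in> B" "v \<in> V" "w \<in> W" for a b v w
    using tmap_tens[OF l(1)[OF that(1)] l(2)[OF that(2)] sub(3,4) that(3,4)] .
  have ad: "tmap V W (\<alpha> a) (\<beta> b) (s + t) = tmap V W (\<alpha> a) (\<beta> b) s + tmap V W (\<alpha> a) (\<beta> b) t"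
    if "a \<in> A" "b \<in> B" "s \<in> tens_space V W" "t \<in> tens_space V W" for a b s t
    using lin_on_add[OF tmap_lin[OF l(1)[OF that(1)] l(2)[OF that(2)] sub(3,4)] that(3,4)] .
  note cl = vec.subspace_add[OF sub(1)] vec.subspace_add[OF sub(2)] vec.subspace_scale[OF sub(1)] vec.subspace_scale[OF sub(2)]
  have \<alpha>1: "\<alpha> (x + y) v = \<alpha> x v + \<alpha> y v" "\<alpha> (vscale c x) v = vscale c (\<alpha> x v)"
    if "x \<in> A" "y \<in> A" "v \<in> V" for x y v c
    using bilin_on_lin'[OF \<alpha> that(3)] that lin_on_add lin_on_scale by fastforce+
  fix b assume b: "b \<in> B"
  show "lin_on A (tens_space V' W') (\<lambda>a. tmap V W (\<alpha> a) (\<beta> b) t)"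
  proof (rule lin_onI)
    fix x y assume xy: "x \<in> A" "y \<in> A"
    from t sub(3) show "tmap V W (\<alpha> (x + y)) (\<beta> b) t = tmap V W (\<alpha> x) (\<beta> b) t + tmap V W (\<alpha> y) (\<beta> b) t"
      by (induction t rule: tens_induct)
        (use xy b sub in \<open>simp_all add: tt ad cl \<alpha>1 tens_add_left add_ac\<close>)
  next
    fix c x assume x: "x \<in> A"
    from t sub(3) show "tmap V W (\<alpha> (vscale c x)) (\<beta> b) t = vscale c (tmap V W (\<alpha> x) (\<beta> b) t)"
      by (induction t rule: tens_induct)
        (use x b sub in \<open>simp_all add: tt ad cl \<alpha>1 tens_scale_left vscale_add add_ac\<close>)
  qed (use b mem in auto)
qed

lemma actt_lin_alg:
  assumes t: "t \<in> tens_space V W"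
  shows "lin_on (tens_space A B) (tens_space V' W') (\<lambda>x. actt A B V W \<alpha> \<beta> x t)"
  unfolding actt_def by (rule lin_tens_lift[OF tmap_bilin[OF t]]) (use sub in auto)

lemma actt_tens_alg:
  assumes "a \<in> A" "b \<in> B" "t \<in> tens_space V W"
  shows "actt A B V W \<alpha> \<beta> (tens a b) t = tmap V W (\<alpha> a) (\<beta> b) t"
  unfolding actt_def
  by (rule tens_lift_tens[OF bilin_on_bil[OF tmap_bilin[OF assms(3)] sub(1,2)] assms(1,2)])

lemma actt_tens:
  assumes "a \<in> A" "b \<in> B" "v \<in> V" "w \<in> W"
  shows "actt A B V W \<alpha> \<beta> (tens a b) (tens v w) = tens (\<alpha> a v) (\<beta> b w)"
  using actt_tens_alg[OF assms(1,2) tens_in[OF assms(3,4)]]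
    tmap_tens[OF bilin_on_lin[OF \<alpha> assms(1)] bilin_on_lin[OF \<beta> assms(2)] sub(3,4) assms(3,4)] by simp

lemma actt_lin_mod:
  assumes x: "x \<in> tens_space A B"
  shows "lin_on (tens_space V W) (tens_space V' W') (actt A B V W \<alpha> \<beta> x)"
proof -
  have *: "actt A B V W \<alpha> \<beta> x (s + t) = actt A B V W \<alpha> \<beta> x s + actt A B V W \<alpha> \<beta> x t
      \<and> actt A B V W \<alpha> \<beta> x (vscale c s) = vscale c (actt A B V W \<alpha> \<beta> x s)"
    if st: "s \<in> tens_space V W" "t \<in> tens_space V W" for s t c
    using x sub(1)
  proof (induction x rule: tens_induct)
    case (tens a b)
    have mem: "s + t \<in> tens_space V W" "vscale c s \<in> tens_space V W"
      using st vec.subspace_add vec.subspace_scale subspace_tens_space by blast+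
    note l = tmap_lin[OF bilin_on_lin[OF \<alpha> tens(1)] bilin_on_lin[OF \<beta> tens(2)] sub(3,4)]
    show ?case
      by (simp add: actt_tens_alg tens st mem lin_on_add[OF l st] lin_on_scale[OF l st(1)])
  next
    case (add x y)
    have "s + t \<in> tens_space V W" "vscale c s \<in> tens_space V W"
      using st vec.subspace_add vec.subspace_scale subspace_tens_space by blast+
    with add st show ?case
      by (simp add: lin_on_add[OF actt_lin_alg] vscale_add)
  qed (use sub in auto)
  show ?thesis
    by (rule lin_onI) (use * lin_on_in[OF actt_lin_alg x] in auto)
qed

lemma actt_bilin:
  "bilin_on (tens_space A B) (tens_space V W) (tens_space V' W') (actt A B V W \<alpha> \<beta>)"
  using actt_lin_alg actt_lin_mod by (auto simp: bilin_on_def)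

end

lemma actt_mult:
  assumes \<alpha>: "bilin_on A V V \<alpha>" and \<beta>: "bilin_on B W W \<beta>"
    and mA: "bilin_on A A A mA" and mB: "bilin_on B B B mB"
    and sub: "vec.subspace A" "vec.subspace B" "vec.subspace V" "vec.subspace W"
    and m\<alpha>: "\<And>a a' v. \<lbrakk>a \<in> A; a' \<in> A; v \<in> V\<rbrakk> \<Longrightarrow> \<alpha> (mA a a') v = \<alpha> a (\<alpha> a' v)"
    and m\<beta>: "\<And>b b' w. \<lbrakk>b \<in> B; b' \<in> B; w \<in> W\<rbrakk> \<Longrightarrow> \<beta> (mB b b') w = \<beta> b (\<beta> b' w)"
    and x: "x \<in> tens_space A B" and y: "y \<in> tens_space A B" and t: "t \<in> tens_space V W"
  shows "actt A B V W \<alpha> \<beta> (actt A B A B mA mB x y) t = actt A B V W \<alpha> \<beta> x (actt A B V W \<alpha> \<beta> y t)"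
proof -
  let ?act = "actt A B V W \<alpha> \<beta>" and ?mult = "actt A B A B mA mB"
  note act = actt_bilin[OF \<alpha> \<beta> sub] and mult = actt_bilin[OF mA mB sub(1,2,1,2)]
  have addl: "?act (x + y) t = ?act x t + ?act y t" if "x \<in> tens_space A B" "y \<in> tens_space A B" "t \<in> tens_space V W" for x y t
    using lin_on_add[OF bilin_on_lin'[OF act that(3)] that(1,2)] .
  have addr: "?act x (s + t) = ?act x s + ?act x t" if "x \<in> tens_space A B" "s \<in> tens_space V W" "t \<in> tens_space V W" for x s t
    using lin_on_add[OF bilin_on_lin[OF act that(1)] that(2,3)] .
  have maddl: "?mult (x + y) t = ?mult x t + ?mult y t" if "x \<in> tens_space A B" "y \<in> tens_space A B" "t \<in> tens_space A B" for x y t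
    using lin_on_add[OF bilin_on_lin'[OF mult that(3)] that(1,2)] .
  have maddr: "?mult x (s + t) = ?mult x s + ?mult x t" if "x \<in> tens_space A B" "s \<in> tens_space A B" "t \<in> tens_space A B" for x s t
    using lin_on_add[OF bilin_on_lin[OF mult that(1)] that(2,3)] .
  note ain = bilin_on_in[OF act] bilin_on_in[OF mult] bilin_on_in[OF \<alpha>] bilin_on_in[OF \<beta>] bilin_on_in[OF mA] bilin_on_in[OF mB]
  note tt = actt_tens[OF \<alpha> \<beta> sub] actt_tens[OF mA mB sub(1,2,1,2)]
  from x sub(1) show ?thesis
  proof (induction x rule: tens_induct)
    case (tens a b)
    from y sub(1) show ?case
    proof (induction y rule: tens_induct)
      case (tens a' b')
      from t sub(3) show ?case
      proof (induction t rule: tens_induct)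
        case (tens v w)
        then show ?case using \<open>a \<in> A\<close> \<open>b \<in> B\<close> \<open>a' \<in> A\<close> \<open>b' \<in> B\<close> by (simp add: tt ain m\<alpha> m\<beta>)
      next
        case (add s t)
        then show ?case using \<open>a \<in> A\<close> \<open>b \<in> B\<close> \<open>a' \<in> A\<close> \<open>b' \<in> B\<close> by (simp add: addr ain)
      qed (rule sub)
    next
      case (add s s')
      then show ?case using \<open>a \<in> A\<close> \<open>b \<in> B\<close> t by (simp add: addr addl maddr ain)
    qed (rule sub)
  next
    case (add x x')
    then show ?case using y t by (simp add: addr addl maddl ain)
  qed (rule sub)
qed

text \<open>If the coordinates of elements of \<open>A\<close> and \<open>B\<close> are matrix coefficients of their actions, then so are
  the coordinates of elements of \<open>A \<otimes> B\<close>. In this form tensor products of faithful actions are seen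
  to be faithful.\<close>

lemma actt_coef:
  assumes \<alpha>: "bilin_on A V V' \<alpha>" and \<beta>: "bilin_on B W W' \<beta>"
    and sub: "vec.subspace A" "vec.subspace B" "vec.subspace V" "vec.subspace W"
    and v: "v \<in> V" "\<And>a. a \<in> A \<Longrightarrow> a n = \<alpha> a v p" and w: "w \<in> W" "\<And>b. b \<in> B \<Longrightarrow> b m = \<beta> b w q"
    and x: "x \<in> tens_space A B"
  shows "x (prod_encode (n, m)) = actt A B V W \<alpha> \<beta> x (tens v w) (prod_encode (p, q))"
  using x sub(1)
proof (induction x rule: tens_induct)
  case (tens a b)
  then show ?case using v w by (simp add: actt_tens[OF \<alpha> \<beta> sub])
next
  case (add s t)
  then show ?case using v w
    by (simp add: lin_on_add[OF actt_lin_alg[OF \<alpha> \<beta> sub]]) (simp add: fun_apply)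
qed (rule sub)

lemma reassoc_lin: "lin_on UNIV UNIV reassoc"
  by (auto simp: lin_on_def reassoc_def fun_eq_iff fun_apply vscale_def split: prod.splits)

lemma reassoc_add: "reassoc (x + y) = reassoc x + reassoc y"
  and reassoc_scale: "reassoc (vscale c x) = vscale c (reassoc x)"
  by (auto simp: reassoc_def fun_eq_iff fun_apply vscale_def split: prod.splits)

lemma reassoc_apply [simp]:
  "reassoc t (prod_encode (a, prod_encode (b, c))) = t (prod_encode (prod_encode (a, b), c))"
  by (simp add: reassoc_def)

lemma reassoc_inj: assumes "reassoc x = reassoc y" shows "x = y"
proof (rule seq_eqI)
  fix a c
  obtain a1 a2 where a: "a = prod_encode (a1, a2)" by (metis prod_decode_inverse surj_pair)
  show "x (prod_encode (a, c)) = y (prod_encode (a, c))"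
    unfolding a using fun_cong[OF assms, of "prod_encode (a1, prod_encode (a2, c))"] by simp
qed

lemma reassoc_in:
  assumes "vec.subspace U" "vec.subspace V" "vec.subspace W" "t \<in> tens_space (tens_space U V) W"
  shows "reassoc t \<in> tens_space U (tens_space V W)"
  using assms(4) subspace_tens_space
proof (induction t rule: tens_induct)
  case (tens s w)
  from tens(1) assms(1) show ?case
    by (induction s rule: tens_induct)
      (use tens assms in \<open>auto simp: reassoc_tens tens_add_left reassoc_add intro: vec.subspace_add\<close>)
next
  case (add s t)
  then show ?case by (simp add: reassoc_add vec.subspace_add)
qed (rule assms)

lemma tens3_induct [consumes 4, case_names tens add]:
  assumes "t \<in> tens_space (tens_space U V) W"
    and sub: "vec.subspace U" "vec.subspace V" "vec.subspace W"
    and tens: "\<And>u v w. \<lbrakk>u \<in> U; v \<in> V; w \<in> W\<rbrakk> \<Longrightarrow> P (tens (tens u v) w)"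
    and add: "\<And>s t. \<lbrakk>s \<in> tens_space (tens_space U V) W; t \<in> tens_space (tens_space U V) W; P s; P t\<rbrakk> \<Longrightarrow> P (s + t)"
  shows "P t"
  using assms(1) subspace_tens_space
proof (induction t rule: tens_induct)
  case (tens s w)
  from tens(1) sub(1) show ?case
    by (induction s rule: tens_induct)
      (use tens(2) assms in \<open>auto simp: tens_add_left\<close>)
qed (use add sub in auto)

section \<open>Linear categories\<close>

context vspace_on
begin

lemma add_cancel: assumes "x \<in> S" "y \<in> S" "z \<in> S" "add x y = add x z" shows "y = z"
proof -
  obtain x' where x': "x' \<in> S" "add x x' = zero" using add_inverse assms by blast
  have "add x' (add x y) = add x' (add x z)" using assms by simp
  then show ?thesis using x' assms add_assoc[of x' x] add_commute[of x' x] add_zero by metis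
qed

lemma scale_0_left: assumes "x \<in> S" shows "scale 0 x = zero"
proof -
  have m: "scale 0 x \<in> S" using scale_in assms by blast
  have "add (scale 0 x) (scale 0 x) = add (scale 0 x) zero"
    using scale_add_left[OF assms, of 0 0] add_zero[OF m] add_commute[OF m zero_in] by simp
  then show ?thesis using add_cancel m zero_in by blast
qed

lemma scale_0_right: "scale a zero = zero"
  using scale_0_left[OF zero_in] scale_scale[OF zero_in, of a 0] by simp

lemma add_zero_right: "x \<in> S \<Longrightarrow> add x zero = x"
  using add_zero add_commute zero_in by metis

end

context linear_category
begin

lemma hom_facts [simp]:
  assumes "X \<in> obj C" "Y \<in> obj C"
  shows "hzero C X Y \<in> hom C X Y"
    "f \<in> hom C X Y \<Longrightarrow> g \<in> hom C X Y \<Longrightarrow> hadd C X Y f g \<in> hom C X Y"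
    "f \<in> hom C X Y \<Longrightarrow> hscale C X Y a f \<in> hom C X Y"
    "f \<in> hom C X Y \<Longrightarrow> hscale C X Y 1 f = f"
    "f \<in> hom C X Y \<Longrightarrow> hscale C X Y 0 f = hzero C X Y"
    "f \<in> hom C X Y \<Longrightarrow> hadd C X Y (hzero C X Y) f = f"
    "f \<in> hom C X Y \<Longrightarrow> hadd C X Y f (hzero C X Y) = f"
proof -
  interpret vspace_on "hom C X Y" "hzero C X Y" "hadd C X Y" "hscale C X Y"
    using hom_vspace assms .
  show "hzero C X Y \<in> hom C X Y"
    "f \<in> hom C X Y \<Longrightarrow> g \<in> hom C X Y \<Longrightarrow> hadd C X Y f g \<in> hom C X Y"
    "f \<in> hom C X Y \<Longrightarrow> hscale C X Y a f \<in> hom C X Y"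
    "f \<in> hom C X Y \<Longrightarrow> hscale C X Y 1 f = f"
    "f \<in> hom C X Y \<Longrightarrow> hscale C X Y 0 f = hzero C X Y"
    "f \<in> hom C X Y \<Longrightarrow> hadd C X Y (hzero C X Y) f = f"
    "f \<in> hom C X Y \<Longrightarrow> hadd C X Y f (hzero C X Y) = f"
    using zero_in add_in scale_in scale_one scale_0_left add_zero add_zero_right by auto
qed

lemmas cat_in [simp] = ident_in cmp_in
lemmas cat_unit [simp] = ident_left ident_right

lemma cmp_zero_right [simp]:
  assumes "X \<in> obj C" "Y \<in> obj C" "Z \<in> obj C" "g \<in> hom C Y Z"
  shows "cmp C X Y Z g (hzero C X Y) = hzero C X Z"
  using cmp_scale_right[OF assms(1-3) hom_facts(1)[OF assms(1,2)] assms(4), of 0] assms by simp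

lemma cmp_zero_left [simp]:
  assumes "X \<in> obj C" "Y \<in> obj C" "Z \<in> obj C" "f \<in> hom C X Y"
  shows "cmp C X Y Z (hzero C Y Z) f = hzero C X Z"
  using cmp_scale_left[OF assms(1-4) hom_facts(1)[OF assms(2,3)], of 0] assms by simp

lemma hom_sum_in [simp]:
  assumes "X \<in> obj C" "Y \<in> obj C" "\<And>j. j < n \<Longrightarrow> f j \<in> hom C X Y"
  shows "hom_sum C X Y f n \<in> hom C X Y"
  using assms(3) by (induction n) (use assms(1,2) in auto)

lemma hom_sum_cong:
  "(\<And>j. j < n \<Longrightarrow> f j = g j) \<Longrightarrow> hom_sum C X Y f n = hom_sum C X Y g n"
  by (induction n) auto

lemma cmp_hom_sum_right:
  assumes "X \<in> obj C" "Y \<in> obj C" "Z \<in> obj C" "\<And>j. j < n \<Longrightarrow> f j \<in> hom C X Y" "g \<in> hom C Y Z"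
  shows "cmp C X Y Z g (hom_sum C X Y f n) = hom_sum C X Z (\<lambda>j. cmp C X Y Z g (f j)) n"
  using assms(4) by (induction n) (use assms(1,2,3,5) in \<open>auto simp: cmp_add_right\<close>)

lemma cmp_hom_sum_left:
  assumes "X \<in> obj C" "Y \<in> obj C" "Z \<in> obj C" "\<And>j. j < n \<Longrightarrow> f j \<in> hom C Y Z" "g \<in> hom C X Y"
  shows "cmp C X Y Z (hom_sum C Y Z f n) g = hom_sum C X Z (\<lambda>j. cmp C X Y Z (f j) g) n"
  using assms(4) by (induction n) (use assms(1,2,3,5) in \<open>auto simp: cmp_add_left\<close>)

lemma direct_sumD:
  assumes "direct_sum C n S X i p"
  shows "X \<in> obj C" "j < n \<Longrightarrow> S j \<in> obj C" "j < n \<Longrightarrow> i j \<in> hom C (S j) X"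
    "j < n \<Longrightarrow> p j \<in> hom C X (S j)"
    "j < n \<Longrightarrow> l < n \<Longrightarrow> cmp C (S j) X (S l) (p l) (i j) = (if j = l then ident C (S j) else hzero C (S j) (S l))"
    "hom_sum C X X (\<lambda>j. cmp C X (S j) X (i j) (p j)) n = ident C X"
  using assms by (auto simp: direct_sum_def)

lemma direct_sum_cancel_proj:
  assumes "direct_sum C n S X i p" "W \<in> obj C" "f \<in> hom C W X" "g \<in> hom C W X"
    "\<And>j. j < n \<Longrightarrow> cmp C W X (S j) (p j) f = cmp C W X (S j) (p j) g"
  shows "f = g"
proof -
  note d = direct_sumD[OF assms(1)]
  have "h = hom_sum C W X (\<lambda>j. cmp C W (S j) X (i j) (cmp C W X (S j) (p j) h)) n" if h: "h \<in> hom C W X" for h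
  proof -
    have "h = cmp C W X X (hom_sum C X X (\<lambda>j. cmp C X (S j) X (i j) (p j)) n) h"
      using d h assms(2) by simp
    also have "\<dots> = hom_sum C W X (\<lambda>j. cmp C W X X (cmp C X (S j) X (i j) (p j)) h) n"
      by (rule cmp_hom_sum_left) (use d h assms(2) in auto)
    also have "\<dots> = hom_sum C W X (\<lambda>j. cmp C W (S j) X (i j) (cmp C W X (S j) (p j) h)) n"
      by (rule hom_sum_cong) (use d h assms(2) cmp_assoc in auto)
    finally show ?thesis .
  qed
  from this[OF assms(3)] this[OF assms(4)] show ?thesis
    using hom_sum_cong[of n "\<lambda>j. cmp C W (S j) X (i j) (cmp C W X (S j) (p j) f)"
      "\<lambda>j. cmp C W (S j) X (i j) (cmp C W X (S j) (p j) g)" W X] assms(5) by simp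
qed

lemma direct_sum_cancel_incl:
  assumes "direct_sum C n S X i p" "W \<in> obj C" "f \<in> hom C X W" "g \<in> hom C X W"
    "\<And>j. j < n \<Longrightarrow> cmp C (S j) X W f (i j) = cmp C (S j) X W g (i j)"
  shows "f = g"
proof -
  note d = direct_sumD[OF assms(1)]
  have "h = hom_sum C X W (\<lambda>j. cmp C X (S j) W (cmp C (S j) X W h (i j)) (p j)) n" if h: "h \<in> hom C X W" for h
  proof -
    have "h = cmp C X X W h (hom_sum C X X (\<lambda>j. cmp C X (S j) X (i j) (p j)) n)"
      using d h assms(2) by simp
    also have "\<dots> = hom_sum C X W (\<lambda>j. cmp C X X W h (cmp C X (S j) X (i j) (p j))) n"
      by (rule cmp_hom_sum_right) (use d h assms(2) in auto)
    also have "\<dots> = hom_sum C X W (\<lambda>j. cmp C X (S j) W (cmp C (S j) X W h (i j)) (p j)) n"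
      by (rule hom_sum_cong) (use d h assms(2) cmp_assoc in auto)
    finally show ?thesis .
  qed
  from this[OF assms(3)] this[OF assms(4)] show ?thesis
    using hom_sum_cong[of n "\<lambda>j. cmp C X (S j) W (cmp C (S j) X W f (i j)) (p j)"
      "\<lambda>j. cmp C X (S j) W (cmp C (S j) X W g (i j)) (p j)" X W] assms(5) by simp
qed

lemma is_isoI:
  assumes "f \<in> hom C X Y" "g \<in> hom C Y X" "cmp C X Y X g f = ident C X" "cmp C Y X Y f g = ident C Y"
  shows "is_iso C X Y f"
  using assms by (auto simp: is_iso_def)

lemma is_isoE:
  assumes "is_iso C X Y f"
  obtains g where "f \<in> hom C X Y" "g \<in> hom C Y X" "cmp C X Y X g f = ident C X" "cmp C Y X Y f g = ident C Y"
  using assms by (auto simp: is_iso_def)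

lemma iso_cmp:
  assumes "X \<in> obj C" "Y \<in> obj C" "Z \<in> obj C" "is_iso C X Y f" "is_iso C Y Z g"
  shows "is_iso C X Z (cmp C X Y Z g f)"
proof -
  obtain f' where f: "f \<in> hom C X Y" "f' \<in> hom C Y X" "cmp C X Y X f' f = ident C X" "cmp C Y X Y f f' = ident C Y"
    using assms(4) by (rule is_isoE)
  obtain g' where g: "g \<in> hom C Y Z" "g' \<in> hom C Z Y" "cmp C Y Z Y g' g = ident C Y" "cmp C Z Y Z g g' = ident C Z"
    using assms(5) by (rule is_isoE)
  have "cmp C X Z X (cmp C Z Y X f' g') (cmp C X Y Z g f) = cmp C X Y X f' (cmp C X Y Y (cmp C Y Z Y g' g) f)"
    using assms f(1,2) g(1,2) by (simp add: cmp_assoc del: cat_unit)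
  moreover have "cmp C Z X Z (cmp C X Y Z g f) (cmp C Z Y X f' g') = cmp C Z Y Z g (cmp C Z Y Y (cmp C Y X Y f f') g')"
    using assms f(1,2) g(1,2) by (simp add: cmp_assoc del: cat_unit)
  ultimately show ?thesis using assms f g by (intro is_isoI[of _ _ _ "cmp C Z Y X f' g'"]) auto
qed

lemma iso_cancel_left:
  assumes "X \<in> obj C" "Y \<in> obj C" "W \<in> obj C" "is_iso C X Y u" "f \<in> hom C W X" "g \<in> hom C W X"
    "cmp C W X Y u f = cmp C W X Y u g"
  shows "f = g"
proof -
  obtain u' where u: "u \<in> hom C X Y" "u' \<in> hom C Y X" "cmp C X Y X u' u = ident C X"
    using assms(4) by (rule is_isoE)
  have "cmp C W X X (cmp C X Y X u' u) f = cmp C W X X (cmp C X Y X u' u) g"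
    using assms u(1,2) by (simp add: cmp_assoc)
  then show ?thesis using u assms by simp
qed

lemma iso_cancel_right:
  assumes "X \<in> obj C" "Y \<in> obj C" "W \<in> obj C" "is_iso C X Y u" "f \<in> hom C Y W" "g \<in> hom C Y W"
    "cmp C X Y W f u = cmp C X Y W g u"
  shows "f = g"
proof -
  obtain u' where u: "u \<in> hom C X Y" "u' \<in> hom C Y X" "cmp C Y X Y u u' = ident C Y"
    using assms(4) by (rule is_isoE)
  have "cmp C Y Y W f (cmp C Y X Y u u') = cmp C Y Y W g (cmp C Y X Y u u')"
    using assms u(1,2) by (simp add: cmp_assoc[symmetric])
  then show ?thesis using u assms by simp
qed

end

section \<open>Fully faithful and essentially surjective functors are equivalences\<close>

text \<open>A quasi-inverse is chosen on objects by essential surjectivity and on morphisms by transporting along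
  the chosen isomorphisms and taking preimages. Every equation required of it becomes an equation in
  \<open>D\<close> by faithfulness, where the isomorphisms cancel.\<close>

lemma (in linear_functor) equivalenceI:
  assumes full: "\<And>X Y g. \<lbrakk>X \<in> obj C; Y \<in> obj C; g \<in> hom D (Fo X) (Fo Y)\<rbrakk> \<Longrightarrow> \<exists>f\<in>hom C X Y. Fm X Y f = g"
    and faithful: "\<And>X Y f g. \<lbrakk>X \<in> obj C; Y \<in> obj C; f \<in> hom C X Y; g \<in> hom C X Y; Fm X Y f = Fm X Y g\<rbrakk> \<Longrightarrow> f = g"
    and ess: "\<And>V. V \<in> obj D \<Longrightarrow> \<exists>X\<in>obj C. isomorphic D (Fo X) V"
  shows "is_equivalence C D Fo Fm"
proof -
  have "\<exists>X t t'. X \<in> obj C \<and> t \<in> hom D (Fo X) V \<and> t' \<in> hom D V (Fo X) \<and>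
      cmp D (Fo X) V (Fo X) t' t = ident D (Fo X) \<and> cmp D V (Fo X) V t t' = ident D V" if "V \<in> obj D" for V
    using ess[OF that] unfolding isomorphic_def is_iso_def by blast
  then obtain Go t t' where G [simp]: "\<And>V. V \<in> obj D \<Longrightarrow> Go V \<in> obj C"
    "\<And>V. V \<in> obj D \<Longrightarrow> t V \<in> hom D (Fo (Go V)) V" "\<And>V. V \<in> obj D \<Longrightarrow> t' V \<in> hom D V (Fo (Go V))"
    "\<And>V. V \<in> obj D \<Longrightarrow> cmp D (Fo (Go V)) V (Fo (Go V)) (t' V) (t V) = ident D (Fo (Go V))"
    "\<And>V. V \<in> obj D \<Longrightarrow> cmp D V (Fo (Go V)) V (t V) (t' V) = ident D V"
    by metis
  note [simp] = Fo_in Fm_in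
  have can1 [simp]: "cmp D U V (Fo (Go V)) (t' V) (cmp D U (Fo (Go V)) V (t V) h) = h"
    if "V \<in> obj D" "U \<in> obj D" "h \<in> hom D U (Fo (Go V))" for U V h
    using D.cmp_assoc[of U "Fo (Go V)" V "Fo (Go V)" h "t V" "t' V"] that by simp
  have can2 [simp]: "cmp D U (Fo (Go V)) V (t V) (cmp D U V (Fo (Go V)) (t' V) h) = h"
    if "V \<in> obj D" "U \<in> obj D" "h \<in> hom D U V" for U V h
    using D.cmp_assoc[of U V "Fo (Go V)" V h "t' V" "t V"] that by simp
  have "\<exists>g. X \<in> obj C \<longrightarrow> Y \<in> obj C \<longrightarrow> f \<in> hom D (Fo X) (Fo Y) \<longrightarrow> g \<in> hom C X Y \<and> Fm X Y g = f" for X Y f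
    using full by blast
  then obtain pre where pre': "\<And>X Y f. X \<in> obj C \<longrightarrow> Y \<in> obj C \<longrightarrow> f \<in> hom D (Fo X) (Fo Y)
    \<longrightarrow> pre X Y f \<in> hom C X Y \<and> Fm X Y (pre X Y f) = f" by metis
  then have pre [simp]: "pre X Y f \<in> hom C X Y" "Fm X Y (pre X Y f) = f"
    if "X \<in> obj C" "Y \<in> obj C" "f \<in> hom D (Fo X) (Fo Y)" for X Y f using that by auto
  define Gm where "Gm V W f = pre (Go V) (Go W) (cmp D (Fo (Go V)) W (Fo (Go W)) (t' W) (cmp D (Fo (Go V)) V W f (t V)))" for V W f
  have Gm_in [simp]: "Gm V W f \<in> hom C (Go V) (Go W)"
    and FGm [simp]: "Fm (Go V) (Go W) (Gm V W f) = cmp D (Fo (Go V)) W (Fo (Go W)) (t' W) (cmp D (Fo (Go V)) V W f (t V))"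
    if "V \<in> obj D" "W \<in> obj D" "f \<in> hom D V W" for V W f
    using that by (auto simp: Gm_def)
  have Gfun: "linear_functor D C Go Gm"
  proof unfold_locales
    fix X Y Z f g assume [simp]: "X \<in> obj D" "Y \<in> obj D" "Z \<in> obj D" "f \<in> hom D X Y" "g \<in> hom D Y Z"
    show "Gm X Z (cmp D X Y Z g f) = cmp C (Go X) (Go Y) (Go Z) (Gm Y Z g) (Gm X Y f)"
      by (rule faithful[of "Go X" "Go Z"]) (simp_all add: Fm_cmp D.cmp_assoc)
  next
    fix X assume [simp]: "X \<in> obj D"
    show "Gm X X (ident D X) = ident C (Go X)"
      by (rule faithful[of "Go X" "Go X"]) (simp_all add: Fm_ident)
  next
    fix X Y f g assume [simp]: "X \<in> obj D" "Y \<in> obj D" "f \<in> hom D X Y" "g \<in> hom D X Y"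
    show "Gm X Y (hadd D X Y f g) = hadd C (Go X) (Go Y) (Gm X Y f) (Gm X Y g)"
      by (rule faithful[of "Go X" "Go Y"]) (simp_all add: Fm_add D.cmp_add_left D.cmp_add_right)
    fix a
    show "Gm X Y (hscale D X Y a f) = hscale C (Go X) (Go Y) a (Gm X Y f)"
      by (rule faithful[of "Go X" "Go Y"]) (simp_all add: Fm_scale D.cmp_scale_left D.cmp_scale_right)
  qed auto
  define \<eta> where "\<eta> X = pre X (Go (Fo X)) (t' (Fo X))" for X
  have \<eta> [simp]: "\<eta> X \<in> hom C X (Go (Fo X))" "Fm X (Go (Fo X)) (\<eta> X) = t' (Fo X)" if "X \<in> obj C" for X
    using that by (auto simp: \<eta>_def)
  have 1: "natural_iso C C (\<lambda>X. X) (\<lambda>X Y f. f)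
          (\<lambda>X. Go (Fo X)) (\<lambda>X Y f. Gm (Fo X) (Fo Y) (Fm X Y f)) \<eta>"
    unfolding natural_iso_def
  proof (intro conjI ballI)
    fix X assume [simp]: "X \<in> obj C"
    show "is_iso C X (Go (Fo X)) (\<eta> X)"
    proof (rule C.is_isoI[of _ _ _ "pre (Go (Fo X)) X (t (Fo X))"])
      show "cmp C X (Go (Fo X)) X (pre (Go (Fo X)) X (t (Fo X))) (\<eta> X) = ident C X"
        by (rule faithful[of X X]) (simp_all add: Fm_cmp Fm_ident)
      show "cmp C (Go (Fo X)) X (Go (Fo X)) (\<eta> X) (pre (Go (Fo X)) X (t (Fo X))) = ident C (Go (Fo X))"
        by (rule faithful[of "Go (Fo X)" "Go (Fo X)"]) (simp_all add: Fm_cmp Fm_ident)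
    qed auto
    fix Y f assume [simp]: "Y \<in> obj C" "f \<in> hom C X Y"
    show "cmp C X Y (Go (Fo Y)) (\<eta> Y) f = cmp C X (Go (Fo X)) (Go (Fo Y)) (Gm (Fo X) (Fo Y) (Fm X Y f)) (\<eta> X)"
      by (rule faithful[of X "Go (Fo Y)"]) (simp_all add: Fm_cmp D.cmp_assoc)
  qed
  have 2: "natural_iso D D (\<lambda>V. Fo (Go V)) (\<lambda>V W f. Fm (Go V) (Go W) (Gm V W f))
          (\<lambda>V. V) (\<lambda>V W f. f) t"
    unfolding natural_iso_def
  proof (intro conjI ballI)
    fix V assume [simp]: "V \<in> obj D"
    show "is_iso D (Fo (Go V)) V (t V)" by (rule D.is_isoI[of _ _ _ "t' V"]) auto
    fix W f assume [simp]: "W \<in> obj D" "f \<in> hom D V W"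
    show "cmp D (Fo (Go V)) (Fo (Go W)) W (t W) (Fm (Go V) (Go W) (Gm V W f))
       = cmp D (Fo (Go V)) V W f (t V)" by simp
  qed
  show ?thesis unfolding is_equivalence_def
    using linear_functor_axioms Gfun 1 2 by blast
qed

section \<open>The linear category of modules\<close>

lemma hmod_homD:
  assumes "f \<in> hmod_hom H V W"
  shows "lin_on (mcarr V) (mcarr W) f" "\<And>x. x \<notin> mcarr V \<Longrightarrow> f x = 0"
    "\<And>h v. h \<in> carr H \<Longrightarrow> v \<in> mcarr V \<Longrightarrow> f (act V h v) = act W h (f v)"
  using assms by (auto simp: hmod_hom_def)

lemma hmod_homI:
  assumes "lin_on (mcarr V) (mcarr W) f" "\<And>x. x \<notin> mcarr V \<Longrightarrow> f x = 0"
    "\<And>h v. h \<in> carr H \<Longrightarrow> v \<in> mcarr V \<Longrightarrow> f (act V h v) = act W h (f v)"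
  shows "f \<in> hmod_hom H V W"
  using assms by (auto simp: hmod_hom_def)

lemma is_hmodD:
  assumes "is_hmod H V"
  shows "fin_dim (mcarr V)" "vec.subspace (mcarr V)" "bilin_on (carr H) (mcarr V) (mcarr V) (act V)"
    "v \<in> mcarr V \<Longrightarrow> act V (one H) v = v"
    "g \<in> carr H \<Longrightarrow> h \<in> carr H \<Longrightarrow> v \<in> mcarr V \<Longrightarrow> act V (mult H g h) v = act V g (act V h v)"
    "h \<in> carr H \<Longrightarrow> v \<in> mcarr V \<Longrightarrow> act V h v \<in> mcarr V"
  using assms fin_dim_subspace bilin_on_in by (auto simp: is_hmod_def)

lemma zero_ext_in [simp]: "x \<in> V \<Longrightarrow> zero_ext V f x = f x"
  and zero_ext_out [simp]: "x \<notin> V \<Longrightarrow> zero_ext V f x = 0"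
  by (auto simp: zero_ext_def)

lemma lin_on_zero_ext [simp]: "vec.subspace V \<Longrightarrow> lin_on V W (zero_ext V f) \<longleftrightarrow> lin_on V W f"
  by (auto simp: lin_on_def zero_ext_def vec.subspace_add vec.subspace_scale)

lemma Rep_sel [simp]:
  "obj (Rep H) = {V. is_hmod H V}" "hom (Rep H) = hmod_hom H"
  "ident (Rep H) V = zero_ext (mcarr V) (\<lambda>v. v)" "cmp (Rep H) U V W g f = g \<circ> f"
  "hzero (Rep H) V W = (\<lambda>v. 0)" "hadd (Rep H) V W = (\<lambda>f g v. f v + g v)"
  "hscale (Rep H) V W = (\<lambda>a f v. vscale a (f v))"
  "tobj (Rep H) = hmod_tensor H"
  "tmor (Rep H) V V' W W' f g = zero_ext (mcarr (hmod_tensor H V W)) (tmap (mcarr V) (mcarr W) f g)"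
  "unit_obj (Rep H) = hmod_unit H"
  "associator (Rep H) U V W = zero_ext (mcarr (hmod_tensor H (hmod_tensor H U V) W)) reassoc"
  "lunit (Rep H) V = zero_ext (mcarr (hmod_tensor H (hmod_unit H) V))
        (tens_lift (base H) (mcarr V) (\<lambda>z v. vscale (counit H z) v))"
  "runit (Rep H) V = zero_ext (mcarr (hmod_tensor H V (hmod_unit H)))
        (tens_lift (mcarr V) (base H) (\<lambda>v z. vscale (counit H z) v))"
  by (simp_all add: Rep_def)

lemma hmod_hom_0: "is_hmod H V \<Longrightarrow> f \<in> hmod_hom H V W \<Longrightarrow> f 0 = 0"
  using lin_on_0 hmod_homD(1) is_hmodD(2) vec.subspace_0 by blast

lemma hmod_hom_in: "f \<in> hmod_hom H V W \<Longrightarrow> v \<in> mcarr V \<Longrightarrow> f v \<in> mcarr W"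
  using hmod_homD(1) lin_on_in by blast

lemma hmod_hom_add:
  assumes "is_hmod H V" "f \<in> hmod_hom H V W" "(x \<in> mcarr V \<and> y \<in> mcarr V) \<or> x = 0 \<and> y = 0"
  shows "f (x + y) = f x + f y"
  using assms lin_on_add[OF hmod_homD(1)[OF assms(2)]] hmod_hom_0[OF assms(1,2)] by auto

lemma hmod_hom_scale:
  assumes "is_hmod H V" "f \<in> hmod_hom H V W" "x \<in> mcarr V \<or> x = 0"
  shows "f (vscale a x) = vscale a (f x)"
  using assms lin_on_scale[OF hmod_homD(1)[OF assms(2)]] hmod_hom_0[OF assms(1,2)] by auto

lemma Rep_linear: "linear_category (Rep H)"
proof (rule linear_category.intro, unfold Rep_sel mem_Collect_eq)
  fix X assume X: "is_hmod H X"
  show "zero_ext (mcarr X) (\<lambda>v. v) \<in> hmod_hom H X X"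
    by (rule hmod_homI) (use is_hmodD[OF X] in auto)
next
  fix X Y Z f g assume X: "is_hmod H X" "is_hmod H Y" "is_hmod H Z" and f: "f \<in> hmod_hom H X Y" and g: "g \<in> hmod_hom H Y Z"
  show "g \<circ> f \<in> hmod_hom H X Z"
  proof (rule hmod_homI)
    show "lin_on (mcarr X) (mcarr Z) (g \<circ> f)"
      using lin_on_cmp[OF hmod_homD(1)[OF f] hmod_homD(1)[OF g]] by (simp add: o_def)
    show "(g \<circ> f) x = 0" if "x \<notin> mcarr X" for x
      using hmod_homD(2)[OF f that] hmod_hom_0[OF X(2) g] by simp
    show "(g \<circ> f) (act X h v) = act Z h ((g \<circ> f) v)" if "h \<in> carr H" "v \<in> mcarr X" for h v
      using that hmod_homD(3)[OF f] hmod_homD(3)[OF g] hmod_hom_in[OF f] by simp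
  qed
  fix a
  show "(\<lambda>v. vscale a (g v)) \<circ> f = (\<lambda>v. vscale a ((g \<circ> f) v))" by (simp add: fun_eq_iff)
  have f0: "f x = 0" if "x \<notin> mcarr X" for x using hmod_homD(2)[OF f that] .
  show "g \<circ> (\<lambda>v. vscale a (f v)) = (\<lambda>v. vscale a ((g \<circ> f) v))"
  proof
    fix v show "(g \<circ> (\<lambda>v. vscale a (f v))) v = vscale a ((g \<circ> f) v)"
      using hmod_hom_scale[OF X(2) g, of "f v" a] f0 hmod_hom_in[OF f] by (cases "v \<in> mcarr X") auto
  qed
  fix f' assume f': "f' \<in> hmod_hom H X Y"
  show "g \<circ> (\<lambda>v. f v + f' v) = (\<lambda>v. (g \<circ> f) v + (g \<circ> f') v)"
  proof
    fix v show "(g \<circ> (\<lambda>v. f v + f' v)) v = (g \<circ> f) v + (g \<circ> f') v"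
      using hmod_hom_add[OF X(2) g, of "f v" "f' v"] f0 hmod_homD(2)[OF f', of v] hmod_hom_in[OF f] hmod_hom_in[OF f']
      by (cases "v \<in> mcarr X") auto
  qed
next
  fix X Y f assume X: "is_hmod H X" "is_hmod H Y" and f: "f \<in> hmod_hom H X Y"
  show "zero_ext (mcarr Y) (\<lambda>v. v) \<circ> f = f"
  proof
    fix x show "(zero_ext (mcarr Y) (\<lambda>v. v) \<circ> f) x = f x"
      using hmod_hom_in[OF f] hmod_homD(2)[OF f] by (cases "x \<in> mcarr X") (auto simp: zero_ext_def)
  qed
  show "f \<circ> zero_ext (mcarr X) (\<lambda>v. v) = f"
  proof
    fix x show "(f \<circ> zero_ext (mcarr X) (\<lambda>v. v)) x = f x"
      using hmod_hom_0[OF X(1) f] hmod_homD(2)[OF f] by (cases "x \<in> mcarr X") auto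
  qed
next
  fix X Y assume X: "is_hmod H X" "is_hmod H Y"
  note Y = is_hmodD[OF X(2)]
  note yl = bilin_on_lin[OF Y(3)]
  have ya: "act Y h (x + y) = act Y h x + act Y h y" if "h \<in> carr H" "x \<in> mcarr Y" "y \<in> mcarr Y" for h x y
    using lin_on_add[OF yl[OF that(1)] that(2,3)] .
  have ys: "act Y h (vscale a x) = vscale a (act Y h x)" if "h \<in> carr H" "x \<in> mcarr Y" for h x a
    using lin_on_scale[OF yl[OF that(1)] that(2)] .
  have lin: "f (x + y) = f x + f y" "f (vscale a x) = vscale a (f x)"
    if "f \<in> hmod_hom H X Y" "x \<in> mcarr X" "y \<in> mcarr X" for f x y a
    using hmod_homD(1)[OF that(1)] that by (auto simp: lin_on_def)
  have sc: "(\<lambda>v. vscale a (f v)) \<in> hmod_hom H X Y" if "f \<in> hmod_hom H X Y" for a f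
    by (rule hmod_homI; (rule lin_onI)?)
      (use that in \<open>simp_all add: vec.subspace_scale[OF Y(2)] hmod_hom_in lin vscale_add hmod_homD(2,3) ys mult.commute\<close>)
  show "vspace_on (hmod_hom H X Y) (\<lambda>v. 0) (\<lambda>f g v. f v + g v) (\<lambda>a f v. vscale a (f v))"
  proof
    show "(\<lambda>v. 0) \<in> hmod_hom H X Y"
      by (rule hmod_homI) (use vec.subspace_0[OF Y(2)] lin_on_0[OF yl] in \<open>auto simp: lin_on_def\<close>)
    show "(\<lambda>v. f v + g v) \<in> hmod_hom H X Y" if "f \<in> hmod_hom H X Y" "g \<in> hmod_hom H X Y" for f g
      by (rule hmod_homI; (rule lin_onI)?)
        (use that in \<open>simp_all add: vec.subspace_add[OF Y(2)] hmod_hom_in lin vscale_add hmod_homD(2,3) ya\<close>)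
    show "(\<lambda>v. vscale a (f v)) \<in> hmod_hom H X Y" if "f \<in> hmod_hom H X Y" for a f
      using sc[OF that] .
    show "\<exists>g\<in>hmod_hom H X Y. (\<lambda>v. f v + g v) = (\<lambda>v. 0)" if "f \<in> hmod_hom H X Y" for f
      by (rule bexI[OF _ sc[OF that, of "-1"]]) (auto simp: fun_eq_iff vscale_def fun_apply)
  qed (auto simp: vscale_add vscale_add_left add_ac)
qed (auto simp: o_def)

section \<open>Fibre functors and their algebra of natural endomorphisms\<close>

lemma csp_lin_expand:
  assumes "finite B" "v \<in> csp B" "lin_on (csp B) U f"
  shows "f v = (\<Sum>i\<in>B. vscale (v i) (f (uv i)))"
proof -
  have mem: "vscale c (uv i) \<in> csp B" if "i \<in> B" for i c
    using that subspace_csp uv_in_csp vec.subspace_scale by blast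
  have "f v = f (\<Sum>i\<in>B. vscale (v i) (uv i))" using csp_expand[OF assms(1,2)] by (rule arg_cong)
  also have "\<dots> = (\<Sum>i\<in>B. f (vscale (v i) (uv i)))" by (rule lin_on_sum[OF assms(3) subspace_csp mem])
  also have "\<dots> = (\<Sum>i\<in>B. vscale (v i) (f (uv i)))"
    by (intro sum.cong) (auto intro: lin_on_scale[OF assms(3)])
  finally show ?thesis .
qed

text \<open>A linear functor to finite dimensional vector spaces on a split semisimple category with simple
  objects \<open>S 0, \<dots>, S (n - 1)\<close>. Its value on \<open>X\<close> is the coordinate space over \<open>B X\<close>. Nonvanishing
  on the simple objects is what makes the functor faithful.\<close>

locale linear_fibre_functor = linear_category C
  for C :: "('o, 'm, 'k::field, 'z) lin_cat_scheme" +
  fixes n :: nat and S :: "nat \<Rightarrow> 'o" and B :: "'o \<Rightarrow> nat set"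
    and Fm :: "'o \<Rightarrow> 'o \<Rightarrow> 'm \<Rightarrow> 'k seq \<Rightarrow> 'k seq"
  assumes S_obj [simp]: "\<And>i. i < n \<Longrightarrow> S i \<in> obj C"
    and schur_eq: "\<And>i f. \<lbrakk>i < n; f \<in> hom C (S i) (S i)\<rbrakk> \<Longrightarrow> \<exists>c. f = hscale C (S i) (S i) c (ident C (S i))"
    and schur_neq: "\<And>i j f. \<lbrakk>i < n; j < n; i \<noteq> j; f \<in> hom C (S i) (S j)\<rbrakk> \<Longrightarrow> f = hzero C (S i) (S j)"
    and decomp: "\<And>X. X \<in> obj C \<Longrightarrow> \<exists>m \<sigma> i p. (\<forall>j<m. \<sigma> j < n) \<and> direct_sum C m (\<lambda>j. S (\<sigma> j)) X i p"
    and sums: "\<And>m \<sigma>. \<forall>j<m. \<sigma> j < n \<Longrightarrow> \<exists>X i p. direct_sum C m (\<lambda>j. S (\<sigma> j)) X i p"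
    and B_fin [simp]: "\<And>X. X \<in> obj C \<Longrightarrow> finite (B X)"
    and B_ne: "\<And>i. i < n \<Longrightarrow> B (S i) \<noteq> {}"
    and Fm_lin: "\<And>X Y f. \<lbrakk>X \<in> obj C; Y \<in> obj C; f \<in> hom C X Y\<rbrakk> \<Longrightarrow> lin_on (csp (B X)) (csp (B Y)) (Fm X Y f)"
    and Fm_ident [simp]: "\<And>X v. \<lbrakk>X \<in> obj C; v \<in> csp (B X)\<rbrakk> \<Longrightarrow> Fm X X (ident C X) v = v"
    and Fm_cmp: "\<And>X Y Z f g v. \<lbrakk>X \<in> obj C; Y \<in> obj C; Z \<in> obj C; f \<in> hom C X Y; g \<in> hom C Y Z; v \<in> csp (B X)\<rbrakk>
      \<Longrightarrow> Fm X Z (cmp C X Y Z g f) v = Fm Y Z g (Fm X Y f v)"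
    and Fm_hadd: "\<And>X Y f g v. \<lbrakk>X \<in> obj C; Y \<in> obj C; f \<in> hom C X Y; g \<in> hom C X Y; v \<in> csp (B X)\<rbrakk>
      \<Longrightarrow> Fm X Y (hadd C X Y f g) v = Fm X Y f v + Fm X Y g v"
    and Fm_hscale: "\<And>X Y f a v. \<lbrakk>X \<in> obj C; Y \<in> obj C; f \<in> hom C X Y; v \<in> csp (B X)\<rbrakk>
      \<Longrightarrow> Fm X Y (hscale C X Y a f) v = vscale a (Fm X Y f v)"
begin

abbreviation "V X \<equiv> (csp (B X) :: 'k seq set)"

lemma V_closed [simp]: "u \<in> csp A \<Longrightarrow> v \<in> csp A \<Longrightarrow> u + v \<in> csp A" "v \<in> csp A \<Longrightarrow> vscale c v \<in> csp A"
  "0 \<in> csp A" "(\<And>i. i \<in> I \<Longrightarrow> f i \<in> csp A) \<Longrightarrow> sum f I \<in> csp A"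
  for u v :: "'k seq" and f :: "'i \<Rightarrow> 'k seq"
  using subspace_csp[of A] by (auto intro: vec.subspace_add vec.subspace_scale vec.subspace_0 vec.subspace_sum)

lemma Fm_in [simp]: "\<lbrakk>X \<in> obj C; Y \<in> obj C; f \<in> hom C X Y; v \<in> V X\<rbrakk> \<Longrightarrow> Fm X Y f v \<in> V Y"
  using Fm_lin lin_on_in by blast

lemma Fm_add: "\<lbrakk>X \<in> obj C; Y \<in> obj C; f \<in> hom C X Y; u \<in> V X; v \<in> V X\<rbrakk> \<Longrightarrow> Fm X Y f (u + v) = Fm X Y f u + Fm X Y f v"
  using Fm_lin lin_on_add by blast

lemma Fm_scale: "\<lbrakk>X \<in> obj C; Y \<in> obj C; f \<in> hom C X Y; u \<in> V X\<rbrakk> \<Longrightarrow> Fm X Y f (vscale c u) = vscale c (Fm X Y f u)"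
  using Fm_lin lin_on_scale by blast

lemma Fm_0 [simp]: "\<lbrakk>X \<in> obj C; Y \<in> obj C; f \<in> hom C X Y\<rbrakk> \<Longrightarrow> Fm X Y f 0 = 0"
  using lin_on_0[OF Fm_lin] by simp

lemma Fm_sum:
  assumes "X \<in> obj C" "Y \<in> obj C" "f \<in> hom C X Y" "\<And>i. i \<in> I \<Longrightarrow> g i \<in> V X"
  shows "Fm X Y f (\<Sum>i\<in>I. g i) = (\<Sum>i\<in>I. Fm X Y f (g i))"
  by (rule lin_on_sum[OF Fm_lin[OF assms(1-3)] subspace_csp assms(4)])

lemma Fm_hzero [simp]: "\<lbrakk>X \<in> obj C; Y \<in> obj C; v \<in> V X\<rbrakk> \<Longrightarrow> Fm X Y (hzero C X Y) v = 0"
  using Fm_hscale[of X Y "hzero C X Y" v 0] by simp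

lemma Fm_hom_sum:
  assumes "X \<in> obj C" "Y \<in> obj C" "\<And>j. j < m \<Longrightarrow> f j \<in> hom C X Y" "v \<in> V X"
  shows "Fm X Y (hom_sum C X Y f m) v = (\<Sum>j<m. Fm X Y (f j) v)"
  using assms(3) by (induction m) (use assms in \<open>auto simp: Fm_hadd\<close>)

lemma direct_sum_expand:
  assumes "direct_sum C m T X i p" "v \<in> V X"
  shows "v = (\<Sum>j<m. Fm (T j) X (i j) (Fm X (T j) (p j) v))"
proof -
  note d = direct_sumD[OF assms(1)]
  have "v = Fm X X (hom_sum C X X (\<lambda>j. cmp C X (T j) X (i j) (p j)) m) v" using d assms by simp
  also have "\<dots> = (\<Sum>j<m. Fm X X (cmp C X (T j) X (i j) (p j)) v)"
    by (rule Fm_hom_sum) (use d assms in auto)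
  also have "\<dots> = (\<Sum>j<m. Fm (T j) X (i j) (Fm X (T j) (p j) v))"
    by (rule sum.cong) (use d assms in \<open>auto simp: Fm_cmp\<close>)
  finally show ?thesis .
qed

text \<open>\<open>F(X)\<close> is the sum of the images of \<open>F(f)\<close> over all \<open>f : S\<^sub>s \<rightarrow> X\<close>. Hence additive identities
  that are natural in \<open>X\<close> need only be checked on simple objects.\<close>

lemma simple_induct [consumes 2, case_names zero simple add]:
  assumes X: "X \<in> obj C" and v: "v \<in> V X" and "P 0"
    and simple: "\<And>s f w. \<lbrakk>s < n; f \<in> hom C (S s) X; w \<in> V (S s)\<rbrakk> \<Longrightarrow> P (Fm (S s) X f w)"
    and add: "\<And>u w. \<lbrakk>u \<in> V X; w \<in> V X; P u; P w\<rbrakk> \<Longrightarrow> P (u + w)"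
  shows "P v"
proof -
  obtain m \<sigma> i p where \<sigma>: "\<forall>j<m. \<sigma> j < n" and d: "direct_sum C m (\<lambda>j. S (\<sigma> j)) X i p"
    using decomp[OF X] by blast
  note dd = direct_sumD[OF d]
  have "k \<le> m \<Longrightarrow> P (\<Sum>j<k. Fm (S (\<sigma> j)) X (i j) (Fm X (S (\<sigma> j)) (p j) v))" for k
  proof (induction k)
    case (Suc k)
    have "Fm (S (\<sigma> j)) X (i j) (Fm X (S (\<sigma> j)) (p j) v) \<in> V X"
      "P (Fm (S (\<sigma> j)) X (i j) (Fm X (S (\<sigma> j)) (p j) v))" if "j < Suc k" for j
      using dd \<sigma> v X Suc.prems that by (auto intro!: simple)
    moreover from this have "(\<Sum>j<k. Fm (S (\<sigma> j)) X (i j) (Fm X (S (\<sigma> j)) (p j) v)) \<in> V X"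
      by (intro V_closed(4)) auto
    ultimately show ?case using Suc by (simp add: add)
  qed (use \<open>P 0\<close> in simp)
  from this[of m] show ?thesis by (subst direct_sum_expand[OF d v]) simp
qed

subsection \<open>The algebra\<close>

text \<open>The index of the matrix entry \<open>(p, q)\<close> of the block \<open>End(F(S\<^sub>s))\<close>.\<close>

definition enc3 :: "nat \<Rightarrow> nat \<Rightarrow> nat \<Rightarrow> nat" where
  "enc3 s p q = prod_encode (s, prod_encode (p, q))"

lemma enc3_eq [simp]: "enc3 s p q = enc3 s' p' q' \<longleftrightarrow> s = s' \<and> p = p' \<and> q = q'"
  by (auto simp: enc3_def)

definition BH :: "nat set" where
  "BH = (\<Union>s\<in>{..<n}. \<Union>p\<in>B (S s). \<Union>q\<in>B (S s). {enc3 s p q})"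

lemma BH_fin [simp]: "finite BH"
  by (auto simp: BH_def)

lemma enc3_BH [simp]: "enc3 s p q \<in> BH \<longleftrightarrow> s < n \<and> p \<in> B (S s) \<and> q \<in> B (S s)"
  by (auto simp: BH_def)

text \<open>The elements of the algebra are the families of endomorphisms of the \<open>F(S\<^sub>s)\<close>, stored by their matrix
  entries. \<open>M s h\<close> is the operator given by the block \<open>s\<close> of \<open>h\<close>; conversely \<open>mat\<close> collects a family
  of operators into an element.\<close>

definition M :: "nat \<Rightarrow> 'k seq \<Rightarrow> 'k seq \<Rightarrow> 'k seq" where
  "M s h v = (\<lambda>p. if p \<in> B (S s) then \<Sum>q\<in>B (S s). h (enc3 s p q) * v q else 0)"

definition mat :: "(nat \<Rightarrow> 'k seq \<Rightarrow> 'k seq) \<Rightarrow> 'k seq" where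
  "mat T = (\<lambda>m. if m \<in> BH then
     (case prod_decode m of (s, pq) \<Rightarrow> case prod_decode pq of (p, q) \<Rightarrow> T s (uv q) p) else 0)"

lemma mat_in [simp]: "mat T \<in> csp BH"
  by (simp add: csp_def mat_def)

lemma mat_enc3 [simp]: "s < n \<Longrightarrow> p \<in> B (S s) \<Longrightarrow> q \<in> B (S s) \<Longrightarrow> mat T (enc3 s p q) = T s (uv q) p"
  by (simp add: mat_def) (simp add: enc3_def)

lemma M_in [simp]: "M s h v \<in> V (S s)"
  by (simp add: M_def csp_def)

lemma M_simps: "M s (g + h) v = M s g v + M s h v" "M s h (v + w) = M s h v + M s h w"
  "M s (vscale c h) v = vscale c (M s h v)" "M s h (vscale c v) = vscale c (M s h v)"
  "M s h 0 = 0" "M s 0 v = 0"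
  by (auto simp: M_def fun_eq_iff fun_apply distrib_right distrib_left sum.distrib)
    (auto simp: vscale_def sum_distrib_left mult_ac intro!: sum.cong)

lemma M_uv: "s < n \<Longrightarrow> p \<in> B (S s) \<Longrightarrow> q \<in> B (S s) \<Longrightarrow> M s h (uv q) p = h (enc3 s p q)"
  using B_fin[OF S_obj] by (simp add: M_def uv_def if_distrib cong: if_cong)

lemma M_mat:
  assumes "s < n" "lin_on (V (S s)) (V (S s)) (T s)" "v \<in> V (S s)"
  shows "M s (mat T) v = T s v"
proof
  fix p
  have T: "T s v = (\<Sum>q\<in>B (S s). vscale (v q) (T s (uv q)))"
    by (rule csp_lin_expand[OF _ assms(3,2)]) (use assms in auto)
  show "M s (mat T) v p = T s v p"
  proof (cases "p \<in> B (S s)")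
    case True
    then show ?thesis using assms(1) unfolding T
      by (simp add: M_def fun_sum_apply vscale_def mult.commute)
  next
    case False
    then show ?thesis using lin_on_in[OF assms(2,3)] by (simp add: M_def csp_def)
  qed
qed

lemma alg_eqI:
  assumes "g \<in> csp BH" "h \<in> csp BH" "\<And>s v. s < n \<Longrightarrow> v \<in> V (S s) \<Longrightarrow> M s g v = M s h v"
  shows "g = h"
proof
  fix m
  show "g m = h m"
  proof (cases "m \<in> BH")
    case True
    then obtain s p q where m: "m = enc3 s p q" "s < n" "p \<in> B (S s)" "q \<in> B (S s)"
      by (auto simp: BH_def)
    then show ?thesis using M_uv[OF m(2-4)] assms(3)[OF m(2), of "uv q"] by simp metis
  qed (use assms in \<open>auto simp: csp_def\<close>)
qed

definition mu :: "'k seq \<Rightarrow> 'k seq \<Rightarrow> 'k seq" where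
  "mu g h = mat (\<lambda>s v. M s g (M s h v))"

definition e1 :: "'k seq" where
  "e1 = mat (\<lambda>s v. v)"

lemma mu_in [simp]: "mu g h \<in> csp BH" and e1_in [simp]: "e1 \<in> csp BH"
  by (auto simp: mu_def e1_def)

lemma M_mu [simp]: "s < n \<Longrightarrow> v \<in> V (S s) \<Longrightarrow> M s (mu g h) v = M s g (M s h v)"
  unfolding mu_def by (subst M_mat) (auto simp: lin_on_def M_simps)

lemma M_e1 [simp]: "s < n \<Longrightarrow> v \<in> V (S s) \<Longrightarrow> M s e1 v = v"
  unfolding e1_def by (subst M_mat) auto

lemma mu_bilin: "bilin_on (csp BH) (csp BH) (csp BH) mu"
  unfolding bilin_on_def by (intro conjI ballI lin_onI; (rule mu_in | rule alg_eqI)) (auto simp: M_simps)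

lemma mu_assoc: "mu (mu f g) h = mu f (mu g h)"
  by (rule alg_eqI) auto

lemma mu_e1 [simp]: "h \<in> csp BH \<Longrightarrow> mu e1 h = h" "h \<in> csp BH \<Longrightarrow> mu h e1 = h"
  by (rule alg_eqI, auto)+

lemma Fm_simple:
  assumes "s < n" "t < n" "f \<in> hom C (S s) (S t)"
  obtains c where "s = t" "\<And>v. v \<in> V (S s) \<Longrightarrow> Fm (S s) (S t) f v = vscale c v"
  | "s \<noteq> t" "\<And>v. v \<in> V (S s) \<Longrightarrow> Fm (S s) (S t) f v = 0"
proof (cases "s = t")
  case True
  then obtain c where c: "f = hscale C (S s) (S s) c (ident C (S s))" using schur_eq assms by blast
  have "Fm (S s) (S t) f v = vscale c v" if "v \<in> V (S s)" for v
    using assms that unfolding True[symmetric] c by (simp add: Fm_hscale)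
  with True that(1) show ?thesis by blast
next
  case False
  then have "f = hzero C (S s) (S t)" using schur_neq assms by blast
  with False assms that(2) show ?thesis by simp
qed

lemma M_comm:
  assumes "s < n" "t < n" "f \<in> hom C (S s) (S t)" "v \<in> V (S s)"
  shows "M t h (Fm (S s) (S t) f v) = Fm (S s) (S t) f (M s h v)"
  by (rule Fm_simple[OF assms(1-3)]) (use assms in \<open>auto simp: M_simps\<close>)

subsection \<open>The action\<close>

text \<open>A chosen decomposition into simple objects, through which the algebra acts on \<open>F(X)\<close>. Naturality
  below shows that the action does not depend on the choice.\<close>

definition dcp :: "'o \<Rightarrow> nat \<times> (nat \<Rightarrow> nat) \<times> (nat \<Rightarrow> 'm) \<times> (nat \<Rightarrow> 'm)" where
  "dcp X = (SOME q. case q of (m, \<sigma>, i, p) \<Rightarrow> (\<forall>j<m. \<sigma> j < n) \<and> direct_sum C m (\<lambda>j. S (\<sigma> j)) X i p)"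

definition A :: "'o \<Rightarrow> 'k seq \<Rightarrow> 'k seq \<Rightarrow> 'k seq" where
  "A X h v = (case dcp X of (m, \<sigma>, i, p) \<Rightarrow>
     \<Sum>j<m. Fm (S (\<sigma> j)) X (i j) (M (\<sigma> j) h (Fm X (S (\<sigma> j)) (p j) v)))"

lemma A_expand:
  assumes "X \<in> obj C"
  obtains m \<sigma> i p where "\<And>j. j < m \<Longrightarrow> \<sigma> j < n" "direct_sum C m (\<lambda>j. S (\<sigma> j)) X i p"
    "\<And>h v. A X h v = (\<Sum>j<m. Fm (S (\<sigma> j)) X (i j) (M (\<sigma> j) h (Fm X (S (\<sigma> j)) (p j) v)))"
proof -
  obtain m \<sigma> i p where *: "dcp X = (m, \<sigma>, i, p)" by (metis prod_cases4)
  have "case dcp X of (m, \<sigma>, i, p) \<Rightarrow> (\<forall>j<m. \<sigma> j < n) \<and> direct_sum C m (\<lambda>j. S (\<sigma> j)) X i p"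
    unfolding dcp_def by (rule someI_ex) (use decomp[OF assms] in auto)
  then show ?thesis using that[of m \<sigma> i p] by (simp add: * A_def)
qed

lemma A_bilin: assumes "X \<in> obj C" shows "bilin_on UNIV (V X) (V X) (A X)"
proof -
  obtain m \<sigma> i p where \<sigma>: "\<And>j. j < m \<Longrightarrow> \<sigma> j < n" and d: "direct_sum C m (\<lambda>j. S (\<sigma> j)) X i p"
    and A: "\<And>h v. A X h v = (\<Sum>j<m. Fm (S (\<sigma> j)) X (i j) (M (\<sigma> j) h (Fm X (S (\<sigma> j)) (p j) v)))"
    by (rule A_expand[OF assms]) (rule that)
  note dd = direct_sumD[OF d]
  show ?thesis unfolding bilin_on_def A
    using \<sigma> dd assms
    by (auto intro!: lin_on_sumI lin_onI simp: M_simps Fm_add Fm_scale)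
qed

lemma A_in [simp]: "X \<in> obj C \<Longrightarrow> v \<in> V X \<Longrightarrow> A X h v \<in> V X"
  using bilin_on_in[OF A_bilin] by simp

lemma A_simps:
  assumes "X \<in> obj C"
  shows "v \<in> V X \<Longrightarrow> A X (g + h) v = A X g v + A X h v"
    "v \<in> V X \<Longrightarrow> w \<in> V X \<Longrightarrow> A X h (v + w) = A X h v + A X h w"
    "v \<in> V X \<Longrightarrow> A X (vscale c h) v = vscale c (A X h v)"
    "v \<in> V X \<Longrightarrow> A X h (vscale c v) = vscale c (A X h v)" "A X h 0 = 0"
  using A_bilin[OF assms] lin_on_0[of "V X" "V X" "A X h"] by (auto simp: bilin_on_def lin_on_def)

text \<open>The composites \<open>p\<^sub>j f\<close> of \<open>f : S\<^sub>s \<rightarrow> X\<close> with the projections are scalars or zero by Schur's lemma, so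
  they commute with the action on simple objects.\<close>

lemma A_Fm_simple:
  assumes "X \<in> obj C" "s < n" "f \<in> hom C (S s) X" "v \<in> V (S s)"
  shows "A X h (Fm (S s) X f v) = Fm (S s) X f (M s h v)"
proof -
  obtain m \<sigma> i p where \<sigma>: "\<And>j. j < m \<Longrightarrow> \<sigma> j < n" and d: "direct_sum C m (\<lambda>j. S (\<sigma> j)) X i p"
    and A: "\<And>h v. A X h v = (\<Sum>j<m. Fm (S (\<sigma> j)) X (i j) (M (\<sigma> j) h (Fm X (S (\<sigma> j)) (p j) v)))"
    by (rule A_expand[OF assms(1)]) (rule that)
  note dd = direct_sumD[OF d]
  have "M (\<sigma> j) h (Fm X (S (\<sigma> j)) (p j) (Fm (S s) X f v)) = Fm X (S (\<sigma> j)) (p j) (Fm (S s) X f (M s h v))"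
    if j: "j < m" for j
  proof -
    have "M (\<sigma> j) h (Fm X (S (\<sigma> j)) (p j) (Fm (S s) X f v)) = M (\<sigma> j) h (Fm (S s) (S (\<sigma> j)) (cmp C (S s) X (S (\<sigma> j)) (p j) f) v)"
      using assms dd \<sigma> j by (simp add: Fm_cmp)
    also have "\<dots> = Fm (S s) (S (\<sigma> j)) (cmp C (S s) X (S (\<sigma> j)) (p j) f) (M s h v)"
      by (rule M_comm) (use assms dd \<sigma> j in auto)
    also have "\<dots> = Fm X (S (\<sigma> j)) (p j) (Fm (S s) X f (M s h v))"
      using assms dd \<sigma> j by (simp add: Fm_cmp)
    finally show ?thesis .
  qed
  then have "A X h (Fm (S s) X f v) = (\<Sum>j<m. Fm (S (\<sigma> j)) X (i j) (Fm X (S (\<sigma> j)) (p j) (Fm (S s) X f (M s h v))))"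
    unfolding A by simp
  also have "\<dots> = Fm (S s) X f (M s h v)"
    by (rule direct_sum_expand[OF d, symmetric]) (use assms in simp)
  finally show ?thesis .
qed

lemma A_simple [simp]: "s < n \<Longrightarrow> v \<in> V (S s) \<Longrightarrow> A (S s) h v = M s h v"
  using A_Fm_simple[of "S s" s "ident C (S s)" v h] by simp

lemma A_Fm:
  assumes "X \<in> obj C" "Y \<in> obj C" "f \<in> hom C X Y" "v \<in> V X"
  shows "A Y h (Fm X Y f v) = Fm X Y f (A X h v)"
  using assms(1,4)
proof (induction v rule: simple_induct)
  case (simple s g w)
  then show ?case using assms A_Fm_simple[of Y s "cmp C (S s) X Y f g" w h]
    by (simp add: Fm_cmp A_Fm_simple)
qed (use assms in \<open>simp_all add: Fm_add A_simps\<close>)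

lemma A_mu [simp]:
  assumes "X \<in> obj C" "v \<in> V X" shows "A X (mu g h) v = A X g (A X h v)"
  using assms
  by (induction v rule: simple_induct) (use assms(1) in \<open>simp_all add: Fm_add A_simps A_Fm_simple\<close>)

lemma A_e1 [simp]:
  assumes "X \<in> obj C" "v \<in> V X" shows "A X e1 v = v"
  using assms
  by (induction v rule: simple_induct) (use assms(1) in \<open>simp_all add: Fm_add A_simps A_Fm_simple\<close>)

lemma alg_eqI':
  assumes "g \<in> csp BH" "h \<in> csp BH" "\<And>X v. X \<in> obj C \<Longrightarrow> v \<in> V X \<Longrightarrow> A X g v = A X h v"
  shows "g = h"
  by (rule alg_eqI) (use assms in \<open>auto simp flip: A_simple\<close>)

text \<open>A natural endomorphism is determined by its values on the simple objects, and conversely these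
  can be prescribed freely. This is how elements of \<open>H\<close> are constructed from natural families.\<close>

lemma A_mat:
  assumes T: "\<And>X. X \<in> obj C \<Longrightarrow> lin_on (V X) (V X) (T X)"
    and nat: "\<And>X Y f v. \<lbrakk>X \<in> obj C; Y \<in> obj C; f \<in> hom C X Y; v \<in> V X\<rbrakk> \<Longrightarrow> T Y (Fm X Y f v) = Fm X Y f (T X v)"
    and X: "X \<in> obj C" and v: "v \<in> V X"
  shows "A X (mat (\<lambda>s. T (S s))) v = T X v"
  using X v
proof (induction v rule: simple_induct)
  case (simple s f w)
  then show ?case using X nat T by (simp add: A_Fm_simple M_mat)
qed (use X T lin_on_0[OF T] in \<open>simp_all add: A_simps lin_on_add[OF T]\<close>)

text \<open>The algebra structure determines the linear category of modules; comultiplication and counit are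
  parameters until they are constructed.\<close>

definition HH :: "('k seq \<Rightarrow> 'k seq) \<Rightarrow> ('k seq \<Rightarrow> 'k) \<Rightarrow> 'k wbialg" where
  "HH \<Delta> \<epsilon> = \<lparr>carr = csp BH, mult = mu, one = e1, comult = \<Delta>, counit = \<epsilon>\<rparr>"

lemma HH_sel [simp]: "carr (HH \<Delta> \<epsilon>) = csp BH" "mult (HH \<Delta> \<epsilon>) = mu" "one (HH \<Delta> \<epsilon>) = e1"
  "comult (HH \<Delta> \<epsilon>) = \<Delta>" "counit (HH \<Delta> \<epsilon>) = \<epsilon>"
  by (simp_all add: HH_def)

definition Md :: "'o \<Rightarrow> 'k hmod" where
  "Md X = \<lparr>mcarr = V X, act = A X\<rparr>"

lemma Md_sel [simp]: "mcarr (Md X) = V X" "act (Md X) = A X"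
  by (simp_all add: Md_def)

lemma bilin_on_subset: "bilin_on U W Z b \<Longrightarrow> U' \<subseteq> U \<Longrightarrow> W' \<subseteq> W \<Longrightarrow> bilin_on U' W' Z b"
  unfolding bilin_on_def lin_on_def by blast

lemma Md_hmod [simp]: "X \<in> obj C \<Longrightarrow> is_hmod (HH \<Delta> \<epsilon>) (Md X)"
  using bilin_on_subset[OF A_bilin] by (simp add: is_hmod_def fin_dim_csp)

text \<open>Homomorphisms of modules vanish outside their domain, whence the extension by zero.\<close>

definition Fmz where "Fmz X Y f = zero_ext (V X) (Fm X Y f)"

lemma Fmz_in [simp]:
  assumes "X \<in> obj C" "Y \<in> obj C" "f \<in> hom C X Y"
  shows "Fmz X Y f \<in> hmod_hom (HH \<Delta> \<epsilon>) (Md X) (Md Y)"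
  by (rule hmod_homI) (use assms Fm_lin in \<open>auto simp: Fmz_def A_Fm\<close>)

lemma Md_functor: "linear_functor C (Rep (HH \<Delta> \<epsilon>)) Md Fmz"
proof -
  interpret D: linear_category "Rep (HH \<Delta> \<epsilon>)" by (rule Rep_linear)
  show ?thesis
    by unfold_locales (auto simp: Fmz_def zero_ext_def fun_eq_iff Fm_cmp Fm_hadd Fm_hscale
      Fmz_in[unfolded Fmz_def zero_ext_def])
qed

subsection \<open>The functor to modules is an equivalence\<close>

lemma scalar_cancel:
  assumes "c \<noteq> d" "vscale c v = vscale d v" shows "v = 0"
proof
  fix i show "v i = 0 i" using fun_cong[OF assms(2), of i] assms(1) by (auto simp: vscale_def fun_apply)
qed

lemma uv_nz: "uv i \<noteq> (0 :: 'k seq)"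
proof
  assume "uv i = (0 :: 'k seq)"
  from fun_cong[OF this, of i] show False by (simp add: uv_def fun_apply)
qed

text \<open>Matrix entries of a morphism with respect to decompositions into simple objects are scalars, and these
  can be read off from \<open>F\<close> because \<open>F(S\<^sub>s) \<noteq> 0\<close>.\<close>

lemma Fm_faithful:
  assumes X: "X \<in> obj C" "Y \<in> obj C" "f \<in> hom C X Y" "g \<in> hom C X Y"
    and eq: "\<And>v. v \<in> V X \<Longrightarrow> Fm X Y f v = Fm X Y g v"
  shows "f = g"
proof -
  obtain m \<sigma> i p where \<sigma>: "\<And>j. j < m \<Longrightarrow> \<sigma> j < n" and d: "direct_sum C m (\<lambda>j. S (\<sigma> j)) X i p"
    using decomp[OF X(1)] by blast
  obtain m' \<sigma>' i' p' where \<sigma>': "\<And>j. j < m' \<Longrightarrow> \<sigma>' j < n" and d': "direct_sum C m' (\<lambda>j. S (\<sigma>' j)) Y i' p'"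
    using decomp[OF X(2)] by blast
  note dd = direct_sumD[OF d] and dd' = direct_sumD[OF d']
  show ?thesis
  proof (rule direct_sum_cancel_incl[OF d X(2-4)], rule direct_sum_cancel_proj[OF d'])
    fix j l assume jl: "j < m" "l < m'"
    define c where "c h = cmp C (S (\<sigma> j)) Y (S (\<sigma>' l)) (p' l) (cmp C (S (\<sigma> j)) X Y h (i j))" for h
    have c: "c h \<in> hom C (S (\<sigma> j)) (S (\<sigma>' l))"
      "v \<in> V (S (\<sigma> j)) \<Longrightarrow> Fm (S (\<sigma> j)) (S (\<sigma>' l)) (c h) v = Fm Y (S (\<sigma>' l)) (p' l) (Fm X Y h (Fm (S (\<sigma> j)) X (i j) v))"
      if "h \<in> hom C X Y" for h v
      using that X jl \<sigma> \<sigma>' dd dd' by (auto simp: c_def Fm_cmp)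
    have "c f = c g"
    proof (cases "\<sigma> j = \<sigma>' l")
      case False
      then show ?thesis using schur_neq[OF \<sigma> \<sigma>' False] c(1) jl X by metis
    next
      case True
      let ?T = "S (\<sigma> j)"
      have sj: "\<sigma> j < n" using jl \<sigma> by simp
      obtain a where a: "c f = hscale C ?T ?T a (ident C ?T)"
        using schur_eq[OF sj, of "c f"] c(1)[OF X(3)] unfolding True by auto
      obtain b where b: "c g = hscale C ?T ?T b (ident C ?T)"
        using schur_eq[OF sj, of "c g"] c(1)[OF X(4)] unfolding True by auto
      obtain q where q: "q \<in> B ?T" using B_ne[OF sj] by blast
      have "Fm ?T ?T (c f) (uv q) = Fm ?T ?T (c g) (uv q)"
        using c(2)[OF X(3), of "uv q"] c(2)[OF X(4), of "uv q"] q eq dd jl sj X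
        by (simp flip: True)
      then have "vscale a (uv q :: 'k seq) = vscale b (uv q)"
        unfolding a b using sj q by (simp add: Fm_hscale)
      then have "a = b" using scalar_cancel uv_nz by blast
      then show ?thesis using a b by simp
    qed
    then show "cmp C (S (\<sigma> j)) Y (S (\<sigma>' l)) (p' l) (cmp C (S (\<sigma> j)) X Y f (i j)) =
         cmp C (S (\<sigma> j)) Y (S (\<sigma>' l)) (p' l) (cmp C (S (\<sigma> j)) X Y g (i j))" by (simp add: c_def)
  qed (use dd \<sigma> X in auto)
qed

text \<open>The rank one operator \<open>v \<mapsto> v\<^sub>q w\<close> on the block \<open>s\<close>; for \<open>w = uv p\<close> it is the matrix unit
  \<open>E\<^sub>p\<^sub>q\<close>.\<close>

definition R :: "nat \<Rightarrow> nat \<Rightarrow> 'k seq \<Rightarrow> 'k seq" where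
  "R s q w = mat (\<lambda>r v. if r = s then vscale (v q) w else 0)"

lemma R_in [simp]: "R s q w \<in> csp BH"
  by (simp add: R_def)

lemma M_R:
  assumes "s < n" "w \<in> V (S s)" "r < n" "v \<in> V (S r)"
  shows "M r (R s q w) v = (if r = s then vscale (v q) w else 0)"
  unfolding R_def
  by (subst M_mat) (use assms in \<open>auto simp: lin_on_def fun_apply vscale_add_left\<close>, auto simp: vscale_def)

lemma mu_R: "s < n \<Longrightarrow> w \<in> V (S s) \<Longrightarrow> mu h (R s q w) = R s q (M s h w)"
  by (rule alg_eqI) (auto simp: M_R M_simps)

lemma mu_R_R:
  assumes "s < n" "t < n" "w \<in> V (S s)" "w' \<in> V (S t)"
  shows "mu (R s q w) (R t q' w') = (if s = t then vscale (w' q) (R s q' w) else 0)"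
  by (rule alg_eqI) (use assms in \<open>auto simp: M_R M_simps\<close>, auto simp: vscale_def fun_apply)

lemma R_lin: "s < n \<Longrightarrow> lin_on (V (S s)) (csp BH) (R s q)"
  by (rule lin_onI; (rule alg_eqI)?) (auto simp: M_R M_simps vscale_add mult.commute)

lemma M_sum: "M s (\<Sum>i\<in>I. f i) v = (\<Sum>i\<in>I. M s (f i) v)"
  by (induction I rule: infinite_finite_induct) (auto simp: M_simps)

lemma e1_R: "e1 = (\<Sum>s<n. \<Sum>q\<in>B (S s). R s q (uv q))"
proof (rule alg_eqI)
  fix s and v :: "'k seq" assume s: "s < n" "v \<in> V (S s)"
  have "M s (\<Sum>s<n. \<Sum>q\<in>B (S s). R s q (uv q)) v = (\<Sum>r<n. \<Sum>q\<in>B (S r). if s = r then vscale (v q) (uv q) else 0)"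
    unfolding M_sum by (intro sum.cong refl) (use s in \<open>auto simp: M_R\<close>)
  also have "\<dots> = (\<Sum>r<n. if s = r then \<Sum>q\<in>B (S r). vscale (v q) (uv q) else 0)"
    by (intro sum.cong refl) auto
  also have "\<dots> = v" using s csp_expand[of "B (S s)" v] by simp
  finally show "M s e1 v = M s (\<Sum>s<n. \<Sum>q\<in>B (S s). R s q (uv q)) v" using s by simp
qed auto

text \<open>Decomposing source and target reduces the claim to simple objects. There an intertwiner of matrix
  algebras is zero between different blocks and a scalar on each block.\<close>

lemma Fm_full:
  assumes X: "X \<in> obj C" "Y \<in> obj C" and T: "T \<in> hmod_hom (HH \<Delta> \<epsilon>) (Md X) (Md Y)"
  shows "\<exists>f\<in>hom C X Y. \<forall>v\<in>V X. Fm X Y f v = T v"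
proof -
  obtain m \<sigma> i p where \<sigma>: "\<And>j. j < m \<Longrightarrow> \<sigma> j < n" and d: "direct_sum C m (\<lambda>j. S (\<sigma> j)) X i p"
    using decomp[OF X(1)] by blast
  obtain m' \<sigma>' i' p' where \<sigma>': "\<And>j. j < m' \<Longrightarrow> \<sigma>' j < n" and d': "direct_sum C m' (\<lambda>j. S (\<sigma>' j)) Y i' p'"
    using decomp[OF X(2)] by blast
  note dd = direct_sumD[OF d] and dd' = direct_sumD[OF d']
  have Tl: "lin_on (V X) (V Y) T" and TA: "\<And>h v. h \<in> csp BH \<Longrightarrow> v \<in> V X \<Longrightarrow> T (A X h v) = A Y h (T v)"
    using hmod_homD[OF T] by auto
  (* The case of simple objects. *)
  have simple: "\<exists>f\<in>hom C (S s) (S t). \<forall>v\<in>V (S s). Fm (S s) (S t) f v = U v"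
    if st: "s < n" "t < n" and U: "lin_on (V (S s)) (V (S t)) U"
      "\<And>h v. h \<in> csp BH \<Longrightarrow> v \<in> V (S s) \<Longrightarrow> U (M s h v) = M t h (U v)" for s t U
  proof (cases "s = t")
    case True
    obtain q where q: "q \<in> B (S s)" using B_ne[OF st(1)] by blast
    (* The scalar is found by applying the rank one operators R s q v to a basis vector. *)
    define c where "c = U (uv q) q"
    have "U v = vscale c v" if v: "v \<in> V (S s)" for v :: "'k seq"
      using U(2)[of "R s q v" "uv q"] v q st lin_on_in[OF U(1), of "uv q"] True
      by (simp add: M_R c_def) (simp add: uv_def)
    then show ?thesis using st True
      by (intro bexI[of _ "hscale C (S s) (S s) c (ident C (S s))"]) (auto simp: Fm_hscale)
  next
    case False
    have "U v = 0" if v: "v \<in> V (S s)" for v :: "'k seq"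
    proof -
      (* g is the central idempotent of the block s. *)
      define g where "g = mat (\<lambda>r v. if r = s then v else 0)"
      have "M s g v = v" unfolding g_def by (subst M_mat) (use st v in auto)
      moreover have "M t g (U v) = 0" unfolding g_def
        by (subst M_mat) (use st False v lin_on_in[OF U(1)] in \<open>auto simp: lin_on_def\<close>)
      ultimately show ?thesis using U(2)[of g v] v by (simp add: g_def)
    qed
    then show ?thesis using st by (intro bexI[of _ "hzero C (S s) (S t)"]) auto
  qed
  have "\<exists>f. f \<in> hom C (S (\<sigma> j)) (S (\<sigma>' l)) \<and> (\<forall>v\<in>V (S (\<sigma> j)). Fm (S (\<sigma> j)) (S (\<sigma>' l)) f v
      = Fm Y (S (\<sigma>' l)) (p' l) (T (Fm (S (\<sigma> j)) X (i j) v)))" if jl: "j < m" "l < m'" for j l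
  proof -
    have "\<exists>f\<in>hom C (S (\<sigma> j)) (S (\<sigma>' l)). \<forall>v\<in>V (S (\<sigma> j)). Fm (S (\<sigma> j)) (S (\<sigma>' l)) f v
      = (\<lambda>v. Fm Y (S (\<sigma>' l)) (p' l) (T (Fm (S (\<sigma> j)) X (i j) v))) v"
    proof (rule simple)
      show "lin_on (V (S (\<sigma> j))) (V (S (\<sigma>' l))) (\<lambda>v. Fm Y (S (\<sigma>' l)) (p' l) (T (Fm (S (\<sigma> j)) X (i j) v)))"
        by (intro lin_on_cmp[OF lin_on_cmp[OF Fm_lin Tl] Fm_lin]) (use jl \<sigma> \<sigma>' dd dd' X in auto)
      fix h v :: "'k seq" assume h: "h \<in> csp BH" "v \<in> V (S (\<sigma> j))"
      have "Fm (S (\<sigma> j)) X (i j) v \<in> V X" using jl h \<sigma> dd X by simp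
      note fX = lin_on_in[OF Tl this]
      have "Fm (S (\<sigma> j)) X (i j) (M (\<sigma> j) h v) = A X h (Fm (S (\<sigma> j)) X (i j) v)"
        using jl h \<sigma> X dd by (simp add: A_Fm)
      then have "Fm Y (S (\<sigma>' l)) (p' l) (T (Fm (S (\<sigma> j)) X (i j) (M (\<sigma> j) h v)))
          = Fm Y (S (\<sigma>' l)) (p' l) (A Y h (T (Fm (S (\<sigma> j)) X (i j) v)))"
        using TA jl h \<sigma> X dd by simp
      also have "\<dots> = A (S (\<sigma>' l)) h (Fm Y (S (\<sigma>' l)) (p' l) (T (Fm (S (\<sigma> j)) X (i j) v)))"
        by (rule A_Fm[symmetric]) (use fX jl h \<sigma>' X dd' in auto)
      finally show "Fm Y (S (\<sigma>' l)) (p' l) (T (Fm (S (\<sigma> j)) X (i j) (M (\<sigma> j) h v))) =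
           M (\<sigma>' l) h (Fm Y (S (\<sigma>' l)) (p' l) (T (Fm (S (\<sigma> j)) X (i j) v)))"
        using fX jl h \<sigma>' X dd' by simp
    qed (use jl \<sigma> \<sigma>' in auto)
    then show ?thesis by blast
  qed
  then obtain f where f: "\<And>j l. j < m \<Longrightarrow> l < m' \<Longrightarrow> f j l \<in> hom C (S (\<sigma> j)) (S (\<sigma>' l))"
    "\<And>j l v. \<lbrakk>j < m; l < m'; v \<in> V (S (\<sigma> j))\<rbrakk> \<Longrightarrow> Fm (S (\<sigma> j)) (S (\<sigma>' l)) (f j l) v
      = Fm Y (S (\<sigma>' l)) (p' l) (T (Fm (S (\<sigma> j)) X (i j) v))" by metis
  define k where "k j l = cmp C X (S (\<sigma> j)) Y (cmp C (S (\<sigma> j)) (S (\<sigma>' l)) Y (i' l) (f j l)) (p j)" for j l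
  have k: "k j l \<in> hom C X Y" "v \<in> V X \<Longrightarrow> Fm X Y (k j l) v = Fm (S (\<sigma>' l)) Y (i' l) (Fm Y (S (\<sigma>' l)) (p' l) (T (Fm (S (\<sigma> j)) X (i j) (Fm X (S (\<sigma> j)) (p j) v))))"
    if "j < m" "l < m'" for j l and v :: "'k seq"
    using that f dd dd' \<sigma> \<sigma>' X by (auto simp: k_def Fm_cmp)
  define g where "g = hom_sum C X Y (\<lambda>j. hom_sum C X Y (\<lambda>l. k j l) m') m"
  have "g \<in> hom C X Y" using k X by (auto simp: g_def)
  moreover have "Fm X Y g v = T v" if v: "v \<in> V X" for v :: "'k seq"
  proof -
    have "Fm X Y g v = (\<Sum>j<m. \<Sum>l<m'. Fm X Y (k j l) v)"
      using k X v by (simp add: g_def Fm_hom_sum)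
    also have "\<dots> = (\<Sum>j<m. \<Sum>l<m'. Fm (S (\<sigma>' l)) Y (i' l) (Fm Y (S (\<sigma>' l)) (p' l) (T (Fm (S (\<sigma> j)) X (i j) (Fm X (S (\<sigma> j)) (p j) v)))))"
      using k(2) v by simp
    also have "\<dots> = (\<Sum>j<m. T (Fm (S (\<sigma> j)) X (i j) (Fm X (S (\<sigma> j)) (p j) v)))"
      by (rule sum.cong[OF refl], rule direct_sum_expand[OF d', symmetric])
        (use lin_on_in[OF Tl] v dd \<sigma> X in auto)
    also have "\<dots> = T (\<Sum>j<m. Fm (S (\<sigma> j)) X (i j) (Fm X (S (\<sigma> j)) (p j) v))"
      by (rule lin_on_sum[OF Tl subspace_csp, symmetric]) (use v dd \<sigma> X in auto)
    also have "\<dots> = T v" using direct_sum_expand[OF d v] by (rule arg_cong[OF sym])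
    finally show ?thesis .
  qed
  ultimately show ?thesis by blast
qed

end

lemma hmod_isoI:
  assumes V: "is_hmod H V" and W: "is_hmod H W" and f: "f \<in> hmod_hom H V W"
    and bij: "bij_betw f (mcarr V) (mcarr W)"
  shows "is_iso (Rep H) V W f"
proof -
  define g where "g = zero_ext (mcarr W) (inv_into (mcarr V) f)"
  have g1: "g w \<in> mcarr V" "f (g w) = w" if "w \<in> mcarr W" for w
    using that bij by (auto simp: g_def bij_betw_def inv_into_into f_inv_into_f)
  have g2: "g (f v) = v" if "v \<in> mcarr V" for v
    using that bij hmod_hom_in[OF f that] by (simp add: g_def bij_betw_def)
  note fl = hmod_homD(1)[OF f]
  note V' = is_hmodD[OF V] and W' = is_hmodD[OF W]
  have inj: "x = y" if "x \<in> mcarr V" "y \<in> mcarr V" "f x = f y" for x y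
    using that bij by (auto simp: bij_betw_def inj_on_def)
  have "g \<in> hmod_hom H W V"
  proof (rule hmod_homI)
    show "lin_on (mcarr W) (mcarr V) g"
    proof (rule lin_onI)
      fix x y assume xy: "x \<in> mcarr W" "y \<in> mcarr W"
      show "g (x + y) = g x + g y"
        by (rule inj) (use xy g1 vec.subspace_add[OF W'(2)] vec.subspace_add[OF V'(2)] in \<open>simp_all add: lin_on_add[OF fl]\<close>)
    next
      fix a x assume xy: "x \<in> mcarr W"
      show "g (vscale a x) = vscale a (g x)"
        by (rule inj) (use xy g1 vec.subspace_scale[OF W'(2)] vec.subspace_scale[OF V'(2)] in \<open>simp_all add: lin_on_scale[OF fl]\<close>)
    qed (use g1 in auto)
    show "g (act W h w) = act V h (g w)" if "h \<in> carr H" "w \<in> mcarr W" for h w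
      by (rule inj) (use that g1 W'(6) V'(6) in \<open>simp_all add: hmod_homD(3)[OF f]\<close>)
  qed (simp add: g_def)
  moreover have "g \<circ> f = zero_ext (mcarr V) (\<lambda>v. v)"
  proof
    fix v show "(g \<circ> f) v = zero_ext (mcarr V) (\<lambda>v. v) v"
      using g2 hmod_homD(2)[OF f] hmod_hom_0[OF W \<open>g \<in> hmod_hom H W V\<close>] by (cases "v \<in> mcarr V") auto
  qed
  moreover have "f \<circ> g = zero_ext (mcarr W) (\<lambda>v. v)"
  proof
    fix v show "(f \<circ> g) v = zero_ext (mcarr W) (\<lambda>v. v) v"
      using g1 hmod_hom_0[OF V f] by (cases "v \<in> mcarr W") (auto simp: g_def)
  qed
  ultimately show ?thesis using f by (auto simp: is_iso_def)
qed

lemma hmod_isoD: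
  assumes f: "is_iso (Rep H) V W f"
  shows "f \<in> hmod_hom H V W" "bij_betw f (mcarr V) (mcarr W)"
proof -
  obtain g where g: "f \<in> hmod_hom H V W" "g \<in> hmod_hom H W V" "g \<circ> f = zero_ext (mcarr V) (\<lambda>v. v)"
    "f \<circ> g = zero_ext (mcarr W) (\<lambda>v. v)" using assms by (auto simp: is_iso_def)
  show "f \<in> hmod_hom H V W" by fact
  show "bij_betw f (mcarr V) (mcarr W)"
  proof (rule bij_betw_byWitness[of _ g])
    show "\<forall>x\<in>mcarr V. g (f x) = x" using fun_cong[OF g(3)] by simp
    show "\<forall>x\<in>mcarr W. f (g x) = x" using fun_cong[OF g(4)] by simp
  qed (use g hmod_hom_in in auto)
qed

lemma fin_dim_basis:
  assumes "fin_dim U"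
  obtains A where "finite A" "A \<subseteq> U" "vec.independent A" "vec.span A = U"
proof -
  obtain F where F: "finite F" "vec.span F = U" using assms by (auto simp: fin_dim_def)
  obtain A where A: "A \<subseteq> U" "vec.independent A" "U \<subseteq> vec.span A"
    by (rule vec.basis_exists[of U])
  have "finite A" using vec.independent_span_bound[OF F(1) A(2)] A(1) F(2) by auto
  moreover have "vec.span A = U"
    using A vec.span_minimal[OF A(1) fin_dim_subspace[OF assms]] by auto
  ultimately show ?thesis using A that by blast
qed

context linear_fibre_functor
begin

text \<open>A module over a product of matrix algebras is the direct sum, over the blocks \<open>s\<close>, of the column
  space \<open>F(S\<^sub>s)\<close> tensored with the multiplicity space \<open>E\<^sub>p\<^sub>p W\<close>, where \<open>p\<close> is any index in the block. Bases
  of the multiplicity spaces therefore give a direct sum of simple objects that \<open>F\<close> sends to the module.\<close>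

lemma Md_ess_surj:
  assumes W: "is_hmod (HH \<Delta> \<epsilon>) W"
  shows "\<exists>X\<in>obj C. isomorphic (Rep (HH \<Delta> \<epsilon>)) (Md X) W"
proof -
  define a where "a = act W"
  define Y where "Y = mcarr W"
  have fin: "fin_dim Y" and sub [simp]: "vec.subspace Y" and bil: "bilin_on (csp BH) Y Y a"
    and a1: "\<And>v. v \<in> Y \<Longrightarrow> a e1 v = v"
    and am: "\<And>g h v. g \<in> csp BH \<Longrightarrow> h \<in> csp BH \<Longrightarrow> v \<in> Y \<Longrightarrow> a g (a h v) = a (mu g h) v"
    and ain [simp]: "\<And>h v. h \<in> csp BH \<Longrightarrow> v \<in> Y \<Longrightarrow> a h v \<in> Y"
    using is_hmodD[OF W] by (auto simp: a_def Y_def)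
  note al = bilin_on_lin'[OF bil] and ar = bilin_on_lin[OF bil]
  have a0 [simp]: "a 0 v = 0" if "v \<in> Y" for v using lin_on_0[OF al[OF that]] by simp
  have Ycl [simp]: "0 \<in> Y" "\<And>u v. u \<in> Y \<Longrightarrow> v \<in> Y \<Longrightarrow> u + v \<in> Y" "\<And>c u. u \<in> Y \<Longrightarrow> vscale c u \<in> Y"
    "\<And>I f. (\<And>i. i \<in> I \<Longrightarrow> f i \<in> Y) \<Longrightarrow> sum f I \<in> Y" for I :: "'i set"
    using sub by (auto intro: vec.subspace_0 vec.subspace_add vec.subspace_scale vec.subspace_sum)
  have "\<exists>p. s < n \<longrightarrow> p \<in> B (S s)" for s using B_ne by blast
  then obtain p0 where p0 [simp]: "\<And>s. s < n \<Longrightarrow> p0 s \<in> B (S s)" by metis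
  have uv1 [simp]: "uv q q = (1 :: 'k)" for q by (simp add: uv_def)
  (* The multiplicity space of the block s, cut out by a diagonal matrix unit. *)
  define U where "U s = a (R s (p0 s) (uv (p0 s))) ` Y" for s
  have "fin_dim (U s)" for s
    unfolding U_def by (rule fin_dim_image[OF ar fin]) simp
  then have "\<exists>A. finite A \<and> A \<subseteq> U s \<and> vec.independent A \<and> vec.span A = U s" for s
    using fin_dim_basis by metis
  then obtain Bas where Bas: "\<And>s. finite (Bas s)" "\<And>s. Bas s \<subseteq> U s" "\<And>s. vec.independent (Bas s)"
    "\<And>s. vec.span (Bas s) = U s" by metis
  have PU: "u \<in> Y" "a (R s (p0 s) (uv (p0 s))) u = u" if "u \<in> U s" "s < n" for s u
    using that by (auto simp: U_def am mu_R_R)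
  have BY: "b \<in> Y" "a (R s (p0 s) (uv (p0 s))) b = b" if "b \<in> Bas s" "s < n" for s b
    using PU[of b s] Bas(2) that by auto
  (* One summand S s for every basis vector of the multiplicity space of the block s. *)
  define Pr where "Pr = Sigma {..<n} Bas"
  have "finite Pr" unfolding Pr_def using Bas(1) by auto
  define m where "m = card Pr"
  obtain h where h: "bij_betw h {..<m} Pr"
    using ex_bij_betw_nat_finite[OF \<open>finite Pr\<close>] by (auto simp: m_def atLeast0LessThan)
  define \<sigma> where "\<sigma> j = fst (h j)" for j
  define \<beta> where "\<beta> j = snd (h j)" for j
  have hj: "\<sigma> j < n" "\<beta> j \<in> Bas (\<sigma> j)" if "j < m" for j
    using bij_betw_apply[OF h, of j] that by (auto simp: \<sigma>_def \<beta>_def Pr_def)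
  have reindex: "(\<Sum>j<m. G (\<sigma> j) (\<beta> j)) = (\<Sum>s<n. \<Sum>b\<in>Bas s. G s b)" for G :: "nat \<Rightarrow> 'k seq \<Rightarrow> 'k seq"
  proof -
    have "(\<Sum>j<m. G (\<sigma> j) (\<beta> j)) = (\<Sum>j<m. (\<lambda>(s, b). G s b) (h j))"
      by (simp add: \<sigma>_def \<beta>_def case_prod_beta)
    also have "\<dots> = (\<Sum>(s, b)\<in>Pr. G s b)" by (rule sum.reindex_bij_betw[OF h])
    also have "\<dots> = (\<Sum>s<n. \<Sum>b\<in>Bas s. G s b)"
      unfolding Pr_def by (rule sum.Sigma[symmetric]) (use Bas in auto)
    finally show ?thesis .
  qed
  obtain X i p where d: "direct_sum C m (\<lambda>j. S (\<sigma> j)) X i p" using sums[of m \<sigma>] hj by blast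
  note dd = direct_sumD[OF d]
  define w where "w j x = Fm X (S (\<sigma> j)) (p j) x" for j x
  have w [simp]: "w j x \<in> V (S (\<sigma> j))" if "j < m" "x \<in> V X" for j x
    using that dd hj by (simp add: w_def)
  (* The component w in F(S s) and the basis vector b yield w tensor b, that is, the operator with column w applied to b. *)
  define T where "T x = (\<Sum>j<m. a (R (\<sigma> j) (p0 (\<sigma> j)) (w j x)) (\<beta> j))" for x
  have \<beta>Y [simp]: "\<beta> j \<in> Y" if "j < m" for j using BY hj that by blast
  have Tin: "T x \<in> Y" for x unfolding T_def by (rule vec.subspace_sum[OF sub]) auto
  have Tlin: "lin_on (V X) Y T"
    unfolding T_def
  proof (rule lin_on_sumI)
    fix j assume j: "j \<in> {..<m}"
    show "lin_on (V X) Y (\<lambda>x. a (R (\<sigma> j) (p0 (\<sigma> j)) (w j x)) (\<beta> j))"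
      unfolding w_def by (rule lin_on_cmp[OF lin_on_cmp[OF Fm_lin R_lin] al]) (use j hj dd in auto)
  qed simp
  have key: "a (R s q (uv (p0 s))) (a (R t (p0 t) v) b) = (if s = t then vscale (v q) b else 0)"
    if "s < n" "t < n" "v \<in> V (S t)" "b \<in> Bas t" for s t q v b
    using that BY[of b t] lin_on_scale[OF al] by (simp add: am mu_R_R)
  have asum: "a g (\<Sum>i\<in>I. f i) = (\<Sum>i\<in>I. a g (f i))" if "g \<in> csp BH" "\<And>i. i \<in> I \<Longrightarrow> f i \<in> Y" for g f and I :: "'i set"
    by (rule lin_on_sum[OF ar[OF that(1)] sub that(2)])
  have ker: "x = 0" if x: "x \<in> V X" "T x = 0" for x
  proof -
    define hi where "hi = inv_into {..<m} h"
    have hi: "hi (\<sigma> j, \<beta> j) = j" if "j < m" for j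
      using that h by (simp add: hi_def \<sigma>_def \<beta>_def bij_betw_def)
    have "w j x = 0" if j: "j < m" for j
    proof
      fix q
      show "w j x q = 0 q"
      proof (cases "q \<in> B (S (\<sigma> j))")
        case False
        then show ?thesis using w[OF j x(1)] by (simp add: csp_def fun_apply)
      next
        case True
        define s where "s = \<sigma> j"
        have s: "s < n" using hj j by (simp add: s_def)
        (* This matrix unit isolates the q-th coordinates in the block s. *)
        have "0 = a (R s q (uv (p0 s))) (T x)" using x(2) lin_on_0[OF ar] by simp
        also have "\<dots> = (\<Sum>l<m. a (R s q (uv (p0 s))) (a (R (\<sigma> l) (p0 (\<sigma> l)) (w l x)) (\<beta> l)))"
          unfolding T_def by (rule asum) auto
        also have "\<dots> = (\<Sum>l<m. (\<lambda>t b. if s = t then vscale (w (hi (t, b)) x q) b else 0) (\<sigma> l) (\<beta> l))"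
          by (rule sum.cong) (use hj key s x hi in auto)
        also have "\<dots> = (\<Sum>t<n. \<Sum>b\<in>Bas t. if s = t then vscale (w (hi (t, b)) x q) b else 0)"
          by (rule reindex)
        also have "\<dots> = (\<Sum>t<n. if s = t then \<Sum>b\<in>Bas t. vscale (w (hi (t, b)) x q) b else 0)"
          by (intro sum.cong) auto
        also have "\<dots> = (\<Sum>b\<in>Bas s. vscale (w (hi (s, b)) x q) b)" using s by simp
        finally have "(\<Sum>b\<in>Bas s. vscale (w (hi (s, b)) x q) b) = 0" by simp
        from vec.independentD[OF Bas(3) Bas(1) subset_refl this, of "\<beta> j"]
        show ?thesis using hj[OF j] hi[OF j] by (simp add: s_def fun_apply)
      qed
    qed
    then show "x = 0" using direct_sum_expand[OF d x(1)] dd hj by (simp add: w_def)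
  qed
  have inj: "inj_on T (V X)"
  proof (rule inj_onI)
    fix x y assume xy: "x \<in> V X" "y \<in> V X" "T x = T y"
    have "T (x + vscale (-1) y) = T x + T (vscale (-1) y)"
      by (rule lin_on_add[OF Tlin xy(1) V_closed(2)[OF xy(2)]])
    also have "T (vscale (-1) y) = vscale (-1) (T y)" by (rule lin_on_scale[OF Tlin xy(2)])
    also have "T x + vscale (-1) (T y) = 0" using xy(3) by simp
    finally have "x + vscale (-1) y = 0"
      by (rule ker[OF V_closed(1)[OF xy(1) V_closed(2)[OF xy(2)]]])
    then show "x = y" by simp
  qed
  have surj: "\<exists>x\<in>V X. T x = v" if v: "v \<in> Y" for v
  proof -
    (* 1 is the sum of E_qp E_pq over all q, for p = p0 s, and E_pq v lies in the multiplicity space. *)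
    define u where "u s q = a (R s q (uv (p0 s))) v" for s q
    have uU: "u s q \<in> U s" if "s < n" for s q
    proof -
      have "u s q = a (R s (p0 s) (uv (p0 s))) (u s q)"
        using that v by (simp add: u_def am mu_R_R)
      then show ?thesis using v by (auto simp: U_def u_def)
    qed
    define r where "r s q b = vec.representation (Bas s) (u s q) b" for s q b
    have r: "(\<Sum>b\<in>Bas s. vscale (r s q b) b) = u s q" if "s < n" for s q
      unfolding r_def
      by (rule vec.sum_representation_eq) (use Bas uU that in auto)
    define z where "z s b = (\<Sum>q\<in>B (S s). vscale (r s q b) (uv q))" for s b
    have z [simp]: "z s b \<in> V (S s)" for s b by (auto simp: z_def)
    define x where "x = (\<Sum>j<m. Fm (S (\<sigma> j)) X (i j) (z (\<sigma> j) (\<beta> j)))"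
    have xV: "x \<in> V X" unfolding x_def by (rule V_closed(4)) (use dd hj in auto)
    have wx: "w l x = z (\<sigma> l) (\<beta> l)" if l: "l < m" for l
    proof -
      have "w l x = (\<Sum>j<m. Fm X (S (\<sigma> l)) (p l) (Fm (S (\<sigma> j)) X (i j) (z (\<sigma> j) (\<beta> j))))"
        unfolding w_def x_def by (rule Fm_sum) (use l dd hj in auto)
      also have "\<dots> = (\<Sum>j<m. if j = l then z (\<sigma> l) (\<beta> l) else 0)"
        by (rule sum.cong) (use l dd hj in \<open>auto simp flip: Fm_cmp\<close>)
      also have "\<dots> = z (\<sigma> l) (\<beta> l)" using l by simp
      finally show ?thesis .
    qed
    have "T x = (\<Sum>j<m. (\<lambda>s b. a (R s (p0 s) (z s b)) b) (\<sigma> j) (\<beta> j))"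
      unfolding T_def by (rule sum.cong) (auto simp: wx)
    also have "\<dots> = (\<Sum>s<n. \<Sum>b\<in>Bas s. a (R s (p0 s) (z s b)) b)" by (rule reindex)
    also have "\<dots> = (\<Sum>s<n. \<Sum>b\<in>Bas s. \<Sum>q\<in>B (S s). vscale (r s q b) (a (R s (p0 s) (uv q)) b))"
    proof (intro sum.cong refl)
      fix s b assume s: "s \<in> {..<n}" and b: "b \<in> Bas s"
      note l = lin_on_cmp[OF R_lin al[OF BY(1)[OF b]]]
      have "a (R s (p0 s) (z s b)) b = (\<Sum>q\<in>B (S s). a (R s (p0 s) (vscale (r s q b) (uv q))) b)"
        unfolding z_def by (rule lin_on_sum[OF l subspace_csp]) (use s in auto)
      also have "\<dots> = (\<Sum>q\<in>B (S s). vscale (r s q b) (a (R s (p0 s) (uv q)) b))"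
        by (intro sum.cong refl lin_on_scale[OF l]) (use s in auto)
      finally show "a (R s (p0 s) (z s b)) b = (\<Sum>q\<in>B (S s). vscale (r s q b) (a (R s (p0 s) (uv q)) b))" .
    qed
    also have "\<dots> = (\<Sum>s<n. \<Sum>q\<in>B (S s). \<Sum>b\<in>Bas s. vscale (r s q b) (a (R s (p0 s) (uv q)) b))"
      by (intro sum.cong refl sum.swap)
    also have "\<dots> = (\<Sum>s<n. \<Sum>q\<in>B (S s). a (R s q (uv q)) v)"
    proof (intro sum.cong refl)
      fix s q assume s: "s \<in> {..<n}" and q: "q \<in> B (S s)"
      have "(\<Sum>b\<in>Bas s. vscale (r s q b) (a (R s (p0 s) (uv q)) b)) = (\<Sum>b\<in>Bas s. a (R s (p0 s) (uv q)) (vscale (r s q b) b))"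
        by (intro sum.cong refl lin_on_scale[OF ar, symmetric]) (use s BY in auto)
      also have "\<dots> = a (R s (p0 s) (uv q)) (u s q)"
        unfolding r[symmetric, OF s[unfolded lessThan_iff]] by (rule asum[symmetric]) (use s BY in auto)
      also have "\<dots> = a (R s q (uv q)) v"
        using s q v by (simp add: u_def am mu_R_R)
      finally show "(\<Sum>b\<in>Bas s. vscale (r s q b) (a (R s (p0 s) (uv q)) b)) = a (R s q (uv q)) v" .
    qed
    also have "\<dots> = a (\<Sum>s<n. \<Sum>q\<in>B (S s). R s q (uv q)) v"
      by (subst lin_on_sum[OF al[OF v] subspace_csp], force)
        (intro sum.cong refl lin_on_sum[OF al[OF v] subspace_csp, symmetric], simp)
    also have "\<dots> = v" using a1[OF v] by (simp flip: e1_R)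
    finally show ?thesis using xV by blast
  qed
  define T' where "T' = zero_ext (V X) T"
  have "T' \<in> hmod_hom (HH \<Delta> \<epsilon>) (Md X) W"
  proof (rule hmod_homI)
    show "lin_on (mcarr (Md X)) (mcarr W) T'" using Tlin by (simp add: T'_def flip: Y_def)
    fix g x assume g: "g \<in> carr (HH \<Delta> \<epsilon>)" and x: "x \<in> mcarr (Md X)"
    have x': "x \<in> V X" and g': "g \<in> csp BH" and X: "X \<in> obj C" using x g dd by auto
    have "T (A X g x) = (\<Sum>j<m. a g (a (R (\<sigma> j) (p0 (\<sigma> j)) (w j x)) (\<beta> j)))"
      unfolding T_def
    proof (rule sum.cong[OF refl])
      fix j assume j: "j \<in> {..<m}"
      have "w j (A X g x) = M (\<sigma> j) g (w j x)"
        using j x' X dd hj by (simp add: w_def flip: A_Fm)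
      then show "a (R (\<sigma> j) (p0 (\<sigma> j)) (w j (A X g x))) (\<beta> j) = a g (a (R (\<sigma> j) (p0 (\<sigma> j)) (w j x)) (\<beta> j))"
        using j hj x' g' by (simp add: am mu_R)
    qed
    also have "\<dots> = a g (T x)" unfolding T_def by (rule asum[symmetric]) (use g' in auto)
    finally show "T' (act (Md X) g x) = act W g (T' x)"
      using x' X by (simp add: T'_def flip: a_def)
  qed (simp add: T'_def)
  moreover have "bij_betw T' (mcarr (Md X)) (mcarr W)"
    unfolding bij_betw_def
  proof
    show "inj_on T' (mcarr (Md X))" using inj by (simp add: inj_on_def T'_def)
    show "T' ` mcarr (Md X) = mcarr W"
      using Tin surj by (force simp: T'_def simp flip: Y_def)
  qed
  ultimately have "is_iso (Rep (HH \<Delta> \<epsilon>)) (Md X) W T'"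
    using dd by (intro hmod_isoI W) auto
  then show ?thesis using dd unfolding isomorphic_def by blast
qed

lemma Md_equivalence: "is_equivalence C (Rep (HH \<Delta> \<epsilon>)) Md Fmz"
proof -
  interpret F: linear_functor C "Rep (HH \<Delta> \<epsilon>)" Md Fmz by (rule Md_functor)
  show ?thesis
  proof (rule F.equivalenceI)
    fix X Y T assume X: "X \<in> obj C" "Y \<in> obj C" "T \<in> hom (Rep (HH \<Delta> \<epsilon>)) (Md X) (Md Y)"
    then obtain f where f: "f \<in> hom C X Y" "\<forall>v\<in>V X. Fm X Y f v = T v"
      using Fm_full[of X Y T \<Delta> \<epsilon>] by auto
    have "Fmz X Y f = T"
      using f(2) hmod_homD(2)[of T "HH \<Delta> \<epsilon>" "Md X" "Md Y"] X
      by (auto simp: Fmz_def fun_eq_iff[of "zero_ext _ _"] zero_ext_def)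
    then show "\<exists>f\<in>hom C X Y. Fmz X Y f = T" using f by blast
  next
    fix X Y f g assume X: "X \<in> obj C" "Y \<in> obj C" "f \<in> hom C X Y" "g \<in> hom C X Y" and eq: "Fmz X Y f = Fmz X Y g"
    show "f = g"
    proof (rule Fm_faithful[OF X])
      fix v :: "'k seq" assume "v \<in> V X"
      then show "Fm X Y f v = Fm X Y g v" using fun_cong[OF eq, of v] by (simp add: Fmz_def)
    qed
  next
    fix W assume "W \<in> obj (Rep (HH \<Delta> \<epsilon>))"
    then show "\<exists>X\<in>obj C. isomorphic (Rep (HH \<Delta> \<epsilon>)) (Md X) W" using Md_ess_surj by simp
  qed
qed

end

section \<open>Coherence of the unit constraints\<close>

context monoidal_category
begin

abbreviation "U \<equiv> unit_obj C"

lemmas mon_in [simp] = tobj_in tmor_in unit_obj_in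

lemma associator_in [simp]: "\<lbrakk>X \<in> obj C; Y \<in> obj C; Z \<in> obj C\<rbrakk>
    \<Longrightarrow> associator C X Y Z \<in> hom C (tobj C (tobj C X Y) Z) (tobj C X (tobj C Y Z))"
  and lunit_in [simp]: "X \<in> obj C \<Longrightarrow> lunit C X \<in> hom C (tobj C U X) X"
  and runit_in [simp]: "X \<in> obj C \<Longrightarrow> runit C X \<in> hom C (tobj C X U) X"
  using associator_iso lunit_iso runit_iso by (auto simp: is_iso_def)

lemma unit_tensor_cancel:
  assumes "X \<in> obj C" "Y \<in> obj C" "f \<in> hom C X Y" "g \<in> hom C X Y"
    "tmor C U U X Y (ident C U) f = tmor C U U X Y (ident C U) g"
  shows "f = g"
proof (rule iso_cancel_right[OF _ _ _ lunit_iso])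
  show "cmp C (tobj C U X) X Y f (lunit C X) = cmp C (tobj C U X) X Y g (lunit C X)"
    using lunit_natural[of X Y f] lunit_natural[of X Y g] assms by simp
qed (use assms in auto)

lemma tensor_unit_cancel:
  assumes "X \<in> obj C" "Y \<in> obj C" "f \<in> hom C X Y" "g \<in> hom C X Y"
    "tmor C X Y U U f (ident C U) = tmor C X Y U U g (ident C U)"
  shows "f = g"
proof (rule iso_cancel_right[OF _ _ _ runit_iso])
  show "cmp C (tobj C X U) X Y f (runit C X) = cmp C (tobj C X U) X Y g (runit C X)"
    using runit_natural[of X Y f] runit_natural[of X Y g] assms by simp
qed (use assms in auto)

lemma lw_cmp:
  assumes "W \<in> obj C" "X \<in> obj C" "Y \<in> obj C" "Z \<in> obj C" "f \<in> hom C X Y" "g \<in> hom C Y Z"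
  shows "cmp C (tobj C W X) (tobj C W Y) (tobj C W Z) (tmor C W W Y Z (ident C W) g) (tmor C W W X Y (ident C W) f)
    = tmor C W W X Z (ident C W) (cmp C X Y Z g f)"
  using tmor_cmp[of W W W X Y Z "ident C W" "ident C W" f g] assms by simp

lemma rw_cmp:
  assumes "W \<in> obj C" "X \<in> obj C" "Y \<in> obj C" "Z \<in> obj C" "f \<in> hom C X Y" "g \<in> hom C Y Z"
  shows "cmp C (tobj C X W) (tobj C Y W) (tobj C Z W) (tmor C Y Z W W g (ident C W)) (tmor C X Y W W f (ident C W))
    = tmor C X Z W W (cmp C X Y Z g f) (ident C W)"
  using tmor_cmp[of X Y Z W W W f g "ident C W" "ident C W"] assms by simp

lemma tensor_iso:
  assumes "X \<in> obj C" "X' \<in> obj C" "Y \<in> obj C" "Y' \<in> obj C" "is_iso C X X' f" "is_iso C Y Y' g"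
  shows "is_iso C (tobj C X Y) (tobj C X' Y') (tmor C X X' Y Y' f g)"
proof -
  obtain f' where f: "f \<in> hom C X X'" "f' \<in> hom C X' X" "cmp C X X' X f' f = ident C X" "cmp C X' X X' f f' = ident C X'"
    using assms(5) by (rule is_isoE)
  obtain g' where g: "g \<in> hom C Y Y'" "g' \<in> hom C Y' Y" "cmp C Y Y' Y g' g = ident C Y" "cmp C Y' Y Y' g g' = ident C Y'"
    using assms(6) by (rule is_isoE)
  show ?thesis
    by (rule is_isoI[of _ _ _ "tmor C X' X Y' Y f' g'"])
      (use assms(1-4) f g in \<open>simp_all add: tmor_ident flip: tmor_cmp\<close>)
qed

text \<open>Kelly's lemma. Tensoring with \<open>\<one>\<close> on the left reflects equality, and the two sides tensored with \<open>\<one>\<close>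
  agree after precomposition with an isomorphism: the pentagon for \<open>\<one>\<close>, \<open>\<one>\<close>, \<open>X\<close>, \<open>Y\<close>, whose edges
  are rewritten with the triangle axiom and naturality.\<close>

lemma lunit_tensor:
  assumes [simp]: "X \<in> obj C" "Y \<in> obj C"
  shows "cmp C (tobj C (tobj C U X) Y) (tobj C U (tobj C X Y)) (tobj C X Y) (lunit C (tobj C X Y)) (associator C U X Y)
    = tmor C (tobj C U X) X Y Y (lunit C X) (ident C Y)"
proof (rule unit_tensor_cancel)
  let ?UX = "tobj C U X" and ?XY = "tobj C X Y" and ?UU = "tobj C U U"
  let ?a = "associator C U X Y"
  let ?A = "tobj C (tobj C ?UU X) Y" and ?B = "tobj C (tobj C U ?UX) Y" and ?D = "tobj C U (tobj C ?UX Y)"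
    and ?E = "tobj C U (tobj C U ?XY)" and ?G = "tobj C U ?XY" and ?H = "tobj C ?UU ?XY"
    and ?K = "tobj C (tobj C U X) Y"
  let ?s = "tmor C (tobj C ?UU X) (tobj C U ?UX) Y Y (associator C U U X) (ident C Y)"
  let ?t = "associator C U ?UX Y"
  let ?l = "tmor C U U (tobj C U ?XY) ?XY (ident C U) (lunit C ?XY)"
  let ?r = "tmor C ?UU U ?XY ?XY (runit C U) (ident C ?XY)"
  let ?m = "tmor C (tobj C U ?UX) ?UX Y Y (tmor C U U ?UX X (ident C U) (lunit C X)) (ident C Y)"
  let ?f = "cmp C ?K (tobj C U ?XY) ?XY (lunit C ?XY) ?a" and ?g = "tmor C ?UX X Y Y (lunit C X) (ident C Y)"
  have s: "is_iso C ?A ?B ?s"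
    by (rule tensor_iso) (auto intro: associator_iso is_isoI[of _ _ _ "ident C Y"])
  have iso: "is_iso C ?A ?D (cmp C ?A ?B ?D ?t ?s)"
    by (rule iso_cmp[OF _ _ _ s associator_iso]) auto
  have eq: "cmp C ?A ?D ?G (tmor C U U ?K ?XY (ident C U) ?f) (cmp C ?A ?B ?D ?t ?s)
     = cmp C ?A ?D ?G (tmor C U U ?K ?XY (ident C U) ?g) (cmp C ?A ?B ?D ?t ?s)"
  proof -
    have "cmp C ?A ?D ?G (tmor C U U ?K ?XY (ident C U) ?f) (cmp C ?A ?B ?D ?t ?s)
      = cmp C ?A ?D ?G (cmp C ?D ?E ?G ?l (tmor C U U ?K (tobj C U ?XY) (ident C U) ?a)) (cmp C ?A ?B ?D ?t ?s)"
      by (simp add: lw_cmp)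
    also have "\<dots> = cmp C ?A ?E ?G ?l (cmp C ?A ?D ?E (tmor C U U ?K (tobj C U ?XY) (ident C U) ?a) (cmp C ?A ?B ?D ?t ?s))"
      by (rule cmp_assoc) auto
    also have "\<dots> = cmp C ?A ?E ?G ?l (cmp C ?A ?H ?E (associator C U U ?XY) (associator C ?UU X Y))"
      by (subst pentagon) auto
    also have "\<dots> = cmp C ?A ?H ?G (cmp C ?H ?E ?G ?l (associator C U U ?XY)) (associator C ?UU X Y)"
      by (rule cmp_assoc[symmetric]) auto
    also have "\<dots> = cmp C ?A ?H ?G ?r (associator C ?UU X Y)"
      by (subst triangle) auto
    also have "\<dots> = cmp C ?A ?K ?G ?a (tmor C (tobj C ?UU X) ?UX Y Y (tmor C ?UU U X X (runit C U) (ident C X)) (ident C Y))"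
      using associator_natural[of ?UU U X X Y Y "runit C U" "ident C X" "ident C Y"] by (simp add: tmor_ident)
    also have "tmor C ?UU U X X (runit C U) (ident C X)
       = cmp C (tobj C ?UU X) (tobj C U ?UX) ?UX (tmor C U U ?UX X (ident C U) (lunit C X)) (associator C U U X)"
      by (subst triangle) auto
    also have "tmor C (tobj C ?UU X) ?UX Y Y \<dots> (ident C Y) = cmp C ?A ?B ?K ?m ?s"
      by (rule rw_cmp[symmetric]) auto
    also have "cmp C ?A ?K ?G ?a (cmp C ?A ?B ?K ?m ?s) = cmp C ?A ?B ?G (cmp C ?B ?K ?G ?a ?m) ?s"
      by (rule cmp_assoc[symmetric]) auto
    also have "cmp C ?B ?K ?G ?a ?m = cmp C ?B ?D ?G (tmor C U U ?K ?XY (ident C U) ?g) ?t"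
      by (rule associator_natural) auto
    also have "cmp C ?A ?B ?G (cmp C ?B ?D ?G (tmor C U U ?K ?XY (ident C U) ?g) ?t) ?s
       = cmp C ?A ?D ?G (tmor C U U ?K ?XY (ident C U) ?g) (cmp C ?A ?B ?D ?t ?s)"
      by (rule cmp_assoc) auto
    finally show ?thesis .
  qed
  show "tmor C U U ?K ?XY (ident C U) ?f = tmor C U U ?K ?XY (ident C U) ?g"
    by (rule iso_cancel_right[OF _ _ _ iso _ _ eq]) auto
qed auto

text \<open>Compare \<open>lunit_tensor\<close> with the triangle axiom, both for \<open>\<one>\<close>, \<open>\<one>\<close>.\<close>

lemma lunit_unit_eq_runit: "lunit C U = runit C U"
proof (rule tensor_unit_cancel)
  let ?UU = "tobj C U U"
  have "lunit C ?UU = tmor C U U ?UU U (ident C U) (lunit C U)"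
    by (rule iso_cancel_left[where X = ?UU and Y = U and W = "tobj C U ?UU" and u = "lunit C U"])
      (use lunit_iso[of U] lunit_natural[of ?UU U "lunit C U"] in auto)
  then show "tmor C ?UU U U U (lunit C U) (ident C U) = tmor C ?UU U U U (runit C U) (ident C U)"
    using lunit_tensor[of U U] triangle[of U U] by simp
qed auto

end

section \<open>The weak bialgebra of a fibre functor\<close>

text \<open>A fibre functor with values in bimodules over \<open>k\<^sup>N\<close>. The maps \<open>Lp i\<close> and \<open>Rp i\<close> are the left and
  right actions of the idempotents; \<open>P\<close> is the bilinear form of \<open>\<pi>\<close>, \<open>io\<close> is \<open>\<iota>\<close>, and \<open>eta\<close> and \<open>lam\<close> are the
  unit vector and the linear form on \<open>F(\<one>)\<close>. The two formulas for the unit constraints express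
  that \<open>F(\<one>)\<close> acts on \<open>F(Y)\<close> from either side through the algebra \<open>k\<^sup>N\<close>.\<close>

locale frobenius_fibre_functor = monoidal_category C + linear_fibre_functor C n S B Fm
  for C :: "('o, 'm, 'k::field, 'z) mon_cat_scheme" and n S B Fm +
  fixes P :: "'o \<Rightarrow> 'o \<Rightarrow> 'k seq \<Rightarrow> 'k seq \<Rightarrow> 'k seq" and io :: "'o \<Rightarrow> 'o \<Rightarrow> 'k seq \<Rightarrow> 'k seq"
    and N :: nat and Lp Rp :: "nat \<Rightarrow> 'k seq \<Rightarrow> 'k seq" and eta :: "'k seq" and lam :: "'k seq \<Rightarrow> 'k"
  assumes P_bilin: "\<And>X Y. \<lbrakk>X \<in> obj C; Y \<in> obj C\<rbrakk> \<Longrightarrow> bilin_on (csp (B X)) (csp (B Y)) (csp (B (tobj C X Y))) (P X Y)"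
    and io_lin: "\<And>X Y. \<lbrakk>X \<in> obj C; Y \<in> obj C\<rbrakk> \<Longrightarrow> lin_on (csp (B (tobj C X Y))) (tens_space (csp (B X)) (csp (B Y))) (io X Y)"
    and P_io: "\<And>X Y z. \<lbrakk>X \<in> obj C; Y \<in> obj C; z \<in> csp (B (tobj C X Y))\<rbrakk>
      \<Longrightarrow> tens_lift (csp (B X)) (csp (B Y)) (P X Y) (io X Y z) = z"
    and io_P: "\<And>X Y x y. \<lbrakk>X \<in> obj C; Y \<in> obj C; x \<in> csp (B X); y \<in> csp (B Y)\<rbrakk>
      \<Longrightarrow> io X Y (P X Y x y) = (\<Sum>i<N. tens (Rp i x) (Lp i y))"
    and P_nat: "\<And>X X' Y Y' f g x y. \<lbrakk>X \<in> obj C; X' \<in> obj C; Y \<in> obj C; Y' \<in> obj C; f \<in> hom C X X'; g \<in> hom C Y Y';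
        x \<in> csp (B X); y \<in> csp (B Y)\<rbrakk>
      \<Longrightarrow> P X' Y' (Fm X X' f x) (Fm Y Y' g y) = Fm (tobj C X Y) (tobj C X' Y') (tmor C X X' Y Y' f g) (P X Y x y)"
    and P_assoc: "\<And>X Y Z x y z. \<lbrakk>X \<in> obj C; Y \<in> obj C; Z \<in> obj C; x \<in> csp (B X); y \<in> csp (B Y); z \<in> csp (B Z)\<rbrakk>
      \<Longrightarrow> Fm (tobj C (tobj C X Y) Z) (tobj C X (tobj C Y Z)) (associator C X Y Z) (P (tobj C X Y) Z (P X Y x y) z)
        = P X (tobj C Y Z) x (P Y Z y z)"
    and Lp_lin: "\<And>X i. X \<in> obj C \<Longrightarrow> lin_on (csp (B X)) (csp (B X)) (Lp i)"
    and Rp_lin: "\<And>X i. X \<in> obj C \<Longrightarrow> lin_on (csp (B X)) (csp (B X)) (Rp i)"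
    and Fm_Lp: "\<And>X Y f i x. \<lbrakk>X \<in> obj C; Y \<in> obj C; f \<in> hom C X Y; x \<in> csp (B X)\<rbrakk> \<Longrightarrow> Fm X Y f (Lp i x) = Lp i (Fm X Y f x)"
    and Fm_Rp: "\<And>X Y f i x. \<lbrakk>X \<in> obj C; Y \<in> obj C; f \<in> hom C X Y; x \<in> csp (B X)\<rbrakk> \<Longrightarrow> Fm X Y f (Rp i x) = Rp i (Fm X Y f x)"
    and P_Lp: "\<And>X Y i x y. \<lbrakk>X \<in> obj C; Y \<in> obj C; x \<in> csp (B X); y \<in> csp (B Y)\<rbrakk> \<Longrightarrow> Lp i (P X Y x y) = P X Y (Lp i x) y"
    and P_Rp: "\<And>X Y i x y. \<lbrakk>X \<in> obj C; Y \<in> obj C; x \<in> csp (B X); y \<in> csp (B Y)\<rbrakk> \<Longrightarrow> Rp i (P X Y x y) = P X Y x (Rp i y)"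
    and Lp_Rp: "\<And>X i j x. \<lbrakk>X \<in> obj C; x \<in> csp (B X)\<rbrakk> \<Longrightarrow> Lp i (Rp j x) = Rp j (Lp i x)"
    and Lp_Lp: "\<And>X i j x. \<lbrakk>X \<in> obj C; x \<in> csp (B X)\<rbrakk> \<Longrightarrow> Lp i (Lp j x) = Lp j (Lp i x)"
    and eta_in [simp]: "eta \<in> csp (B (unit_obj C))"
    and lam_add: "\<And>x y. \<lbrakk>x \<in> csp (B (unit_obj C)); y \<in> csp (B (unit_obj C))\<rbrakk> \<Longrightarrow> lam (x + y) = lam x + lam y"
    and lam_scale: "\<And>c x. x \<in> csp (B (unit_obj C)) \<Longrightarrow> lam (vscale c x) = c * lam x"
    and lunit_P: "\<And>Y x y. \<lbrakk>Y \<in> obj C; x \<in> csp (B (unit_obj C)); y \<in> csp (B Y)\<rbrakk>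
      \<Longrightarrow> Fm (tobj C (unit_obj C) Y) Y (lunit C Y) (P (unit_obj C) Y x y) = (\<Sum>i<N. vscale (lam (Rp i x)) (Lp i y))"
    and runit_P: "\<And>Y x y. \<lbrakk>Y \<in> obj C; x \<in> csp (B (unit_obj C)); y \<in> csp (B Y)\<rbrakk>
      \<Longrightarrow> Fm (tobj C Y (unit_obj C)) Y (runit C Y) (P Y (unit_obj C) y x) = (\<Sum>i<N. vscale (lam (Lp i x)) (Rp i y))"
    and lunit_eta: "\<And>Y y. \<lbrakk>Y \<in> obj C; y \<in> csp (B Y)\<rbrakk>
      \<Longrightarrow> Fm (tobj C (unit_obj C) Y) Y (lunit C Y) (P (unit_obj C) Y eta y) = y"
    and runit_eta: "\<And>Y y. \<lbrakk>Y \<in> obj C; y \<in> csp (B Y)\<rbrakk>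
      \<Longrightarrow> Fm (tobj C Y (unit_obj C)) Y (runit C Y) (P Y (unit_obj C) y eta) = y"
begin

abbreviation "VV X Y \<equiv> tens_space (V X) (V Y)"
abbreviation "Pt X Y \<equiv> tens_lift (V X) (V Y) (P X Y)"
abbreviation "HA \<equiv> (csp BH :: 'k seq set)"
abbreviation "HT \<equiv> tens_space HA HA"
abbreviation "A2 X Y \<equiv> actt HA HA (V X) (V Y) (A X) (A Y)"

lemma tens_space_closed [simp]: "s \<in> tens_space E F \<Longrightarrow> t \<in> tens_space E F \<Longrightarrow> s + t \<in> tens_space E F"
  "s \<in> tens_space E F \<Longrightarrow> vscale c s \<in> tens_space E F" "0 \<in> tens_space E F"
  for s t :: "'k seq"
  using vec.subspace_add vec.subspace_scale vec.subspace_0 subspace_tens_space by blast+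

lemma tens_space_sum: "(\<And>i. i \<in> I \<Longrightarrow> f i \<in> tens_space E F) \<Longrightarrow> sum f I \<in> tens_space E F"
  for f :: "'i \<Rightarrow> 'k seq"
  by (rule vec.subspace_sum[OF subspace_tens_space])

lemma P_in [simp]: "\<lbrakk>X \<in> obj C; Y \<in> obj C; x \<in> V X; y \<in> V Y\<rbrakk> \<Longrightarrow> P X Y x y \<in> V (tobj C X Y)"
  using bilin_on_in[OF P_bilin] by blast

lemma io_in [simp]: "\<lbrakk>X \<in> obj C; Y \<in> obj C; z \<in> V (tobj C X Y)\<rbrakk> \<Longrightarrow> io X Y z \<in> VV X Y"
  using lin_on_in[OF io_lin] by blast

lemma Lp_in [simp]: "X \<in> obj C \<Longrightarrow> x \<in> V X \<Longrightarrow> Lp i x \<in> V X"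
  and Rp_in [simp]: "X \<in> obj C \<Longrightarrow> x \<in> V X \<Longrightarrow> Rp i x \<in> V X"
  using lin_on_in[OF Lp_lin] lin_on_in[OF Rp_lin] by blast+

lemma Pt_lin: "\<lbrakk>X \<in> obj C; Y \<in> obj C\<rbrakk> \<Longrightarrow> lin_on (VV X Y) (V (tobj C X Y)) (Pt X Y)"
  by (rule lin_tens_lift[OF P_bilin]) auto

lemma Pt_in [simp]: "\<lbrakk>X \<in> obj C; Y \<in> obj C; t \<in> VV X Y\<rbrakk> \<Longrightarrow> Pt X Y t \<in> V (tobj C X Y)"
  using lin_on_in[OF Pt_lin] by blast

lemma Pt_tens [simp]: "\<lbrakk>X \<in> obj C; Y \<in> obj C; x \<in> V X; y \<in> V Y\<rbrakk> \<Longrightarrow> Pt X Y (tens x y) = P X Y x y"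
  by (rule tens_lift_tens[OF bilin_on_bil[OF P_bilin]]) auto

lemma Pt_add: "\<lbrakk>X \<in> obj C; Y \<in> obj C; s \<in> VV X Y; t \<in> VV X Y\<rbrakk> \<Longrightarrow> Pt X Y (s + t) = Pt X Y s + Pt X Y t"
  using lin_on_add[OF Pt_lin] by blast

lemma io_add: "\<lbrakk>X \<in> obj C; Y \<in> obj C; s \<in> V (tobj C X Y); t \<in> V (tobj C X Y)\<rbrakk> \<Longrightarrow> io X Y (s + t) = io X Y s + io X Y t"
  using lin_on_add[OF io_lin] by blast

lemma io_scale: "\<lbrakk>X \<in> obj C; Y \<in> obj C; s \<in> V (tobj C X Y)\<rbrakk> \<Longrightarrow> io X Y (vscale c s) = vscale c (io X Y s)"
  using lin_on_scale[OF io_lin] by blast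

declare P_io [simp]

text \<open>\<open>\<pi>\<close> is surjective, having the section \<open>\<iota>\<close>.\<close>

lemma P_induct [consumes 3, case_names P add]:
  assumes X: "X \<in> obj C" "Y \<in> obj C" and z: "z \<in> V (tobj C X Y)"
    and P: "\<And>x y. \<lbrakk>x \<in> V X; y \<in> V Y\<rbrakk> \<Longrightarrow> Q (P X Y x y)"
    and add: "\<And>u w. \<lbrakk>u \<in> V (tobj C X Y); w \<in> V (tobj C X Y); Q u; Q w\<rbrakk> \<Longrightarrow> Q (u + w)"
  shows "Q z"
proof -
  have "Q (Pt X Y t)" if "t \<in> VV X Y" for t
    using that subspace_csp by (induction t rule: tens_induct) (use X in \<open>auto simp: Pt_add intro: P add\<close>)
  from this[of "io X Y z"] show ?thesis using X z by simp
qed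

lemma A_bil: "X \<in> obj C \<Longrightarrow> bilin_on HA (V X) (V X) (A X)"
  using bilin_on_subset[OF A_bilin] by simp

lemma A2_bilin: "\<lbrakk>X \<in> obj C; Y \<in> obj C\<rbrakk> \<Longrightarrow> bilin_on HT (VV X Y) (VV X Y) (A2 X Y)"
  by (rule actt_bilin[OF A_bil A_bil]) auto

lemma A2_in [simp]: "\<lbrakk>X \<in> obj C; Y \<in> obj C; x \<in> HT; t \<in> VV X Y\<rbrakk> \<Longrightarrow> A2 X Y x t \<in> VV X Y"
  using bilin_on_in[OF A2_bilin] by blast

lemma A2_tens [simp]: "\<lbrakk>X \<in> obj C; Y \<in> obj C; a \<in> HA; b \<in> HA; v \<in> V X; w \<in> V Y\<rbrakk>
    \<Longrightarrow> A2 X Y (tens a b) (tens v w) = tens (A X a v) (A Y b w)"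
  by (rule actt_tens[OF A_bil A_bil]) auto

lemma A2_simps:
  assumes "X \<in> obj C" "Y \<in> obj C"
  shows "\<lbrakk>x \<in> HT; y \<in> HT; t \<in> VV X Y\<rbrakk> \<Longrightarrow> A2 X Y (x + y) t = A2 X Y x t + A2 X Y y t"
    "\<lbrakk>x \<in> HT; s \<in> VV X Y; t \<in> VV X Y\<rbrakk> \<Longrightarrow> A2 X Y x (s + t) = A2 X Y x s + A2 X Y x t"
    "\<lbrakk>x \<in> HT; t \<in> VV X Y\<rbrakk> \<Longrightarrow> A2 X Y (vscale c x) t = vscale c (A2 X Y x t)"
    "\<lbrakk>x \<in> HT; t \<in> VV X Y\<rbrakk> \<Longrightarrow> A2 X Y x (vscale c t) = vscale c (A2 X Y x t)"
  using A2_bilin[OF assms] by (auto simp: bilin_on_def lin_on_def)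

lemma csp_zero: "v \<in> csp E \<Longrightarrow> i \<notin> E \<Longrightarrow> v i = 0"
  by (simp add: csp_def)

lemma HT_csp: "HT = csp (prod_encode ` (BH \<times> BH))"
  by (rule tens_space_csp) auto

lemma VV_csp: "\<lbrakk>X \<in> obj C; Y \<in> obj C\<rbrakk> \<Longrightarrow> VV X Y = csp (prod_encode ` (B X \<times> B Y))"
  by (rule tens_space_csp) auto

lemma HA_coef: "s < n \<Longrightarrow> p \<in> B (S s) \<Longrightarrow> q \<in> B (S s) \<Longrightarrow> a (enc3 s p q) = A (S s) a (uv q) p"
  by (simp add: M_uv)

lemma A2_coef:
  assumes "s < n" "p \<in> B (S s)" "q \<in> B (S s)" "t < n" "p' \<in> B (S t)" "q' \<in> B (S t)" "x \<in> HT"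
  shows "x (prod_encode (enc3 s p q, enc3 t p' q')) = A2 (S s) (S t) x (tens (uv q) (uv q')) (prod_encode (p, p'))"
  by (rule actt_coef[OF A_bil A_bil _ _ _ _ _ HA_coef _ HA_coef]) (use assms in auto)

text \<open>\<open>H \<otimes> H\<close> acts faithfully on the tensor products \<open>F(S\<^sub>s) \<otimes> F(S\<^sub>t)\<close>: their matrix coefficients
  are its coordinates.\<close>

lemma HT_eqI:
  assumes "x \<in> HT" "y \<in> HT"
    and eq: "\<And>s t v w. \<lbrakk>s < n; t < n; v \<in> V (S s); w \<in> V (S t)\<rbrakk>
      \<Longrightarrow> A2 (S s) (S t) x (tens v w) = A2 (S s) (S t) y (tens v w)"
  shows "x = y"
proof (rule seq_eqI)
  fix a b
  show "x (prod_encode (a, b)) = y (prod_encode (a, b))"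
  proof (cases "a \<in> BH \<and> b \<in> BH")
    case True
    then obtain s p q t p' q' where ab: "a = enc3 s p q" "s < n" "p \<in> B (S s)" "q \<in> B (S s)"
      "b = enc3 t p' q'" "t < n" "p' \<in> B (S t)" "q' \<in> B (S t)" by (auto simp: BH_def)
    then show ?thesis
      using A2_coef[OF ab(2-4) ab(6-8) assms(1)] A2_coef[OF ab(2-4) ab(6-8) assms(2)]
        eq[OF ab(2,6), of "uv q" "uv q'"] by simp
  next
    case False
    then have "prod_encode (a, b) \<notin> prod_encode ` (BH \<times> BH)" by auto
    then show ?thesis using assms(1,2)[unfolded HT_csp] by (simp add: csp_zero)
  qed
qed

text \<open>The element of \<open>H \<otimes> H\<close> with prescribed action on the tensor products of simple objects.\<close>

definition mat2 :: "(nat \<Rightarrow> nat \<Rightarrow> 'k seq \<Rightarrow> 'k seq) \<Rightarrow> 'k seq" where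
  "mat2 T = (\<lambda>m. if m \<in> prod_encode ` (BH \<times> BH) then
     (case prod_decode m of (m1, m2) \<Rightarrow> case prod_decode m1 of (s, pq) \<Rightarrow> case prod_decode pq of (p, q) \<Rightarrow>
      case prod_decode m2 of (t, pq') \<Rightarrow> case prod_decode pq' of (p', q') \<Rightarrow>
        T s t (tens (uv q) (uv q')) (prod_encode (p, p'))) else 0)"

lemma mat2_in [simp]: "mat2 T \<in> HT"
  unfolding HT_csp by (simp add: csp_def mat2_def)

lemma mat2_apply:
  assumes "s < n" "p \<in> B (S s)" "q \<in> B (S s)" "t < n" "p' \<in> B (S t)" "q' \<in> B (S t)"
  shows "mat2 T (prod_encode (enc3 s p q, enc3 t p' q')) = T s t (tens (uv q) (uv q')) (prod_encode (p, p'))"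
proof -
  have "prod_encode (enc3 s p q, enc3 t p' q') \<in> prod_encode ` (BH \<times> BH)" using assms by auto
  then show ?thesis unfolding mat2_def by (simp add: enc3_def)
qed

lemma A2_mat2:
  assumes st: "s < n" "t < n" and T: "lin_on (VV (S s) (S t)) (VV (S s) (S t)) (T s t)" and z: "z \<in> VV (S s) (S t)"
  shows "A2 (S s) (S t) (mat2 T) z = T s t z"
proof -
  have X: "S s \<in> obj C" "S t \<in> obj C" using st by auto
  note c = VV_csp[OF X]
  have l: "lin_on (VV (S s) (S t)) (VV (S s) (S t)) (A2 (S s) (S t) (mat2 T))"
    by (rule bilin_on_lin[OF A2_bilin[OF X] mat2_in])
  show ?thesis
  proof (rule csp_lin_eq[OF _ z[unfolded c] l[unfolded c] T[unfolded c]])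
    fix i assume "i \<in> prod_encode ` (B (S s) \<times> B (S t))"
    then obtain q q' where i: "i = prod_encode (q, q')" "q \<in> B (S s)" "q' \<in> B (S t)" by auto
    have m: "tens (uv q) (uv q') \<in> VV (S s) (S t)" using i by simp
    show "A2 (S s) (S t) (mat2 T) (uv i) = T s t (uv i)"
      unfolding i(1) uv_prod
    proof (rule seq_eqI)
      fix a b
      show "A2 (S s) (S t) (mat2 T) (tens (uv q) (uv q')) (prod_encode (a, b)) = T s t (tens (uv q) (uv q')) (prod_encode (a, b))"
      proof (cases "a \<in> B (S s) \<and> b \<in> B (S t)")
        case True
        then show ?thesis
          using A2_coef[of s a q t b q' "mat2 T"] mat2_apply[of s a q t b q' T] i st by simp
      next
        case False
        then have "prod_encode (a, b) \<notin> prod_encode ` (B (S s) \<times> B (S t))" by auto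
        then show ?thesis using csp_zero[OF lin_on_in[OF l m, unfolded c]] csp_zero[OF lin_on_in[OF T m, unfolded c]]
          by simp
      qed
    qed
  qed (use st in auto)
qed

text \<open>The comultiplication \<open>\<Delta>(h) = \<iota> h \<pi>\<close>.\<close>

definition D :: "'k seq \<Rightarrow> 'k seq" where
  "D h = mat2 (\<lambda>s t z. io (S s) (S t) (A (tobj C (S s) (S t)) h (Pt (S s) (S t) z)))"

lemma D_in [simp]: "D h \<in> HT"
  by (simp add: D_def)

abbreviation "tF X X' Y Y' f g \<equiv> tmap (V X) (V Y) (Fm X X' f) (Fm Y Y' g)"

lemma tF_lin:
  assumes "X \<in> obj C" "X' \<in> obj C" "Y \<in> obj C" "Y' \<in> obj C" "f \<in> hom C X X'" "g \<in> hom C Y Y'"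
  shows "lin_on (VV X Y) (VV X' Y') (tF X X' Y Y' f g)"
  by (rule tmap_lin[OF Fm_lin Fm_lin]) (use assms in auto)

lemma tF_tens:
  assumes "X \<in> obj C" "X' \<in> obj C" "Y \<in> obj C" "Y' \<in> obj C" "f \<in> hom C X X'" "g \<in> hom C Y Y'" "x \<in> V X" "y \<in> V Y"
  shows "tF X X' Y Y' f g (tens x y) = tens (Fm X X' f x) (Fm Y Y' g y)"
  by (rule tmap_tens[OF Fm_lin Fm_lin]) (use assms in auto)

lemma A2_nat:
  assumes X: "X \<in> obj C" "X' \<in> obj C" "Y \<in> obj C" "Y' \<in> obj C" "f \<in> hom C X X'" "g \<in> hom C Y Y'"
    and x: "x \<in> HT" and t: "t \<in> VV X Y"
  shows "A2 X' Y' x (tF X X' Y Y' f g t) = tF X X' Y Y' f g (A2 X Y x t)"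
proof -
  note l = tF_lin[OF X]
  from x subspace_csp show ?thesis
  proof (induction x rule: tens_induct)
    case (tens a b)
    from t subspace_csp show ?case
      by (induction t rule: tens_induct)
        (use X tens in \<open>simp_all add: tF_tens A_Fm A2_simps lin_on_add[OF l] lin_on_in[OF l]\<close>)
  next
    case (add x y)
    then show ?case using X t by (simp add: A2_simps lin_on_add[OF l] lin_on_in[OF l])
  qed auto
qed

lemma Pt_nat:
  assumes X: "X \<in> obj C" "X' \<in> obj C" "Y \<in> obj C" "Y' \<in> obj C" "f \<in> hom C X X'" "g \<in> hom C Y Y'" and t: "t \<in> VV X Y"
  shows "Pt X' Y' (tF X X' Y Y' f g t) = Fm (tobj C X Y) (tobj C X' Y') (tmor C X X' Y Y' f g) (Pt X Y t)"
  using t subspace_csp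
  by (induction t rule: tens_induct)
    (use X in \<open>simp_all add: tF_tens P_nat Pt_add Fm_add lin_on_add[OF tF_lin[OF X]] lin_on_in[OF tF_lin[OF X]]\<close>)

text \<open>The naturality of \<open>\<iota>\<close> follows from that of \<open>\<pi>\<close>: on the image of \<open>\<pi>\<close> the section is the idempotent
  \<open>\<iota> \<pi>\<close>, which is natural because \<open>F\<close> takes values in bimodules.\<close>

lemma io_nat:
  assumes X: "X \<in> obj C" "X' \<in> obj C" "Y \<in> obj C" "Y' \<in> obj C" "f \<in> hom C X X'" "g \<in> hom C Y Y'"
    and z: "z \<in> V (tobj C X Y)"
  shows "io X' Y' (Fm (tobj C X Y) (tobj C X' Y') (tmor C X X' Y Y' f g) z) = tF X X' Y Y' f g (io X Y z)"
  using X(1,3) z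
proof (induction z rule: P_induct)
  case (P x y)
  have "tF X X' Y Y' f g (\<Sum>i<N. tens (Rp i x) (Lp i y)) = (\<Sum>i<N. tF X X' Y Y' f g (tens (Rp i x) (Lp i y)))"
    by (rule lin_on_sum[OF tF_lin[OF X] subspace_tens_space]) (use X P in simp)
  also have "\<dots> = (\<Sum>i<N. tens (Rp i (Fm X X' f x)) (Lp i (Fm Y Y' g y)))"
    using X P by (simp add: tF_tens Fm_Lp Fm_Rp)
  finally show ?case using X P io_P[of X' Y' "Fm X X' f x" "Fm Y Y' g y"]
    by (simp add: io_P P_nat)
next
  case (add u w)
  then show ?case using X by (simp add: Fm_add io_add lin_on_add[OF tF_lin[OF X]])
qed

text \<open>The comultiplication is defined by its action on pairs of simple objects. Both sides are natural in
  \<open>X\<close> and \<open>Y\<close>, so the formula extends to all pairs of objects; this extension is used with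
  \<open>X\<close> or \<open>Y\<close> itself a tensor product.\<close>

lemma A2_D:
  assumes X: "X \<in> obj C" "Y \<in> obj C" and t: "t \<in> VV X Y"
  shows "A2 X Y (D h) t = io X Y (A (tobj C X Y) h (Pt X Y t))"
  using t subspace_csp
proof (induction t rule: tens_induct)
  case (tens v w)
  from X(1) tens(1) show ?case
  proof (induction v rule: simple_induct)
    case (simple s f v)
    note sf = this
    from X(2) tens(2) show ?case
    proof (induction w rule: simple_induct)
      case (simple t g w)
      let ?T = "\<lambda>s t z. io (S s) (S t) (A (tobj C (S s) (S t)) h (Pt (S s) (S t) z))"
      have o: "S s \<in> obj C" "S t \<in> obj C" using sf simple by auto
      note fg = o(1) X(1) o(2) X(2) sf(2) simple(2)
      have l: "lin_on (VV (S s) (S t)) (VV (S s) (S t)) (?T s t)"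
        by (rule lin_on_cmp[OF lin_on_cmp[OF Pt_lin bilin_on_lin[OF A_bilin]] io_lin]) (use o in auto)
      have "A2 X Y (D h) (tens (Fm (S s) X f v) (Fm (S t) Y g w))
          = A2 X Y (D h) (tF (S s) X (S t) Y f g (tens v w))"
        using fg sf simple by (simp add: tF_tens)
      also have "\<dots> = tF (S s) X (S t) Y f g (A2 (S s) (S t) (D h) (tens v w))"
        by (rule A2_nat) (use fg sf simple in auto)
      also have "A2 (S s) (S t) (D h) (tens v w) = ?T s t (tens v w)"
        unfolding D_def by (rule A2_mat2[where T = ?T, OF sf(1) simple(1) l]) (use sf simple in simp)
      also have "tF (S s) X (S t) Y f g \<dots> = io X Y (Fm (tobj C (S s) (S t)) (tobj C X Y) (tmor C (S s) X (S t) Y f g)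
           (A (tobj C (S s) (S t)) h (P (S s) (S t) v w)))"
        using io_nat[OF fg, of "A (tobj C (S s) (S t)) h (P (S s) (S t) v w)"] fg sf simple by simp
      also have "\<dots> = io X Y (A (tobj C X Y) h (P X Y (Fm (S s) X f v) (Fm (S t) Y g w)))"
        using fg sf simple by (simp add: P_nat A_Fm)
      finally show ?case using fg sf simple by simp
    next
      case zero
      have "P X Y (Fm (S s) X f v) 0 = 0"
        by (rule lin_on_0[OF bilin_on_lin[OF P_bilin]]) (use X sf in auto)
      then show ?case using X sf lin_on_0[OF bilin_on_lin[OF A2_bilin[OF X] D_in[of h]]]
        by (simp add: A_simps lin_on_0[OF io_lin] lin_on_0[OF Pt_lin])
    next
      case (add u w)
      then show ?case using X sf
        by (simp add: tens_add_right A2_simps Pt_add A_simps io_add flip: Pt_tens)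
    qed
  next
    case zero
    then show ?case using X tens lin_on_0[OF bilin_on_lin[OF A2_bilin[OF X] D_in[of h]]]
      by (simp add: A_simps lin_on_0[OF io_lin] lin_on_0[OF Pt_lin])
  next
    case (add u w)
    then show ?case using X tens
      by (simp add: tens_add_left A2_simps Pt_add A_simps io_add flip: Pt_tens)
  qed
next
  case (add s t)
  then show ?case using X by (simp add: A2_simps Pt_add A_simps io_add)
qed simp

lemma D_lin: "lin_on HA HT D"
proof (rule lin_onI)
  show "D (g + h) = D g + D h" for g h
    by (rule HT_eqI) (simp_all add: A2_simps A2_D A_simps io_add)
  show "D (vscale c h) = vscale c (D h)" for c h
    by (rule HT_eqI) (simp_all add: A2_simps A2_D A_simps io_scale)
qed simp

subsection \<open>Triple tensor products\<close>

abbreviation "io1 X Y Z \<equiv> tmap (V (tobj C X Y)) (V Z) (io X Y) (\<lambda>z. z)"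
abbreviation "io2 X Y Z \<equiv> tmap (V X) (V (tobj C Y Z)) (\<lambda>x. x) (io Y Z)"
abbreviation "Pt1 X Y Z \<equiv> tmap (VV X Y) (V Z) (Pt X Y) (\<lambda>z. z)"
abbreviation "Pt2 X Y Z \<equiv> tmap (V X) (VV Y Z) (\<lambda>x. x) (Pt Y Z)"
abbreviation "VL X Y Z \<equiv> tens_space (VV X Y) (V Z)"
abbreviation "VR X Y Z \<equiv> tens_space (V X) (VV Y Z)"

lemma io1_lin: "\<lbrakk>X \<in> obj C; Y \<in> obj C; Z \<in> obj C\<rbrakk> \<Longrightarrow> lin_on (VV (tobj C X Y) Z) (VL X Y Z) (io1 X Y Z)"
  and io2_lin: "\<lbrakk>X \<in> obj C; Y \<in> obj C; Z \<in> obj C\<rbrakk> \<Longrightarrow> lin_on (VV X (tobj C Y Z)) (VR X Y Z) (io2 X Y Z)"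
  and Pt1_lin: "\<lbrakk>X \<in> obj C; Y \<in> obj C; Z \<in> obj C\<rbrakk> \<Longrightarrow> lin_on (VL X Y Z) (VV (tobj C X Y) Z) (Pt1 X Y Z)"
  and Pt2_lin: "\<lbrakk>X \<in> obj C; Y \<in> obj C; Z \<in> obj C\<rbrakk> \<Longrightarrow> lin_on (VR X Y Z) (VV X (tobj C Y Z)) (Pt2 X Y Z)"
  by (rule tmap_lin[OF io_lin lin_on_id] tmap_lin[OF lin_on_id io_lin] tmap_lin[OF Pt_lin lin_on_id]
    tmap_lin[OF lin_on_id Pt_lin]; simp)+

lemma
  assumes "X \<in> obj C" "Y \<in> obj C" "Z \<in> obj C"
  shows io1_tens [simp]: "\<lbrakk>u \<in> V (tobj C X Y); z \<in> V Z\<rbrakk> \<Longrightarrow> io1 X Y Z (tens u z) = tens (io X Y u) z"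
    and io2_tens [simp]: "\<lbrakk>x \<in> V X; w \<in> V (tobj C Y Z)\<rbrakk> \<Longrightarrow> io2 X Y Z (tens x w) = tens x (io Y Z w)"
    and Pt1_tens [simp]: "\<lbrakk>s \<in> VV X Y; z \<in> V Z\<rbrakk> \<Longrightarrow> Pt1 X Y Z (tens s z) = tens (Pt X Y s) z"
    and Pt2_tens [simp]: "\<lbrakk>x \<in> V X; t \<in> VV Y Z\<rbrakk> \<Longrightarrow> Pt2 X Y Z (tens x t) = tens x (Pt Y Z t)"
  using assms by (simp_all add: tmap_tens[OF io_lin lin_on_id] tmap_tens[OF lin_on_id io_lin]
    tmap_tens[OF Pt_lin lin_on_id] tmap_tens[OF lin_on_id Pt_lin])

lemma
  assumes "X \<in> obj C" "Y \<in> obj C" "Z \<in> obj C"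
  shows io1_in [simp]: "u \<in> VV (tobj C X Y) Z \<Longrightarrow> io1 X Y Z u \<in> VL X Y Z"
    and io2_in [simp]: "u \<in> VV X (tobj C Y Z) \<Longrightarrow> io2 X Y Z u \<in> VR X Y Z"
    and Pt1_in [simp]: "t \<in> VL X Y Z \<Longrightarrow> Pt1 X Y Z t \<in> VV (tobj C X Y) Z"
    and Pt2_in [simp]: "r \<in> VR X Y Z \<Longrightarrow> Pt2 X Y Z r \<in> VV X (tobj C Y Z)"
    and io1_add: "u \<in> VV (tobj C X Y) Z \<Longrightarrow> u' \<in> VV (tobj C X Y) Z \<Longrightarrow> io1 X Y Z (u + u') = io1 X Y Z u + io1 X Y Z u'"
    and io2_add: "w \<in> VV X (tobj C Y Z) \<Longrightarrow> w' \<in> VV X (tobj C Y Z) \<Longrightarrow> io2 X Y Z (w + w') = io2 X Y Z w + io2 X Y Z w'"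
    and Pt1_add: "t \<in> VL X Y Z \<Longrightarrow> t' \<in> VL X Y Z \<Longrightarrow> Pt1 X Y Z (t + t') = Pt1 X Y Z t + Pt1 X Y Z t'"
    and Pt2_add: "r \<in> VR X Y Z \<Longrightarrow> r' \<in> VR X Y Z \<Longrightarrow> Pt2 X Y Z (r + r') = Pt2 X Y Z r + Pt2 X Y Z r'"
  using io1_lin[OF assms] io2_lin[OF assms] Pt1_lin[OF assms] Pt2_lin[OF assms]
  by (auto simp: lin_on_def)

lemma reassoc_VL [simp]: "t \<in> VL X Y Z \<Longrightarrow> reassoc t \<in> VR X Y Z"
  by (rule reassoc_in) auto

lemma reassoc_sum: "reassoc (\<Sum>i\<in>I. f i) = (\<Sum>i\<in>I. reassoc (f i))" for f :: "'i \<Rightarrow> 'k seq"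
  by (rule lin_on_sum[OF reassoc_lin subspace_UNIV]) simp

lemma Pt_assoc:
  assumes X: "X \<in> obj C" "Y \<in> obj C" "Z \<in> obj C" and t: "t \<in> VL X Y Z"
  shows "Fm (tobj C (tobj C X Y) Z) (tobj C X (tobj C Y Z)) (associator C X Y Z) (Pt (tobj C X Y) Z (Pt1 X Y Z t))
    = Pt X (tobj C Y Z) (Pt2 X Y Z (reassoc t))"
  using t subspace_csp subspace_csp subspace_csp
  by (induction t rule: tens3_induct)
    (use X in \<open>simp_all add: reassoc_tens P_assoc reassoc_add Pt1_add Pt2_add Pt_add Fm_add\<close>)

lemma io1_io_P:
  assumes X: "X \<in> obj C" "Y \<in> obj C" "Z \<in> obj C" "x \<in> V X" "y \<in> V Y" "z \<in> V Z"
  shows "reassoc (io1 X Y Z (io (tobj C X Y) Z (P (tobj C X Y) Z (P X Y x y) z)))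
    = (\<Sum>i<N. \<Sum>j<N. tens (Rp j x) (tens (Rp i (Lp j y)) (Lp i z)))"
proof -
  have "io1 X Y Z (io (tobj C X Y) Z (P (tobj C X Y) Z (P X Y x y) z)) = io1 X Y Z (\<Sum>i<N. tens (P X Y x (Rp i y)) (Lp i z))"
    using X by (simp add: io_P P_Rp)
  also have "\<dots> = (\<Sum>i<N. io1 X Y Z (tens (P X Y x (Rp i y)) (Lp i z)))"
    by (rule lin_on_sum[OF io1_lin subspace_tens_space]) (use X in auto)
  also have "\<dots> = (\<Sum>i<N. \<Sum>j<N. tens (tens (Rp j x) (Lp j (Rp i y))) (Lp i z))"
    using X by (simp add: io_P tens_sum_left)
  finally show ?thesis using X by (simp add: reassoc_sum reassoc_tens Lp_Rp)
qed

lemma io2_io_P: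
  assumes X: "X \<in> obj C" "Y \<in> obj C" "Z \<in> obj C" "x \<in> V X" "y \<in> V Y" "z \<in> V Z"
  shows "io2 X Y Z (io X (tobj C Y Z) (P X (tobj C Y Z) x (P Y Z y z)))
    = (\<Sum>i<N. \<Sum>j<N. tens (Rp j x) (tens (Rp i (Lp j y)) (Lp i z)))"
proof -
  have "io2 X Y Z (io X (tobj C Y Z) (P X (tobj C Y Z) x (P Y Z y z))) = io2 X Y Z (\<Sum>j<N. tens (Rp j x) (P Y Z (Lp j y) z))"
    using X by (simp add: io_P P_Lp)
  also have "\<dots> = (\<Sum>j<N. io2 X Y Z (tens (Rp j x) (P Y Z (Lp j y) z)))"
    by (rule lin_on_sum[OF io2_lin subspace_tens_space]) (use X in auto)
  also have "\<dots> = (\<Sum>j<N. \<Sum>i<N. tens (Rp j x) (tens (Rp i (Lp j y)) (Lp i z)))"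
    using X by (simp add: io_P tens_sum_right)
  finally show ?thesis by (subst sum.swap)
qed

text \<open>On vectors of the form \<open>\<pi>(\<pi>(x \<otimes> y) \<otimes> z)\<close> both sides are
  \<open>\<Sum>\<^sub>i\<^sub>j x e\<^sub>j \<otimes> e\<^sub>j y e\<^sub>i \<otimes> e\<^sub>i z\<close>, and these vectors span.\<close>

lemma io_coassoc:
  assumes X: "X \<in> obj C" "Y \<in> obj C" "Z \<in> obj C" and z: "z \<in> V (tobj C (tobj C X Y) Z)"
  shows "reassoc (io1 X Y Z (io (tobj C X Y) Z z))
    = io2 X Y Z (io X (tobj C Y Z) (Fm (tobj C (tobj C X Y) Z) (tobj C X (tobj C Y Z)) (associator C X Y Z) z))"
  using tobj_in[OF X(1,2)] X(3) z
proof (induction z rule: P_induct)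
  case (P u w)
  from X(1,2) P(1) show ?case
  proof (induction u rule: P_induct)
    case (P x y)
    then show ?case using X \<open>w \<in> V Z\<close> by (simp add: io1_io_P io2_io_P P_assoc)
  next
    case (add u u')
    have "P (tobj C X Y) Z (u + u') w = P (tobj C X Y) Z u w + P (tobj C X Y) Z u' w"
      using X add P(2) lin_on_add[OF bilin_on_lin'[OF P_bilin]] by simp
    then show ?case using X add P(2) by (simp add: io_add io1_add io2_add Fm_add reassoc_add)
  qed
next
  case (add u u')
  then show ?case using X by (simp add: io_add io1_add io2_add Fm_add reassoc_add)
qed

abbreviation "A3 X Y Z \<equiv> actt HA HT (V X) (VV Y Z) (A X) (A2 Y Z)"
abbreviation "A3L X Y Z \<equiv> actt HT HA (VV X Y) (V Z) (A2 X Y) (A Z)"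
abbreviation "HR \<equiv> tens_space HA HT"
abbreviation "HL \<equiv> tens_space HT HA"

lemma A3_bilin: "\<lbrakk>X \<in> obj C; Y \<in> obj C; Z \<in> obj C\<rbrakk> \<Longrightarrow> bilin_on HR (VR X Y Z) (VR X Y Z) (A3 X Y Z)"
  by (rule actt_bilin[OF A_bil A2_bilin]) auto

lemma A3L_bilin: "\<lbrakk>X \<in> obj C; Y \<in> obj C; Z \<in> obj C\<rbrakk> \<Longrightarrow> bilin_on HL (VL X Y Z) (VL X Y Z) (A3L X Y Z)"
  by (rule actt_bilin[OF A2_bilin A_bil]) auto

lemma A3_tens [simp]: "\<lbrakk>X \<in> obj C; Y \<in> obj C; Z \<in> obj C; a \<in> HA; b \<in> HT; v \<in> V X; w \<in> VV Y Z\<rbrakk>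
    \<Longrightarrow> A3 X Y Z (tens a b) (tens v w) = tens (A X a v) (A2 Y Z b w)"
  by (rule actt_tens[OF A_bil A2_bilin]) auto

lemma A3L_tens [simp]: "\<lbrakk>X \<in> obj C; Y \<in> obj C; Z \<in> obj C; a \<in> HT; b \<in> HA; v \<in> VV X Y; w \<in> V Z\<rbrakk>
    \<Longrightarrow> A3L X Y Z (tens a b) (tens v w) = tens (A2 X Y a v) (A Z b w)"
  by (rule actt_tens[OF A2_bilin A_bil]) auto

lemma A3_simps:
  assumes "X \<in> obj C" "Y \<in> obj C" "Z \<in> obj C"
  shows "\<lbrakk>x \<in> HR; y \<in> HR; t \<in> VR X Y Z\<rbrakk> \<Longrightarrow> A3 X Y Z (x + y) t = A3 X Y Z x t + A3 X Y Z y t"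
    "\<lbrakk>x \<in> HR; s \<in> VR X Y Z; t \<in> VR X Y Z\<rbrakk> \<Longrightarrow> A3 X Y Z x (s + t) = A3 X Y Z x s + A3 X Y Z x t"
    "\<lbrakk>x' \<in> HL; y' \<in> HL; t' \<in> VL X Y Z\<rbrakk> \<Longrightarrow> A3L X Y Z (x' + y') t' = A3L X Y Z x' t' + A3L X Y Z y' t'"
    "\<lbrakk>x' \<in> HL; s' \<in> VL X Y Z; t' \<in> VL X Y Z\<rbrakk> \<Longrightarrow> A3L X Y Z x' (s' + t') = A3L X Y Z x' s' + A3L X Y Z x' t'"
  using A3_bilin[OF assms] A3L_bilin[OF assms] by (auto simp: bilin_on_def lin_on_def)

lemma reassoc_HL [simp]: "x \<in> HL \<Longrightarrow> reassoc x \<in> HR"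
  by (rule reassoc_in) auto

text \<open>The nested tensor products \<open>(H \<otimes> H) \<otimes> H\<close> and \<open>H \<otimes> (H \<otimes> H)\<close> are different spaces of sequences, and so are
  the spaces on which they act; both are reassociated together.\<close>

lemma A3_reassoc:
  assumes X: "X \<in> obj C" "Y \<in> obj C" "Z \<in> obj C" and x: "x \<in> HL" and t: "t \<in> VL X Y Z"
  shows "A3 X Y Z (reassoc x) (reassoc t) = reassoc (A3L X Y Z x t)"
  using x subspace_csp subspace_csp subspace_csp
proof (induction x rule: tens3_induct)
  case (tens a b c)
  from t subspace_csp subspace_csp subspace_csp show ?case
    by (induction t rule: tens3_induct)
      (use X tens in \<open>simp_all add: reassoc_tens reassoc_add A3_simps\<close>)
next
  case (add x y)
  then show ?case using X t by (simp add: reassoc_add A3_simps)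
qed

lemma HR_csp: "HR = csp (prod_encode ` (BH \<times> prod_encode ` (BH \<times> BH)))"
  unfolding HT_csp by (rule tens_space_csp) auto

lemma HR_eqI:
  assumes "x \<in> HR" "y \<in> HR"
    and eq: "\<And>X Y Z u v w. \<lbrakk>X \<in> obj C; Y \<in> obj C; Z \<in> obj C; u \<in> V X; v \<in> V Y; w \<in> V Z\<rbrakk>
      \<Longrightarrow> A3 X Y Z x (tens u (tens v w)) = A3 X Y Z y (tens u (tens v w))"
  shows "x = y"
proof
  fix m
  show "x m = y m"
  proof (cases "m \<in> prod_encode ` (BH \<times> prod_encode ` (BH \<times> BH))")
    case True
    then obtain a b c where m0: "m = prod_encode (a, prod_encode (b, c))" "a \<in> BH" "b \<in> BH" "c \<in> BH" by auto
    obtain r o' o'' where a: "a = enc3 r o' o''" "r < n" "o' \<in> B (S r)" "o'' \<in> B (S r)" using m0(2) by (auto simp: BH_def)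
    obtain s p q where b: "b = enc3 s p q" "s < n" "p \<in> B (S s)" "q \<in> B (S s)" using m0(3) by (auto simp: BH_def)
    obtain t p' q' where c: "c = enc3 t p' q'" "t < n" "p' \<in> B (S t)" "q' \<in> B (S t)" using m0(4) by (auto simp: BH_def)
    note m = m0(1)[unfolded a(1) b(1) c(1)] and rst = a(2-) b(2-) c(2-)
    have c: "z m = A3 (S r) (S s) (S t) z (tens (uv o'') (tens (uv q) (uv q'))) (prod_encode (o', prod_encode (p, p')))"
      if "z \<in> HR" for z
      unfolding m
    proof (rule actt_coef[OF A_bil A2_bilin, where v = "uv o''" and w = "tens (uv q) (uv q')"])
      show "x (enc3 r o' o'') = A (S r) x (uv o'') o'" for x by (rule HA_coef[OF rst(1-3)])
      show "x (prod_encode (enc3 s p q, enc3 t p' q')) = A2 (S s) (S t) x (tens (uv q) (uv q')) (prod_encode (p, p'))"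
        if "x \<in> HT" for x by (rule A2_coef[OF rst(4-9) that])
    qed (use rst that in simp_all)
    have "A3 (S r) (S s) (S t) x (tens (uv o'') (tens (uv q) (uv q'))) = A3 (S r) (S s) (S t) y (tens (uv o'') (tens (uv q) (uv q')))"
      by (rule eq) (use rst in auto)
    then show ?thesis unfolding c[OF assms(1)] c[OF assms(2)] by (rule arg_cong)
  next
    case False
    then show ?thesis using csp_zero[OF assms(1)[unfolded HR_csp]] csp_zero[OF assms(2)[unfolded HR_csp]] by simp
  qed
qed

subsection \<open>The axioms\<close>

text \<open>The counit \<open>\<epsilon>\<close>.\<close>

definition ep :: "'k seq \<Rightarrow> 'k" where
  "ep h = lam (A U h eta)"

abbreviation "H \<equiv> HH D ep"

lemma act2_A2: "act2 H (Md X) (Md Y) = A2 X Y"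
  by (simp add: act2_actt)

lemma mult2_H: "mult2 H = actt HA HA HA HA mu mu"
  by (simp add: mult2_def tens_mult_actt)

lemma mult3_H: "mult3 H = actt HA HT HA HT mu (mult2 H)"
  by (simp add: mult3_def tens_mult_actt)

lemma mult2_bilin: "bilin_on HT HT HT (mult2 H)"
  unfolding mult2_H by (rule actt_bilin[OF mu_bilin mu_bilin]) auto

lemma mult2_in [simp]: "x \<in> HT \<Longrightarrow> y \<in> HT \<Longrightarrow> mult2 H x y \<in> HT"
  using bilin_on_in[OF mult2_bilin] .

lemma A2_mult2 [simp]:
  assumes "X \<in> obj C" "Y \<in> obj C" "x \<in> HT" "y \<in> HT" "t \<in> VV X Y"
  shows "A2 X Y (mult2 H x y) t = A2 X Y x (A2 X Y y t)"
  unfolding mult2_H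
  by (rule actt_mult[OF A_bil A_bil mu_bilin mu_bilin]) (use assms in auto)

lemma mult3_in [simp]: "x \<in> HR \<Longrightarrow> y \<in> HR \<Longrightarrow> mult3 H x y \<in> HR"
  unfolding mult3_H by (rule bilin_on_in[OF actt_bilin[OF mu_bilin mult2_bilin]]) auto

lemma A3_mult3 [simp]:
  assumes "X \<in> obj C" "Y \<in> obj C" "Z \<in> obj C" "x \<in> HR" "y \<in> HR" "t \<in> VR X Y Z"
  shows "A3 X Y Z (mult3 H x y) t = A3 X Y Z x (A3 X Y Z y t)"
  unfolding mult3_H
  by (rule actt_mult[OF A_bil A2_bilin mu_bilin mult2_bilin]) (use assms in auto)

lemma D_mu: "D (mu g h) = mult2 H (D g) (D h)"
  by (rule HT_eqI) (simp_all add: A2_D)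

abbreviation "Dl \<equiv> tmap HA HA D (\<lambda>b. b)"
abbreviation "Dr \<equiv> tmap HA HA (\<lambda>a. a) D"

lemma Dl_lin: "lin_on HT HL Dl" and Dr_lin: "lin_on HT HR Dr"
  by (rule tmap_lin[OF D_lin lin_on_id] tmap_lin[OF lin_on_id D_lin]; simp)+

lemma Dl_in [simp]: "x \<in> HT \<Longrightarrow> Dl x \<in> HL" and Dr_in [simp]: "x \<in> HT \<Longrightarrow> Dr x \<in> HR"
  using lin_on_in[OF Dl_lin] lin_on_in[OF Dr_lin] by auto

lemma A3L_Dl:
  assumes X: "X \<in> obj C" "Y \<in> obj C" "Z \<in> obj C" and x: "x \<in> HT" and t: "t \<in> VL X Y Z"
  shows "A3L X Y Z (Dl x) t = io1 X Y Z (A2 (tobj C X Y) Z x (Pt1 X Y Z t))"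
  using x subspace_csp
proof (induction x rule: tens_induct)
  case (tens a b)
  from t subspace_tens_space show ?case
    by (induction t rule: tens_induct)
      (use X tens in \<open>simp_all add: A3_simps io1_add Pt1_add A2_simps A2_D tmap_tens[OF D_lin lin_on_id]\<close>)
next
  case (add x y)
  then show ?case using X t by (simp add: A3_simps io1_add A2_simps lin_on_add[OF Dl_lin])
qed simp

lemma A3_Dr:
  assumes X: "X \<in> obj C" "Y \<in> obj C" "Z \<in> obj C" and x: "x \<in> HT" and t: "t \<in> VR X Y Z"
  shows "A3 X Y Z (Dr x) t = io2 X Y Z (A2 X (tobj C Y Z) x (Pt2 X Y Z t))"
  using x subspace_csp
proof (induction x rule: tens_induct)
  case (tens a b)
  from t subspace_csp show ?case
    by (induction t rule: tens_induct)
      (use X tens in \<open>simp_all add: A3_simps io2_add Pt2_add A2_simps A2_D tmap_tens[OF lin_on_id D_lin]\<close>)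
next
  case (add x y)
  then show ?case using X t by (simp add: A3_simps io2_add A2_simps lin_on_add[OF Dr_lin])
qed simp

lemma comult_left_H: "comult_left H h = reassoc (Dl (D h))"
  by (simp add: comult_left_def)

lemma comult_right_H: "comult_right H h = Dr (D h)"
  by (simp add: comult_right_def)

lemma A3_comult_left:
  assumes X: "X \<in> obj C" "Y \<in> obj C" "Z \<in> obj C" and t: "t \<in> VL X Y Z"
  shows "A3 X Y Z (comult_left H h) (reassoc t)
    = reassoc (io1 X Y Z (io (tobj C X Y) Z (A (tobj C (tobj C X Y) Z) h (Pt (tobj C X Y) Z (Pt1 X Y Z t)))))"
  using X t by (simp add: comult_left_H A3_reassoc A3L_Dl A2_D)

text \<open>The two iterated comultiplications act on threefold tensor products by \<open>h\<close> on \<open>F((X \<otimes> Y) \<otimes> Z)\<close> and on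
  \<open>F(X \<otimes> (Y \<otimes> Z))\<close>, between threefold versions of \<open>\<pi>\<close> and \<open>\<iota>\<close>. The associator relates the two by
  coherence of \<open>\<pi>\<close> and \<open>\<iota>\<close>.\<close>

lemma coassoc_H: "comult_left H h = comult_right H h"
proof (rule HR_eqI)
  fix X Y Z and u v w :: "'k seq" assume X: "X \<in> obj C" "Y \<in> obj C" "Z \<in> obj C" "u \<in> V X" "v \<in> V Y" "w \<in> V Z"
  let ?t = "tens (tens u v) w"
  have "A3 X Y Z (comult_left H h) (reassoc ?t) = A3 X Y Z (comult_right H h) (reassoc ?t)"
    using X by (simp add: A3_comult_left comult_right_H A3_Dr A2_D io_coassoc flip: A_Fm)
      (simp add: reassoc_tens P_assoc)
  then show "A3 X Y Z (comult_left H h) (tens u (tens v w)) = A3 X Y Z (comult_right H h) (tens u (tens v w))"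
    by (simp add: reassoc_tens)
qed (simp_all add: comult_left_H comult_right_H)

lemma D_e1: "\<lbrakk>X \<in> obj C; Y \<in> obj C; x \<in> V X; y \<in> V Y\<rbrakk> \<Longrightarrow> A2 X Y (D e1) (tens x y) = (\<Sum>i<N. tens (Rp i x) (Lp i y))"
  by (simp add: A2_D io_P)

lemma A3_left_e1:
  assumes "X \<in> obj C" "Y \<in> obj C" "Z \<in> obj C" "u \<in> V X" "v \<in> V Y" "w \<in> V Z"
  shows "A3 X Y Z (reassoc (tens (D e1) e1)) (tens u (tens v w)) = (\<Sum>i<N. tens (Rp i u) (tens (Lp i v) w))"
proof -
  have "A3 X Y Z (reassoc (tens (D e1) e1)) (reassoc (tens (tens u v) w)) = reassoc (tens (\<Sum>i<N. tens (Rp i u) (Lp i v)) w)"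
    using assms by (subst A3_reassoc) (simp_all add: D_e1)
  then show ?thesis by (simp add: tens_sum_left reassoc_sum reassoc_tens)
qed

lemma A3_right_e1:
  assumes "X \<in> obj C" "Y \<in> obj C" "Z \<in> obj C" "u \<in> V X" "v \<in> V Y" "w \<in> V Z"
  shows "A3 X Y Z (tens e1 (D e1)) (tens u (tens v w)) = (\<Sum>i<N. tens u (tens (Rp i v) (Lp i w)))"
  using assms by (simp add: D_e1 tens_sum_right)

lemma A3_sum:
  assumes "X \<in> obj C" "Y \<in> obj C" "Z \<in> obj C" "x \<in> HR" "\<And>i. i \<in> I \<Longrightarrow> f i \<in> VR X Y Z"
  shows "A3 X Y Z x (\<Sum>i\<in>I. f i) = (\<Sum>i\<in>I. A3 X Y Z x (f i))"
  by (rule lin_on_sum[OF bilin_on_lin[OF A3_bilin]]) (use assms in auto)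

lemma A3_comult_left_e1:
  assumes X: "X \<in> obj C" "Y \<in> obj C" "Z \<in> obj C" "u \<in> V X" "v \<in> V Y" "w \<in> V Z"
  shows "A3 X Y Z (comult_left H e1) (tens u (tens v w)) = (\<Sum>i<N. \<Sum>j<N. tens (Rp j u) (tens (Rp i (Lp j v)) (Lp i w)))"
  using A3_comult_left[of X Y Z "tens (tens u v) w" e1] X by (simp add: io1_io_P reassoc_tens)

text \<open>The iterated comultiplication of \<open>1\<close> and both products of \<open>\<Delta>(1) \<otimes> 1\<close> and \<open>1 \<otimes> \<Delta>(1)\<close> act by the bimodule idempotents,
  \<open>u \<otimes> v \<otimes> w \<mapsto> \<Sum>\<^sub>i\<^sub>j u e\<^sub>j \<otimes> e\<^sub>j v e\<^sub>i \<otimes> e\<^sub>i w\<close>; the order of the factors does not matter because left and right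
  actions commute.\<close>

lemma comult_one_H: "comult_left H e1 = mult3 H (reassoc (tens (D e1) e1)) (tens e1 (D e1))"
proof (rule HR_eqI)
  fix X Y Z and u v w :: "'k seq" assume X: "X \<in> obj C" "Y \<in> obj C" "Z \<in> obj C" "u \<in> V X" "v \<in> V Y" "w \<in> V Z"
  have "A3 X Y Z (mult3 H (reassoc (tens (D e1) e1)) (tens e1 (D e1))) (tens u (tens v w))
     = A3 X Y Z (reassoc (tens (D e1) e1)) (\<Sum>i<N. tens u (tens (Rp i v) (Lp i w)))"
    using X A3_right_e1[OF X] by simp
  also have "\<dots> = (\<Sum>i<N. A3 X Y Z (reassoc (tens (D e1) e1)) (tens u (tens (Rp i v) (Lp i w))))"
    by (rule A3_sum) (use X in auto)
  also have "\<dots> = (\<Sum>i<N. \<Sum>j<N. tens (Rp j u) (tens (Rp i (Lp j v)) (Lp i w)))"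
    using X by (simp add: A3_left_e1 Lp_Rp)
  finally show "A3 X Y Z (comult_left H e1) (tens u (tens v w))
     = A3 X Y Z (mult3 H (reassoc (tens (D e1) e1)) (tens e1 (D e1))) (tens u (tens v w))"
    using A3_comult_left_e1[OF X] by simp
qed (simp_all add: comult_left_H)

lemma comult_one_H': "comult_left H e1 = mult3 H (tens e1 (D e1)) (reassoc (tens (D e1) e1))"
proof (rule HR_eqI)
  fix X Y Z and u v w :: "'k seq" assume X: "X \<in> obj C" "Y \<in> obj C" "Z \<in> obj C" "u \<in> V X" "v \<in> V Y" "w \<in> V Z"
  have "A3 X Y Z (mult3 H (tens e1 (D e1)) (reassoc (tens (D e1) e1))) (tens u (tens v w))
     = A3 X Y Z (tens e1 (D e1)) (\<Sum>j<N. tens (Rp j u) (tens (Lp j v) w))"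
    using X A3_left_e1[OF X] by simp
  also have "\<dots> = (\<Sum>j<N. A3 X Y Z (tens e1 (D e1)) (tens (Rp j u) (tens (Lp j v) w)))"
    by (rule A3_sum) (use X in auto)
  also have "\<dots> = (\<Sum>j<N. \<Sum>i<N. tens (Rp j u) (tens (Rp i (Lp j v)) (Lp i w)))"
    using X by (simp add: A3_right_e1 del: A3_tens)
  also have "\<dots> = (\<Sum>i<N. \<Sum>j<N. tens (Rp j u) (tens (Rp i (Lp j v)) (Lp i w)))" by (rule sum.swap)
  finally show "A3 X Y Z (comult_left H e1) (tens u (tens v w))
     = A3 X Y Z (mult3 H (tens e1 (D e1)) (reassoc (tens (D e1) e1))) (tens u (tens v w))"
    using A3_comult_left_e1[OF X] by simp
qed (simp_all add: comult_left_H)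

end

text \<open>Linear forms, with values in the field and not in a space of sequences.\<close>

definition linf :: "'k::field seq set \<Rightarrow> ('k seq \<Rightarrow> 'k) \<Rightarrow> bool" where
  "linf E f \<longleftrightarrow> (\<forall>x\<in>E. \<forall>y\<in>E. f (x + y) = f x + f y) \<and> (\<forall>c. \<forall>x\<in>E. f (vscale c x) = c * f x)"

lemma bil_linf:
  assumes "linf E f" "linf F g" "vec.subspace E" "vec.subspace F"
  shows "bil E F (\<lambda>u v. f u * g v)"
  using assms by (auto simp: bil_def linf_def algebra_simps)

lemma bilin_linf:
  assumes "linf E f" "vec.subspace F"
  shows "bilin_on E F F (\<lambda>u v. vscale (f u) v)" "bilin_on F E F (\<lambda>v u. vscale (f u) v)"
  using assms by (auto simp: bilin_on_def lin_on_def linf_def vscale_add vscale_add_left mult_ac vec.subspace_scale)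

context frobenius_fibre_functor
begin

lemma lam_linf [simp]: "linf (V U) lam"
  by (auto simp: linf_def lam_add lam_scale)

lemma linf_A: "f \<in> HA \<Longrightarrow> linf (V U) (\<lambda>u. lam (A U f u))" "w \<in> V U \<Longrightarrow> linf HA (\<lambda>a. lam (A U a w))"
  by (auto simp: linf_def A_simps lam_add lam_scale)

lemma linf_A2: "linf (V U) f \<Longrightarrow> w \<in> V U \<Longrightarrow> linf HA (\<lambda>a. f (A U a w))"
  by (auto simp: linf_def A_simps)

lemma linf_sum:
  assumes "linf E f" "vec.subspace E" "\<And>i. i \<in> I \<Longrightarrow> g i \<in> E"
  shows "f (\<Sum>i\<in>I. g i) = (\<Sum>i\<in>I. f (g i))"
proof -
  have f0: "f 0 = 0"
    using assms(1)[unfolded linf_def, THEN conjunct2, THEN spec, THEN bspec, OF vec.subspace_0[OF assms(2)], of 0] by simp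
  show ?thesis using assms(3)
proof (induction I rule: infinite_finite_induct)
  case (insert x F)
  have "sum g F \<in> E" using insert assms(2) by (auto intro: vec.subspace_sum)
  then have "f (g x + sum g F) = f (g x) + f (sum g F)" using assms(1) insert by (auto simp: linf_def)
  then show ?case using insert by (simp add: sum.insert)
qed (use f0 in auto)
qed

abbreviation "LL Y \<equiv> tens_lift (V U) (V Y) (\<lambda>u v. vscale (lam u) v)"
abbreviation "RR Y \<equiv> tens_lift (V Y) (V U) (\<lambda>v u. vscale (lam u) v)"

lemma LL_lin: "lin_on (VV U Y) (V Y) (LL Y)" and RR_lin: "lin_on (VV Y U) (V Y) (RR Y)"
  by (rule lin_tens_lift[OF bilin_linf(1)] lin_tens_lift[OF bilin_linf(2)]; simp)+

lemma LL_tens [simp]: "\<lbrakk>u \<in> V U; y \<in> V Y\<rbrakk> \<Longrightarrow> LL Y (tens u y) = vscale (lam u) y"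
  and RR_tens [simp]: "\<lbrakk>u \<in> V U; y \<in> V Y\<rbrakk> \<Longrightarrow> RR Y (tens y u) = vscale (lam u) y"
  by (rule tens_lift_tens[OF bilin_on_bil[OF bilin_linf(1)]] tens_lift_tens[OF bilin_on_bil[OF bilin_linf(2)]]; simp)+

text \<open>Contracting \<open>\<iota>\<close> with \<open>\<lambda>\<close> in the first factor yields the left unit constraint: on \<open>\<pi>(u \<otimes> y)\<close> it gives
  \<open>\<Sum>\<^sub>i \<lambda>(u e\<^sub>i) e\<^sub>i y\<close>.\<close>

lemma LL_io:
  assumes Y: "Y \<in> obj C" and z: "z \<in> V (tobj C U Y)"
  shows "LL Y (io U Y z) = Fm (tobj C U Y) Y (lunit C Y) z"
  using unit_obj_in Y z
proof (induction z rule: P_induct)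
  case (P x y)
  have "LL Y (\<Sum>i<N. tens (Rp i x) (Lp i y)) = (\<Sum>i<N. LL Y (tens (Rp i x) (Lp i y)))"
    by (rule lin_on_sum[OF LL_lin]) (use P Y in auto)
  then show ?case using P Y by (simp add: io_P lunit_P)
next
  case (add u w)
  then show ?case using Y by (simp add: io_add Fm_add lin_on_add[OF LL_lin])
qed

lemma RR_io:
  assumes Y: "Y \<in> obj C" and z: "z \<in> V (tobj C Y U)"
  shows "RR Y (io Y U z) = Fm (tobj C Y U) Y (runit C Y) z"
  using Y unit_obj_in z
proof (induction z rule: P_induct)
  case (P y x)
  have "RR Y (\<Sum>i<N. tens (Rp i y) (Lp i x)) = (\<Sum>i<N. RR Y (tens (Rp i y) (Lp i x)))"
    by (rule lin_on_sum[OF RR_lin]) (use P Y in auto)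
  then show ?case using P Y by (simp add: io_P runit_P)
next
  case (add u w)
  then show ?case using Y by (simp add: io_add Fm_add lin_on_add[OF RR_lin])
qed

text \<open>Contraction of one leg of an element of \<open>H \<otimes> H\<close> with the functional \<open>a \<mapsto> \<lambda>(a w)\<close>; for \<open>w = \<eta>\<close> this is the
  counit, and the counit axioms follow from the unit constraints on \<open>\<eta>\<close>.\<close>

abbreviation "cl w \<equiv> tens_lift HA HA (\<lambda>a b. vscale (lam (A U a w)) b)"
abbreviation "cr w \<equiv> tens_lift HA HA (\<lambda>a b. vscale (lam (A U b w)) a)"

lemma cl_lin: "w \<in> V U \<Longrightarrow> lin_on HT HA (cl w)" and cr_lin: "w \<in> V U \<Longrightarrow> lin_on HT HA (cr w)"
  by (rule lin_tens_lift[OF bilin_linf(1)[OF linf_A(2)]] lin_tens_lift[OF bilin_linf(2)[OF linf_A(2)]]; simp)+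

lemma cl_in [simp]: "w \<in> V U \<Longrightarrow> x \<in> HT \<Longrightarrow> cl w x \<in> HA" and cr_in [simp]: "w \<in> V U \<Longrightarrow> x \<in> HT \<Longrightarrow> cr w x \<in> HA"
  using lin_on_in[OF cl_lin] lin_on_in[OF cr_lin] by auto

lemma cl_tens [simp]: "\<lbrakk>w \<in> V U; a \<in> HA; b \<in> HA\<rbrakk> \<Longrightarrow> cl w (tens a b) = vscale (lam (A U a w)) b"
  and cr_tens [simp]: "\<lbrakk>w \<in> V U; a \<in> HA; b \<in> HA\<rbrakk> \<Longrightarrow> cr w (tens a b) = vscale (lam (A U b w)) a"
  by (rule tens_lift_tens[OF bilin_on_bil[OF bilin_linf(1)[OF linf_A(2)]]]
    tens_lift_tens[OF bilin_on_bil[OF bilin_linf(2)[OF linf_A(2)]]]; simp)+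

lemma A_cl:
  assumes "w \<in> V U" "Y \<in> obj C" "y \<in> V Y" "x \<in> HT"
  shows "A Y (cl w x) y = LL Y (A2 U Y x (tens w y))"
  using assms(4) subspace_csp
proof (induction x rule: tens_induct)
  case (add s t)
  then show ?case using assms
    by (simp add: lin_on_add[OF cl_lin] A_simps A2_simps lin_on_add[OF LL_lin])
qed (use assms in \<open>simp_all add: A_simps\<close>)

lemma A_cr:
  assumes "w \<in> V U" "Y \<in> obj C" "y \<in> V Y" "x \<in> HT"
  shows "A Y (cr w x) y = RR Y (A2 Y U x (tens y w))"
  using assms(4) subspace_csp
proof (induction x rule: tens_induct)
  case (add s t)
  then show ?case using assms
    by (simp add: lin_on_add[OF cr_lin] A_simps A2_simps lin_on_add[OF RR_lin])
qed (use assms in \<open>simp_all add: A_simps\<close>)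

lemma counit_left_H: "h \<in> HA \<Longrightarrow> cl eta (D h) = h"
  by (rule alg_eqI') (simp_all add: A_cl A2_D LL_io lunit_eta flip: A_Fm)

lemma counit_right_H: "h \<in> HA \<Longrightarrow> cr eta (D h) = h"
  by (rule alg_eqI') (simp_all add: A_cr A2_D RR_io runit_eta flip: A_Fm)

abbreviation "pr f g \<equiv> tens_lift (V U) (V U) (\<lambda>u v. f u * g v)"

lemma pr_tens: "\<lbrakk>linf (V U) f; linf (V U) g; u \<in> V U; v \<in> V U\<rbrakk> \<Longrightarrow> pr f g (tens u v) = f u * g v"
  by (rule tens_lift_tens[OF bil_linf]) auto

lemma pr_add: "\<lbrakk>linf (V U) f; linf (V U) g; s \<in> VV U U; t \<in> VV U U\<rbrakk> \<Longrightarrow> pr f g (s + t) = pr f g s + pr f g t"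
  by (rule tens_lift_add[OF bil_linf]) auto

lemma pr_0: "\<lbrakk>linf (V U) f; linf (V U) g\<rbrakk> \<Longrightarrow> pr f g 0 = 0"
  for f g :: "'k seq \<Rightarrow> 'k"
  using pr_add[of f g 0 0] by (simp only: add_0_left tens_space_closed(3) add_cancel_right_right)

lemma pr_sum:
  assumes fg: "linf (V U) f" "linf (V U) g" and t: "\<And>i. i \<in> I \<Longrightarrow> t i \<in> VV U U"
  shows "pr f g (\<Sum>i\<in>I. t i) = (\<Sum>i\<in>I. pr f g (t i))"
  using t
proof (induction I rule: infinite_finite_induct)
  case (insert x F)
  have "sum t F \<in> VV U U" by (rule tens_space_sum) (use insert in auto)
  then have "pr f g (t x + sum t F) = pr f g (t x) + pr f g (sum t F)" using pr_add[OF fg] insert by simp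
  then show ?case using insert by (simp add: sum.insert)
qed (auto simp: pr_0[OF fg])

lemma lift_pr:
  assumes fg: "linf (V U) f" "linf (V U) g" and uw: "u \<in> V U" "w \<in> V U" and x: "x \<in> HT"
  shows "tens_lift HA HA (\<lambda>a b. f (A U a u) * g (A U b w)) x = pr f g (A2 U U x (tens u w))"
proof -
  note b = bil_linf[OF linf_A2[OF fg(1) uw(1)] linf_A2[OF fg(2) uw(2)] subspace_csp subspace_csp]
  from x subspace_csp show ?thesis
  proof (induction x rule: tens_induct)
    case (tens a b)
    then show ?case using uw fg by (simp add: tens_lift_tens[OF b] pr_tens)
  next
    case (add s t)
    then show ?case using uw fg by (simp add: tens_lift_add[OF b] A2_simps pr_add)
  qed simp
qed

text \<open>The form \<open>\<lambda>(f -) \<otimes> \<lambda>\<close> on \<open>F(\<one>) \<otimes> F(\<one>)\<close>, pulled back along \<open>\<iota>\<close>, is \<open>\<lambda>(f -)\<close> on \<open>F(\<one> \<otimes> \<one>) \<cong> F(\<one>)\<close>.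
  Applied to \<open>\<Delta>(g) = \<iota> g \<pi>\<close> this is the weak multiplicativity of the counit.\<close>

lemma pr_io_r:
  assumes f: "f \<in> HA" and z: "z \<in> V (tobj C U U)"
  shows "pr (\<lambda>u. lam (A U f u)) lam (io U U z) = lam (A U f (Fm (tobj C U U) U (runit C U) z))"
  using unit_obj_in unit_obj_in z
proof (induction z rule: P_induct)
  case (P x y)
  have "pr (\<lambda>u. lam (A U f u)) lam (\<Sum>i<N. tens (Rp i x) (Lp i y)) = (\<Sum>i<N. lam (A U f (Rp i x)) * lam (Lp i y))"
    by (subst pr_sum) (use P f in \<open>auto simp: pr_tens linf_A\<close>)
  also have "\<dots> = (\<Sum>i<N. lam (A U f (vscale (lam (Lp i y)) (Rp i x))))"
    using P by (simp add: A_simps lam_scale mult.commute)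
  also have "\<dots> = lam (A U f (\<Sum>i<N. vscale (lam (Lp i y)) (Rp i x)))"
    by (rule linf_sum[OF linf_A(1)[OF f] subspace_csp, symmetric]) (use P in simp)
  finally show ?case using P by (simp add: io_P runit_P)
next
  case (add u w)
  then show ?case using f by (simp add: io_add Fm_add A_simps lam_add pr_add linf_A)
qed

lemma pr_io_l:
  assumes f: "f \<in> HA" and z: "z \<in> V (tobj C U U)"
  shows "pr lam (\<lambda>u. lam (A U f u)) (io U U z) = lam (A U f (Fm (tobj C U U) U (lunit C U) z))"
  using unit_obj_in unit_obj_in z
proof (induction z rule: P_induct)
  case (P x y)
  have "pr lam (\<lambda>u. lam (A U f u)) (\<Sum>i<N. tens (Rp i x) (Lp i y)) = (\<Sum>i<N. lam (Rp i x) * lam (A U f (Lp i y)))"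
    by (subst pr_sum) (use P f in \<open>auto simp: pr_tens linf_A\<close>)
  also have "\<dots> = (\<Sum>i<N. lam (A U f (vscale (lam (Rp i x)) (Lp i y))))"
    using P by (simp add: A_simps lam_scale)
  also have "\<dots> = lam (A U f (\<Sum>i<N. vscale (lam (Rp i x)) (Lp i y)))"
    by (rule linf_sum[OF linf_A(1)[OF f] subspace_csp, symmetric]) (use P in simp)
  finally show ?case using P by (simp add: io_P lunit_P)
next
  case (add u w)
  then show ?case using f by (simp add: io_add Fm_add A_simps lam_add pr_add linf_A)
qed

lemma ep_mu: "ep (mu g h) = lam (A U g (A U h eta))"
  by (simp add: ep_def)

text \<open>Contracting \<open>\<Delta>(g) = \<iota> g \<pi>\<close> on one side yields one unit constraint of \<open>\<one> \<otimes> \<one>\<close>, while the vector \<open>\<eta>\<close> on the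
  other side is absorbed by the other one; the two constraints agree by \<open>lunit_unit_eq_runit\<close>.\<close>

lemma counit_mult_H:
  assumes "f \<in> HA" "g \<in> HA" "h \<in> HA"
  shows "ep (mu (mu f g) h) = tens_lift HA HA (\<lambda>a b. ep (mu f a) * ep (mu b h)) (D g)"
proof -
  have "tens_lift HA HA (\<lambda>a b. ep (mu f a) * ep (mu b h)) (D g)
      = pr (\<lambda>u. lam (A U f u)) lam (A2 U U (D g) (tens eta (A U h eta)))"
    unfolding ep_mu by (rule lift_pr) (use assms in \<open>auto simp: linf_A\<close>)
  also have "\<dots> = lam (A U f (A U g (Fm (tobj C U U) U (lunit C U) (P U U eta (A U h eta)))))"
    using assms by (simp add: A2_D pr_io_r lunit_unit_eq_runit flip: A_Fm)
  finally show ?thesis using assms by (simp add: ep_def lunit_eta)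
qed

lemma counit_mult_H':
  assumes "f \<in> HA" "g \<in> HA" "h \<in> HA"
  shows "ep (mu (mu f g) h) = tens_lift HA HA (\<lambda>a b. ep (mu f b) * ep (mu a h)) (D g)"
proof -
  have "tens_lift HA HA (\<lambda>a b. ep (mu f b) * ep (mu a h)) (D g)
      = tens_lift HA HA (\<lambda>a b. lam (A U a (A U h eta)) * lam (A U f (A U b eta))) (D g)"
    by (simp add: ep_mu mult.commute)
  also have "\<dots> = pr lam (\<lambda>u. lam (A U f u)) (A2 U U (D g) (tens (A U h eta) eta))"
    by (rule lift_pr) (use assms in \<open>auto simp: linf_A\<close>)
  also have "\<dots> = lam (A U f (A U g (Fm (tobj C U U) U (runit C U) (P U U (A U h eta) eta))))"
    using assms by (simp add: A2_D pr_io_l lunit_unit_eq_runit flip: A_Fm)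
  finally show ?thesis using assms by (simp add: ep_def runit_eta)
qed

lemma weak_bialgebra_H: "weak_bialgebra H"
proof
  show "fin_dim (carr H)" by (simp add: fin_dim_csp)
  show "bilin_on (carr H) (carr H) (carr H) (mult H)" using mu_bilin by simp
  show "lin_on (carr H) (tens_space (carr H) (carr H)) (comult H)" using D_lin by simp
  show "comult_left H (one H) = mult3 H (reassoc (tens (comult H (one H)) (one H))) (tens (one H) (comult H (one H)))"
    using comult_one_H by simp
  show "comult_left H (one H) = mult3 H (tens (one H) (comult H (one H))) (reassoc (tens (comult H (one H)) (one H)))"
    using comult_one_H' by simp
  fix f g h assume fgh: "f \<in> carr H" "g \<in> carr H" "h \<in> carr H"
  show "counit H (mult H (mult H f g) h)
    = tens_lift (carr H) (carr H) (\<lambda>a b. counit H (mult H f a) * counit H (mult H b h)) (comult H g)"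
    using counit_mult_H fgh by simp
  show "counit H (mult H (mult H f g) h)
    = tens_lift (carr H) (carr H) (\<lambda>a b. counit H (mult H f b) * counit H (mult H a h)) (comult H g)"
    using counit_mult_H' fgh by simp
next
  fix h assume "h \<in> carr H"
  then have h: "h \<in> HA" by simp
  show "tens_lift (carr H) (carr H) (\<lambda>a b. vscale (counit H a) b) (comult H h) = h"
    using counit_left_H[OF h] by (simp add: ep_def)
  show "tens_lift (carr H) (carr H) (\<lambda>a b. vscale (counit H b) a) (comult H h) = h"
    using counit_right_H[OF h] by (simp add: ep_def)
qed (simp_all add: mu_assoc ep_def A_simps lam_add lam_scale coassoc_H D_mu)

subsection \<open>The base\<close>

text \<open>The left action of \<open>F(\<one>)\<close> on \<open>F(Y)\<close> through \<open>F(\<one>) \<otimes> F(Y) \<rightarrow> F(\<one> \<otimes> Y) \<cong> F(Y)\<close>. It is natural in \<open>Y\<close>, hence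
  given by elements of \<open>H\<close>, and these turn out to form the base.\<close>

definition Z :: "'k seq \<Rightarrow> 'k seq" where
  "Z x = mat (\<lambda>s y. Fm (tobj C U (S s)) (S s) (lunit C (S s)) (P U (S s) x y))"

lemma Z_in [simp]: "Z x \<in> HA"
  by (simp add: Z_def)

lemma A_Z:
  assumes x: "x \<in> V U" and Y: "Y \<in> obj C" "y \<in> V Y"
  shows "A Y (Z x) y = Fm (tobj C U Y) Y (lunit C Y) (P U Y x y)"
  unfolding Z_def
proof (rule A_mat[where T = "\<lambda>Y y. Fm (tobj C U Y) Y (lunit C Y) (P U Y x y)", OF _ _ Y])
  show "lin_on (V X) (V X) (\<lambda>y. Fm (tobj C U X) X (lunit C X) (P U X x y))" if "X \<in> obj C" for X
    by (rule lin_on_cmp[OF bilin_on_lin[OF P_bilin] Fm_lin]) (use x that in auto)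
  show "Fm (tobj C U Y) Y (lunit C Y) (P U Y x (Fm X Y f v)) = Fm X Y f (Fm (tobj C U X) X (lunit C X) (P U X x v))"
    if f: "X \<in> obj C" "Y \<in> obj C" "f \<in> hom C X Y" "v \<in> V X" for X Y f v
  proof -
    have "P U Y x (Fm X Y f v) = Fm (tobj C U X) (tobj C U Y) (tmor C U U X Y (ident C U) f) (P U X x v)"
      using P_nat[of U U X Y "ident C U" f x v] f x by simp
    then show ?thesis using f x by (simp add: lunit_natural flip: Fm_cmp)
  qed
qed

lemma Z_lin: "lin_on (V U) HA Z"
proof (rule lin_onI)
  have l: "lin_on (V U) (V Y) (\<lambda>x. Fm (tobj C U Y) Y (lunit C Y) (P U Y x y))" if "Y \<in> obj C" "y \<in> V Y" for Y y
    by (rule lin_on_cmp[OF bilin_on_lin'[OF P_bilin] Fm_lin]) (use that in auto)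
  show "Z (x + y) = Z x + Z y" if "x \<in> V U" "y \<in> V U" for x y
    by (rule alg_eqI') (use that in \<open>auto simp: A_Z A_simps lin_on_add[OF l]\<close>)
  show "Z (vscale c x) = vscale c (Z x)" if "x \<in> V U" for x c
    by (rule alg_eqI') (use that in \<open>auto simp: A_Z A_simps lin_on_scale[OF l]\<close>)
qed simp

lemma Z_eta [simp]: "x \<in> V U \<Longrightarrow> A U (Z x) eta = x"
  by (simp add: A_Z lunit_unit_eq_runit runit_eta)

lemma eps_t_Z: "eps_t H h = Z (A U h eta)"
proof -
  have "eps_t H h = cl (A U h eta) (D e1)" by (simp add: eps_t_def ep_mu)
  also have "\<dots> = Z (A U h eta)"
    by (rule alg_eqI') (simp_all add: A_cl A2_D LL_io A_Z)
  finally show ?thesis .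
qed

lemma base_Z: "base H = Z ` V U"
proof
  show "base H \<subseteq> Z ` V U" by (auto simp: base_def eps_t_Z)
  show "Z ` V U \<subseteq> base H"
  proof safe
    fix x :: "'k seq" assume "x \<in> V U"
    then have "Z x = eps_t H (Z x)" by (simp add: eps_t_Z)
    then show "Z x \<in> base H" unfolding base_def by (simp only: image_eqI[OF _ Z_in] HH_sel)
  qed
qed

lemma ep_Z: "x \<in> V U \<Longrightarrow> ep (Z x) = lam x"
  by (simp add: ep_def)

text \<open>\<open>Z x\<close> acts as \<open>\<Sum>\<^sub>i \<lambda>(x e\<^sub>i) e\<^sub>i\<close>, a linear combination of the left actions of the idempotents, which
  commute.\<close>

lemma commutative_base_H: "commutative_base H"
proof -
  have "mu (Z x) (Z x') = mu (Z x') (Z x)" if x: "x \<in> V U" "x' \<in> V U" for x x'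
  proof (rule alg_eqI')
    fix Y y assume Y: "Y \<in> obj C" "y \<in> V Y"
    have *: "A Y (mu (Z x) (Z x')) y = (\<Sum>i<N. \<Sum>j<N. vscale (lam (Rp i x) * lam (Rp j x')) (Lp i (Lp j y)))"
      if x: "x \<in> V U" "x' \<in> V U" for x x'
    proof -
      have m: "(\<Sum>j<N. vscale (lam (Rp j x')) (Lp j y)) \<in> V Y" by (rule V_closed(4)) (use Y in simp)
      have "Lp i (\<Sum>j<N. vscale (lam (Rp j x')) (Lp j y)) = (\<Sum>j<N. vscale (lam (Rp j x')) (Lp i (Lp j y)))" for i
        by (subst lin_on_sum[OF Lp_lin subspace_csp]) (use Y in \<open>auto simp: lin_on_scale[OF Lp_lin]\<close>)
      then show ?thesis using x Y m by (simp add: A_Z lunit_P vscale_sum)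
    qed
    show "A Y (mu (Z x) (Z x')) y = A Y (mu (Z x') (Z x)) y"
      unfolding *[OF x] *[OF x(2,1)]
      by (subst sum.swap) (use Y in \<open>simp add: Lp_Lp mult.commute\<close>)
  qed auto
  then show ?thesis by (auto simp: commutative_base_def base_Z)
qed

end

section \<open>The module category is monoidal\<close>

context frobenius_fibre_functor
begin

abbreviation "TT Q Q' \<equiv> tens_space (mcarr Q) (mcarr Q')"
abbreviation "hm \<equiv> is_hmod H"
abbreviation "ten \<equiv> hmod_tensor H"

lemma hmD:
  assumes "hm Q"
  shows "vec.subspace (mcarr Q)" "bilin_on HA (mcarr Q) (mcarr Q) (act Q)"
  using is_hmodD[OF assms] by auto

lemma act2_actt_H: "act2 H Q Q' = actt HA HA (mcarr Q) (mcarr Q') (act Q) (act Q')"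
  by (simp add: act2_actt)

lemma act2_bilin: "hm Q \<Longrightarrow> hm Q' \<Longrightarrow> bilin_on HT (TT Q Q') (TT Q Q') (act2 H Q Q')"
  unfolding act2_actt_H by (rule actt_bilin) (auto intro: hmD)

lemma act2_in: "hm Q \<Longrightarrow> hm Q' \<Longrightarrow> x \<in> HT \<Longrightarrow> t \<in> TT Q Q' \<Longrightarrow> act2 H Q Q' x t \<in> TT Q Q'"
  using bilin_on_in[OF act2_bilin] .

lemma act2_tens: "\<lbrakk>hm Q; hm Q'; a \<in> HA; b \<in> HA; v \<in> mcarr Q; w \<in> mcarr Q'\<rbrakk>
    \<Longrightarrow> act2 H Q Q' (tens a b) (tens v w) = tens (act Q a v) (act Q' b w)"
  unfolding act2_actt_H by (rule actt_tens) (auto intro: hmD)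

lemma act2_add:
  assumes "hm Q" "hm Q'"
  shows "\<lbrakk>x \<in> HT; y \<in> HT; t \<in> TT Q Q'\<rbrakk> \<Longrightarrow> act2 H Q Q' (x + y) t = act2 H Q Q' x t + act2 H Q Q' y t"
    "\<lbrakk>x \<in> HT; s \<in> TT Q Q'; t \<in> TT Q Q'\<rbrakk> \<Longrightarrow> act2 H Q Q' x (s + t) = act2 H Q Q' x s + act2 H Q Q' x t"
  using act2_bilin[OF assms] by (auto simp: bilin_on_def lin_on_def)

lemma ten_sel [simp]: "mcarr (ten Q Q') = act2 H Q Q' (D e1) ` TT Q Q'" "act (ten Q Q') h = act2 H Q Q' (D h)"
  by (simp_all add: hmod_tensor_def)

declare ten_sel(1) [simp del]

lemma ten_sub: "hm Q \<Longrightarrow> hm Q' \<Longrightarrow> mcarr (ten Q Q') \<subseteq> TT Q Q'"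
  by (auto simp: ten_sel(1) act2_in)

text \<open>Intertwiners, considered on the carriers only; they become homomorphisms by extension by zero.\<close>

definition itw :: "'k hmod \<Rightarrow> 'k hmod \<Rightarrow> ('k seq \<Rightarrow> 'k seq) \<Rightarrow> bool" where
  "itw Q G f \<longleftrightarrow> lin_on (mcarr Q) (mcarr G) f \<and> (\<forall>h\<in>HA. \<forall>v\<in>mcarr Q. f (act Q h v) = act G h (f v))"

lemma hom_itw: "f \<in> hmod_hom H Q G \<Longrightarrow> itw Q G f"
  by (auto simp: hmod_hom_def itw_def)

lemma itw_hom: "hm Q \<Longrightarrow> itw Q G f \<Longrightarrow> zero_ext (mcarr Q) f \<in> hmod_hom H Q G"
  by (auto simp: hmod_hom_def itw_def hmD is_hmodD)

lemma itwD:
  assumes "itw Q G f"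
  shows "lin_on (mcarr Q) (mcarr G) f" "v \<in> mcarr Q \<Longrightarrow> f v \<in> mcarr G"
    "h \<in> HA \<Longrightarrow> v \<in> mcarr Q \<Longrightarrow> f (act Q h v) = act G h (f v)"
  using assms lin_on_in by (auto simp: itw_def)

abbreviation "tm Q Q' f g \<equiv> tmap (mcarr Q) (mcarr Q') f g"

context
  fixes Q Q' G G' f g
  assumes Q: "hm Q" "hm Q'" "hm G" "hm G'" and fg: "itw Q G f" "itw Q' G' g"
begin

lemma tm_lin: "lin_on (TT Q Q') (TT G G') (tm Q Q' f g)"
  by (rule tmap_lin) (use Q fg in \<open>auto intro: itwD hmD\<close>)

lemma tm_tens: "v \<in> mcarr Q \<Longrightarrow> w \<in> mcarr Q' \<Longrightarrow> tm Q Q' f g (tens v w) = tens (f v) (g w)"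
  by (rule tmap_tens) (use Q fg in \<open>auto intro: itwD hmD\<close>)

lemma tm_act2:
  assumes "x \<in> HT" "t \<in> TT Q Q'"
  shows "tm Q Q' f g (act2 H Q Q' x t) = act2 H G G' x (tm Q Q' f g t)"
  using assms(1) subspace_csp
proof (induction x rule: tens_induct)
  case (tens a b)
  from assms(2) hmD(1)[OF Q(1)] show ?case
    by (induction t rule: tens_induct)
      (use Q tens fg in \<open>simp_all add: act2_tens tm_tens itwD is_hmodD act2_add act2_in lin_on_add[OF tm_lin] lin_on_in[OF tm_lin] hmD\<close>)
next
  case (add x y)
  then show ?case using assms Q
    by (simp add: act2_add act2_in lin_on_add[OF tm_lin] lin_on_in[OF tm_lin])
qed simp

lemma tm_itw: "itw (ten Q Q') (ten G G') (tm Q Q' f g)"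
  unfolding itw_def
proof (intro conjI ballI)
  have "tm Q Q' f g v \<in> mcarr (ten G G')" if v: "v \<in> mcarr (ten Q Q')" for v
  proof -
    obtain t where t: "t \<in> TT Q Q'" "v = act2 H Q Q' (D e1) t" using v by (auto simp: ten_sel(1))
    then show ?thesis using tm_act2[of "D e1" t] lin_on_in[OF tm_lin t(1)] by (simp add: ten_sel(1))
  qed
  then show "lin_on (mcarr (ten Q Q')) (mcarr (ten G G')) (tm Q Q' f g)"
    using tm_lin ten_sub[OF Q(1,2)] unfolding lin_on_def by blast
  show "tm Q Q' f g (act (ten Q Q') h v) = act (ten G G') h (tm Q Q' f g v)"
    if "h \<in> HA" "v \<in> mcarr (ten Q Q')" for h v
    using that tm_act2 ten_sub[OF Q(1,2)] by auto
qed

end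

text \<open>A presentation of a module \<open>Q\<close> is a surjective intertwiner from some \<open>F(X)\<close>. Every module has one,
  and presentations are compatible with tensor products, so facts about \<open>C\<close> can be carried over to
  modules.\<close>

definition pres :: "'k hmod \<Rightarrow> 'o \<Rightarrow> ('k seq \<Rightarrow> 'k seq) \<Rightarrow> bool" where
  "pres Q X \<phi> \<longleftrightarrow> X \<in> obj C \<and> lin_on (V X) (mcarr Q) \<phi> \<and> \<phi> ` V X = mcarr Q \<and>
     (\<forall>h\<in>HA. \<forall>x\<in>V X. \<phi> (A X h x) = act Q h (\<phi> x))"

lemma presD:
  assumes "pres Q X \<phi>"
  shows "X \<in> obj C" "lin_on (V X) (mcarr Q) \<phi>" "mcarr Q = \<phi> ` V X" "h \<in> HA \<Longrightarrow> x \<in> V X \<Longrightarrow> \<phi> (A X h x) = act Q h (\<phi> x)"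
    "itw (Md X) Q \<phi>"
  using assms by (auto simp: pres_def itw_def)

lemma pres_hmod:
  assumes "pres Q X \<phi>"
  shows "hm Q"
proof -
  note p = presD[OF assms]
  note add = lin_on_add[OF p(2)] and sc = lin_on_scale[OF p(2)] and p4 = p(4)[symmetric]
  have pe: "\<phi> x \<in> mcarr Q" if "x \<in> V X" for x using that p(3) by auto
  have "bilin_on HA (mcarr Q) (mcarr Q) (act Q)"
    unfolding bilin_on_def lin_on_def p(3)
    using p(1) by (auto simp: p4 A_simps simp flip: add sc)
  moreover have "fin_dim (mcarr Q)" unfolding p(3) by (rule fin_dim_image[OF p(2) fin_dim_csp]) (use p in simp)
  ultimately show ?thesis unfolding is_hmod_def p(3) using p(1) by (auto simp: p4)
qed

lemma pres_Md: "X \<in> obj C \<Longrightarrow> pres (Md X) X (\<lambda>x. x)"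
  by (simp add: pres_def)

lemma pres_ex:
  assumes "hm Q"
  obtains X \<phi> where "pres Q X \<phi>" "inj_on \<phi> (V X)"
proof -
  obtain X \<phi> where X: "X \<in> obj C" "is_iso (Rep H) (Md X) Q \<phi>"
    using Md_ess_surj[OF assms] by (auto simp: isomorphic_def)
  note h = hmod_isoD[OF X(2)]
  show ?thesis
  proof (rule that)
    show "pres Q X \<phi>" using X(1) hmod_homD[OF h(1)] h(2) by (auto simp: pres_def bij_betw_def)
    show "inj_on \<phi> (V X)" using h(2) by (simp add: bij_betw_def)
  qed
qed

lemma tm_surj:
  assumes Q: "hm Q" "hm Q'" "hm G" "hm G'" and fg: "itw Q G f" "itw Q' G' g"
    and s: "f ` mcarr Q = mcarr G" "g ` mcarr Q' = mcarr G'" and t: "t \<in> TT G G'"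
  shows "\<exists>s\<in>TT Q Q'. t = tm Q Q' f g s"
  using t hmD(1)[OF Q(3)]
proof (induction t rule: tens_induct)
  case (tens v w)
  obtain v' where "v' \<in> mcarr Q" "v = f v'" using tens(1) unfolding s(1)[symmetric] by blast
  moreover obtain w' where "w' \<in> mcarr Q'" "w = g w'" using tens(2) unfolding s(2)[symmetric] by blast
  ultimately  show ?case using tm_tens[OF Q fg] by (intro bexI[of _ "tens v' w'"]) auto
next
  case (add s t)
  then obtain s' t' where "s' \<in> TT Q Q'" "s = tm Q Q' f g s'" "t' \<in> TT Q Q'" "t = tm Q Q' f g t'" by blast
  then show ?case using lin_on_add[OF tm_lin[OF Q fg]] by (intro bexI[of _ "s' + t'"]) auto
qed (rule hmD(1)[OF Q(4)])

text \<open>\<open>F(X \<otimes> Y)\<close> is carried by \<open>\<iota>\<close> onto \<open>\<Delta>(1) (F(X) \<otimes> F(Y))\<close>, since \<open>\<Delta>(1) = \<iota> \<pi>\<close>, and the latter is mapped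
  onto \<open>\<Delta>(1) (Q \<otimes> G)\<close> because \<open>\<phi> \<otimes> \<psi>\<close> commutes with \<open>\<Delta>(1)\<close>.\<close>

lemma pres_ten:
  assumes p: "pres Q X \<phi>" and q: "pres G Y \<psi>"
  shows "pres (ten Q G) (tobj C X Y) (\<lambda>z. tmap (V X) (V Y) \<phi> \<psi> (io X Y z))"
proof -
  note p' = presD[OF p] and q' = presD[OF q]
  have X: "X \<in> obj C" "Y \<in> obj C" using p' q' by auto
  note hm = Md_hmod[OF X(1)] Md_hmod[OF X(2)] pres_hmod[OF p] pres_hmod[OF q]
  note l = tm_lin[OF hm p'(5) q'(5)] and ac = tm_act2[OF hm p'(5) q'(5)]
  let ?F = "tmap (V X) (V Y) \<phi> \<psi>"
  have l': "lin_on (VV X Y) (TT Q G) ?F" using l by simp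
  have ac': "?F (A2 X Y x t) = act2 H Q G x (?F t)" if "x \<in> HT" "t \<in> VV X Y" for x t
    using ac[OF that(1)] that(2) by (simp add: act2_A2)
  have surj: "\<exists>s\<in>VV X Y. t = ?F s" if "t \<in> TT Q G" for t
    using tm_surj[OF hm p'(5) q'(5) _ _ that] p'(3) q'(3) by simp
  have im: "mcarr (ten Q G) = (\<lambda>z. ?F (io X Y z)) ` V (tobj C X Y)"
  proof
    show "mcarr (ten Q G) \<subseteq> (\<lambda>z. ?F (io X Y z)) ` V (tobj C X Y)"
    proof
      fix v assume "v \<in> mcarr (ten Q G)"
      then obtain t where t: "t \<in> TT Q G" "v = act2 H Q G (D e1) t" by (auto simp: ten_sel(1))
      then obtain s where s: "s \<in> VV X Y" "t = ?F s" using surj by blast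
      have "v = ?F (io X Y (Pt X Y s))" using s t X by (simp add: A2_D flip: ac')
      then show "v \<in> (\<lambda>z. ?F (io X Y z)) ` V (tobj C X Y)" using X s by (intro image_eqI[where x = "Pt X Y s"]) simp_all
    qed
    show "(\<lambda>z. ?F (io X Y z)) ` V (tobj C X Y) \<subseteq> mcarr (ten Q G)"
    proof safe
      fix z :: "'k seq" assume z: "z \<in> V (tobj C X Y)"
      have "?F (io X Y z) = act2 H Q G (D e1) (?F (io X Y z))"
        using X z by (simp add: A2_D flip: ac')
      then show "?F (io X Y z) \<in> mcarr (ten Q G)"
        using lin_on_in[OF l', of "io X Y z"] X z by (simp add: ten_sel(1))
    qed
  qed
  have ll: "lin_on (V (tobj C X Y)) (TT Q G) (\<lambda>z. ?F (io X Y z))"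
    by (rule lin_on_cmp[OF io_lin l']) (use X in auto)
  show ?thesis unfolding pres_def
  proof (intro conjI ballI)
    show "lin_on (V (tobj C X Y)) (mcarr (ten Q G)) (\<lambda>z. ?F (io X Y z))"
      using ll unfolding lin_on_def im by blast
    show "?F (io X Y (A (tobj C X Y) h x)) = act (ten Q G) h (?F (io X Y x))" if "h \<in> HA" "x \<in> V (tobj C X Y)" for h x
      using that X by (simp add: A2_D flip: ac')
  qed (use X im in auto)
qed

lemma ten_hm [simp]: "hm Q \<Longrightarrow> hm G \<Longrightarrow> hm (ten Q G)"
  using pres_ex pres_ten pres_hmod by metis

lemma pres_unit: "pres (hmod_unit H) U Z"
  unfolding pres_def
proof (intro conjI ballI)
  show "lin_on (V U) (mcarr (hmod_unit H)) Z"
    using Z_lin by (auto simp: hmod_unit_def base_Z lin_on_def)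
  show "Z ` V U = mcarr (hmod_unit H)" by (simp add: hmod_unit_def base_Z)
  show "Z (A U h x) = act (hmod_unit H) h (Z x)" if "h \<in> HA" "x \<in> V U" for h x
    using that by (simp add: hmod_unit_def eps_t_Z)
qed simp

lemma unit_hm [simp]: "hm (hmod_unit H)"
  using pres_hmod[OF pres_unit] .

lemma unit_carr [simp]: "mcarr (hmod_unit H) = base H"
  by (simp add: hmod_unit_def)

lemma subspace_base [simp]: "vec.subspace (base H)"
  using hmD(1)[OF unit_hm] by simp

lemma hmod_hom_eqI:
  assumes "f \<in> hmod_hom H Q G" "g \<in> hmod_hom H Q G" "\<And>v. v \<in> mcarr Q \<Longrightarrow> f v = g v"
  shows "f = g"
proof
  fix v show "f v = g v" using assms(3) hmod_homD(2)[OF assms(1)] hmod_homD(2)[OF assms(2)] by (cases "v \<in> mcarr Q") auto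
qed

lemma itw_bij_iso:
  assumes "hm Q" "hm G" "itw Q G f" "inj_on f (mcarr Q)" "f ` mcarr Q = mcarr G"
  shows "is_iso (Rep H) Q G (zero_ext (mcarr Q) f)"
  by (rule hmod_isoI[OF assms(1,2) itw_hom[OF assms(1,3)]])
    (use assms(4,5) in \<open>auto simp: bij_betw_def inj_on_def\<close>)

subsection \<open>The associator\<close>

lemma reassoc_tm:
  assumes Q: "hm M1" "hm M2" "hm M3" "hm N1" "hm N2" "hm N3"
    and f: "lin_on (mcarr M1) (mcarr N1) f" "lin_on (mcarr M2) (mcarr N2) g" "lin_on (mcarr M3) (mcarr N3) k"
    and t: "t \<in> tens_space (TT M1 M2) (mcarr M3)"
  shows "reassoc (tmap (TT M1 M2) (mcarr M3) (tm M1 M2 f g) k t)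
    = tmap (mcarr M1) (TT M2 M3) f (tm M2 M3 g k) (reassoc t)"
  using t Q(1-3)[THEN hmD(1)]
proof (induction t rule: tens3_induct)
  case (tens u v w)
  then show ?case using f Q
    by (simp add: hmD(1) reassoc_tens tmap_tens[OF f(1,2)] tmap_tens[OF f(2,3)] tmap_tens[OF tmap_lin[OF f(1,2)] f(3)]
      tmap_tens[OF f(1) tmap_lin[OF f(2,3)]])
next
  case (add s t)
  have r: "reassoc s \<in> tens_space (mcarr M1) (TT M2 M3)" "reassoc t \<in> tens_space (mcarr M1) (TT M2 M3)"
    using add Q by (auto intro: reassoc_in hmD(1))
  show ?case using add r Q
    by (simp add: reassoc_add lin_on_add[OF tmap_lin[OF tmap_lin[OF f(1,2)] f(3)]] lin_on_add[OF tmap_lin[OF f(1) tmap_lin[OF f(2,3)]]] hmD(1))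
qed

text \<open>Through presentations of the two threefold tensor products by \<open>F((X \<otimes> Y) \<otimes> Z)\<close> and \<open>F(X \<otimes> (Y \<otimes> Z))\<close>,
  reassociation of tensors corresponds to the associator of \<open>C\<close>, by coassociativity of \<open>\<iota>\<close>. So it maps one
  carrier onto the other.\<close>

lemma reassoc_iso:
  assumes hm: "hm M1" "hm M2" "hm M3"
  shows "itw (ten (ten M1 M2) M3) (ten M1 (ten M2 M3)) reassoc"
    "reassoc ` mcarr (ten (ten M1 M2) M3) = mcarr (ten M1 (ten M2 M3))"
proof -
  obtain X \<phi>1 where p1: "pres M1 X \<phi>1" using pres_ex[OF hm(1)] by blast
  obtain Y \<phi>2 where p2: "pres M2 Y \<phi>2" using pres_ex[OF hm(2)] by blast
  obtain W \<phi>3 where p3: "pres M3 W \<phi>3" using pres_ex[OF hm(3)] by blast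
  note q1 = presD[OF p1] and q2 = presD[OF p2] and q3 = presD[OF p3]
  have X [simp]: "X \<in> obj C" "Y \<in> obj C" "W \<in> obj C" using q1 q2 q3 by auto
  let ?a = "associator C X Y W" and ?L = "tobj C (tobj C X Y) W" and ?R = "tobj C X (tobj C Y W)"
  define L where "L z = tmap (V (tobj C X Y)) (V W) (\<lambda>z. tmap (V X) (V Y) \<phi>1 \<phi>2 (io X Y z)) \<phi>3 (io (tobj C X Y) W z)" for z
  define R' where "R' z = tmap (V X) (V (tobj C Y W)) \<phi>1 (\<lambda>z. tmap (V Y) (V W) \<phi>2 \<phi>3 (io Y W z)) (io X (tobj C Y W) z)" for z
  have pL: "pres (ten (ten M1 M2) M3) ?L L" unfolding L_def by (rule pres_ten[OF pres_ten[OF p1 p2] p3])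
  have pR: "pres (ten M1 (ten M2 M3)) ?R R'" unfolding R'_def by (rule pres_ten[OF p1 pres_ten[OF p2 p3]])
  note l12 = tmap_lin[OF q1(2) q2(2) subspace_csp subspace_csp] and l23 = tmap_lin[OF q2(2) q3(2) subspace_csp subspace_csp]
  have key: "reassoc (L z) = R' (Fm ?L ?R ?a z)" if z: "z \<in> V ?L" for z
  proof -
    have "L z = tmap (VV X Y) (V W) (tmap (V X) (V Y) \<phi>1 \<phi>2) \<phi>3 (io1 X Y W (io (tobj C X Y) W z))"
      unfolding L_def by (rule tmap_cmp[OF io_lin lin_on_id l12 q3(2), symmetric]) (use z in auto)
    moreover have "io1 X Y W (io (tobj C X Y) W z) \<in> VL X Y W" using z by simp
    ultimately have "reassoc (L z) = tmap (V X) (VV Y W) \<phi>1 (tmap (V Y) (V W) \<phi>2 \<phi>3) (reassoc (io1 X Y W (io (tobj C X Y) W z)))"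
      using reassoc_tm[of "Md X" "Md Y" "Md W" M1 M2 M3 \<phi>1 \<phi>2 \<phi>3] q1(2) q2(2) q3(2) hm by simp
    also have "\<dots> = tmap (V X) (VV Y W) \<phi>1 (tmap (V Y) (V W) \<phi>2 \<phi>3) (io2 X Y W (io X (tobj C Y W) (Fm ?L ?R ?a z)))"
      using z by (simp add: io_coassoc)
    also have "\<dots> = R' (Fm ?L ?R ?a z)"
      unfolding R'_def by (rule tmap_cmp[OF lin_on_id io_lin q1(2) l23]) (use z in auto)
    finally show ?thesis .
  qed
  note L = presD[OF pL] and R = presD[OF pR]
  obtain b where b: "?a \<in> hom C ?L ?R" "b \<in> hom C ?R ?L" "cmp C ?L ?R ?L b ?a = ident C ?L" "cmp C ?R ?L ?R ?a b = ident C ?R"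
    using associator_iso[OF X] by (rule is_isoE)
  show im: "reassoc ` mcarr (ten (ten M1 M2) M3) = mcarr (ten M1 (ten M2 M3))"
    unfolding L(3) R(3)
  proof safe
    fix z assume "z \<in> V ?L"
    then show "reassoc (L z) \<in> R' ` V ?R" using key by simp
  next
    fix z assume z: "z \<in> V ?R"
    have "R' z = reassoc (L (Fm ?R ?L b z))" using z b by (simp add: key flip: Fm_cmp)
    then show "R' z \<in> reassoc ` L ` V ?L" using z b by auto
  qed
  show "itw (ten (ten M1 M2) M3) (ten M1 (ten M2 M3)) reassoc"
    unfolding itw_def
  proof (intro conjI ballI)
    show "lin_on (mcarr (ten (ten M1 M2) M3)) (mcarr (ten M1 (ten M2 M3))) reassoc"
      unfolding lin_on_def im[symmetric] by (auto simp: reassoc_add reassoc_scale)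
    fix h v assume h: "h \<in> HA" and "v \<in> mcarr (ten (ten M1 M2) M3)"
    then obtain z where z: "z \<in> V ?L" "v = L z" using L(3) by auto
    have "reassoc (act (ten (ten M1 M2) M3) h (L z)) = reassoc (L (A ?L h z))" using L(4)[OF h z(1)] by simp
    also have "\<dots> = R' (A ?R h (Fm ?L ?R ?a z))" using z by (simp add: key A_Fm)
    also have "\<dots> = act (ten M1 (ten M2 M3)) h (R' (Fm ?L ?R ?a z))" by (rule R(4)) (use h z in auto)
    finally show "reassoc (act (ten (ten M1 M2) M3) h v) = act (ten M1 (ten M2 M3)) h (reassoc v)"
      using z by (simp add: key)
  qed
qed

subsection \<open>The unit constraints\<close>

lemma ep_linf: "linf HA ep"
  by (auto simp: linf_def ep_def A_simps lam_add lam_scale)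

lemma base_HA: "base H \<subseteq> HA"
  by (auto simp: base_Z)

lemma ep_base: "linf (base H) ep"
  using ep_linf base_HA unfolding linf_def by blast

abbreviation "lu Q \<equiv> tens_lift (base H) (mcarr Q) (\<lambda>z v. vscale (ep z) v)"
abbreviation "ru Q \<equiv> tens_lift (mcarr Q) (base H) (\<lambda>v z. vscale (ep z) v)"

lemma lu_lin: "hm Q \<Longrightarrow> lin_on (tens_space (base H) (mcarr Q)) (mcarr Q) (lu Q)"
  and ru_lin: "hm Q \<Longrightarrow> lin_on (tens_space (mcarr Q) (base H)) (mcarr Q) (ru Q)"
  by (rule lin_tens_lift[OF bilin_linf(1)] lin_tens_lift[OF bilin_linf(2)]; simp add: ep_base hmD)+

lemma lu_tens: "\<lbrakk>hm Q; z \<in> base H; v \<in> mcarr Q\<rbrakk> \<Longrightarrow> lu Q (tens z v) = vscale (ep z) v"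
  and ru_tens: "\<lbrakk>hm Q; z \<in> base H; v \<in> mcarr Q\<rbrakk> \<Longrightarrow> ru Q (tens v z) = vscale (ep z) v"
  by (rule tens_lift_tens[OF bilin_on_bil[OF bilin_linf(1)]] tens_lift_tens[OF bilin_on_bil[OF bilin_linf(2)]]; simp add: ep_base hmD)+

lemma lu_pres:
  assumes p: "pres Q Y \<psi>" and z: "z \<in> V (tobj C U Y)"
  shows "lu Q (tmap (V U) (V Y) Z \<psi> (io U Y z)) = \<psi> (Fm (tobj C U Y) Y (lunit C Y) z)"
proof -
  note p' = presD[OF p] and h = pres_hmod[OF p]
  have Zl: "lin_on (V U) (base H) Z" using presD(2)[OF pres_unit] by simp
  note l = tmap_lin[OF Zl p'(2) subspace_csp subspace_csp]
  have "lu Q (tmap (V U) (V Y) Z \<psi> s) = \<psi> (LL Y s)" if "s \<in> VV U Y" for s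
    using that subspace_csp
  proof (induction s rule: tens_induct)
    case (tens x y)
    then have "\<psi> y \<in> mcarr Q" "Z x \<in> base H" using p'(3) base_Z by auto
    then show ?case using h tens lin_on_scale[OF p'(2)]
      by (simp add: tmap_tens[OF Zl p'(2)] lu_tens ep_Z)
  next
    case (add s t)
    then show ?case using lin_on_in[OF l] lin_on_in[OF LL_lin]
      by (simp add: lin_on_add[OF l] lin_on_add[OF lu_lin[OF h]] lin_on_add[OF LL_lin] lin_on_add[OF p'(2)])
  qed simp
  then show ?thesis using p'(1) z by (simp add: LL_io)
qed

lemma ru_pres:
  assumes p: "pres Q Y \<psi>" and z: "z \<in> V (tobj C Y U)"
  shows "ru Q (tmap (V Y) (V U) \<psi> Z (io Y U z)) = \<psi> (Fm (tobj C Y U) Y (runit C Y) z)"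
proof -
  note p' = presD[OF p] and h = pres_hmod[OF p]
  have Zl: "lin_on (V U) (base H) Z" using presD(2)[OF pres_unit] by simp
  note l = tmap_lin[OF p'(2) Zl subspace_csp subspace_csp]
  have "ru Q (tmap (V Y) (V U) \<psi> Z s) = \<psi> (RR Y s)" if "s \<in> VV Y U" for s
    using that subspace_csp
  proof (induction s rule: tens_induct)
    case (tens x y)
    then have "\<psi> x \<in> mcarr Q" "Z y \<in> base H" using p'(3) base_Z by auto
    then show ?case using h tens lin_on_scale[OF p'(2)]
      by (simp add: tmap_tens[OF p'(2) Zl] ru_tens ep_Z)
  next
    case (add s t)
    then show ?case using lin_on_in[OF l] lin_on_in[OF RR_lin]
      by (simp add: lin_on_add[OF l] lin_on_add[OF ru_lin[OF h]] lin_on_add[OF RR_lin] lin_on_add[OF p'(2)])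
  qed simp
  then show ?thesis using p'(1) z by (simp add: RR_io)
qed

text \<open>A linear map covered by an isomorphism of \<open>C\<close>, with target presented faithfully, is an isomorphism of
  modules. It yields the unit constraints and the monoidal structure of the equivalence.\<close>

lemma pres_iso:
  assumes T: "pres T X \<Phi>" and Q: "pres Q Y \<psi>" "inj_on \<psi> (V Y)" and r: "is_iso C X Y r"
    and key: "\<And>z. z \<in> V X \<Longrightarrow> k (\<Phi> z) = \<psi> (Fm X Y r z)" and k: "lin_on E (mcarr Q) k" "mcarr T \<subseteq> E"
  shows "itw T Q k" "inj_on k (mcarr T)" "k ` mcarr T = mcarr Q"
proof -
  note T' = presD[OF T] and Q' = presD[OF Q(1)]
  note [simp] = T'(1) Q'(1)
  obtain b where b [simp]: "r \<in> hom C X Y" "b \<in> hom C Y X" "cmp C X Y X b r = ident C X" "cmp C Y X Y r b = ident C Y"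
    using r by (rule is_isoE)
  show "itw T Q k" unfolding itw_def
  proof (intro conjI ballI)
    show "lin_on (mcarr T) (mcarr Q) k" using k unfolding lin_on_def by blast
    fix h v assume h: "h \<in> HA" and v: "v \<in> mcarr T"
    then obtain z where z: "z \<in> V X" "v = \<Phi> z" using T'(3) by auto
    have "k (act T h v) = k (\<Phi> (A X h z))" using z T'(4)[OF h] by simp
    also have "\<dots> = \<psi> (A Y h (Fm X Y r z))" using z by (simp add: key A_Fm)
    also have "\<dots> = act Q h (k v)" using z Q'(4)[OF h] by (simp add: key)
    finally show "k (act T h v) = act Q h (k v)" .
  qed
  have inv: "Fm Y X b (Fm X Y r z) = z" if "z \<in> V X" for z using that by (simp flip: Fm_cmp)
  have inv': "Fm X Y r (Fm Y X b z) = z" if "z \<in> V Y" for z using that by (simp flip: Fm_cmp)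
  show "inj_on k (mcarr T)"
  proof (rule inj_onI)
    fix v w assume vw: "v \<in> mcarr T" "w \<in> mcarr T" "k v = k w"
    then obtain x y where xy: "x \<in> V X" "v = \<Phi> x" "y \<in> V X" "w = \<Phi> y" using T'(3) by auto
    then have "\<psi> (Fm X Y r x) = \<psi> (Fm X Y r y)" using vw(3) by (simp add: key)
    then have "Fm X Y r x = Fm X Y r y" using inj_onD[OF Q(2)] xy by simp
    then have "x = y" using inv xy by metis
    then show "v = w" using xy by simp
  qed
  show "k ` mcarr T = mcarr Q" unfolding T'(3) Q'(3)
  proof safe
    fix z assume "z \<in> V X" then show "k (\<Phi> z) \<in> \<psi> ` V Y" by (simp add: key)
  next
    fix y assume y: "y \<in> V Y"
    have "\<psi> y = k (\<Phi> (Fm Y X b y))" using y by (simp add: key inv')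
    then show "\<psi> y \<in> k ` \<Phi> ` V X" using y by simp
  qed
qed

lemma lu_iso:
  assumes h: "hm Q"
  shows "itw (ten (hmod_unit H) Q) Q (lu Q)" "inj_on (lu Q) (mcarr (ten (hmod_unit H) Q))"
    "lu Q ` mcarr (ten (hmod_unit H) Q) = mcarr Q"
proof -
  obtain Y \<psi> where p: "pres Q Y \<psi>" "inj_on \<psi> (V Y)" by (rule pres_ex[OF h])
  have Y: "Y \<in> obj C" by (rule presD(1)[OF p(1)])
  have sub: "mcarr (ten (hmod_unit H) Q) \<subseteq> tens_space (base H) (mcarr Q)" using ten_sub[OF unit_hm h] by simp
  show "itw (ten (hmod_unit H) Q) Q (lu Q)" "inj_on (lu Q) (mcarr (ten (hmod_unit H) Q))"
    "lu Q ` mcarr (ten (hmod_unit H) Q) = mcarr Q"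
    using pres_iso[OF pres_ten[OF pres_unit p(1)] p lunit_iso[OF Y] lu_pres[OF p(1)] lu_lin[OF h] sub] by auto
qed

lemma ru_iso:
  assumes h: "hm Q"
  shows "itw (ten Q (hmod_unit H)) Q (ru Q)" "inj_on (ru Q) (mcarr (ten Q (hmod_unit H)))"
    "ru Q ` mcarr (ten Q (hmod_unit H)) = mcarr Q"
proof -
  obtain Y \<psi> where p: "pres Q Y \<psi>" "inj_on \<psi> (V Y)" by (rule pres_ex[OF h])
  have Y: "Y \<in> obj C" by (rule presD(1)[OF p(1)])
  have sub: "mcarr (ten Q (hmod_unit H)) \<subseteq> tens_space (mcarr Q) (base H)" using ten_sub[OF h unit_hm] by simp
  show "itw (ten Q (hmod_unit H)) Q (ru Q)" "inj_on (ru Q) (mcarr (ten Q (hmod_unit H)))"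
    "ru Q ` mcarr (ten Q (hmod_unit H)) = mcarr Q"
    using pres_iso[OF pres_ten[OF p(1) pres_unit] p runit_iso[OF Y] ru_pres[OF p(1)] ru_lin[OF h] sub] by auto
qed

end

context frobenius_fibre_functor
begin

lemma hom_cmp: "\<lbrakk>hm Q; hm G; hm K; f \<in> hmod_hom H Q G; g \<in> hmod_hom H G K\<rbrakk> \<Longrightarrow> g \<circ> f \<in> hmod_hom H Q K"
  using linear_category.cmp_in[OF Rep_linear, of Q H G K f g] by simp

lemma hom_id: "hm Q \<Longrightarrow> zero_ext (mcarr Q) (\<lambda>v. v) \<in> hmod_hom H Q Q"
  using linear_category.ident_in[OF Rep_linear, of Q H] by simp

abbreviation "tmz Q Q' f g \<equiv> zero_ext (mcarr (ten Q Q')) (tm Q Q' f g)"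

lemma tmz_hom:
  assumes "hm Q" "hm Q'" "hm G" "hm G'" "f \<in> hmod_hom H Q G" "g \<in> hmod_hom H Q' G'"
  shows "tmz Q Q' f g \<in> hmod_hom H (ten Q Q') (ten G G')"
  by (rule itw_hom[OF ten_hm tm_itw]) (use assms in \<open>auto intro: hom_itw\<close>)

lemma ten_sub': "hm Q \<Longrightarrow> hm G \<Longrightarrow> v \<in> mcarr (ten Q G) \<Longrightarrow> v \<in> TT Q G"
  using ten_sub by blast

lemma tm_left:
  assumes "hm Q" "hm G" "v \<in> tens_space (mcarr Q) (mcarr G)" "mcarr Q \<subseteq> E" "vec.subspace E"
    "lin_on E W F" "lin_on (mcarr G) W' k" "\<And>x. x \<in> mcarr G \<Longrightarrow> k' x = k x"
  shows "tmap (mcarr Q) (mcarr G) (zero_ext (mcarr Q) F) k' v = tmap E (mcarr G) F k v"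
  by (rule tmap_restrict[OF assms(3,6,7)]) (use assms in \<open>auto intro: hmD\<close>)

lemma tm_right:
  assumes "hm Q" "hm G" "v \<in> tens_space (mcarr Q) (mcarr G)" "mcarr G \<subseteq> E" "vec.subspace E"
    "lin_on E W F" "lin_on (mcarr Q) W' k" "\<And>x. x \<in> mcarr Q \<Longrightarrow> k' x = k x"
  shows "tmap (mcarr Q) (mcarr G) k' (zero_ext (mcarr G) F) v = tmap (mcarr Q) E k F v"
  by (rule tmap_restrict[OF assms(3,7,6)]) (use assms in \<open>auto intro: hmD\<close>)

lemma tens_space_in: "t \<in> tens_space E F \<Longrightarrow> E \<subseteq> E' \<Longrightarrow> F \<subseteq> F' \<Longrightarrow> t \<in> tens_space E' F'"
  using tens_space_mono by blast

text \<open>The coherence laws of \<open>Rep(H)\<close> hold already on the full tensor products of vector spaces; the next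
  lemmas state them there, for restriction to the carriers of the modules.\<close>

lemma reassoc_pentagon:
  fixes v :: "'k seq"
  assumes E: "vec.subspace E1" "vec.subspace E2" "vec.subspace E3" "vec.subspace E4"
    and v: "v \<in> tens_space (tens_space (tens_space E1 E2) E3) E4"
  shows "tmap UNIV UNIV (\<lambda>x. x) reassoc (reassoc (tmap UNIV UNIV reassoc (\<lambda>x. x) v)) = reassoc (reassoc v)"
proof -
  note l1 = tmap_lin[OF reassoc_lin lin_on_id subspace_UNIV subspace_UNIV]
    and l2 = tmap_lin[OF lin_on_id reassoc_lin subspace_UNIV subspace_UNIV]
  let ?x = "\<lambda>v. reassoc (tmap UNIV UNIV reassoc (\<lambda>x. x) (v :: 'k seq))"
  have "?x v \<in> tens_space UNIV UNIV \<and> v \<in> tens_space UNIV UNIV \<and> tmap UNIV UNIV (\<lambda>x. x) reassoc (?x v) = reassoc (reassoc v)"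
    using v subspace_tens_space E(3,4)
  proof (induction v rule: tens3_induct)
    case (tens p y z)
    from tens(1) E(1) show ?case
    proof (induction p rule: tens_induct)
      case (tens w x)
      then show ?case
        by (simp add: tmap_tens[OF reassoc_lin lin_on_id] tmap_tens[OF lin_on_id reassoc_lin] reassoc_tens)
    next
      case (add s t)
      then show ?case
        by (simp add: tens_add_left lin_on_add[OF l1] lin_on_add[OF l2] reassoc_add del: tens_in)
    qed (rule E)
  next
    case (add s t)
    then show ?case
      by (simp add: lin_on_add[OF l1] lin_on_add[OF l2] reassoc_add)
  qed
  then show ?thesis by blast
qed

lemma tmap_add_left:
  assumes E: "vec.subspace E" "vec.subspace F" and f: "lin_on E E' f" "lin_on E E' f'" "lin_on E E' h" "lin_on F F' g"
    and t: "t \<in> tens_space E F" and h: "\<And>v. h v = f v + f' v"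
  shows "tmap E F h g t = tmap E F f g t + tmap E F f' g t"
  using t E(1)
proof (induction t rule: tens_induct)
  case (tens v w)
  then show ?case using E by (simp add: tmap_tens[OF f(1,4)] tmap_tens[OF f(2,4)] tmap_tens[OF f(3,4)] tens_add_left h[of v])
qed (use E in \<open>simp_all add: lin_on_add[OF tmap_lin[OF f(1,4)]] lin_on_add[OF tmap_lin[OF f(2,4)]] lin_on_add[OF tmap_lin[OF f(3,4)]] add_ac\<close>)

lemma tmap_add_right:
  assumes E: "vec.subspace E" "vec.subspace F" and f: "lin_on F F' f" "lin_on F F' f'" "lin_on F F' h" "lin_on E E' g"
    and t: "t \<in> tens_space E F" and h: "\<And>v. h v = f v + f' v"
  shows "tmap E F g h t = tmap E F g f t + tmap E F g f' t"
  using t E(1)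
proof (induction t rule: tens_induct)
  case (tens v w)
  then show ?case using E by (simp add: tmap_tens[OF f(4,1)] tmap_tens[OF f(4,2)] tmap_tens[OF f(4,3)] tens_add_right h[of w])
qed (use E in \<open>simp_all add: lin_on_add[OF tmap_lin[OF f(4,1)]] lin_on_add[OF tmap_lin[OF f(4,2)]] lin_on_add[OF tmap_lin[OF f(4,3)]] add_ac\<close>)

lemma tmap_scale_left:
  assumes E: "vec.subspace E" "vec.subspace F" and f: "lin_on E E' f" "lin_on E E' h" "lin_on F F' g"
    and t: "t \<in> tens_space E F" and h: "\<And>v. h v = vscale a (f v)"
  shows "tmap E F h g t = vscale a (tmap E F f g t)"
  using t E(1)
proof (induction t rule: tens_induct)
  case (tens v w)
  then show ?case using E by (simp add: tmap_tens[OF f(1,3)] tmap_tens[OF f(2,3)] tens_scale_left h[of v])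
qed (use E in \<open>simp_all add: lin_on_add[OF tmap_lin[OF f(1,3)]] lin_on_add[OF tmap_lin[OF f(2,3)]] vscale_add\<close>)

lemma tmap_scale_right:
  assumes E: "vec.subspace E" "vec.subspace F" and f: "lin_on F F' f" "lin_on F F' h" "lin_on E E' g"
    and t: "t \<in> tens_space E F" and h: "\<And>v. h v = vscale a (f v)"
  shows "tmap E F g h t = vscale a (tmap E F g f t)"
  using t E(1)
proof (induction t rule: tens_induct)
  case (tens v w)
  then show ?case using E by (simp add: tmap_tens[OF f(3,1)] tmap_tens[OF f(3,2)] tens_scale_right h[of w])
qed (use E in \<open>simp_all add: lin_on_add[OF tmap_lin[OF f(3,1)]] lin_on_add[OF tmap_lin[OF f(3,2)]] vscale_add\<close>)

lemma triangle_full: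
  assumes Q: "hm Q" "hm G" and v: "v \<in> tens_space (tens_space (mcarr Q) (base H)) (mcarr G)"
  shows "tmap (mcarr Q) (tens_space (base H) (mcarr G)) (\<lambda>x. x) (lu G) (reassoc v)
    = tmap (tens_space (mcarr Q) (base H)) (mcarr G) (ru Q) (\<lambda>x. x) v"
  using v hmD(1)[OF Q(1)] subspace_base hmD(1)[OF Q(2)]
proof (induction v rule: tens3_induct)
  case (tens u z w)
  then show ?case using Q
    by (simp add: reassoc_tens tmap_tens[OF lin_on_id lu_lin] tmap_tens[OF ru_lin lin_on_id] hmD lu_tens ru_tens tens_vscale)
next
  case (add s t)
  have r: "reassoc s \<in> tens_space (mcarr Q) (tens_space (base H) (mcarr G))" "reassoc t \<in> tens_space (mcarr Q) (tens_space (base H) (mcarr G))"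
    using add Q by (auto intro: reassoc_in hmD(1))
  then show ?case using add Q
    by (simp add: reassoc_add lin_on_add[OF tmap_lin[OF lin_on_id lu_lin]] lin_on_add[OF tmap_lin[OF ru_lin lin_on_id]] hmD)
qed

lemma lu_nat:
  assumes Q: "hm Q" "hm G" and f: "lin_on (mcarr Q) (mcarr G) f" and v: "v \<in> tens_space (base H) (mcarr Q)"
  shows "lu G (tmap (base H) (mcarr Q) (\<lambda>x. x) f v) = f (lu Q v)"
  using v subspace_base
proof (induction v rule: tens_induct)
  case (tens z w)
  then show ?case using Q lin_on_scale[OF f] lin_on_in[OF f] by (simp add: tmap_tens[OF lin_on_id f] hmD lu_tens)
next
  case (add s t)
  have l: "lin_on (tens_space (base H) (mcarr Q)) (tens_space (base H) (mcarr G)) (tmap (base H) (mcarr Q) (\<lambda>x. x) f)"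
    by (rule tmap_lin[OF lin_on_id f]) (use Q in \<open>auto intro: hmD\<close>)
  show ?case using add lin_on_in[OF l] lin_on_in[OF lu_lin[OF Q(1)]]
    by (simp add: lin_on_add[OF l] lin_on_add[OF lu_lin[OF Q(1)]] lin_on_add[OF lu_lin[OF Q(2)]] lin_on_add[OF f])
qed (rule hmD(1)[OF Q(1)])

lemma ru_nat:
  assumes Q: "hm Q" "hm G" and f: "lin_on (mcarr Q) (mcarr G) f" and v: "v \<in> tens_space (mcarr Q) (base H)"
  shows "ru G (tmap (mcarr Q) (base H) f (\<lambda>x. x) v) = f (ru Q v)"
  using v hmD(1)[OF Q(1)]
proof (induction v rule: tens_induct)
  case (tens z w)
  then show ?case using Q lin_on_scale[OF f] lin_on_in[OF f] by (simp add: tmap_tens[OF f lin_on_id] hmD ru_tens)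
next
  case (add s t)
  have l: "lin_on (tens_space (mcarr Q) (base H)) (tens_space (mcarr G) (base H)) (tmap (mcarr Q) (base H) f (\<lambda>x. x))"
    by (rule tmap_lin[OF f lin_on_id]) (use Q in \<open>auto intro: hmD\<close>)
  show ?case using add lin_on_in[OF l] lin_on_in[OF ru_lin[OF Q(1)]]
    by (simp add: lin_on_add[OF l] lin_on_add[OF ru_lin[OF Q(1)]] lin_on_add[OF ru_lin[OF Q(2)]] lin_on_add[OF f])
qed (rule subspace_base)

abbreviation "as Q G K \<equiv> zero_ext (mcarr (ten (ten Q G) K)) reassoc"

lemma as_hom: "\<lbrakk>hm Q; hm G; hm K\<rbrakk> \<Longrightarrow> as Q G K \<in> hmod_hom H (ten (ten Q G) K) (ten Q (ten G K))"
  by (rule itw_hom) (auto intro: reassoc_iso)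

lemma lun_hom: "hm Q \<Longrightarrow> zero_ext (mcarr (ten (hmod_unit H) Q)) (lu Q) \<in> hmod_hom H (ten (hmod_unit H) Q) Q"
  and run_hom: "hm Q \<Longrightarrow> zero_ext (mcarr (ten Q (hmod_unit H))) (ru Q) \<in> hmod_hom H (ten Q (hmod_unit H)) Q"
  by (rule itw_hom; simp add: lu_iso ru_iso)+

lemma zero_ext_hom: "f \<in> hmod_hom H Q G \<Longrightarrow> v \<in> mcarr Q \<Longrightarrow> f v \<in> mcarr G"
  by (rule hmod_hom_in)

lemma ten3_sub: "\<lbrakk>hm Q; hm G; hm K; v \<in> mcarr (ten (ten Q G) K)\<rbrakk> \<Longrightarrow> v \<in> tens_space (TT Q G) (mcarr K)"
  by (rule tens_space_in[OF ten_sub'[OF ten_hm]]) (auto dest: ten_sub')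

text \<open>The tensor product of morphisms and the associator are restrictions of the corresponding maps of vector spaces,
  so their laws are equations on pure tensors. Invertibility of the constraints is the substance, and has been
  obtained from \<open>C\<close>.\<close>

lemma Rep_monoidal: "monoidal_category (Rep H)"
proof (intro monoidal_category.intro Rep_linear monoidal_category_axioms.intro, unfold Rep_sel mem_Collect_eq)
  show "hm (ten X Y)" if "hm X" "hm Y" for X Y using that by simp
  show "tmz X Y f g \<in> hmod_hom H (ten X Y) (ten X' Y')"
    if "hm X" "hm X'" "hm Y" "hm Y'" "f \<in> hmod_hom H X X'" "g \<in> hmod_hom H Y Y'" for X X' Y Y' f g
    using that(1,3,2,4,5,6) by (rule tmz_hom)
  show "tmz X Y (zero_ext (mcarr X) (\<lambda>v. v)) (zero_ext (mcarr Y) (\<lambda>v. v)) = zero_ext (mcarr (ten X Y)) (\<lambda>v. v)"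
    if "hm X" "hm Y" for X Y
  proof (rule hmod_hom_eqI[OF tmz_hom hom_id])
    fix v assume v: "v \<in> mcarr (ten X Y)"
    have "tm X Y (zero_ext (mcarr X) (\<lambda>v. v)) (zero_ext (mcarr Y) (\<lambda>v. v)) v = v"
      by (rule tmap_id) (use that v in \<open>auto intro: hmD ten_sub'\<close>)
    then show "tmz X Y (zero_ext (mcarr X) (\<lambda>v. v)) (zero_ext (mcarr Y) (\<lambda>v. v)) v = zero_ext (mcarr (ten X Y)) (\<lambda>v. v) v"
      using v by simp
  qed (use that in \<open>auto intro: hom_id\<close>)
  show "tmz X Y (f' \<circ> f) (g' \<circ> g) = tmz X' Y' f' g' \<circ> tmz X Y f g"
    if X: "hm X" "hm X'" "hm X''" "hm Y" "hm Y'" "hm Y''"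
      and f: "f \<in> hmod_hom H X X'" "f' \<in> hmod_hom H X' X''" "g \<in> hmod_hom H Y Y'" "g' \<in> hmod_hom H Y' Y''"
    for X X' X'' Y Y' Y'' f f' g g'
  proof (rule hmod_hom_eqI)
    show "tmz X Y (f' \<circ> f) (g' \<circ> g) \<in> hmod_hom H (ten X Y) (ten X'' Y'')"
      by (intro tmz_hom hom_cmp[OF _ _ _ f(1,2)] hom_cmp[OF _ _ _ f(3,4)] X)
    show "tmz X' Y' f' g' \<circ> tmz X Y f g \<in> hmod_hom H (ten X Y) (ten X'' Y'')"
      by (rule hom_cmp[OF _ _ _ tmz_hom tmz_hom]) (use X f in auto)
    fix v assume v: "v \<in> mcarr (ten X Y)"
    have "tm X' Y' f' g' (tm X Y f g v) = tm X Y (\<lambda>x. f' (f x)) (\<lambda>x. g' (g x)) v"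
      by (rule tmap_cmp[OF f(1,3,2,4)[THEN hmod_homD(1)]]) (use X v in \<open>auto intro: hmD ten_sub'\<close>)
    then show "tmz X Y (f' \<circ> f) (g' \<circ> g) v = (tmz X' Y' f' g' \<circ> tmz X Y f g) v"
      using v zero_ext_hom[OF tmz_hom[OF X(1,4,2,5) f(1,3)] v] by (simp add: o_def)
  qed
  show "tmz X Y (\<lambda>v. f v + f' v) g = (\<lambda>v. tmz X Y f g v + tmz X Y f' g v)"
    if X: "hm X" "hm X'" "hm Y" "hm Y'" and f: "f \<in> hmod_hom H X X'" "f' \<in> hmod_hom H X X'" "g \<in> hmod_hom H Y Y'"
    for X X' Y Y' f f' g
  proof
    have "(\<lambda>v. f v + f' v) \<in> hmod_hom H X X'"
      using linear_category.hom_facts(2)[OF Rep_linear, of X H X' f f'] X f by simp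
    note l = hmod_homD(1)[OF f(1)] hmod_homD(1)[OF f(2)] hmod_homD(1)[OF this] hmod_homD(1)[OF f(3)]
    fix v show "tmz X Y (\<lambda>v. f v + f' v) g v = tmz X Y f g v + tmz X Y f' g v"
      using tmap_add_left[OF X(1,3)[THEN hmD(1)] l ten_sub'[OF X(1,3)] refl] by (cases "v \<in> mcarr (ten X Y)") auto
  qed
  show "tmz X Y f (\<lambda>v. g v + g' v) = (\<lambda>v. tmz X Y f g v + tmz X Y f g' v)"
    if X: "hm X" "hm X'" "hm Y" "hm Y'" and f: "f \<in> hmod_hom H X X'" "g \<in> hmod_hom H Y Y'" "g' \<in> hmod_hom H Y Y'"
    for X X' Y Y' f g g'
  proof
    have "(\<lambda>v. g v + g' v) \<in> hmod_hom H Y Y'"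
      using linear_category.hom_facts(2)[OF Rep_linear, of Y H Y' g g'] X f by simp
    note l = hmod_homD(1)[OF f(2)] hmod_homD(1)[OF f(3)] hmod_homD(1)[OF this] hmod_homD(1)[OF f(1)]
    fix v show "tmz X Y f (\<lambda>v. g v + g' v) v = tmz X Y f g v + tmz X Y f g' v"
      using tmap_add_right[OF X(1,3)[THEN hmD(1)] l ten_sub'[OF X(1,3)] refl] by (cases "v \<in> mcarr (ten X Y)") auto
  qed
  show "tmz X Y (\<lambda>v. vscale a (f v)) g = (\<lambda>v. vscale a (tmz X Y f g v))"
    "tmz X Y f (\<lambda>v. vscale a (g v)) = (\<lambda>v. vscale a (tmz X Y f g v))"
    if X: "hm X" "hm X'" "hm Y" "hm Y'" and f: "f \<in> hmod_hom H X X'" "g \<in> hmod_hom H Y Y'"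
    for X X' Y Y' a f g
  proof -
    have s: "(\<lambda>v. vscale a (f v)) \<in> hmod_hom H X X'" "(\<lambda>v. vscale a (g v)) \<in> hmod_hom H Y Y'"
      using linear_category.hom_facts(3)[OF Rep_linear, of X H X' f a] linear_category.hom_facts(3)[OF Rep_linear, of Y H Y' g a] X f by auto
    note l = f(1)[THEN hmod_homD(1)] s(1)[THEN hmod_homD(1)] f(2)[THEN hmod_homD(1)] s(2)[THEN hmod_homD(1)]
    show "tmz X Y (\<lambda>v. vscale a (f v)) g = (\<lambda>v. vscale a (tmz X Y f g v))"
    proof
      fix v show "tmz X Y (\<lambda>v. vscale a (f v)) g v = vscale a (tmz X Y f g v)"
        using tmap_scale_left[OF X(1,3)[THEN hmD(1)] l(1,2,3) ten_sub'[OF X(1,3)] refl] by (cases "v \<in> mcarr (ten X Y)") auto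
    qed
    show "tmz X Y f (\<lambda>v. vscale a (g v)) = (\<lambda>v. vscale a (tmz X Y f g v))"
    proof
      fix v show "tmz X Y f (\<lambda>v. vscale a (g v)) v = vscale a (tmz X Y f g v)"
        using tmap_scale_right[OF X(1,3)[THEN hmD(1)] l(3,4,1) ten_sub'[OF X(1,3)] refl] by (cases "v \<in> mcarr (ten X Y)") auto
    qed
  qed
  show "hm (hmod_unit H)" by simp
  show "is_iso (Rep H) (ten (ten X Y) W) (ten X (ten Y W)) (as X Y W)" if "hm X" "hm Y" "hm W" for X Y W
    by (rule itw_bij_iso) (use that reassoc_iso[OF that] reassoc_inj in \<open>auto simp: inj_on_def\<close>)
  show "is_iso (Rep H) (ten (hmod_unit H) X) X (zero_ext (mcarr (ten (hmod_unit H) X)) (tens_lift (base H) (mcarr X) (\<lambda>z v. vscale (counit H z) v)))"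
    if "hm X" for X
    using itw_bij_iso[OF _ that lu_iso[OF that]] that by simp
  show "is_iso (Rep H) (ten X (hmod_unit H)) X (zero_ext (mcarr (ten X (hmod_unit H))) (tens_lift (mcarr X) (base H) (\<lambda>v z. vscale (counit H z) v)))"
    if "hm X" for X
    using itw_bij_iso[OF _ that ru_iso[OF that]] that by simp
  show "as X' Y' W' \<circ> tmz (ten X Y) W (tmz X Y f g) k = tmz X (ten Y W) f (tmz Y W g k) \<circ> as X Y W"
    if X: "hm X" "hm X'" "hm Y" "hm Y'" "hm W" "hm W'"
      and f: "f \<in> hmod_hom H X X'" "g \<in> hmod_hom H Y Y'" "k \<in> hmod_hom H W W'"
    for X X' Y Y' W W' f g k
  proof -
    have a: "tmz (ten X Y) W (tmz X Y f g) k \<in> hmod_hom H (ten (ten X Y) W) (ten (ten X' Y') W')"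
      using X f by (intro tmz_hom) auto
    have b: "tmz X (ten Y W) f (tmz Y W g k) \<in> hmod_hom H (ten X (ten Y W)) (ten X' (ten Y' W'))"
      using X f by (intro tmz_hom) auto
    note l = f[THEN hmod_homD(1)]
    show ?thesis
    proof (rule hmod_hom_eqI)
      show "as X' Y' W' \<circ> tmz (ten X Y) W (tmz X Y f g) k \<in> hmod_hom H (ten (ten X Y) W) (ten X' (ten Y' W'))"
        by (rule hom_cmp[OF _ _ _ a as_hom]) (use X in auto)
      show "tmz X (ten Y W) f (tmz Y W g k) \<circ> as X Y W \<in> hmod_hom H (ten (ten X Y) W) (ten X' (ten Y' W'))"
        by (rule hom_cmp[OF _ _ _ as_hom b]) (use X in auto)
      fix v assume v: "v \<in> mcarr (ten (ten X Y) W)"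
      have rv: "reassoc v \<in> mcarr (ten X (ten Y W))" using reassoc_iso(2)[OF X(1,3,5)] v by blast
      have 1: "tmz (ten X Y) W (tmz X Y f g) k v = tmap (TT X Y) (mcarr W) (tm X Y f g) k v"
        using v tm_left[OF _ _ _ _ _ tmap_lin[OF l(1,2)] l(3), of "ten X Y" v k] X ten_sub'[OF _ _ v]
        by (simp add: hmD ten_sub)
      have 2: "tmz X (ten Y W) f (tmz Y W g k) (reassoc v) = tmap (mcarr X) (TT Y W) f (tm Y W g k) (reassoc v)"
        using rv tm_right[OF _ _ _ _ _ tmap_lin[OF l(2,3)] l(1), of "ten Y W" "reassoc v" f] X ten_sub'[OF _ _ rv]
        by (simp add: hmD ten_sub)
      show "(as X' Y' W' \<circ> tmz (ten X Y) W (tmz X Y f g) k) v = (tmz X (ten Y W) f (tmz Y W g k) \<circ> as X Y W) v"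
        using zero_ext_hom[OF a v] v reassoc_tm[OF X(1,3,5,2,4,6) l ten3_sub[OF X(1,3,5) v]] unfolding o_def 1 by (simp add: 2)
    qed
  qed
  show "zero_ext (mcarr (ten (hmod_unit H) Y)) (tens_lift (base H) (mcarr Y) (\<lambda>z v. vscale (counit H z) v)) \<circ>
        tmz (hmod_unit H) X (zero_ext (mcarr (hmod_unit H)) (\<lambda>v. v)) f =
       f \<circ> zero_ext (mcarr (ten (hmod_unit H) X)) (tens_lift (base H) (mcarr X) (\<lambda>z v. vscale (counit H z) v))"
    if X: "hm X" "hm Y" and f: "f \<in> hmod_hom H X Y" for X Y f
    unfolding HH_sel
  proof (rule hmod_hom_eqI)
    let ?t = "tmz (hmod_unit H) X (zero_ext (mcarr (hmod_unit H)) (\<lambda>v. v)) f"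
    have a: "?t \<in> hmod_hom H (ten (hmod_unit H) X) (ten (hmod_unit H) Y)"
      using X f hom_id[of "hmod_unit H"] by (intro tmz_hom) auto
    show "zero_ext (mcarr (ten (hmod_unit H) Y)) (lu Y) \<circ> ?t \<in> hmod_hom H (ten (hmod_unit H) X) Y"
      by (rule hom_cmp[OF _ _ _ a lun_hom]) (use X in auto)
    show "f \<circ> zero_ext (mcarr (ten (hmod_unit H) X)) (lu X) \<in> hmod_hom H (ten (hmod_unit H) X) Y"
      by (rule hom_cmp[OF _ _ _ lun_hom f]) (use X in auto)
    fix v assume v: "v \<in> mcarr (ten (hmod_unit H) X)"
    have v': "v \<in> tens_space (base H) (mcarr X)" using ten_sub'[OF unit_hm X(1) v] by simp
    have "?t v = tmap (base H) (mcarr X) (\<lambda>x. x) f v"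
      using v tmap_restrict[OF v' lin_on_id hmod_homD(1)[OF f]] X by (simp add: hmD)
    then show "(zero_ext (mcarr (ten (hmod_unit H) Y)) (lu Y) \<circ> ?t) v = (f \<circ> zero_ext (mcarr (ten (hmod_unit H) X)) (lu X)) v"
      using zero_ext_hom[OF a v] v lu_nat[OF X hmod_homD(1)[OF f] v'] by simp
  qed
  show "zero_ext (mcarr (ten Y (hmod_unit H))) (tens_lift (mcarr Y) (base H) (\<lambda>v z. vscale (counit H z) v)) \<circ>
        tmz X (hmod_unit H) f (zero_ext (mcarr (hmod_unit H)) (\<lambda>v. v)) =
       f \<circ> zero_ext (mcarr (ten X (hmod_unit H))) (tens_lift (mcarr X) (base H) (\<lambda>v z. vscale (counit H z) v))"
    if X: "hm X" "hm Y" and f: "f \<in> hmod_hom H X Y" for X Y f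
    unfolding HH_sel
  proof (rule hmod_hom_eqI)
    let ?t = "tmz X (hmod_unit H) f (zero_ext (mcarr (hmod_unit H)) (\<lambda>v. v))"
    have a: "?t \<in> hmod_hom H (ten X (hmod_unit H)) (ten Y (hmod_unit H))"
      using X f hom_id[of "hmod_unit H"] by (intro tmz_hom) auto
    show "zero_ext (mcarr (ten Y (hmod_unit H))) (ru Y) \<circ> ?t \<in> hmod_hom H (ten X (hmod_unit H)) Y"
      by (rule hom_cmp[OF _ _ _ a run_hom]) (use X in auto)
    show "f \<circ> zero_ext (mcarr (ten X (hmod_unit H))) (ru X) \<in> hmod_hom H (ten X (hmod_unit H)) Y"
      by (rule hom_cmp[OF _ _ _ run_hom f]) (use X in auto)
    fix v assume v: "v \<in> mcarr (ten X (hmod_unit H))"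
    have v': "v \<in> tens_space (mcarr X) (base H)" using ten_sub'[OF X(1) unit_hm v] by simp
    have "?t v = tmap (mcarr X) (base H) f (\<lambda>x. x) v"
      using v tmap_restrict[OF v' hmod_homD(1)[OF f] lin_on_id] X by (simp add: hmD)
    then show "(zero_ext (mcarr (ten Y (hmod_unit H))) (ru Y) \<circ> ?t) v = (f \<circ> zero_ext (mcarr (ten X (hmod_unit H))) (ru X)) v"
      using zero_ext_hom[OF a v] v ru_nat[OF X hmod_homD(1)[OF f] v'] by simp
  qed
  show "as W X (ten Y K) \<circ> as (ten W X) Y K =
       tmz W (ten (ten X Y) K) (zero_ext (mcarr W) (\<lambda>v. v)) (as X Y K) \<circ>
       (as W (ten X Y) K \<circ> tmz (ten (ten W X) Y) K (as W X Y) (zero_ext (mcarr K) (\<lambda>v. v)))"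
    if X: "hm W" "hm X" "hm Y" "hm K" for W X Y K
  proof -
    let ?s = "tmz (ten (ten W X) Y) K (as W X Y) (zero_ext (mcarr K) (\<lambda>v. v))"
    let ?t = "tmz W (ten (ten X Y) K) (zero_ext (mcarr W) (\<lambda>v. v)) (as X Y K)"
    have s: "?s \<in> hmod_hom H (ten (ten (ten W X) Y) K) (ten (ten W (ten X Y)) K)"
      using X by (intro tmz_hom as_hom hom_id) auto
    have t: "?t \<in> hmod_hom H (ten W (ten (ten X Y) K)) (ten W (ten X (ten Y K)))"
      using X by (intro tmz_hom as_hom hom_id) auto
    show ?thesis
    proof (rule hmod_hom_eqI)
      show "as W X (ten Y K) \<circ> as (ten W X) Y K \<in> hmod_hom H (ten (ten (ten W X) Y) K) (ten W (ten X (ten Y K)))"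
        by (rule hom_cmp[OF _ _ _ as_hom as_hom]) (use X in auto)
      show "?t \<circ> (as W (ten X Y) K \<circ> ?s) \<in> hmod_hom H (ten (ten (ten W X) Y) K) (ten W (ten X (ten Y K)))"
        by (rule hom_cmp[OF _ _ _ hom_cmp[OF _ _ _ s as_hom] t]) (use X in auto)
      fix v assume v: "v \<in> mcarr (ten (ten (ten W X) Y) K)"
      have v1: "reassoc v \<in> mcarr (ten (ten W X) (ten Y K))" using reassoc_iso(2)[of "ten W X" Y K] X v by auto
      have sv: "?s v = tmap UNIV UNIV reassoc (\<lambda>x. x) v"
        using v tmap_restrict[OF ten_sub'[OF _ _ v] reassoc_lin lin_on_id, where f' = "as W X Y" and g' = "zero_ext (mcarr K) (\<lambda>v. v)"] X by (simp add: hmD)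
      have v2: "reassoc (?s v) \<in> mcarr (ten W (ten (ten X Y) K))"
        using reassoc_iso(2)[of W "ten X Y" K] X zero_ext_hom[OF s v] by auto
      have tv: "?t (reassoc (?s v)) = tmap UNIV UNIV (\<lambda>x. x) reassoc (reassoc (?s v))"
        using v2 tmap_restrict[OF ten_sub'[OF _ _ v2] lin_on_id reassoc_lin, where f' = "zero_ext (mcarr W) (\<lambda>v. v)" and g' = "as X Y K"] X by (simp add: hmD)
      have v4: "v \<in> tens_space (tens_space (TT W X) (mcarr Y)) (mcarr K)"
        by (rule tens_space_in[OF ten_sub'[OF _ _ v]]) (use X in \<open>auto intro: ten3_sub\<close>)
      have "tmap UNIV UNIV (\<lambda>x. x) reassoc (reassoc (tmap UNIV UNIV reassoc (\<lambda>x. x) v)) = reassoc (reassoc v)"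
        by (rule reassoc_pentagon[OF _ _ _ _ v4]) (use X in \<open>auto intro: hmD\<close>)
      then show "(as W X (ten Y K) \<circ> as (ten W X) Y K) v = (?t \<circ> (as W (ten X Y) K \<circ> ?s)) v"
        using v v1 zero_ext_hom[OF s v] tv unfolding o_def by (simp only: zero_ext_in sv)
    qed
  qed
  show "tmz X (ten (hmod_unit H) Y) (zero_ext (mcarr X) (\<lambda>v. v))
         (zero_ext (mcarr (ten (hmod_unit H) Y)) (tens_lift (base H) (mcarr Y) (\<lambda>z v. vscale (counit H z) v))) \<circ> as X (hmod_unit H) Y =
       tmz (ten X (hmod_unit H)) Y (zero_ext (mcarr (ten X (hmod_unit H))) (tens_lift (mcarr X) (base H) (\<lambda>v z. vscale (counit H z) v)))
         (zero_ext (mcarr Y) (\<lambda>v. v))"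
    if X: "hm X" "hm Y" for X Y
    unfolding HH_sel
  proof (rule hmod_hom_eqI)
    let ?t = "tmz X (ten (hmod_unit H) Y) (zero_ext (mcarr X) (\<lambda>v. v)) (zero_ext (mcarr (ten (hmod_unit H) Y)) (lu Y))"
    let ?s = "tmz (ten X (hmod_unit H)) Y (zero_ext (mcarr (ten X (hmod_unit H))) (ru X)) (zero_ext (mcarr Y) (\<lambda>v. v))"
    show "?s \<in> hmod_hom H (ten (ten X (hmod_unit H)) Y) (ten X Y)"
      using X by (intro tmz_hom run_hom hom_id) auto
    have t: "?t \<in> hmod_hom H (ten X (ten (hmod_unit H) Y)) (ten X Y)"
      using X by (intro tmz_hom lun_hom hom_id) auto
    show "?t \<circ> as X (hmod_unit H) Y \<in> hmod_hom H (ten (ten X (hmod_unit H)) Y) (ten X Y)"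
      by (rule hom_cmp[OF _ _ _ as_hom t]) (use X in auto)
    fix v assume v: "v \<in> mcarr (ten (ten X (hmod_unit H)) Y)"
    have v1: "reassoc v \<in> mcarr (ten X (ten (hmod_unit H) Y))" using reassoc_iso(2)[OF X(1) unit_hm X(2)] v by blast
    have sv: "?s v = tmap (tens_space (mcarr X) (base H)) (mcarr Y) (ru X) (\<lambda>x. x) v"
      using v tm_left[OF _ X(2) ten_sub'[OF _ _ v] _ _ ru_lin[OF X(1)] lin_on_id] ten_sub[OF X(1) unit_hm] X by simp
    have tv: "?t (reassoc v) = tmap (mcarr X) (tens_space (base H) (mcarr Y)) (\<lambda>x. x) (lu Y) (reassoc v)"
      using v1 tm_right[OF X(1) _ ten_sub'[OF _ _ v1] _ _ lu_lin[OF X(2)] lin_on_id] ten_sub[OF unit_hm X(2)] X by simp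
    have v3: "v \<in> tens_space (tens_space (mcarr X) (base H)) (mcarr Y)" using ten3_sub[OF X(1) unit_hm X(2) v] by simp
    show "(?t \<circ> as X (hmod_unit H) Y) v = ?s v"
      using v tv sv triangle_full[OF X v3] by (simp only: o_def zero_ext_in)
  qed
qed

subsection \<open>The monoidal structure of the equivalence\<close>

text \<open>The monoidal structure of the equivalence: \<open>\<pi>\<close> restricted to \<open>\<Delta>(1) (F(X) \<otimes> F(Y))\<close>, where it is inverse to
  \<open>\<iota>\<close>, and the inverse \<open>z \<mapsto> z \<eta>\<close> of the isomorphism \<open>Z\<close> from \<open>F(\<one>)\<close> to the base.\<close>

abbreviation "Jm X Y \<equiv> zero_ext (mcarr (ten (Md X) (Md Y))) (Pt X Y)"
abbreviation "ph \<equiv> zero_ext (base H) (\<lambda>z. A U z eta)"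

lemma pres_Md_ten: "\<lbrakk>X \<in> obj C; Y \<in> obj C\<rbrakk> \<Longrightarrow> pres (ten (Md X) (Md Y)) (tobj C X Y) (\<lambda>z. tmap (V X) (V Y) (\<lambda>x. x) (\<lambda>x. x) (io X Y z))"
  using pres_ten[OF pres_Md pres_Md] .

lemma ident_iso: "X \<in> obj C \<Longrightarrow> is_iso C X X (ident C X)"
  by (rule is_isoI[of _ _ _ "ident C X"]) auto

lemma J_iso: assumes "X \<in> obj C" "Y \<in> obj C" shows "is_iso (Rep H) (ten (Md X) (Md Y)) (Md (tobj C X Y)) (Jm X Y)"
proof (rule itw_bij_iso)
  have k: "lin_on (VV X Y) (mcarr (Md (tobj C X Y))) (Pt X Y)" using Pt_lin assms by simp
  have "inj_on (\<lambda>x. x) (V (tobj C X Y))" by simp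
  note p = pres_iso[OF pres_Md_ten[OF assms] pres_Md this ident_iso, of "Pt X Y", OF _ _ _ k]
  have "Pt X Y (tmap (V X) (V Y) (\<lambda>x. x) (\<lambda>x. x) (io X Y z)) = Fm (tobj C X Y) (tobj C X Y) (ident C (tobj C X Y)) z"
    if "z \<in> V (tobj C X Y)" for z using that assms by (simp add: tmap_id)
  moreover have "mcarr (ten (Md X) (Md Y)) \<subseteq> VV X Y" using ten_sub[of "Md X" "Md Y"] assms by simp
  ultimately show "itw (ten (Md X) (Md Y)) (Md (tobj C X Y)) (Pt X Y)" "inj_on (Pt X Y) (mcarr (ten (Md X) (Md Y)))"
    "Pt X Y ` mcarr (ten (Md X) (Md Y)) = mcarr (Md (tobj C X Y))" using p assms by auto
qed (use assms in auto)

lemma ph_iso: "is_iso (Rep H) (hmod_unit H) (Md U) ph"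
proof -
  have k: "lin_on (base H) (mcarr (Md U)) (\<lambda>z. A U z eta)"
    using lin_on_subset[OF bilin_on_lin'[OF A_bil] base_HA subset_refl, of U eta] by simp
  have "inj_on (\<lambda>x. x) (V U)" by simp
  note p = pres_iso[OF pres_unit pres_Md this ident_iso, of "\<lambda>z. A U z eta", OF _ _ _ k]
  have "is_iso (Rep H) (hmod_unit H) (Md U) (zero_ext (mcarr (hmod_unit H)) (\<lambda>z. A U z eta))"
    by (rule itw_bij_iso) (use p in auto)
  then show ?thesis by simp
qed

lemma Md_monoidal: "monoidal_functor C (Rep H) Md Fmz Jm ph"
proof -
  interpret F: linear_functor C "Rep H" Md Fmz by (rule Md_functor)
  interpret D: monoidal_category "Rep H" by (rule Rep_monoidal)
  note [simp] = F.Fm_in[unfolded Rep_sel]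
  have J [simp]: "Jm X Y \<in> hmod_hom H (ten (Md X) (Md Y)) (Md (tobj C X Y))" if "X \<in> obj C" "Y \<in> obj C" for X Y
    using J_iso[OF that] by (simp add: is_iso_def)
  have ph: "ph \<in> hmod_hom H (hmod_unit H) (Md U)" using ph_iso by (simp add: is_iso_def)
  have sub: "v \<in> VV X Y" if "X \<in> obj C" "Y \<in> obj C" "v \<in> mcarr (ten (Md X) (Md Y))" for X Y v
    using ten_sub'[of "Md X" "Md Y" v] that by simp
  show ?thesis
  proof (intro monoidal_functor.intro monoidal_functor_axioms.intro F.linear_functor_axioms D.monoidal_category_axioms
      monoidal_category_axioms)
    show "is_iso (Rep H) (tobj (Rep H) (Md X) (Md Y)) (Md (tobj C X Y)) (Jm X Y)" if "X \<in> obj C" "Y \<in> obj C" for X Y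
      using J_iso[OF that] by simp
    show "is_iso (Rep H) (unit_obj (Rep H)) (Md U) ph" using ph_iso by simp
  next
    fix X X' Y Y' f g
    assume X: "X \<in> obj C" "X' \<in> obj C" "Y \<in> obj C" "Y' \<in> obj C" and f: "f \<in> hom C X X'" "g \<in> hom C Y Y'"
    have t: "tmz (Md X) (Md Y) (Fmz X X' f) (Fmz Y Y' g) \<in> hmod_hom H (ten (Md X) (Md Y)) (ten (Md X') (Md Y'))"
      using X f by (intro tmz_hom) auto
    have "Jm X' Y' \<circ> tmz (Md X) (Md Y) (Fmz X X' f) (Fmz Y Y' g)
       = Fmz (tobj C X Y) (tobj C X' Y') (tmor C X X' Y Y' f g) \<circ> Jm X Y"
    proof (rule hmod_hom_eqI)
      show "Jm X' Y' \<circ> tmz (Md X) (Md Y) (Fmz X X' f) (Fmz Y Y' g) \<in> hmod_hom H (ten (Md X) (Md Y)) (Md (tobj C X' Y'))"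
        by (rule hom_cmp[OF _ _ _ t J]) (use X in auto)
      show "Fmz (tobj C X Y) (tobj C X' Y') (tmor C X X' Y Y' f g) \<circ> Jm X Y \<in> hmod_hom H (ten (Md X) (Md Y)) (Md (tobj C X' Y'))"
        by (rule hom_cmp[OF _ _ _ J Fmz_in]) (use X f in auto)
      fix v assume v: "v \<in> mcarr (ten (Md X) (Md Y))"
      note v' = sub[OF X(1,3) v]
      have "tmap (V X) (V Y) (Fmz X X' f) (Fmz Y Y' g) v = tF X X' Y Y' f g v"
        by (rule tmap_restrict[OF v' Fm_lin Fm_lin]) (use X f in \<open>auto simp: Fmz_def\<close>)
      then have "tmz (Md X) (Md Y) (Fmz X X' f) (Fmz Y Y' g) v = tF X X' Y Y' f g v" using v by simp
      then show "(Jm X' Y' \<circ> tmz (Md X) (Md Y) (Fmz X X' f) (Fmz Y Y' g)) v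
        = (Fmz (tobj C X Y) (tobj C X' Y') (tmor C X X' Y Y' f g) \<circ> Jm X Y) v"
        using zero_ext_hom[OF t v] v v' X f Pt_nat[OF X f v'] by (simp add: Fmz_def)
    qed
    then show "cmp (Rep H) (tobj (Rep H) (Md X) (Md Y)) (tobj (Rep H) (Md X') (Md Y')) (Md (tobj C X' Y')) (Jm X' Y')
        (tmor (Rep H) (Md X) (Md X') (Md Y) (Md Y') (Fmz X X' f) (Fmz Y Y' g)) =
       cmp (Rep H) (tobj (Rep H) (Md X) (Md Y)) (Md (tobj C X Y)) (Md (tobj C X' Y'))
        (Fmz (tobj C X Y) (tobj C X' Y') (tmor C X X' Y Y' f g)) (Jm X Y)" by simp
  next
    fix X Y W assume X: "X \<in> obj C" "Y \<in> obj C" "W \<in> obj C"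
    let ?a = "Fmz (tobj C (tobj C X Y) W) (tobj C X (tobj C Y W)) (associator C X Y W)"
    let ?s = "tmz (ten (Md X) (Md Y)) (Md W) (Jm X Y) (zero_ext (V W) (\<lambda>v. v))"
    let ?t = "tmz (Md X) (ten (Md Y) (Md W)) (zero_ext (V X) (\<lambda>v. v)) (Jm Y W)"
    have s: "?s \<in> hmod_hom H (ten (ten (Md X) (Md Y)) (Md W)) (ten (Md (tobj C X Y)) (Md W))"
      using X hom_id[of "Md W"] by (intro tmz_hom J) auto
    have t: "?t \<in> hmod_hom H (ten (Md X) (ten (Md Y) (Md W))) (ten (Md X) (Md (tobj C Y W)))"
      using X hom_id[of "Md X"] by (intro tmz_hom J) auto
    have "?a \<circ> (Jm (tobj C X Y) W \<circ> ?s) = Jm X (tobj C Y W) \<circ> (?t \<circ> as (Md X) (Md Y) (Md W))"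
    proof (rule hmod_hom_eqI)
      show "?a \<circ> (Jm (tobj C X Y) W \<circ> ?s) \<in> hmod_hom H (ten (ten (Md X) (Md Y)) (Md W)) (Md (tobj C X (tobj C Y W)))"
        by (rule hom_cmp[OF _ _ _ hom_cmp[OF _ _ _ s J] Fmz_in]) (use X in auto)
      show "Jm X (tobj C Y W) \<circ> (?t \<circ> as (Md X) (Md Y) (Md W)) \<in> hmod_hom H (ten (ten (Md X) (Md Y)) (Md W)) (Md (tobj C X (tobj C Y W)))"
        by (rule hom_cmp[OF _ _ _ hom_cmp[OF _ _ _ as_hom t] J]) (use X in auto)
      fix v assume v: "v \<in> mcarr (ten (ten (Md X) (Md Y)) (Md W))"
      have X': "hm (Md X)" "hm (Md Y)" "hm (Md W)" using X by auto
      have v1: "reassoc v \<in> mcarr (ten (Md X) (ten (Md Y) (Md W)))" using reassoc_iso(2)[OF X'] v by blast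
      have v3: "v \<in> VL X Y W" using ten3_sub[OF X' v] by simp
      have sv: "?s v = Pt1 X Y W v"
        using v tm_left[OF _ X'(3) ten_sub'[OF _ _ v] _ _ Pt_lin[OF X(1,2)] lin_on_id, of "zero_ext (V W) (\<lambda>v. v)"] X' ten_sub[OF X'(1,2)] by simp
      have tv: "?t (reassoc v) = Pt2 X Y W (reassoc v)"
        using v1 tm_right[OF X'(1) _ ten_sub'[OF _ _ v1] _ _ Pt_lin[OF X(2,3)] lin_on_id, of "zero_ext (V X) (\<lambda>v. v)"] X' ten_sub[OF X'(2,3)] by simp
      have "(?a \<circ> (Jm (tobj C X Y) W \<circ> ?s)) v = Fm (tobj C (tobj C X Y) W) (tobj C X (tobj C Y W)) (associator C X Y W) (Pt (tobj C X Y) W (Pt1 X Y W v))"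
        using zero_ext_hom[OF s v] X v3 unfolding o_def sv by (simp add: Fmz_def)
      moreover have "(Jm X (tobj C Y W) \<circ> (?t \<circ> as (Md X) (Md Y) (Md W))) v = Pt X (tobj C Y W) (Pt2 X Y W (reassoc v))"
        using zero_ext_hom[OF t v1] v unfolding o_def by (simp only: zero_ext_in tv)
      ultimately show "(?a \<circ> (Jm (tobj C X Y) W \<circ> ?s)) v = (Jm X (tobj C Y W) \<circ> (?t \<circ> as (Md X) (Md Y) (Md W))) v"
        using Pt_assoc[OF X v3] by simp
    qed
    then show "cmp (Rep H) (tobj (Rep H) (tobj (Rep H) (Md X) (Md Y)) (Md W)) (Md (tobj C (tobj C X Y) W)) (Md (tobj C X (tobj C Y W)))
        ?a (cmp (Rep H) (tobj (Rep H) (tobj (Rep H) (Md X) (Md Y)) (Md W)) (tobj (Rep H) (Md (tobj C X Y)) (Md W)) (Md (tobj C (tobj C X Y) W))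
          (Jm (tobj C X Y) W) (tmor (Rep H) (tobj (Rep H) (Md X) (Md Y)) (Md (tobj C X Y)) (Md W) (Md W) (Jm X Y) (ident (Rep H) (Md W)))) =
       cmp (Rep H) (tobj (Rep H) (tobj (Rep H) (Md X) (Md Y)) (Md W)) (tobj (Rep H) (Md X) (Md (tobj C Y W))) (Md (tobj C X (tobj C Y W)))
        (Jm X (tobj C Y W)) (cmp (Rep H) (tobj (Rep H) (tobj (Rep H) (Md X) (Md Y)) (Md W)) (tobj (Rep H) (Md X) (tobj (Rep H) (Md Y) (Md W)))
          (tobj (Rep H) (Md X) (Md (tobj C Y W)))
          (tmor (Rep H) (Md X) (Md X) (tobj (Rep H) (Md Y) (Md W)) (Md (tobj C Y W)) (ident (Rep H) (Md X)) (Jm Y W))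
          (associator (Rep H) (Md X) (Md Y) (Md W)))" by simp
  next
    fix X assume X: "X \<in> obj C"
    let ?t = "tmz (hmod_unit H) (Md X) ph (zero_ext (V X) (\<lambda>v. v))"
    have t: "?t \<in> hmod_hom H (ten (hmod_unit H) (Md X)) (ten (Md U) (Md X))"
      using X hom_id[of "Md X"] ph by (intro tmz_hom) auto
    have "Fmz (tobj C U X) X (lunit C X) \<circ> (Jm U X \<circ> ?t) = zero_ext (mcarr (ten (hmod_unit H) (Md X))) (lu (Md X))"
    proof (rule hmod_hom_eqI)
      show "Fmz (tobj C U X) X (lunit C X) \<circ> (Jm U X \<circ> ?t) \<in> hmod_hom H (ten (hmod_unit H) (Md X)) (Md X)"
        by (rule hom_cmp[OF _ _ _ hom_cmp[OF _ _ _ t J] Fmz_in]) (use X in auto)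
      show "zero_ext (mcarr (ten (hmod_unit H) (Md X))) (lu (Md X)) \<in> hmod_hom H (ten (hmod_unit H) (Md X)) (Md X)"
        by (rule lun_hom) (use X in simp)
      fix v assume v: "v \<in> mcarr (ten (hmod_unit H) (Md X))"
      have pX: "pres (Md X) X (\<lambda>x. x)" by (rule pres_Md[OF X])
      obtain z where z: "z \<in> V (tobj C U X)" "v = tmap (V U) (V X) Z (\<lambda>x. x) (io U X z)"
        using v presD(3)[OF pres_ten[OF pres_unit pX]] by auto
      have Zl: "lin_on (V U) (base H) Z" using presD(2)[OF pres_unit] by simp
      have pl: "lin_on (base H) (V U) ph" using hmod_homD(1)[OF ph] by simp
      have i: "lin_on (V X) (V X) (zero_ext (V X) (\<lambda>v. v))" by simp
      have "?t v = tmap (base H) (V X) ph (zero_ext (V X) (\<lambda>v. v)) v" using v by simp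
      also have "\<dots> = tmap (V U) (V X) (\<lambda>x. ph (Z x)) (\<lambda>x. zero_ext (V X) (\<lambda>v. v) x) (io U X z)"
        unfolding z(2) by (rule tmap_cmp[OF Zl lin_on_id pl i]) (use z X in auto)
      also have "\<dots> = io U X z"
        by (rule tmap_id) (use z X in \<open>auto simp: base_Z\<close>)
      finally have tv: "?t v = io U X z" .
      show "(Fmz (tobj C U X) X (lunit C X) \<circ> (Jm U X \<circ> ?t)) v = zero_ext (mcarr (ten (hmod_unit H) (Md X))) (lu (Md X)) v"
        using zero_ext_hom[OF t v] v z lu_pres[OF pX z(1)] X unfolding o_def tv by (simp add: Fmz_def)
    qed
    then show "cmp (Rep H) (tobj (Rep H) (unit_obj (Rep H)) (Md X)) (Md (tobj C U X)) (Md X) (Fmz (tobj C U X) X (lunit C X))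
        (cmp (Rep H) (tobj (Rep H) (unit_obj (Rep H)) (Md X)) (tobj (Rep H) (Md U) (Md X)) (Md (tobj C U X)) (Jm U X)
          (tmor (Rep H) (unit_obj (Rep H)) (Md U) (Md X) (Md X) ph (ident (Rep H) (Md X)))) = lunit (Rep H) (Md X)" by simp
  next
    fix X assume X: "X \<in> obj C"
    let ?t = "tmz (Md X) (hmod_unit H) (zero_ext (V X) (\<lambda>v. v)) ph"
    have t: "?t \<in> hmod_hom H (ten (Md X) (hmod_unit H)) (ten (Md X) (Md U))"
      using X hom_id[of "Md X"] ph by (intro tmz_hom) auto
    have "Fmz (tobj C X U) X (runit C X) \<circ> (Jm X U \<circ> ?t) = zero_ext (mcarr (ten (Md X) (hmod_unit H))) (ru (Md X))"
    proof (rule hmod_hom_eqI)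
      show "Fmz (tobj C X U) X (runit C X) \<circ> (Jm X U \<circ> ?t) \<in> hmod_hom H (ten (Md X) (hmod_unit H)) (Md X)"
        by (rule hom_cmp[OF _ _ _ hom_cmp[OF _ _ _ t J] Fmz_in]) (use X in auto)
      show "zero_ext (mcarr (ten (Md X) (hmod_unit H))) (ru (Md X)) \<in> hmod_hom H (ten (Md X) (hmod_unit H)) (Md X)"
        by (rule run_hom) (use X in simp)
      fix v assume v: "v \<in> mcarr (ten (Md X) (hmod_unit H))"
      have pX: "pres (Md X) X (\<lambda>x. x)" by (rule pres_Md[OF X])
      obtain z where z: "z \<in> V (tobj C X U)" "v = tmap (V X) (V U) (\<lambda>x. x) Z (io X U z)"
        using v presD(3)[OF pres_ten[OF pX pres_unit]] by auto
      have Zl: "lin_on (V U) (base H) Z" using presD(2)[OF pres_unit] by simp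
      have pl: "lin_on (base H) (V U) ph" using hmod_homD(1)[OF ph] by simp
      have i: "lin_on (V X) (V X) (zero_ext (V X) (\<lambda>v. v))" by simp
      have "?t v = tmap (V X) (base H) (zero_ext (V X) (\<lambda>v. v)) ph v" using v by simp
      also have "\<dots> = tmap (V X) (V U) (\<lambda>x. zero_ext (V X) (\<lambda>v. v) x) (\<lambda>x. ph (Z x)) (io X U z)"
        unfolding z(2) by (rule tmap_cmp[OF lin_on_id Zl i pl]) (use z X in auto)
      also have "\<dots> = io X U z"
        by (rule tmap_id) (use z X in \<open>auto simp: base_Z\<close>)
      finally have tv: "?t v = io X U z" .
      show "(Fmz (tobj C X U) X (runit C X) \<circ> (Jm X U \<circ> ?t)) v = zero_ext (mcarr (ten (Md X) (hmod_unit H))) (ru (Md X)) v"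
        using zero_ext_hom[OF t v] v z ru_pres[OF pX z(1)] X unfolding o_def tv by (simp add: Fmz_def)
    qed
    then show "cmp (Rep H) (tobj (Rep H) (Md X) (unit_obj (Rep H))) (Md (tobj C X U)) (Md X) (Fmz (tobj C X U) X (runit C X))
        (cmp (Rep H) (tobj (Rep H) (Md X) (unit_obj (Rep H))) (tobj (Rep H) (Md X) (Md U)) (Md (tobj C X U)) (Jm X U)
          (tmor (Rep H) (Md X) (Md X) (unit_obj (Rep H)) (Md U) (ident (Rep H) (Md X)) ph)) = runit (Rep H) (Md X)" by simp
  qed
qed

theorem reconstruction:
  "\<exists>H :: 'k wbialg. weak_bialgebra H \<and> monoidally_equivalent C (Rep H) \<and> commutative_base H"
  using weak_bialgebra_H commutative_base_H Md_monoidal Md_equivalence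
  unfolding monoidally_equivalent_def by blast

end

section \<open>The canonical fibre functor\<close>

context monoidal_category
begin

definition ainv where
  "ainv X Y W = (SOME b. b \<in> hom C (tobj C X (tobj C Y W)) (tobj C (tobj C X Y) W) \<and>
     cmp C (tobj C (tobj C X Y) W) (tobj C X (tobj C Y W)) (tobj C (tobj C X Y) W) b (associator C X Y W) = ident C (tobj C (tobj C X Y) W) \<and>
     cmp C (tobj C X (tobj C Y W)) (tobj C (tobj C X Y) W) (tobj C X (tobj C Y W)) (associator C X Y W) b = ident C (tobj C X (tobj C Y W)))"

lemma ainv:
  assumes "X \<in> obj C" "Y \<in> obj C" "W \<in> obj C"
  shows ainv_in [simp]: "ainv X Y W \<in> hom C (tobj C X (tobj C Y W)) (tobj C (tobj C X Y) W)"
    and ainv_left: "cmp C (tobj C (tobj C X Y) W) (tobj C X (tobj C Y W)) (tobj C (tobj C X Y) W) (ainv X Y W) (associator C X Y W) = ident C (tobj C (tobj C X Y) W)"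
    and ainv_right: "cmp C (tobj C X (tobj C Y W)) (tobj C (tobj C X Y) W) (tobj C X (tobj C Y W)) (associator C X Y W) (ainv X Y W) = ident C (tobj C X (tobj C Y W))"
proof -
  have "\<exists>b. b \<in> hom C (tobj C X (tobj C Y W)) (tobj C (tobj C X Y) W) \<and>
     cmp C (tobj C (tobj C X Y) W) (tobj C X (tobj C Y W)) (tobj C (tobj C X Y) W) b (associator C X Y W) = ident C (tobj C (tobj C X Y) W) \<and>
     cmp C (tobj C X (tobj C Y W)) (tobj C (tobj C X Y) W) (tobj C X (tobj C Y W)) (associator C X Y W) b = ident C (tobj C X (tobj C Y W))"
    using associator_iso[OF assms] unfolding is_iso_def by blast
  from someI_ex[OF this] show "ainv X Y W \<in> hom C (tobj C X (tobj C Y W)) (tobj C (tobj C X Y) W)"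
    "cmp C (tobj C (tobj C X Y) W) (tobj C X (tobj C Y W)) (tobj C (tobj C X Y) W) (ainv X Y W) (associator C X Y W) = ident C (tobj C (tobj C X Y) W)"
    "cmp C (tobj C X (tobj C Y W)) (tobj C (tobj C X Y) W) (tobj C X (tobj C Y W)) (associator C X Y W) (ainv X Y W) = ident C (tobj C X (tobj C Y W))"
    unfolding ainv_def by blast+
qed

lemma a_ainv [simp]:
  assumes "X \<in> obj C" "Y \<in> obj C" "W \<in> obj C" "T \<in> obj C" "f \<in> hom C T (tobj C X (tobj C Y W))"
  shows "cmp C T (tobj C (tobj C X Y) W) (tobj C X (tobj C Y W)) (associator C X Y W) (cmp C T (tobj C X (tobj C Y W)) (tobj C (tobj C X Y) W) (ainv X Y W) f) = f"
  using cmp_assoc[of T "tobj C X (tobj C Y W)" "tobj C (tobj C X Y) W" "tobj C X (tobj C Y W)" f "ainv X Y W" "associator C X Y W"]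
    assms by (simp add: ainv_right)

lemma ainv_a [simp]:
  assumes "X \<in> obj C" "Y \<in> obj C" "W \<in> obj C" "T \<in> obj C" "f \<in> hom C T (tobj C (tobj C X Y) W)"
  shows "cmp C T (tobj C X (tobj C Y W)) (tobj C (tobj C X Y) W) (ainv X Y W) (cmp C T (tobj C (tobj C X Y) W) (tobj C X (tobj C Y W)) (associator C X Y W) f) = f"
  using cmp_assoc[of T "tobj C (tobj C X Y) W" "tobj C X (tobj C Y W)" "tobj C (tobj C X Y) W" f "associator C X Y W" "ainv X Y W"]
    assms by (simp add: ainv_left)

lemma a_cancel:
  assumes "X \<in> obj C" "Y \<in> obj C" "W \<in> obj C" "T \<in> obj C" "f \<in> hom C T (tobj C (tobj C X Y) W)" "g \<in> hom C T (tobj C (tobj C X Y) W)"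
    "cmp C T (tobj C (tobj C X Y) W) (tobj C X (tobj C Y W)) (associator C X Y W) f = cmp C T (tobj C (tobj C X Y) W) (tobj C X (tobj C Y W)) (associator C X Y W) g"
  shows "f = g"
  using iso_cancel_left[OF _ _ _ associator_iso assms(5-7)] assms(1-4) by simp

lemma lw_cmp2:
  assumes "W \<in> obj C" "X \<in> obj C" "Y \<in> obj C" "Z \<in> obj C" "T \<in> obj C" "f \<in> hom C X Y" "g \<in> hom C Y Z" "k \<in> hom C T (tobj C W X)"
  shows "cmp C T (tobj C W Y) (tobj C W Z) (tmor C W W Y Z (ident C W) g) (cmp C T (tobj C W X) (tobj C W Y) (tmor C W W X Y (ident C W) f) k)
    = cmp C T (tobj C W X) (tobj C W Z) (tmor C W W X Z (ident C W) (cmp C X Y Z g f)) k"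
  using assms by (simp add: cmp_assoc flip: lw_cmp[of W X Y Z f g])

lemma tmor_hzero_right [simp]:
  assumes "X \<in> obj C" "X' \<in> obj C" "Y \<in> obj C" "Y' \<in> obj C" "f \<in> hom C X X'"
  shows "tmor C X X' Y Y' f (hzero C Y Y') = hzero C (tobj C X Y) (tobj C X' Y')"
  using tmor_scale_right[of X X' Y Y' f "hzero C Y Y'" 0] assms by simp

lemma tmor_hom_sum_right:
  assumes "X \<in> obj C" "X' \<in> obj C" "Y \<in> obj C" "Y' \<in> obj C" "f \<in> hom C X X'" "\<And>j. j < m \<Longrightarrow> g j \<in> hom C Y Y'"
  shows "tmor C X X' Y Y' f (hom_sum C Y Y' g m) = hom_sum C (tobj C X Y) (tobj C X' Y') (\<lambda>j. tmor C X X' Y Y' f (g j)) m"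
  using assms(6) by (induction m) (use assms(1-5) in \<open>simp_all add: tmor_add_right\<close>)

end

text \<open>A split semisimple monoidal category with a choice of coordinates on every space of morphisms.\<close>

locale split_monoidal = monoidal_category C
  for C :: "('o, 'm, 'k::field, 'z) mon_cat_scheme" +
  fixes n :: nat and S :: "nat \<Rightarrow> 'o" and dim :: "'o \<Rightarrow> 'o \<Rightarrow> nat"
    and cr :: "'o \<Rightarrow> 'o \<Rightarrow> 'm \<Rightarrow> 'k seq" and dc :: "'o \<Rightarrow> 'o \<Rightarrow> 'k seq \<Rightarrow> 'm"
  assumes S_obj [simp]: "\<And>i. i < n \<Longrightarrow> S i \<in> obj C"
    and S_nz: "\<And>i. i < n \<Longrightarrow> ident C (S i) \<noteq> hzero C (S i) (S i)"
    and schur_eq: "\<And>i f. \<lbrakk>i < n; f \<in> hom C (S i) (S i)\<rbrakk> \<Longrightarrow> \<exists>c. f = hscale C (S i) (S i) c (ident C (S i))"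
    and schur_neq: "\<And>i j f. \<lbrakk>i < n; j < n; i \<noteq> j; f \<in> hom C (S i) (S j)\<rbrakk> \<Longrightarrow> f = hzero C (S i) (S j)"
    and decomp: "\<And>X. X \<in> obj C \<Longrightarrow> \<exists>m \<sigma> i p. (\<forall>j<m. \<sigma> j < n) \<and> direct_sum C m (\<lambda>j. S (\<sigma> j)) X i p"
    and sums: "\<And>m \<sigma>. \<forall>j<m. \<sigma> j < n \<Longrightarrow> \<exists>X i p. direct_sum C m (\<lambda>j. S (\<sigma> j)) X i p"
    and cr_in: "\<And>X Y f. \<lbrakk>X \<in> obj C; Y \<in> obj C; f \<in> hom C X Y\<rbrakk> \<Longrightarrow> cr X Y f \<in> csp {..<dim X Y}"
    and dc_in: "\<And>X Y v. \<lbrakk>X \<in> obj C; Y \<in> obj C; v \<in> csp {..<dim X Y}\<rbrakk> \<Longrightarrow> dc X Y v \<in> hom C X Y"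
    and dc_cr: "\<And>X Y f. \<lbrakk>X \<in> obj C; Y \<in> obj C; f \<in> hom C X Y\<rbrakk> \<Longrightarrow> dc X Y (cr X Y f) = f"
    and cr_dc: "\<And>X Y v. \<lbrakk>X \<in> obj C; Y \<in> obj C; v \<in> csp {..<dim X Y}\<rbrakk> \<Longrightarrow> cr X Y (dc X Y v) = v"
    and cr_add: "\<And>X Y f g. \<lbrakk>X \<in> obj C; Y \<in> obj C; f \<in> hom C X Y; g \<in> hom C X Y\<rbrakk> \<Longrightarrow> cr X Y (hadd C X Y f g) = cr X Y f + cr X Y g"
    and cr_scale: "\<And>X Y f a. \<lbrakk>X \<in> obj C; Y \<in> obj C; f \<in> hom C X Y\<rbrakk> \<Longrightarrow> cr X Y (hscale C X Y a f) = vscale a (cr X Y f)"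
begin

lemma csp_closed [simp]: "u \<in> csp A \<Longrightarrow> v \<in> csp A \<Longrightarrow> u + v \<in> csp A" "v \<in> csp A \<Longrightarrow> vscale c v \<in> csp A"
  "0 \<in> csp A" for u v :: "'k seq"
  using subspace_csp[of A] by (auto intro: vec.subspace_add vec.subspace_scale vec.subspace_0)

lemma csp_sum: "(\<And>i. i \<in> I \<Longrightarrow> f i \<in> csp A) \<Longrightarrow> sum f I \<in> csp A"
  for f :: "'i \<Rightarrow> 'k seq"
  by (rule vec.subspace_sum[OF subspace_csp])

lemma dc_add: "\<lbrakk>X \<in> obj C; Y \<in> obj C; u \<in> csp {..<dim X Y}; v \<in> csp {..<dim X Y}\<rbrakk> \<Longrightarrow> dc X Y (u + v) = hadd C X Y (dc X Y u) (dc X Y v)"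
  using dc_cr[of X Y "hadd C X Y (dc X Y u) (dc X Y v)"] by (simp add: cr_add cr_dc dc_in)

lemma dc_scale: "\<lbrakk>X \<in> obj C; Y \<in> obj C; u \<in> csp {..<dim X Y}\<rbrakk> \<Longrightarrow> dc X Y (vscale a u) = hscale C X Y a (dc X Y u)"
  using dc_cr[of X Y "hscale C X Y a (dc X Y u)"] by (simp add: cr_scale cr_dc dc_in)

subsection \<open>Coordinates\<close>

text \<open>A vector of \<open>F(X)\<close> is indexed by triples \<open>(i, j, a)\<close>, where \<open>a\<close> is the index of a coordinate in
  \<open>Hom(S\<^sub>i, X \<otimes> S\<^sub>j)\<close>.\<close>

definition ii :: "nat \<Rightarrow> nat" where "ii m = fst (prod_decode m)"
definition jj :: "nat \<Rightarrow> nat" where "jj m = fst (prod_decode (snd (prod_decode m)))"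
definition aa :: "nat \<Rightarrow> nat" where "aa m = snd (prod_decode (snd (prod_decode m)))"
definition enc :: "nat \<Rightarrow> nat \<Rightarrow> nat \<Rightarrow> nat" where "enc i j a = prod_encode (i, prod_encode (j, a))"

lemma enc_simps [simp]: "ii (enc i j a) = i" "jj (enc i j a) = j" "aa (enc i j a) = a" "enc (ii m) (jj m) (aa m) = m"
  by (auto simp: ii_def jj_def aa_def enc_def)

abbreviation "d X i j \<equiv> dim (S i) (tobj C X (S j))"
abbreviation "hm X i j \<equiv> hom C (S i) (tobj C X (S j))"

definition BB :: "'o \<Rightarrow> nat set" where
  "BB X = {m. ii m < n \<and> jj m < n \<and> aa m < d X (ii m) (jj m)}"

lemma BB_fin: "finite (BB X)"
proof -
  have "BB X \<subseteq> (\<lambda>(i, j, a). enc i j a) ` (SIGMA i:{..<n}. SIGMA j:{..<n}. {..<d X i j})"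
  proof
    fix m assume "m \<in> BB X"
    then have "(ii m, jj m, aa m) \<in> (SIGMA i:{..<n}. SIGMA j:{..<n}. {..<d X i j})" by (auto simp: BB_def)
    then show "m \<in> (\<lambda>(i, j, a). enc i j a) ` (SIGMA i:{..<n}. SIGMA j:{..<n}. {..<d X i j})"
      by (rule rev_image_eqI) simp
  qed
  then show ?thesis by (rule finite_subset) auto
qed

abbreviation "V X \<equiv> (csp (BB X) :: 'k seq set)"

text \<open>The embedding of the block \<open>Hom(S\<^sub>i, X \<otimes> S\<^sub>j)\<close> into \<open>F(X)\<close>, and the projection to it.\<close>

definition em :: "'o \<Rightarrow> nat \<Rightarrow> nat \<Rightarrow> 'm \<Rightarrow> 'k seq" where
  "em X i j f = (\<lambda>m. if ii m = i \<and> jj m = j then cr (S i) (tobj C X (S j)) f (aa m) else 0)"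

definition co :: "'o \<Rightarrow> nat \<Rightarrow> nat \<Rightarrow> 'k seq \<Rightarrow> 'm" where
  "co X i j x = dc (S i) (tobj C X (S j)) (\<lambda>a. x (enc i j a))"

context
  fixes X assumes X [simp]: "X \<in> obj C"
begin

lemma em_in [simp]: "\<lbrakk>i < n; j < n; f \<in> hm X i j\<rbrakk> \<Longrightarrow> em X i j f \<in> V X"
  using cr_in[of "S i" "tobj C X (S j)" f] by (auto simp: em_def csp_def BB_def)

lemma em_add: "\<lbrakk>i < n; j < n; f \<in> hm X i j; g \<in> hm X i j\<rbrakk>
    \<Longrightarrow> em X i j (hadd C (S i) (tobj C X (S j)) f g) = em X i j f + em X i j g"
  by (auto simp: em_def fun_eq_iff cr_add fun_apply)

lemma em_scale: "\<lbrakk>i < n; j < n; f \<in> hm X i j\<rbrakk>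
    \<Longrightarrow> em X i j (hscale C (S i) (tobj C X (S j)) c f) = vscale c (em X i j f)"
  by (auto simp: em_def fun_eq_iff cr_scale vscale_def)

lemma em_0 [simp]: "\<lbrakk>i < n; j < n\<rbrakk> \<Longrightarrow> em X i j (hzero C (S i) (tobj C X (S j))) = 0"
  using em_scale[of i j "hzero C (S i) (tobj C X (S j))" 0] by simp

lemma em_hom_sum:
  assumes "i < n" "j < n" "\<And>l. l < m \<Longrightarrow> f l \<in> hm X i j"
  shows "em X i j (hom_sum C (S i) (tobj C X (S j)) f m) = (\<Sum>l<m. em X i j (f l))"
  using assms(3) by (induction m) (use assms(1,2) in \<open>simp_all add: em_add\<close>)

lemma block_csp: "\<lbrakk>x \<in> V X; i < n; j < n\<rbrakk> \<Longrightarrow> (\<lambda>a. x (enc i j a)) \<in> csp {..<d X i j}"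
  by (auto simp: csp_def BB_def)

lemma co_in [simp]: "\<lbrakk>x \<in> V X; i < n; j < n\<rbrakk> \<Longrightarrow> co X i j x \<in> hm X i j"
  unfolding co_def by (rule dc_in) (auto simp: block_csp)

lemma co_add: "\<lbrakk>x \<in> V X; y \<in> V X; i < n; j < n\<rbrakk> \<Longrightarrow> co X i j (x + y) = hadd C (S i) (tobj C X (S j)) (co X i j x) (co X i j y)"
  using dc_add[of "S i" "tobj C X (S j)", OF _ _ block_csp block_csp] by (simp add: co_def plus_fun_def fun_apply)

lemma co_scale: "\<lbrakk>x \<in> V X; i < n; j < n\<rbrakk> \<Longrightarrow> co X i j (vscale c x) = hscale C (S i) (tobj C X (S j)) c (co X i j x)"
  using dc_scale[of "S i" "tobj C X (S j)", OF _ _ block_csp] by (simp add: co_def vscale_def)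

lemma co_em:
  assumes "i < n" "j < n" "i' < n" "j' < n" "f \<in> hm X i j"
  shows "co X i' j' (em X i j f) = (if i' = i \<and> j' = j then f else hzero C (S i') (tobj C X (S j')))"
proof (cases "i' = i \<and> j' = j")
  case True
  then show ?thesis using assms by (simp add: co_def em_def dc_cr)
next
  case False
  then have "co X i' j' (em X i j f) = dc (S i') (tobj C X (S j')) 0" by (auto simp: co_def em_def zero_fun_def)
  also have "\<dots> = hzero C (S i') (tobj C X (S j'))"
    using dc_scale[of "S i'" "tobj C X (S j')" 0 0] assms by (simp add: dc_in)
  finally show ?thesis unfolding if_not_P[OF False] .
qed

lemma em_co: assumes x: "x \<in> V X" shows "x = (\<Sum>i<n. \<Sum>j<n. em X i j (co X i j x))"
proof
  fix m
  have "(\<Sum>i<n. \<Sum>j<n. em X i j (co X i j x)) m = (\<Sum>i<n. \<Sum>j<n. if ii m = i \<and> jj m = j then x m else 0)"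
    unfolding fun_sum_apply
  proof (intro sum.cong refl)
    fix i j assume ij: "i \<in> {..<n}" "j \<in> {..<n}"
    have "cr (S i) (tobj C X (S j)) (co X i j x) = (\<lambda>a. x (enc i j a))"
      unfolding co_def by (rule cr_dc) (use ij x block_csp in auto)
    then show "em X i j (co X i j x) m = (if ii m = i \<and> jj m = j then x m else 0)" by (auto simp: em_def)
  qed
  also have "\<dots> = (\<Sum>i<n. if ii m = i then \<Sum>j<n. if jj m = j then x m else 0 else 0)"
    by (intro sum.cong refl) auto
  also have "\<dots> = (if ii m < n \<and> jj m < n then x m else 0)" by simp
  also have "\<dots> = x m" using x by (auto simp: csp_def BB_def)
  finally show "x m = (\<Sum>i<n. \<Sum>j<n. em X i j (co X i j x)) m" by simp
qed

end

text \<open>Elements of a single block generate \<open>F(X)\<close>, so additive identities reduce to diagrams in \<open>C\<close>.\<close>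

lemma em_induct [consumes 2, case_names zero em add]:
  assumes X: "X \<in> obj C" and x: "x \<in> V X" and "Q 0"
    and em: "\<And>i j f. \<lbrakk>i < n; j < n; f \<in> hm X i j\<rbrakk> \<Longrightarrow> Q (em X i j f)"
    and add: "\<And>u w. \<lbrakk>u \<in> V X; w \<in> V X; Q u; Q w\<rbrakk> \<Longrightarrow> Q (u + w)"
  shows "Q x"
proof -
  have sum: "Q (sum f {..<m}) \<and> sum f {..<m} \<in> V X" if "\<And>i. i < m \<Longrightarrow> Q (f i) \<and> f i \<in> V X" for f and m :: nat
    using that
  proof (induction m)
    case (Suc m)
    then show ?case using add[of "sum f {..<m}" "f m"] by (simp add: add.commute)
  qed (use \<open>Q 0\<close> in simp)
  have "Q (\<Sum>i<n. \<Sum>j<n. em X i j (co X i j x))"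
    using em X x by (intro sum[THEN conjunct1] sum) auto
  then show ?thesis using em_co[OF X x] by (rule back_subst[of Q, OF _ sym])
qed

definition hl :: "'o \<Rightarrow> 'o \<Rightarrow> 'o \<Rightarrow> 'o \<Rightarrow> ('m \<Rightarrow> 'm) \<Rightarrow> bool" where
  "hl X Y X' Y' F \<longleftrightarrow> (\<forall>f\<in>hom C X Y. F f \<in> hom C X' Y') \<and>
     (\<forall>f\<in>hom C X Y. \<forall>g\<in>hom C X Y. F (hadd C X Y f g) = hadd C X' Y' (F f) (F g)) \<and>
     (\<forall>a. \<forall>f\<in>hom C X Y. F (hscale C X Y a f) = hscale C X' Y' a (F f))"

lemma em_hl_lin:
  assumes X: "X \<in> obj C" "Y \<in> obj C" "i < n" "j < n" "i' < n" "j' < n"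
    and F: "hl (S i) (tobj C X (S j)) (S i') (tobj C Y (S j')) F"
  shows "lin_on (V X) (V Y) (\<lambda>x. em Y i' j' (F (co X i j x)))"
  by (rule lin_onI) (use X F co_in[OF X(1)] in \<open>simp_all add: hl_def co_add co_scale em_add em_scale\<close>)

subsection \<open>The functor\<close>

abbreviation "rw X Y j f \<equiv> tmor C X Y (S j) (S j) f (ident C (S j))"

definition Fm :: "'o \<Rightarrow> 'o \<Rightarrow> 'm \<Rightarrow> 'k seq \<Rightarrow> 'k seq" where
  "Fm X Y f x = (\<Sum>i<n. \<Sum>j<n. em Y i j (cmp C (S i) (tobj C X (S j)) (tobj C Y (S j)) (rw X Y j f) (co X i j x)))"

lemma hl_cmp:
  assumes "T \<in> obj C" "X \<in> obj C" "Y \<in> obj C" "f \<in> hom C X Y"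
  shows "hl T X T Y (\<lambda>g. cmp C T X Y f g)"
  using assms by (auto simp: hl_def cmp_add_right cmp_scale_right)

lemma Fm_lin:
  assumes "X \<in> obj C" "Y \<in> obj C" "f \<in> hom C X Y"
  shows "lin_on (V X) (V Y) (Fm X Y f)"
  unfolding Fm_def
  by (intro lin_on_sumI em_hl_lin hl_cmp subspace_csp) (use assms in auto)

lemma sum_delta2:
  fixes g :: "nat \<Rightarrow> nat \<Rightarrow> 'k seq"
  assumes "a < n" "b < n" "\<And>i j. \<lbrakk>i < n; j < n; \<not> (i = a \<and> j = b)\<rbrakk> \<Longrightarrow> g i j = 0"
  shows "(\<Sum>i<n. \<Sum>j<n. g i j) = g a b"
proof -
  have "(\<Sum>i<n. \<Sum>j<n. g i j) = (\<Sum>i<n. \<Sum>j<n. if j = b then (if i = a then g a b else 0) else 0)"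
    by (intro sum.cong refl) (use assms in auto)
  also have "\<dots> = g a b" using assms(1,2) by simp
  finally show ?thesis .
qed

lemma Fm_em:
  assumes "X \<in> obj C" "Y \<in> obj C" "f \<in> hom C X Y" "i < n" "j < n" "g \<in> hm X i j"
  shows "Fm X Y f (em X i j g) = em Y i j (cmp C (S i) (tobj C X (S j)) (tobj C Y (S j)) (rw X Y j f) g)"
  unfolding Fm_def by (subst sum_delta2[of i j]) (use assms in \<open>auto simp: co_em\<close>)

lemma Fm_in [simp]: "\<lbrakk>X \<in> obj C; Y \<in> obj C; f \<in> hom C X Y; x \<in> V X\<rbrakk> \<Longrightarrow> Fm X Y f x \<in> V Y"
  using lin_on_in[OF Fm_lin] .

lemma Fm_add: "\<lbrakk>X \<in> obj C; Y \<in> obj C; f \<in> hom C X Y; u \<in> V X; v \<in> V X\<rbrakk> \<Longrightarrow> Fm X Y f (u + v) = Fm X Y f u + Fm X Y f v"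
  using lin_on_add[OF Fm_lin] .

lemma Fm_0 [simp]: "\<lbrakk>X \<in> obj C; Y \<in> obj C; f \<in> hom C X Y\<rbrakk> \<Longrightarrow> Fm X Y f 0 = 0"
  using lin_on_0[OF Fm_lin] by simp

text \<open>If all \<open>Hom(S\<^sub>k, S\<^sub>i \<otimes> S\<^sub>j)\<close> vanish, then \<open>S\<^sub>i \<otimes> S\<^sub>j = 0\<close> for all \<open>j\<close> by semisimplicity. Decomposing
  \<open>\<one>\<close> gives \<open>S\<^sub>i \<otimes> \<one> = 0\<close>, and hence \<open>S\<^sub>i = 0\<close>.\<close>

lemma BB_ne: assumes i: "i < n" shows "BB (S i) \<noteq> {}"
proof
  assume e: "BB (S i) = {}"
  have zero: "f = hzero C (S k) (tobj C (S i) (S j))" if f: "k < n" "j < n" "f \<in> hm (S i) k j" for k j f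
  proof -
    have "enc k j 0 \<notin> BB (S i)" using e by simp
    then have "d (S i) k j = 0" using f by (simp add: BB_def)
    then have "cr (S k) (tobj C (S i) (S j)) f = cr (S k) (tobj C (S i) (S j)) (hzero C (S k) (tobj C (S i) (S j)))"
      using cr_in[of "S k" "tobj C (S i) (S j)" f] cr_in[of "S k" "tobj C (S i) (S j)" "hzero C (S k) (tobj C (S i) (S j))"] f i
      by (auto simp: csp_def fun_eq_iff)
    then show ?thesis using dc_cr f i by (metis S_obj hom_facts(1) tobj_in)
  qed
  have id0: "ident C (tobj C (S i) (S j)) = hzero C (tobj C (S i) (S j)) (tobj C (S i) (S j))" if j: "j < n" for j
  proof -
    let ?X = "tobj C (S i) (S j)"
    have X: "?X \<in> obj C" using i j by simp
    obtain m \<sigma> q p where \<sigma>: "\<And>j. j < m \<Longrightarrow> \<sigma> j < n" and ds: "direct_sum C m (\<lambda>j. S (\<sigma> j)) ?X q p"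
      using decomp[OF X] by blast
    show ?thesis
      by (rule direct_sum_cancel_incl[OF ds X]) (use X zero[OF \<sigma> j] direct_sumD[OF ds] \<sigma> in auto)
  qed
  obtain m \<sigma> q p where \<sigma>: "\<And>j. j < m \<Longrightarrow> \<sigma> j < n" and ds: "direct_sum C m (\<lambda>j. S (\<sigma> j)) U q p"
    using decomp[OF unit_obj_in] by blast
  note dd = direct_sumD[OF ds]
  have "tmor C (S i) (S i) U (S (\<sigma> j)) (ident C (S i)) (p j) = hzero C (tobj C (S i) U) (tobj C (S i) (S (\<sigma> j)))" if j: "j < m" for j
  proof -
    have "tmor C (S i) (S i) U (S (\<sigma> j)) (ident C (S i)) (p j)
      = cmp C (tobj C (S i) U) (tobj C (S i) (S (\<sigma> j))) (tobj C (S i) (S (\<sigma> j))) (ident C (tobj C (S i) (S (\<sigma> j))))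
          (tmor C (S i) (S i) U (S (\<sigma> j)) (ident C (S i)) (p j))"
      using i j \<sigma> dd by simp
    also have "\<dots> = hzero C (tobj C (S i) U) (tobj C (S i) (S (\<sigma> j)))"
      unfolding id0[OF \<sigma>[OF j]] using i j \<sigma> dd by simp
    finally show ?thesis .
  qed
  then have z: "tmor C (S i) (S i) U U (ident C (S i)) (cmp C U (S (\<sigma> j)) U (q j) (p j)) = hzero C (tobj C (S i) U) (tobj C (S i) U)" if j: "j < m" for j
    using lw_cmp[of "S i" U "S (\<sigma> j)" U "p j" "q j"] i j \<sigma> dd by simp
  have hz: "hom_sum C X X (\<lambda>j. hzero C X X) m = hzero C X X" if "X \<in> obj C" for X m
    using that by (induction m) auto
  have "ident C (tobj C (S i) U) = tmor C (S i) (S i) U U (ident C (S i)) (hom_sum C U U (\<lambda>j. cmp C U (S (\<sigma> j)) U (q j) (p j)) m)"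
    using i dd by (simp add: tmor_ident)
  also have "\<dots> = hom_sum C (tobj C (S i) U) (tobj C (S i) U) (\<lambda>j. tmor C (S i) (S i) U U (ident C (S i)) (cmp C U (S (\<sigma> j)) U (q j) (p j))) m"
    by (rule tmor_hom_sum_right) (use i dd \<sigma> in auto)
  also have "\<dots> = hom_sum C (tobj C (S i) U) (tobj C (S i) U) (\<lambda>j. hzero C (tobj C (S i) U) (tobj C (S i) U)) m"
    by (rule hom_sum_cong) (use z in auto)
  also have "\<dots> = hzero C (tobj C (S i) U) (tobj C (S i) U)" using i by (simp add: hz)
  finally have e0: "ident C (tobj C (S i) U) = hzero C (tobj C (S i) U) (tobj C (S i) U)" .
  obtain r where r: "r \<in> hom C (S i) (tobj C (S i) U)" "cmp C (S i) (tobj C (S i) U) (S i) (runit C (S i)) r = ident C (S i)"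
    using runit_iso[OF S_obj[OF i]] by (rule is_isoE)
  have "ident C (S i) = cmp C (S i) (tobj C (S i) U) (S i) (runit C (S i)) (cmp C (S i) (tobj C (S i) U) (tobj C (S i) U) (ident C (tobj C (S i) U)) r)"
    using r i by simp
  also have "\<dots> = hzero C (S i) (S i)" unfolding e0 using r i by simp
  finally show False using S_nz[OF i] by simp
qed

lemma Fm_ident: assumes "X \<in> obj C" "x \<in> V X" shows "Fm X X (ident C X) x = x"
  using assms by (induction x rule: em_induct) (use assms in \<open>simp_all add: Fm_em Fm_add tmor_ident\<close>)

lemma Fm_cmp:
  assumes X: "X \<in> obj C" "Y \<in> obj C" "Z \<in> obj C" "f \<in> hom C X Y" "g \<in> hom C Y Z" and x: "x \<in> V X"
  shows "Fm X Z (cmp C X Y Z g f) x = Fm Y Z g (Fm X Y f x)"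
  using X(1) x
proof (induction x rule: em_induct)
  case (em i j k)
  then show ?case using X by (simp add: Fm_em cmp_assoc flip: rw_cmp)
qed (use X in \<open>simp_all add: Fm_add\<close>)

lemma Fm_hadd:
  assumes X: "X \<in> obj C" "Y \<in> obj C" "f \<in> hom C X Y" "g \<in> hom C X Y" and x: "x \<in> V X"
  shows "Fm X Y (hadd C X Y f g) x = Fm X Y f x + Fm X Y g x"
  using X(1) x
proof (induction x rule: em_induct)
  case (em i j k)
  then show ?case using X by (simp add: Fm_em tmor_add_left cmp_add_left em_add)
qed (use X in \<open>simp_all add: Fm_add add_ac\<close>)

lemma Fm_hscale:
  assumes X: "X \<in> obj C" "Y \<in> obj C" "f \<in> hom C X Y" and x: "x \<in> V X"
  shows "Fm X Y (hscale C X Y a f) x = vscale a (Fm X Y f x)"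
  using X(1) x
proof (induction x rule: em_induct)
  case (em i j k)
  then show ?case using X by (simp add: Fm_em tmor_scale_left cmp_scale_left em_scale)
qed (use X in \<open>simp_all add: Fm_add vscale_add\<close>)

lemma linear_fibre_functor_split: "linear_fibre_functor C n S BB Fm"
  by (unfold_locales; (rule S_obj schur_eq schur_neq decomp sums BB_fin BB_ne Fm_lin Fm_ident Fm_cmp Fm_hadd Fm_hscale; assumption)?)

subsection \<open>The tensor structure\<close>

text \<open>The composite of \<open>f : S\<^sub>i \<rightarrow> X \<otimes> S\<^sub>j\<close> and \<open>g : S\<^sub>j \<rightarrow> Y \<otimes> S\<^sub>l\<close> in \<open>Hom(S\<^sub>i, (X \<otimes> Y) \<otimes> S\<^sub>l)\<close>. The monoidal
  structure \<open>P\<close> of \<open>F\<close> composes blocks with matching middle index.\<close>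

abbreviation "pc X Y i j l f g \<equiv> cmp C (S i) (tobj C X (tobj C Y (S l))) (tobj C (tobj C X Y) (S l)) (ainv X Y (S l))
  (cmp C (S i) (tobj C X (S j)) (tobj C X (tobj C Y (S l))) (tmor C X X (S j) (tobj C Y (S l)) (ident C X) g) f)"

definition P :: "'o \<Rightarrow> 'o \<Rightarrow> 'k seq \<Rightarrow> 'k seq \<Rightarrow> 'k seq" where
  "P X Y x y = (\<Sum>i<n. \<Sum>j<n. \<Sum>l<n. em (tobj C X Y) i l (pc X Y i j l (co X i j x) (co Y j l y)))"

lemma P_bilin:
  assumes X [simp]: "X \<in> obj C" "Y \<in> obj C"
  shows "bilin_on (V X) (V Y) (V (tobj C X Y)) (P X Y)"
  unfolding bilin_on_def P_def
proof (intro conjI ballI lin_on_sumI subspace_csp)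
  fix x i j l assume x: "x \<in> V X" and ij: "i \<in> {..<n}" "j \<in> {..<n}" "l \<in> {..<n}"
  show "lin_on (V Y) (V (tobj C X Y)) (\<lambda>y. em (tobj C X Y) i l (pc X Y i j l (co X i j x) (co Y j l y)))"
    by (rule em_hl_lin) (use x ij in \<open>auto simp: hl_def tmor_add_right tmor_scale_right cmp_add_left cmp_add_right cmp_scale_left cmp_scale_right\<close>)
next
  fix y i j l assume y: "y \<in> V Y" and ij: "i \<in> {..<n}" "j \<in> {..<n}" "l \<in> {..<n}"
  show "lin_on (V X) (V (tobj C X Y)) (\<lambda>x. em (tobj C X Y) i l (pc X Y i j l (co X i j x) (co Y j l y)))"
    by (rule em_hl_lin) (use y ij in \<open>auto simp: hl_def cmp_add_right cmp_scale_right\<close>)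
qed

lemma P_in [simp]: "\<lbrakk>X \<in> obj C; Y \<in> obj C; x \<in> V X; y \<in> V Y\<rbrakk> \<Longrightarrow> P X Y x y \<in> V (tobj C X Y)"
  using bilin_on_in[OF P_bilin] by blast

lemma P_add:
  assumes "X \<in> obj C" "Y \<in> obj C"
  shows "\<lbrakk>x \<in> V X; x' \<in> V X; y \<in> V Y\<rbrakk> \<Longrightarrow> P X Y (x + x') y = P X Y x y + P X Y x' y"
    "\<lbrakk>x \<in> V X; y \<in> V Y; y' \<in> V Y\<rbrakk> \<Longrightarrow> P X Y x (y + y') = P X Y x y + P X Y x y'"
    "y \<in> V Y \<Longrightarrow> P X Y 0 y = 0" "x \<in> V X \<Longrightarrow> P X Y x 0 = 0"
  using P_bilin[OF assms] lin_on_0[OF bilin_on_lin[OF P_bilin[OF assms]]] lin_on_0[OF bilin_on_lin'[OF P_bilin[OF assms]]]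
  by (auto simp: bilin_on_def lin_on_def)

lemma P_em:
  assumes [simp]: "X \<in> obj C" "Y \<in> obj C" and i: "i < n" "j < n" "j' < n" "l < n" and fg: "f \<in> hm X i j" "g \<in> hm Y j' l"
  shows "P X Y (em X i j f) (em Y j' l g) = (if j = j' then em (tobj C X Y) i l (pc X Y i j l f g) else 0)"
proof -
  have "P X Y (em X i j f) (em Y j' l g) = (\<Sum>l'<n. em (tobj C X Y) i l' (pc X Y i j l' f (co Y j l' (em Y j' l g))))"
    unfolding P_def by (subst sum_delta2[OF i(1,2)]) (use i fg in \<open>auto simp: co_em\<close>)
  also have "\<dots> = (\<Sum>l'<n. if l' = l then (if j = j' then em (tobj C X Y) i l (pc X Y i j l f g) else 0) else 0)"
    by (rule sum.cong[OF refl]) (use i fg in \<open>auto simp: co_em\<close>)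
  finally show ?thesis using i by simp
qed

definition ds :: "'o \<Rightarrow> nat \<times> (nat \<Rightarrow> nat) \<times> (nat \<Rightarrow> 'm) \<times> (nat \<Rightarrow> 'm)" where
  "ds W = (SOME q. case q of (m, \<sigma>, i, p) \<Rightarrow> (\<forall>j<m. \<sigma> j < n) \<and> direct_sum C m (\<lambda>j. S (\<sigma> j)) W i p)"

lemma ds_expand:
  assumes "W \<in> obj C"
  obtains m \<sigma> q p where "ds W = (m, \<sigma>, q, p)" "\<And>j. j < m \<Longrightarrow> \<sigma> j < n" "direct_sum C m (\<lambda>j. S (\<sigma> j)) W q p"
proof -
  obtain m \<sigma> q p where *: "ds W = (m, \<sigma>, q, p)" by (metis prod_cases4)
  have "case ds W of (m, \<sigma>, i, p) \<Rightarrow> (\<forall>j<m. \<sigma> j < n) \<and> direct_sum C m (\<lambda>j. S (\<sigma> j)) W i p"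
    unfolding ds_def by (rule someI_ex) (use decomp[OF assms] in auto)
  then show ?thesis using that[OF *] by (simp add: *)
qed

text \<open>The section \<open>\<iota>\<close> factors a morphism \<open>h : S\<^sub>i \<rightarrow> X \<otimes> (Y \<otimes> S\<^sub>l)\<close> through the simple summands of
  \<open>Y \<otimes> S\<^sub>l\<close>: with inclusions \<open>q\<^sub>k\<close> and projections \<open>p\<^sub>k\<close> it is \<open>h \<mapsto> \<Sum>\<^sub>k (X \<otimes> p\<^sub>k) h \<otimes> q\<^sub>k\<close>. The abbreviation \<open>ic\<close> is
  the first factor.\<close>

abbreviation "ic X Y i l k p h \<equiv> cmp C (S i) (tobj C X (tobj C Y (S l))) (tobj C X (S k)) (tmor C X X (tobj C Y (S l)) (S k) (ident C X) p)
  (cmp C (S i) (tobj C (tobj C X Y) (S l)) (tobj C X (tobj C Y (S l))) (associator C X Y (S l)) h)"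

definition io :: "'o \<Rightarrow> 'o \<Rightarrow> 'k seq \<Rightarrow> 'k seq" where
  "io X Y z = (\<Sum>i<n. \<Sum>l<n. case ds (tobj C Y (S l)) of (m, \<sigma>, q, p) \<Rightarrow>
     \<Sum>k<m. tens (em X i (\<sigma> k) (ic X Y i l (\<sigma> k) (p k) (co (tobj C X Y) i l z))) (em Y (\<sigma> k) l (q k)))"

lemma io_lin:
  assumes X [simp]: "X \<in> obj C" "Y \<in> obj C"
  shows "lin_on (V (tobj C X Y)) (tens_space (V X) (V Y)) (io X Y)"
  unfolding io_def
proof (intro lin_on_sumI subspace_tens_space)
  fix i l assume il: "i \<in> {..<n}" "l \<in> {..<n}"
  have Yl: "tobj C Y (S l) \<in> obj C" using il by simp
  obtain m \<sigma> q p where d: "ds (tobj C Y (S l)) = (m, \<sigma>, q, p)" and \<sigma>: "\<And>j. j < m \<Longrightarrow> \<sigma> j < n"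
    and ds: "direct_sum C m (\<lambda>j. S (\<sigma> j)) (tobj C Y (S l)) q p" by (rule ds_expand[OF Yl]) (rule that)
  note dd = direct_sumD[OF ds]
  show "lin_on (V (tobj C X Y)) (tens_space (V X) (V Y)) (\<lambda>z. case ds (tobj C Y (S l)) of (m, \<sigma>, q, p) \<Rightarrow>
     \<Sum>k<m. tens (em X i (\<sigma> k) (ic X Y i l (\<sigma> k) (p k) (co (tobj C X Y) i l z))) (em Y (\<sigma> k) l (q k)))"
    unfolding d prod.case
  proof (intro lin_on_sumI subspace_tens_space)
    fix k assume k: "k \<in> {..<m}"
    have 1: "lin_on (V (tobj C X Y)) (V X) (\<lambda>z. em X i (\<sigma> k) (ic X Y i l (\<sigma> k) (p k) (co (tobj C X Y) i l z)))"
      by (rule em_hl_lin) (use il k \<sigma> dd in \<open>auto simp: hl_def cmp_add_right cmp_scale_right\<close>)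
    have 2: "lin_on (V X) (tens_space (V X) (V Y)) (\<lambda>u. tens u (em Y (\<sigma> k) l (q k)))"
      by (rule lin_onI) (use il k \<sigma> dd in \<open>auto simp: tens_add_left tens_scale_left\<close>)
    show "lin_on (V (tobj C X Y)) (tens_space (V X) (V Y)) (\<lambda>z. tens (em X i (\<sigma> k) (ic X Y i l (\<sigma> k) (p k) (co (tobj C X Y) i l z))) (em Y (\<sigma> k) l (q k)))"
      by (rule lin_on_cmp[OF 1 2])
  qed
qed

lemma io_em:
  assumes X [simp]: "X \<in> obj C" "Y \<in> obj C" and il: "i < n" "l < n" and h: "h \<in> hm (tobj C X Y) i l"
    and d: "ds (tobj C Y (S l)) = (m, \<sigma>, q, p)" and \<sigma>: "\<And>j. j < m \<Longrightarrow> \<sigma> j < n"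
    and ds': "direct_sum C m (\<lambda>j. S (\<sigma> j)) (tobj C Y (S l)) q p"
  shows "io X Y (em (tobj C X Y) i l h) = (\<Sum>k<m. tens (em X i (\<sigma> k) (ic X Y i l (\<sigma> k) (p k) h)) (em Y (\<sigma> k) l (q k)))"
proof -
  have z: "(case ds (tobj C Y (S l')) of (m, \<sigma>, q, p) \<Rightarrow>
     \<Sum>k<m. tens (em X i' (\<sigma> k) (ic X Y i' l' (\<sigma> k) (p k) (hzero C (S i') (tobj C (tobj C X Y) (S l'))))) (em Y (\<sigma> k) l' (q k))) = 0"
    if il': "i' < n" "l' < n" for i' l'
  proof -
    have Yl: "tobj C Y (S l') \<in> obj C" using il' by simp
    obtain m \<sigma> q p where d: "ds (tobj C Y (S l')) = (m, \<sigma>, q, p)" and \<sigma>: "\<And>j. j < m \<Longrightarrow> \<sigma> j < n"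
      and ds: "direct_sum C m (\<lambda>j. S (\<sigma> j)) (tobj C Y (S l')) q p" by (rule ds_expand[OF Yl]) (rule that)
    show ?thesis unfolding d prod.case
      by (rule sum.neutral) (use il' \<sigma> direct_sumD[OF ds] in simp)
  qed
  show ?thesis
    unfolding io_def
    by (subst sum_delta2[OF il]) (use il h z in \<open>auto simp: co_em d\<close>)
qed

text \<open>Composing the two factors again gives \<open>\<Sum>\<^sub>k (X \<otimes> q\<^sub>k p\<^sub>k) h = h\<close>.\<close>

lemma P_io:
  assumes X [simp]: "X \<in> obj C" "Y \<in> obj C" and z: "z \<in> V (tobj C X Y)"
  shows "tens_lift (V X) (V Y) (P X Y) (io X Y z) = z"
proof -
  note l = lin_tens_lift[OF P_bilin[OF X] subspace_csp subspace_csp subspace_csp]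
  have XY: "tobj C X Y \<in> obj C" by simp
  show ?thesis using XY z
  proof (induction z rule: em_induct)
    case zero
    then show ?case by (simp add: lin_on_0[OF io_lin] lin_on_0[OF l] vec.subspace_0)
  next
    case (add u w)
    then show ?case using lin_on_in[OF io_lin[OF X]] by (simp add: lin_on_add[OF io_lin] lin_on_add[OF l])
  next
    case (em i j h)
    let ?W = "tobj C Y (S j)"
    have Yl: "?W \<in> obj C" using em by simp
    obtain m \<sigma> q p where d: "ds ?W = (m, \<sigma>, q, p)" and \<sigma>: "\<And>j. j < m \<Longrightarrow> \<sigma> j < n"
      and ds: "direct_sum C m (\<lambda>j. S (\<sigma> j)) ?W q p" by (rule ds_expand[OF Yl]) (rule that)
    note dd = direct_sumD[OF ds]
    define k where "k = cmp C (S i) (tobj C (tobj C X Y) (S j)) (tobj C X ?W) (associator C X Y (S j)) h"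
    have k [simp]: "k \<in> hom C (S i) (tobj C X ?W)" using em by (simp add: k_def)
    have mem: "em X i (\<sigma> t) (ic X Y i j (\<sigma> t) (p t) h) \<in> V X" "em Y (\<sigma> t) j (q t) \<in> V Y" if "t < m" for t
      using em \<sigma> dd that by auto
    have F: "cmp C ?W (S (\<sigma> t)) ?W (q t) (p t) \<in> hom C ?W ?W" if "t < m" for t
      using that em \<sigma> dd by simp
    have e: "io X Y (em (tobj C X Y) i j h) = (\<Sum>t<m. tens (em X i (\<sigma> t) (ic X Y i j (\<sigma> t) (p t) h)) (em Y (\<sigma> t) j (q t)))"
      by (rule io_em[OF X em d _ ds]) (use \<sigma> in auto)
    have "tens_lift (V X) (V Y) (P X Y) (io X Y (em (tobj C X Y) i j h))
      = (\<Sum>t<m. tens_lift (V X) (V Y) (P X Y) (tens (em X i (\<sigma> t) (ic X Y i j (\<sigma> t) (p t) h)) (em Y (\<sigma> t) j (q t))))"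
      unfolding e
      by (rule lin_on_sum[OF l subspace_tens_space]) (use mem in auto)
    also have "\<dots> = (\<Sum>t<m. em (tobj C X Y) i j (cmp C (S i) (tobj C X ?W) (tobj C (tobj C X Y) (S j)) (ainv X Y (S j))
        (cmp C (S i) (tobj C X ?W) (tobj C X ?W) (tmor C X X ?W ?W (ident C X) (cmp C ?W (S (\<sigma> t)) ?W (q t) (p t))) k)))"
    proof (rule sum.cong[OF refl])
      fix t assume t: "t \<in> {..<m}"
      then show "tens_lift (V X) (V Y) (P X Y) (tens (em X i (\<sigma> t) (ic X Y i j (\<sigma> t) (p t) h)) (em Y (\<sigma> t) j (q t)))
        = em (tobj C X Y) i j (cmp C (S i) (tobj C X ?W) (tobj C (tobj C X Y) (S j)) (ainv X Y (S j))
        (cmp C (S i) (tobj C X ?W) (tobj C X ?W) (tmor C X X ?W ?W (ident C X) (cmp C ?W (S (\<sigma> t)) ?W (q t) (p t))) k))"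
        using em \<sigma> dd mem[of t]
        by (simp add: tens_lift_tens[OF bilin_on_bil[OF P_bilin[OF X]]] P_em lw_cmp2 flip: k_def)
    qed
    also have "\<dots> = em (tobj C X Y) i j (hom_sum C (S i) (tobj C (tobj C X Y) (S j)) (\<lambda>t. cmp C (S i) (tobj C X ?W) (tobj C (tobj C X Y) (S j)) (ainv X Y (S j))
        (cmp C (S i) (tobj C X ?W) (tobj C X ?W) (tmor C X X ?W ?W (ident C X) (cmp C ?W (S (\<sigma> t)) ?W (q t) (p t))) k)) m)"
      by (rule em_hom_sum[symmetric]) (use em \<sigma> dd in auto)
    also have "\<dots> = em (tobj C X Y) i j (cmp C (S i) (tobj C X ?W) (tobj C (tobj C X Y) (S j)) (ainv X Y (S j))
        (cmp C (S i) (tobj C X ?W) (tobj C X ?W) (tmor C X X ?W ?W (ident C X) (hom_sum C ?W ?W (\<lambda>t. cmp C ?W (S (\<sigma> t)) ?W (q t) (p t)) m)) k))"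
      using em F by (simp add: cmp_hom_sum_right cmp_hom_sum_left tmor_hom_sum_right)
    also have "\<dots> = em (tobj C X Y) i j h"
      using em by (simp add: dd(6) tmor_ident) (simp add: k_def)
    finally show ?case .
  qed
qed

text \<open>The projections to the blocks with given first, respectively second, index: the two actions of the
  idempotents of \<open>k\<^sup>n\<close>.\<close>

definition Lp :: "nat \<Rightarrow> 'k seq \<Rightarrow> 'k seq" where "Lp i x = (\<lambda>m. if ii m = i then x m else 0)"
definition Rp :: "nat \<Rightarrow> 'k seq \<Rightarrow> 'k seq" where "Rp j x = (\<lambda>m. if jj m = j then x m else 0)"

lemma Lp_simps: "Lp i (x + y) = Lp i x + Lp i y" "Lp i (vscale c x) = vscale c (Lp i x)" "Lp i 0 = 0"
  "x \<in> csp E \<Longrightarrow> Lp i x \<in> csp E" "Lp t (em X i j f) = (if t = i then em X i j f else 0)"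
  and Rp_simps: "Rp i (x + y) = Rp i x + Rp i y" "Rp i (vscale c x) = vscale c (Rp i x)" "Rp i 0 = 0"
  "x \<in> csp E \<Longrightarrow> Rp i x \<in> csp E" "Rp t (em X i j f) = (if t = j then em X i j f else 0)"
  by (auto simp: Lp_def Rp_def fun_eq_iff fun_apply vscale_def csp_def em_def)

lemma Lp_Rp: "Lp i (Rp j x) = Rp j (Lp i x)" and Lp_Lp: "Lp i (Lp j x) = Lp j (Lp i x)"
  by (auto simp: Lp_def Rp_def)

lemma Lp_lin: "lin_on (V X) (V X) (Lp i)" and Rp_lin: "lin_on (V X) (V X) (Rp i)"
  by (auto simp: lin_on_def Lp_simps Rp_simps)

lemma Fm_Lp:
  assumes X: "X \<in> obj C" "Y \<in> obj C" "f \<in> hom C X Y" and x: "x \<in> V X"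
  shows "Fm X Y f (Lp i x) = Lp i (Fm X Y f x)"
  using X(1) x by (induction x rule: em_induct) (use X in \<open>simp_all add: Lp_simps Fm_em Fm_add\<close>)

lemma Fm_Rp:
  assumes X: "X \<in> obj C" "Y \<in> obj C" "f \<in> hom C X Y" and x: "x \<in> V X"
  shows "Fm X Y f (Rp i x) = Rp i (Fm X Y f x)"
  using X(1) x by (induction x rule: em_induct) (use X in \<open>simp_all add: Rp_simps Fm_em Fm_add\<close>)

lemma em_induct2 [consumes 4, case_names zero1 zero2 em add1 add2]:
  assumes X: "X \<in> obj C" "x \<in> V X" and Y: "Y \<in> obj C" "y \<in> V Y"
    and z: "\<And>y. y \<in> V Y \<Longrightarrow> Q 0 y" "\<And>x. x \<in> V X \<Longrightarrow> Q x 0"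
    and em: "\<And>i j j' l f g. \<lbrakk>i < n; j < n; f \<in> hm X i j; j' < n; l < n; g \<in> hm Y j' l\<rbrakk> \<Longrightarrow> Q (em X i j f) (em Y j' l g)"
    and add: "\<And>u w y. \<lbrakk>u \<in> V X; w \<in> V X; y \<in> V Y; Q u y; Q w y\<rbrakk> \<Longrightarrow> Q (u + w) y"
      "\<And>x u w. \<lbrakk>x \<in> V X; u \<in> V Y; w \<in> V Y; Q x u; Q x w\<rbrakk> \<Longrightarrow> Q x (u + w)"
  shows "Q x y"
  using X
proof (induction x rule: em_induct)
  case (em i j f)
  from Y show ?case
  proof (induction y rule: em_induct)
    case zero then show ?case using z(2) X em by simp
  next
    case (em j' l g) then show ?case using assms(7) \<open>i < n\<close> \<open>j < n\<close> \<open>f \<in> hm X i j\<close> by blast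
  next
    case (add u w) then show ?case using assms(9) X em by simp
  qed
qed (use z add Y in auto)

lemma P_Lp:
  assumes X: "X \<in> obj C" "Y \<in> obj C" "x \<in> V X" "y \<in> V Y"
  shows "Lp i (P X Y x y) = P X Y (Lp i x) y"
  using X(1,3,2,4) by (induction x y rule: em_induct2)
    (use X in \<open>simp_all add: Lp_simps P_em P_add\<close>)

lemma P_Rp:
  assumes X: "X \<in> obj C" "Y \<in> obj C" "x \<in> V X" "y \<in> V Y"
  shows "Rp i (P X Y x y) = P X Y x (Rp i y)"
  using X(1,3,2,4) by (induction x y rule: em_induct2)
    (use X in \<open>simp_all add: Rp_simps P_em P_add\<close>)

text \<open>For \<open>f\<close> and \<open>g\<close> with matching index \<open>j\<close>, the morphism \<open>p\<^sub>k g\<close> between simple objects is a scalar or zero. It can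
  be moved across the tensor sign, and \<open>\<Sum>\<^sub>k q\<^sub>k p\<^sub>k g = g\<close> leaves \<open>f \<otimes> g\<close>.\<close>

lemma io_P:
  assumes X: "X \<in> obj C" "Y \<in> obj C" "x \<in> V X" "y \<in> V Y"
  shows "io X Y (P X Y x y) = (\<Sum>i<n. tens (Rp i x) (Lp i y))"
  using X(1,3,2,4)
proof (induction x y rule: em_induct2)
  case (em i j j' l f g)
  note [simp] = X(1,2)
  have R: "(\<Sum>t<n. tens (Rp t (em X i j f)) (Lp t (em Y j' l g))) = (if j = j' then tens (em X i j f) (em Y j' l g) else 0)"
  proof -
    have "(\<Sum>t<n. tens (Rp t (em X i j f)) (Lp t (em Y j' l g)))
      = (\<Sum>t<n. if t = j then (if j = j' then tens (em X i j f) (em Y j' l g) else 0) else 0)"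
      by (rule sum.cong) (auto simp: Rp_simps Lp_simps)
    then show ?thesis using em by simp
  qed
  show ?case
  proof (cases "j = j'")
    case False
    then show ?thesis using em unfolding R by (simp add: P_em lin_on_0[OF io_lin])
  next
    case True
    let ?W = "tobj C Y (S l)"
    have g: "g \<in> hom C (S j) ?W" using em True by simp
    have Yl: "?W \<in> obj C" using em by simp
    obtain m \<sigma> q p where d: "ds ?W = (m, \<sigma>, q, p)" and \<sigma>: "\<And>j. j < m \<Longrightarrow> \<sigma> j < n"
      and ds: "direct_sum C m (\<lambda>j. S (\<sigma> j)) ?W q p" by (rule ds_expand[OF Yl]) (rule that)
    note dd = direct_sumD[OF ds]
    define c where "c t = cmp C (S j) ?W (S (\<sigma> t)) (p t) g" for t
    have c [simp]: "c t \<in> hom C (S j) (S (\<sigma> t))" if "t < m" for t using that em g \<sigma> dd by (simp add: c_def)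
    have "io X Y (P X Y (em X i j f) (em Y j' l g)) = io X Y (em (tobj C X Y) i l (pc X Y i j l f g))"
      using em True by (simp add: P_em)
    also have "\<dots> = (\<Sum>t<m. tens (em X i (\<sigma> t) (ic X Y i l (\<sigma> t) (p t) (pc X Y i j l f g))) (em Y (\<sigma> t) l (q t)))"
      by (rule io_em[OF X(1,2) _ _ _ d \<sigma> ds]) (use em g in auto)
    also have "\<dots> = (\<Sum>t<m. tens (em X i j f) (em Y j l (cmp C (S j) (S (\<sigma> t)) ?W (q t) (c t))))"
    proof (rule sum.cong[OF refl])
      fix t assume "t \<in> {..<m}"
      then have t: "t < m" by simp
      have "ic X Y i l (\<sigma> t) (p t) (pc X Y i j l f g)
        = cmp C (S i) (tobj C X (S j)) (tobj C X (S (\<sigma> t))) (tmor C X X (S j) (S (\<sigma> t)) (ident C X) (c t)) f"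
        using em g t \<sigma> dd by (simp add: lw_cmp2 c_def)
      moreover have "tens (em X i (\<sigma> t) (cmp C (S i) (tobj C X (S j)) (tobj C X (S (\<sigma> t))) (tmor C X X (S j) (S (\<sigma> t)) (ident C X) (c t)) f)) (em Y (\<sigma> t) l (q t))
        = tens (em X i j f) (em Y j l (cmp C (S j) (S (\<sigma> t)) ?W (q t) (c t)))"
      proof (cases "\<sigma> t = j")
        case True
        then obtain a where a: "c t = hscale C (S j) (S j) a (ident C (S j))" using schur_eq[of j "c t"] c[OF t] em by auto
        show ?thesis using em t dd(3)[OF t] unfolding True a
          by (simp add: tmor_scale_right cmp_scale_left cmp_scale_right tmor_ident em_scale tens_scale_left tens_scale_right)
      next
        case False
        then have "c t = hzero C (S j) (S (\<sigma> t))" using schur_neq[of j "\<sigma> t" "c t"] c[OF t] \<sigma>[OF t] em by auto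
        then show ?thesis using em t \<sigma> dd by simp
      qed
      ultimately show "tens (em X i (\<sigma> t) (ic X Y i l (\<sigma> t) (p t) (pc X Y i j l f g))) (em Y (\<sigma> t) l (q t))
        = tens (em X i j f) (em Y j l (cmp C (S j) (S (\<sigma> t)) ?W (q t) (c t)))" by simp
    qed
    also have "\<dots> = tens (em X i j f) (em Y j l (hom_sum C (S j) ?W (\<lambda>t. cmp C (S j) (S (\<sigma> t)) ?W (q t) (c t)) m))"
      using em dd \<sigma> by (simp add: em_hom_sum tens_sum_right)
    also have "hom_sum C (S j) ?W (\<lambda>t. cmp C (S j) (S (\<sigma> t)) ?W (q t) (c t)) m
       = hom_sum C (S j) ?W (\<lambda>t. cmp C (S j) ?W ?W (cmp C ?W (S (\<sigma> t)) ?W (q t) (p t)) g) m"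
      by (rule hom_sum_cong) (use em g dd \<sigma> in \<open>simp add: c_def cmp_assoc\<close>)
    also have "\<dots> = cmp C (S j) ?W ?W (hom_sum C ?W ?W (\<lambda>t. cmp C ?W (S (\<sigma> t)) ?W (q t) (p t)) m) g"
      by (rule cmp_hom_sum_left[symmetric]) (use em g dd \<sigma> in auto)
    also have "\<dots> = g" using em g by (simp add: dd(6))
    finally show ?thesis unfolding R using True by simp
  qed
next
  case (add1 u w y)
  then show ?case using X by (simp add: P_add lin_on_add[OF io_lin] Rp_simps tens_add_left sum.distrib)
next
  case (add2 x u w)
  then show ?case using X by (simp add: P_add lin_on_add[OF io_lin] Lp_simps tens_add_right sum.distrib)
qed (use X in \<open>simp_all add: P_add lin_on_0[OF io_lin] Lp_simps Rp_simps\<close>)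

lemma P_nat:
  assumes X: "X \<in> obj C" "X' \<in> obj C" "Y \<in> obj C" "Y' \<in> obj C" "f \<in> hom C X X'" "g \<in> hom C Y Y'"
    and x: "x \<in> V X" and y: "y \<in> V Y"
  shows "P X' Y' (Fm X X' f x) (Fm Y Y' g y) = Fm (tobj C X Y) (tobj C X' Y') (tmor C X X' Y Y' f g) (P X Y x y)"
  using X(1) x X(3) y
proof (induction x y rule: em_induct2)
  case (em i j j' l f0 g0)
  show ?case
  proof (cases "j = j'")
    case False
    then show ?thesis using X em by (simp add: Fm_em P_em)
  next
    case True
    have g0: "g0 \<in> hom C (S j) (tobj C Y (S l))" using em True by simp
    let ?Yl = "tobj C Y (S l)" and ?Yl' = "tobj C Y' (S l)"
    let ?k = "cmp C (S i) (tobj C X (S j)) (tobj C X ?Yl) (tmor C X X (S j) ?Yl (ident C X) g0) f0"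
    have o: "S i \<in> obj C" "S j \<in> obj C" "S l \<in> obj C" using em True by auto
    note [simp] = X o
    have "pc X' Y' i j l (cmp C (S i) (tobj C X (S j)) (tobj C X' (S j)) (rw X X' j f) f0) (cmp C (S j) ?Yl ?Yl' (rw Y Y' l g) g0)
       = cmp C (S i) (tobj C (tobj C X Y) (S l)) (tobj C (tobj C X' Y') (S l)) (rw (tobj C X Y) (tobj C X' Y') l (tmor C X X' Y Y' f g)) (pc X Y i j l f0 g0)"
    proof (rule a_cancel[of X' Y' "S l" "S i"])
      have 1: "cmp C (tobj C X (S j)) (tobj C X' (S j)) (tobj C X' ?Yl') (tmor C X' X' (S j) ?Yl' (ident C X') (cmp C (S j) ?Yl ?Yl' (rw Y Y' l g) g0)) (rw X X' j f)
        = cmp C (tobj C X (S j)) (tobj C X ?Yl) (tobj C X' ?Yl') (tmor C X X' ?Yl ?Yl' f (rw Y Y' l g)) (tmor C X X (S j) ?Yl (ident C X) g0)"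
        using g0 by (simp flip: tmor_cmp)
      have "cmp C (S i) (tobj C (tobj C X' Y') (S l)) (tobj C X' ?Yl') (associator C X' Y' (S l))
          (cmp C (S i) (tobj C (tobj C X Y) (S l)) (tobj C (tobj C X' Y') (S l)) (rw (tobj C X Y) (tobj C X' Y') l (tmor C X X' Y Y' f g)) (pc X Y i j l f0 g0))
        = cmp C (S i) (tobj C X ?Yl) (tobj C X' ?Yl') (tmor C X X' ?Yl ?Yl' f (rw Y Y' l g)) ?k"
        using em g0 associator_natural[of X X' Y Y' "S l" "S l" f g "ident C (S l)"]
        by (simp flip: cmp_assoc) (simp add: cmp_assoc)
      also have "\<dots> = cmp C (S i) (tobj C X' (S j)) (tobj C X' ?Yl') (tmor C X' X' (S j) ?Yl' (ident C X') (cmp C (S j) ?Yl ?Yl' (rw Y Y' l g) g0))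
          (cmp C (S i) (tobj C X (S j)) (tobj C X' (S j)) (rw X X' j f) f0)"
        using em g0 1 by (simp flip: cmp_assoc)
      finally show "cmp C (S i) (tobj C (tobj C X' Y') (S l)) (tobj C X' ?Yl') (associator C X' Y' (S l))
          (pc X' Y' i j l (cmp C (S i) (tobj C X (S j)) (tobj C X' (S j)) (rw X X' j f) f0) (cmp C (S j) ?Yl ?Yl' (rw Y Y' l g) g0))
        = cmp C (S i) (tobj C (tobj C X' Y') (S l)) (tobj C X' ?Yl') (associator C X' Y' (S l))
          (cmp C (S i) (tobj C (tobj C X Y) (S l)) (tobj C (tobj C X' Y') (S l)) (rw (tobj C X Y) (tobj C X' Y') l (tmor C X X' Y Y' f g)) (pc X Y i j l f0 g0))"
        using em g0 by simp
    qed (use em g0 in auto)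
    then show ?thesis using True em g0 by (simp add: Fm_em P_em)
  qed
qed (use X in \<open>simp_all add: P_add Fm_add\<close>)

text \<open>Both sides are compared after composition with the associators, where they are related by the pentagon and
  the naturality of the associator.\<close>

lemma assoc_pc:
  assumes X [simp]: "X \<in> obj C" "Y \<in> obj C" "Z \<in> obj C" and o: "i < n" "j < n" "l < n" "r < n"
    and f [simp]: "f \<in> hm X i j" and g [simp]: "g \<in> hm Y j l" and h [simp]: "h \<in> hm Z l r"
  shows "cmp C (S i) (tobj C (tobj C (tobj C X Y) Z) (S r)) (tobj C (tobj C X (tobj C Y Z)) (S r))
      (rw (tobj C (tobj C X Y) Z) (tobj C X (tobj C Y Z)) r (associator C X Y Z)) (pc (tobj C X Y) Z i l r (pc X Y i j l f g) h)
    = pc X (tobj C Y Z) i j r f (pc Y Z j l r g h)"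
proof -
  have [simp]: "S i \<in> obj C" "S j \<in> obj C" "S l \<in> obj C" "S r \<in> obj C" using o by auto
  let ?Zr = "tobj C Z (S r)" and ?YZ = "tobj C Y Z" and ?XY = "tobj C X Y"
  let ?u = "pc ?XY Z i l r (pc X Y i j l f g) h"
  let ?v = "cmp C (S i) (tobj C (tobj C ?XY Z) (S r)) (tobj C (tobj C X ?YZ) (S r)) (rw (tobj C ?XY Z) (tobj C X ?YZ) r (associator C X Y Z)) ?u"
  let ?a = "tmor C X X (tobj C ?YZ (S r)) (tobj C Y ?Zr) (ident C X) (associator C Y Z (S r))"
  let ?w = "cmp C (S i) (tobj C X (S j)) (tobj C X (tobj C Y ?Zr)) (tmor C X X (S j) (tobj C Y ?Zr) (ident C X) (cmp C (S j) (tobj C Y (S l)) (tobj C Y ?Zr) (tmor C Y Y (S l) ?Zr (ident C Y) h) g)) f"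
  have iso: "is_iso C (tobj C X (tobj C ?YZ (S r))) (tobj C X (tobj C Y ?Zr)) ?a"
    by (rule tensor_iso) (auto intro: associator_iso is_isoI[of _ _ _ "ident C X"])
  show ?thesis
  proof (rule a_cancel[of X ?YZ "S r" "S i"], simp, simp, simp, simp, simp, simp, rule iso_cancel_left[OF _ _ _ iso])
    have "cmp C (S i) (tobj C X (tobj C ?YZ (S r))) (tobj C X (tobj C Y ?Zr)) ?a
        (cmp C (S i) (tobj C (tobj C X ?YZ) (S r)) (tobj C X (tobj C ?YZ (S r))) (associator C X ?YZ (S r)) ?v)
      = cmp C (S i) (tobj C (tobj C ?XY Z) (S r)) (tobj C X (tobj C Y ?Zr))
          (cmp C (tobj C (tobj C ?XY Z) (S r)) (tobj C X (tobj C ?YZ (S r))) (tobj C X (tobj C Y ?Zr)) ?a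
            (cmp C (tobj C (tobj C ?XY Z) (S r)) (tobj C (tobj C X ?YZ) (S r)) (tobj C X (tobj C ?YZ (S r))) (associator C X ?YZ (S r))
              (rw (tobj C ?XY Z) (tobj C X ?YZ) r (associator C X Y Z)))) ?u"
      by (simp add: cmp_assoc)
    also have "\<dots> = cmp C (S i) (tobj C (tobj C ?XY Z) (S r)) (tobj C X (tobj C Y ?Zr))
       (cmp C (tobj C (tobj C ?XY Z) (S r)) (tobj C ?XY ?Zr) (tobj C X (tobj C Y ?Zr)) (associator C X Y ?Zr) (associator C ?XY Z (S r))) ?u"
      by (subst pentagon) auto
    also have "\<dots> = cmp C (S i) (tobj C ?XY ?Zr) (tobj C X (tobj C Y ?Zr)) (associator C X Y ?Zr)
       (cmp C (S i) (tobj C ?XY (S l)) (tobj C ?XY ?Zr) (tmor C ?XY ?XY (S l) ?Zr (ident C ?XY) h) (pc X Y i j l f g))"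
      by (simp add: cmp_assoc)
    also have "\<dots> = cmp C (S i) (tobj C ?XY (S l)) (tobj C X (tobj C Y ?Zr)) (cmp C (tobj C ?XY (S l)) (tobj C ?XY ?Zr) (tobj C X (tobj C Y ?Zr)) (associator C X Y ?Zr)
       (tmor C ?XY ?XY (S l) ?Zr (tmor C X X Y Y (ident C X) (ident C Y)) h)) (pc X Y i j l f g)"
      by (simp add: cmp_assoc tmor_ident)
    also have "\<dots> = ?w"
      by (subst associator_natural) (simp_all add: cmp_assoc lw_cmp2)
    finally show "cmp C (S i) (tobj C X (tobj C ?YZ (S r))) (tobj C X (tobj C Y ?Zr)) ?a
        (cmp C (S i) (tobj C (tobj C X ?YZ) (S r)) (tobj C X (tobj C ?YZ (S r))) (associator C X ?YZ (S r)) ?v)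
      = cmp C (S i) (tobj C X (tobj C ?YZ (S r))) (tobj C X (tobj C Y ?Zr)) ?a
        (cmp C (S i) (tobj C (tobj C X ?YZ) (S r)) (tobj C X (tobj C ?YZ (S r))) (associator C X ?YZ (S r)) (pc X ?YZ i j r f (pc Y Z j l r g h)))"
      by (simp add: lw_cmp2)
  qed auto
qed

lemma P_assoc:
  assumes X: "X \<in> obj C" "Y \<in> obj C" "Z \<in> obj C" and x: "x \<in> V X" and y: "y \<in> V Y" and z: "z \<in> V Z"
  shows "Fm (tobj C (tobj C X Y) Z) (tobj C X (tobj C Y Z)) (associator C X Y Z) (P (tobj C X Y) Z (P X Y x y) z)
    = P X (tobj C Y Z) x (P Y Z y z)"
  using X(1) x X(2) y
proof (induction x y rule: em_induct2)
  case (em i j j' l f g)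
  from X(3) z show ?case
  proof (induction z rule: em_induct)
    case (em l' r h)
    then show ?case using X \<open>i < n\<close> \<open>j < n\<close> \<open>j' < n\<close> \<open>l < n\<close> \<open>f \<in> hm X i j\<close> \<open>g \<in> hm Y j' l\<close>
      by (auto simp: P_em P_add Fm_em assoc_pc)
  qed (use X em in \<open>simp_all add: P_add Fm_add\<close>)
qed (use X z in \<open>simp_all add: P_add Fm_add\<close>)

subsection \<open>Unit and counit\<close>

text \<open>The scalar by which an endomorphism of a simple object acts.\<close>

definition sc :: "nat \<Rightarrow> 'm \<Rightarrow> 'k" where
  "sc i f = (SOME c. f = hscale C (S i) (S i) c (ident C (S i)))"

lemma sc: "\<lbrakk>i < n; f \<in> hom C (S i) (S i)\<rbrakk> \<Longrightarrow> hscale C (S i) (S i) (sc i f) (ident C (S i)) = f"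
  unfolding sc_def using someI_ex[OF schur_eq, of i f] by simp

lemma sc_eq:
  assumes i: "i < n" and eq: "hscale C (S i) (S i) a (ident C (S i)) = hscale C (S i) (S i) b (ident C (S i))"
  shows "a = b"
proof -
  let ?u = "cr (S i) (S i) (ident C (S i))"
  have "?u \<noteq> cr (S i) (S i) (hzero C (S i) (S i))"
    using dc_cr[of "S i" "S i"] S_nz[OF i] i by (metis S_obj ident_in hom_facts(1))
  moreover have "cr (S i) (S i) (hzero C (S i) (S i)) = 0"
    using cr_scale[of "S i" "S i" "hzero C (S i) (S i)" 0] i by simp
  ultimately obtain t where t: "?u t \<noteq> 0" by (auto simp: fun_eq_iff fun_apply)
  have "vscale a ?u = vscale b ?u" using arg_cong[OF eq, of "cr (S i) (S i)"] i by (simp add: cr_scale)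
  from fun_cong[OF this, of t] show "a = b" using t by (simp add: vscale_def)
qed

lemma sc_scale_ident: "i < n \<Longrightarrow> sc i (hscale C (S i) (S i) c (ident C (S i))) = c"
  by (rule sc_eq) (auto simp: sc)

lemma sc_ident: "i < n \<Longrightarrow> sc i (ident C (S i)) = 1"
  using sc_scale_ident[of i 1] by simp

lemma hscale_facts:
  assumes "X \<in> obj C" "Y \<in> obj C" "f \<in> hom C X Y"
  shows "hadd C X Y (hscale C X Y a f) (hscale C X Y b f) = hscale C X Y (a + b) f"
    "hscale C X Y a (hscale C X Y b f) = hscale C X Y (a * b) f"
  using vspace_on.scale_add_left[OF hom_vspace[OF assms(1,2)] assms(3)] vspace_on.scale_scale[OF hom_vspace[OF assms(1,2)] assms(3)] by simp_all

lemma sc_add: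
  assumes i: "i < n" and f: "f \<in> hom C (S i) (S i)" and g: "g \<in> hom C (S i) (S i)"
  shows "sc i (hadd C (S i) (S i) f g) = sc i f + sc i g"
proof -
  have "hadd C (S i) (S i) f g = hscale C (S i) (S i) (sc i f + sc i g) (ident C (S i))"
    using hscale_facts(1)[of "S i" "S i" "ident C (S i)" "sc i f" "sc i g"] i
    unfolding sc[OF i f] sc[OF i g] by simp
  then show ?thesis by (simp only: sc_scale_ident[OF i])
qed

lemma sc_scale:
  assumes i: "i < n" and f: "f \<in> hom C (S i) (S i)"
  shows "sc i (hscale C (S i) (S i) a f) = a * sc i f"
proof -
  have "hscale C (S i) (S i) a f = hscale C (S i) (S i) (a * sc i f) (ident C (S i))"
    using hscale_facts(2)[of "S i" "S i" "ident C (S i)" a "sc i f"] i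
    unfolding sc[OF i f] by simp
  then show ?thesis by (simp only: sc_scale_ident[OF i])
qed

lemma sc_0: "i < n \<Longrightarrow> sc i (hzero C (S i) (S i)) = 0"
  using sc_scale[of i "hzero C (S i) (S i)" 0] by simp

abbreviation "lm i j f \<equiv> cmp C (S i) (tobj C U (S j)) (S j) (lunit C (S j)) f"

text \<open>The left unit constraint identifies \<open>Hom(S\<^sub>i, \<one> \<otimes> S\<^sub>j)\<close> with \<open>Hom(S\<^sub>i, S\<^sub>j)\<close>, hence \<open>F(\<one>)\<close> with \<open>k\<^sup>n\<close>. The form
  \<open>lam\<close> is the sum of the coordinates, and \<open>eta\<close> below is the vector with all coordinates \<open>1\<close>.\<close>

definition lam :: "'k seq \<Rightarrow> 'k" where
  "lam x = (\<Sum>i<n. sc i (lm i i (co U i i x)))"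

lemma lam_add: "x \<in> V U \<Longrightarrow> y \<in> V U \<Longrightarrow> lam (x + y) = lam x + lam y"
  by (simp add: lam_def co_add cmp_add_right sc_add sum.distrib)

lemma lam_scale: "x \<in> V U \<Longrightarrow> lam (vscale c x) = c * lam x"
  by (simp add: lam_def co_scale cmp_scale_right sc_scale sum_distrib_left)

lemma lam_0: "lam 0 = 0"
  using lam_scale[of 0 0] by simp

lemma lam_em:
  assumes "i < n" "j < n" "f \<in> hm U i j"
  shows "lam (em U i j f) = (if i = j then sc i (lm i j f) else 0)"
proof -
  have "lam (em U i j f) = (\<Sum>t<n. if t = i then (if i = j then sc i (lm i j f) else 0) else 0)"
    unfolding lam_def by (rule sum.cong[OF refl]) (use assms in \<open>auto simp: co_em sc_0\<close>)
  then show ?thesis using assms by simp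
qed

lemma lm_schur:
  assumes "i < n" "j < n" "f \<in> hm U i j"
  shows "lm i j f = (if i = j then hscale C (S i) (S i) (sc i (lm i j f)) (ident C (S i)) else hzero C (S i) (S j))"
  using schur_neq[of i j "lm i j f"] assms by (auto simp: sc)

text \<open>Kelly's lemma moves the left unit constraint of \<open>Y\<close> past the tensor factor \<open>S\<^sub>l\<close>.\<close>

lemma lunit_pc:
  assumes [simp]: "Y \<in> obj C" and o: "i < n" "j < n" "l < n" and [simp]: "f \<in> hm U i j" "g \<in> hm Y j l"
  shows "cmp C (S i) (tobj C (tobj C U Y) (S l)) (tobj C Y (S l)) (rw (tobj C U Y) Y l (lunit C Y)) (pc U Y i j l f g)
    = cmp C (S i) (S j) (tobj C Y (S l)) g (lm i j f)"
proof -
  have [simp]: "S i \<in> obj C" "S j \<in> obj C" "S l \<in> obj C" using o by auto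
  have "cmp C (S i) (tobj C (tobj C U Y) (S l)) (tobj C Y (S l)) (rw (tobj C U Y) Y l (lunit C Y)) (pc U Y i j l f g)
    = cmp C (S i) (tobj C U (tobj C Y (S l))) (tobj C Y (S l)) (lunit C (tobj C Y (S l)))
       (cmp C (S i) (tobj C U (S j)) (tobj C U (tobj C Y (S l))) (tmor C U U (S j) (tobj C Y (S l)) (ident C U) g) f)"
    by (simp add: cmp_assoc flip: lunit_tensor)
  also have "\<dots> = cmp C (S i) (S j) (tobj C Y (S l)) g (lm i j f)"
    using lunit_natural[of "S j" "tobj C Y (S l)" g] by (simp flip: cmp_assoc)
  finally show ?thesis .
qed

text \<open>The triangle axiom turns the right unit constraint of \<open>Y\<close> into the left one of \<open>S\<^sub>j\<close>.\<close>

lemma runit_pc: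
  assumes [simp]: "Y \<in> obj C" and o: "a < n" "i < n" "j < n" and [simp]: "g \<in> hm Y a i" "f \<in> hm U i j"
  shows "cmp C (S a) (tobj C (tobj C Y U) (S j)) (tobj C Y (S j)) (rw (tobj C Y U) Y j (runit C Y)) (pc Y U a i j g f)
    = cmp C (S a) (tobj C Y (S i)) (tobj C Y (S j)) (tmor C Y Y (S i) (S j) (ident C Y) (lm i j f)) g"
proof -
  have [simp]: "S i \<in> obj C" "S j \<in> obj C" "S a \<in> obj C" using o by auto
  show ?thesis by (simp add: cmp_assoc lw_cmp2 flip: triangle)
qed

lemma lunit_P:
  assumes Y: "Y \<in> obj C" and x: "x \<in> V U" and y: "y \<in> V Y"
  shows "Fm (tobj C U Y) Y (lunit C Y) (P U Y x y) = (\<Sum>t<n. vscale (lam (Rp t x)) (Lp t y))"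
  using unit_obj_in x Y y
proof (induction x y rule: em_induct2)
  case (em i j j' l f g)
  have "(\<Sum>t<n. vscale (lam (Rp t (em U i j f))) (Lp t (em Y j' l g)))
    = (\<Sum>t<n. if t = j then (if j = j' then vscale (lam (em U i j f)) (em Y j' l g) else 0) else 0)"
    by (rule sum.cong[OF refl]) (auto simp: Rp_simps Lp_simps lam_0)
  also have "\<dots> = (if j = j' then vscale (lam (em U i j f)) (em Y j' l g) else 0)" using em by simp
  also have "\<dots> = Fm (tobj C U Y) Y (lunit C Y) (P U Y (em U i j f) (em Y j' l g))"
  proof (cases "j = j'")
    case True
    then have g: "g \<in> hm Y j l" using em by simp
    have "cmp C (S i) (S j) (tobj C Y (S l)) g (lm i j f)
      = (if i = j then hscale C (S i) (tobj C Y (S l)) (sc i (lm i j f)) g else hzero C (S i) (tobj C Y (S l)))"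
      by (subst lm_schur) (use em g Y in \<open>auto simp: cmp_scale_right\<close>)
    then show ?thesis using em g Y True
      by (auto simp: P_em Fm_em lunit_pc lam_em em_scale)
  qed (use em Y in \<open>simp add: P_em\<close>)
  finally show ?case by simp
next
  case (add1 u w y)
  then show ?case using Y by (simp add: P_add Fm_add Rp_simps lam_add vscale_add_left sum.distrib)
next
  case (add2 x u w)
  then show ?case using Y by (simp add: P_add Fm_add Lp_simps vscale_add sum.distrib)
qed (use Y in \<open>simp_all add: P_add Lp_simps Rp_simps lam_0\<close>)

lemma runit_P:
  assumes Y: "Y \<in> obj C" and x: "x \<in> V U" and y: "y \<in> V Y"
  shows "Fm (tobj C Y U) Y (runit C Y) (P Y U y x) = (\<Sum>t<n. vscale (lam (Lp t x)) (Rp t y))"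
  using Y y unit_obj_in x
proof (induction y x rule: em_induct2)
  case (em a b i j g f)
  have "(\<Sum>t<n. vscale (lam (Lp t (em U i j f))) (Rp t (em Y a b g)))
    = (\<Sum>t<n. if t = i then (if b = i then vscale (lam (em U i j f)) (em Y a b g) else 0) else 0)"
    by (rule sum.cong[OF refl]) (auto simp: Rp_simps Lp_simps lam_0)
  also have "\<dots> = (if b = i then vscale (lam (em U i j f)) (em Y a b g) else 0)" using em by simp
  also have "\<dots> = Fm (tobj C Y U) Y (runit C Y) (P Y U (em Y a b g) (em U i j f))"
  proof (cases "b = i")
    case True
    then have g: "g \<in> hm Y a i" using em by simp
    have "cmp C (S a) (tobj C Y (S i)) (tobj C Y (S j)) (tmor C Y Y (S i) (S j) (ident C Y) (lm i j f)) g
      = (if i = j then hscale C (S a) (tobj C Y (S j)) (sc i (lm i j f)) g else hzero C (S a) (tobj C Y (S j)))"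
      by (subst lm_schur) (use em g Y in \<open>auto simp: tmor_scale_right cmp_scale_left tmor_ident\<close>)
    then show ?thesis using em g Y True
      by (auto simp: P_em Fm_em runit_pc lam_em em_scale)
  qed (use em Y in \<open>simp add: P_em\<close>)
  finally show ?case by simp
next
  case (add1 u w y)
  then show ?case using Y by (simp add: P_add Fm_add Rp_simps vscale_add sum.distrib)
next
  case (add2 x u w)
  then show ?case using Y by (simp add: P_add Fm_add Lp_simps lam_add vscale_add_left sum.distrib)
qed (use Y in \<open>simp_all add: P_add Lp_simps Rp_simps lam_0\<close>)

definition li :: "nat \<Rightarrow> 'm" where
  "li i = (SOME r. r \<in> hm U i i \<and> lm i i r = ident C (S i))"

lemma li: "i < n \<Longrightarrow> li i \<in> hm U i i" "i < n \<Longrightarrow> lm i i (li i) = ident C (S i)"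
proof -
  assume i: "i < n"
  have "\<exists>r. r \<in> hm U i i \<and> lm i i r = ident C (S i)"
    using lunit_iso[OF S_obj[OF i]] unfolding is_iso_def by blast
  from someI_ex[OF this] show "li i \<in> hm U i i" "lm i i (li i) = ident C (S i)" by (auto simp: li_def)
qed

definition eta :: "'k seq" where
  "eta = (\<Sum>i<n. em U i i (li i))"

lemma eta_in: "eta \<in> V U"
  unfolding eta_def by (rule csp_sum) (use li in auto)

lemma eta_proj: assumes "t < n" shows "Rp t eta = em U t t (li t)" "Lp t eta = em U t t (li t)"
proof -
  have "Rp t eta = (\<Sum>i<n. Rp t (em U i i (li i)))"
    unfolding eta_def by (rule lin_on_sum[OF Rp_lin[of U] subspace_csp]) (use li in auto)
  then show "Rp t eta = em U t t (li t)" using assms by (simp add: Rp_simps)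
  have "Lp t eta = (\<Sum>i<n. Lp t (em U i i (li i)))"
    unfolding eta_def by (rule lin_on_sum[OF Lp_lin[of U] subspace_csp]) (use li in auto)
  then show "Lp t eta = em U t t (li t)" using assms by (simp add: Lp_simps)
qed

lemma lam_eta: "t < n \<Longrightarrow> lam (Rp t eta) = 1" "t < n \<Longrightarrow> lam (Lp t eta) = 1"
  by (simp_all add: eta_proj lam_em li sc_ident)

lemma sum_Lp: "x \<in> V X \<Longrightarrow> (\<Sum>t<n. Lp t x) = x" and sum_Rp: "x \<in> V X \<Longrightarrow> (\<Sum>t<n. Rp t x) = x"
  by (auto simp: fun_eq_iff fun_sum_apply Lp_def Rp_def csp_def BB_def)

lemma frobenius_fibre_functor_split: "frobenius_fibre_functor C n S BB Fm P io n Lp Rp eta lam"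
proof (rule frobenius_fibre_functor.intro[OF monoidal_category_axioms linear_fibre_functor_split frobenius_fibre_functor_axioms.intro])
  show "Fm (tobj C U Y) Y (lunit C Y) (P U Y eta y) = y" if "Y \<in> obj C" "y \<in> V Y" for Y y
    using that by (simp add: lunit_P eta_in lam_eta sum_Lp)
  show "Fm (tobj C Y U) Y (runit C Y) (P Y U y eta) = y" if "Y \<in> obj C" "y \<in> V Y" for Y y
    using that by (simp add: runit_P eta_in lam_eta sum_Rp)
qed (rule P_bilin io_lin P_io io_P P_nat P_assoc Lp_lin Rp_lin Fm_Lp Fm_Rp P_Lp P_Rp Lp_Rp Lp_Lp eta_in lam_add lam_scale lunit_P runit_P; assumption)+

end

section \<open>Semisimple categories over an algebraically closed field\<close>

text \<open>A spanning family of minimal length is a basis: a nontrivial relation would make one of its members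
  redundant. The recursion matches the form of finite sums of morphisms.\<close>

lemma (in vspace_on) coordinates_ex:
  fixes lc :: "(nat \<Rightarrow> 'k) \<Rightarrow> (nat \<Rightarrow> 'm) \<Rightarrow> nat \<Rightarrow> 'm"
  defines "lc c b \<equiv> rec_nat zero (\<lambda>j s. add s (scale (c j) (b j)))"
  assumes span: "\<exists>n b. (\<forall>j<n. b j \<in> S) \<and> (\<forall>f\<in>S. \<exists>c. f = lc c b n)"
  shows "\<exists>d cr dc. (\<forall>f\<in>S. cr f \<in> csp {..<d} \<and> dc (cr f) = f) \<and> (\<forall>v\<in>csp {..<d}. dc v \<in> S \<and> cr (dc v) = v)
    \<and> (\<forall>f\<in>S. \<forall>g\<in>S. cr (add f g) = cr f + cr g) \<and> (\<forall>a. \<forall>f\<in>S. cr (scale a f) = vscale a (cr f))"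
proof -
  have lc0 [simp]: "lc c b 0 = zero" and lcS [simp]: "lc c b (Suc j) = add (lc c b j) (scale (c j) (b j))" for c b j
    by (simp_all add: lc_def)
  define Q where "Q n \<longleftrightarrow> (\<exists>b. (\<forall>j<n. b j \<in> S) \<and> (\<forall>f\<in>S. \<exists>c. f = lc c b n))" for n
  have "\<exists>n. Q n" using span unfolding Q_def .
  define n where "n = (LEAST n. Q n)"
  have "Q n" unfolding n_def by (rule LeastI_ex) fact
  then obtain b where b: "\<And>j. j < n \<Longrightarrow> b j \<in> S" "\<And>f. f \<in> S \<Longrightarrow> \<exists>c. f = lc c b n" unfolding Q_def by blast
  note [simp] = zero_in add_in scale_in
  have lc_in: "(\<And>j. j < m \<Longrightarrow> b j \<in> S) \<Longrightarrow> lc c b m \<in> S" for c b m by (induction m) auto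
  have swap: "add (add u v) (add w x) = add (add u w) (add v x)" if "u \<in> S" "v \<in> S" "w \<in> S" "x \<in> S" for u v w x
    using that by (simp add: add_assoc) (metis add_assoc add_commute add_in)
  have lc_add: "(\<And>j. j < m \<Longrightarrow> b j \<in> S) \<Longrightarrow> lc (\<lambda>j. c j + c' j) b m = add (lc c b m) (lc c' b m)" for c c' b m
  proof (induction m)
    case (Suc m)
    then show ?case using swap[of "lc c b m" "lc c' b m" "scale (c m) (b m)" "scale (c' m) (b m)"] lc_in
      by (simp add: scale_add_left)
  qed (simp add: add_zero)
  have lc_scale: "(\<And>j. j < m \<Longrightarrow> b j \<in> S) \<Longrightarrow> lc (\<lambda>j. a * c j) b m = scale a (lc c b m)" for a c b m
    by (induction m) (use lc_in in \<open>auto simp: scale_0_right scale_add_right scale_scale\<close>)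
  have lc_cong: "(\<And>j. j < m \<Longrightarrow> c j = c' j) \<Longrightarrow> (\<And>j. j < m \<Longrightarrow> b j = b' j) \<Longrightarrow> lc c b m = lc c' b' m" for c c' b b' m
    by (induction m) auto
  have indep: "c j = 0" if z: "lc c b n = zero" and j: "j < n" for c j
  proof (rule ccontr)
    assume cj: "c j \<noteq> 0"
    obtain n' where n': "n = Suc n'" using j by (cases n) auto
    define b' where "b' l = (if l < j then b l else b (Suc l))" for l
    have b'S: "b' l \<in> S" if "l < n'" for l using that b(1) n' j by (auto simp: b'_def)
    (* Omitting an index with coefficient zero does not change a linear combination. *)
    have drop: "lc e b m = lc (\<lambda>l. if l < j then e l else e (Suc l)) b' (m - 1)" if "j < m" "m \<le> n" "e j = 0" for e m
      using that
    proof (induction m)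
      case (Suc m)
      show ?case
      proof (cases "j = m")
        case True
        have "lc e b m = lc (\<lambda>l. if l < j then e l else e (Suc l)) b' m"
          by (rule lc_cong) (use True in \<open>auto simp: b'_def\<close>)
        moreover have "lc e b m \<in> S" by (rule lc_in) (use Suc.prems b in auto)
        ultimately show ?thesis using True Suc.prems b(1)[of m] by (simp add: scale_0_left add_zero_right)
      next
        case False
        then obtain m' where m': "m = Suc m'" "j \<le> m'" using Suc.prems by (cases m) auto
        then show ?thesis using Suc False by (simp add: b'_def)
      qed
    qed simp
    have "Q n'" unfolding Q_def
    proof (intro exI[of _ b'] conjI allI impI ballI)
      fix f assume "f \<in> S"
      then obtain e where e: "f = lc e b n" using b(2) by blast
      (* Subtracting a multiple of the relation makes the coefficient at j vanish. *)
      define e' where "e' l = e l + (- e j / c j) * c l" for l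
      have "lc e' b n = add (lc e b n) (lc (\<lambda>l. (- e j / c j) * c l) b n)"
        unfolding e'_def by (rule lc_add) (use b in auto)
      also have "\<dots> = f" using b lc_scale[of n b "- e j / c j" c] lc_in[of n b e] z e by (simp add: scale_0_right add_zero_right)
      finally have "f = lc e' b n" by simp
      also have "\<dots> = lc (\<lambda>l. if l < j then e' l else e' (Suc l)) b' (n - 1)"
        by (rule drop) (use j cj in \<open>auto simp: e'_def\<close>)
      finally show "\<exists>c. f = lc c b' n'" unfolding n' by auto
    qed (use b'S in auto)
    then show False using Least_le[of Q n'] n' unfolding n_def by simp
  qed
  have uniq: "c j = c' j" if "lc c b n = lc c' b n" "j < n" for c c' j
  proof -
    have "lc (\<lambda>l. c l + (-1) * c' l) b n = add (lc c b n) (lc (\<lambda>l. (-1) * c' l) b n)" by (rule lc_add) (use b in auto)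
    also have "\<dots> = add (lc (\<lambda>l. 1 * c' l) b n) (lc (\<lambda>l. (-1) * c' l) b n)" using that by simp
    also have "\<dots> = lc (\<lambda>l. 1 * c' l + (-1) * c' l) b n" by (rule lc_add[symmetric]) (use b in auto)
    also have "\<dots> = lc (\<lambda>l. 0 * c' l) b n" by simp
    also have "\<dots> = zero" using lc_scale[of n b 0 c'] b lc_in[of n b c'] by (simp add: scale_0_left)
    finally have "c j + (-1) * c' j = 0" using indep[of "\<lambda>l. c l + (-1) * c' l" j] that by simp
    then show ?thesis by simp
  qed
  define dc where "dc v = lc v b n" for v
  define cr where "cr f = (THE v. v \<in> csp {..<n} \<and> dc v = f)" for f
  have ex1: "\<exists>!v. v \<in> csp {..<n} \<and> dc v = f" if fS: "f \<in> S" for f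
  proof -
    obtain c where c: "f = lc c b n" using b(2)[OF fS] by blast
    let ?v = "\<lambda>j. if j < n then c j else 0"
    have "dc ?v = f" unfolding dc_def c by (rule lc_cong) auto
    moreover have "?v \<in> csp {..<n}" by (auto simp: csp_def)
    moreover have "v = w" if "v \<in> csp {..<n}" "w \<in> csp {..<n}" "dc v = dc w" for v w
    proof
      fix j show "v j = w j" using that uniq[of v w j] by (cases "j < n") (auto simp: dc_def csp_def)
    qed
    ultimately show ?thesis by blast
  qed
  have cr: "cr f \<in> csp {..<n}" "dc (cr f) = f" if "f \<in> S" for f
    using theI'[OF ex1[OF that]] unfolding cr_def by auto
  have dcS: "dc v \<in> S" for v unfolding dc_def by (rule lc_in) (use b in auto)
  have crdc: "cr (dc v) = v" if "v \<in> csp {..<n}" for v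
    using ex1[OF dcS[of v]] cr[OF dcS[of v]] that by blast
  have "cr (add f g) = cr f + cr g" if "f \<in> S" "g \<in> S" for f g
  proof -
    have "dc (cr f + cr g) = add f g"
      using lc_add[of n b "cr f" "cr g"] b cr that by (simp add: dc_def plus_fun_def fun_apply)
    then show ?thesis using crdc[of "cr f + cr g"] cr that vec.subspace_add[OF subspace_csp] by metis
  qed
  moreover have "cr (scale a f) = vscale a (cr f)" if "f \<in> S" for a f
  proof -
    have "dc (vscale a (cr f)) = scale a f"
      using lc_scale[of n b a "cr f"] b cr that by (simp add: dc_def vscale_def)
    then show ?thesis using crdc[of "vscale a (cr f)"] cr that vec.subspace_scale[OF subspace_csp] by metis
  qed
  ultimately show ?thesis using cr dcS crdc by (intro exI[of _ n] exI[of _ cr] exI[of _ dc]) auto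
qed

lemma (in linear_category) hom_coordinates:
  assumes "finite_dim_homs C" "X \<in> obj C" "Y \<in> obj C"
  shows "\<exists>d cr dc. (\<forall>f\<in>hom C X Y. cr f \<in> csp {..<d} \<and> dc (cr f) = f) \<and> (\<forall>v\<in>csp {..<d}. dc v \<in> hom C X Y \<and> cr (dc v) = v)
    \<and> (\<forall>f\<in>hom C X Y. \<forall>g\<in>hom C X Y. cr (hadd C X Y f g) = cr f + cr g)
    \<and> (\<forall>a. \<forall>f\<in>hom C X Y. cr (hscale C X Y a f) = vscale a (cr f))"
proof -
  interpret H: vspace_on "hom C X Y" "hzero C X Y" "hadd C X Y" "hscale C X Y" using hom_vspace assms by blast
  have eq: "hom_sum C X Y (\<lambda>j. hscale C X Y (c j) (b j)) n = rec_nat (hzero C X Y) (\<lambda>j s. hadd C X Y s (hscale C X Y (c j) (b j))) n" for c b n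
    by (induction n) auto
  have "\<exists>n b. (\<forall>j<n. b j \<in> hom C X Y) \<and> (\<forall>f\<in>hom C X Y. \<exists>c. f = rec_nat (hzero C X Y) (\<lambda>j s. hadd C X Y s (hscale C X Y (c j) (b j))) n)"
    using assms(2,3) assms(1)[unfolded finite_dim_homs_def, rule_format, of X Y] unfolding eq by blast
  then show ?thesis by (rule H.coordinates_ex)
qed

lemma csp_dependent:
  fixes w :: "nat \<Rightarrow> 'k::field seq"
  assumes "\<And>k. k \<le> d \<Longrightarrow> w k \<in> csp {..<d}"
  shows "\<exists>c. (\<Sum>k\<le>d. vscale (c k) (w k)) = 0 \<and> (\<exists>k\<le>d. c k \<noteq> 0)"
proof (cases "inj_on w {..d}")
  case False
  then obtain a b where ab: "a \<le> d" "b \<le> d" "a \<noteq> b" "w a = w b" by (auto simp: inj_on_def)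
  let ?c = "\<lambda>k. if k = a then 1 else if k = b then -1 else (0 :: 'k)"
  have "(\<Sum>k\<le>d. vscale (?c k) (w k)) = (\<Sum>k\<in>{a, b}. vscale (?c k) (w k))"
    by (rule sum.mono_neutral_right) (use ab in auto)
  also have "\<dots> = 0" using ab by simp
  finally show ?thesis using ab by (intro exI[of _ ?c]) auto
next
  case True
  let ?W = "w ` {..d}"
  have sp: "?W \<subseteq> vec.span (uv ` {..<d} :: 'k seq set)"
  proof
    fix v assume "v \<in> ?W"
    then have v: "v \<in> csp {..<d}" using assms by auto
    have "v = (\<Sum>i\<in>{..<d}. vscale (v i) (uv i))" by (rule csp_expand[OF _ v]) simp
    moreover have "(\<Sum>i\<in>{..<d}. vscale (v i) (uv i)) \<in> vec.span (uv ` {..<d} :: 'k seq set)"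
      by (intro vec.span_sum vec.span_scale vec.span_base) auto
    ultimately show "v \<in> vec.span (uv ` {..<d})" by (rule ssubst[where P = "\<lambda>x. x \<in> vec.span (uv ` {..<d})"])
  qed
  have "\<not> vec.independent ?W"
  proof
    assume "vec.independent ?W"
    then have "card ?W \<le> card (uv ` {..<d} :: 'k seq set)" using vec.independent_span_bound[OF _ _ sp] by simp
    also have "\<dots> \<le> d" using card_image_le[of "{..<d}" uv] by simp
    finally show False using card_image[OF True] by simp
  qed
  then obtain u where u: "(\<Sum>v\<in>?W. vscale (u v) v) = 0" "\<exists>v\<in>?W. u v \<noteq> 0"
    using vec.dependent_finite[of ?W] by auto
  have "(\<Sum>k\<le>d. vscale (u (w k)) (w k)) = (\<Sum>v\<in>?W. vscale (u v) v)"
    by (rule sum.reindex[OF True, symmetric, unfolded o_def])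
  then show ?thesis using u by (intro exI[of _ "\<lambda>k. u (w k)"]) auto
qed

text \<open>By linear dependence some nonzero polynomial \<open>p\<close> satisfies \<open>p(T) w0 = 0\<close>. Splitting off linear factors of
  \<open>p\<close> one at a time, the first quotient \<open>q\<close> with \<open>q(T) w0 \<noteq> 0\<close> gives an eigenvector \<open>q(T) w0\<close>.\<close>

lemma operator_eigenvector_ex:
  fixes T :: "'k::alg_closed_field seq \<Rightarrow> 'k seq"
  assumes T: "lin_on (csp {..<d}) (csp {..<d}) T" and w0: "(w0 :: 'k seq) \<in> csp {..<d}" "w0 \<noteq> 0"
  shows "\<exists>r v. v \<in> csp {..<d} \<and> v \<noteq> 0 \<and> T v = vscale r v"
proof -
  define w where "w k = (T ^^ k) w0" for k
  have w: "w k \<in> csp {..<d}" for k by (induction k) (use w0 lin_on_in[OF T] in \<open>auto simp: w_def\<close>)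
  have Tw: "T (w k) = w (Suc k)" for k by (simp add: w_def)
  (* The vector p(T) w0. *)
  define pe where "pe p = (\<Sum>k\<le>degree p. vscale (coeff p k) (w k))" for p
  have pe_in: "pe p \<in> csp {..<d}" for p
    unfolding pe_def by (rule vec.subspace_sum[OF subspace_csp], rule vec.subspace_scale[OF subspace_csp w])
  have peN: "pe p = (\<Sum>k\<le>N. vscale (coeff p k) (w k))" if "degree p \<le> N" for p N
    unfolding pe_def by (rule sum.mono_neutral_left) (use that in \<open>auto simp: coeff_eq_0\<close>)
  have step: "pe ([:- r, 1:] * q) = T (pe q) - vscale r (pe q)" for r q
  proof -
    let ?N = "degree q"
    have dle: "degree ([:- r, 1:] * q) \<le> Suc ?N" by (rule order.trans[OF degree_mult_le]) simp
    have "pe ([:- r, 1:] * q) = (\<Sum>k\<le>Suc ?N. vscale (coeff ([:- r, 1:] * q) k) (w k))" by (rule peN[OF dle])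
    also have "\<dots> = (\<Sum>k\<le>Suc ?N. vscale (case k of 0 \<Rightarrow> 0 | Suc l \<Rightarrow> coeff q l) (w k) - vscale r (vscale (coeff q k) (w k)))"
      by (rule sum.cong) (auto simp: coeff_pCons vec.scale_left_diff_distrib split: nat.splits)
    also have "\<dots> = (\<Sum>k\<le>Suc ?N. vscale (case k of 0 \<Rightarrow> 0 | Suc l \<Rightarrow> coeff q l) (w k)) - vscale r (\<Sum>k\<le>Suc ?N. vscale (coeff q k) (w k))"
      unfolding sum_subtractf vscale_sum ..
    also have "(\<Sum>k\<le>Suc ?N. vscale (case k of 0 \<Rightarrow> 0 | Suc l \<Rightarrow> coeff q l) (w k)) = (\<Sum>k\<le>?N. vscale (coeff q k) (w (Suc k)))"
      by (subst sum.atMost_Suc_shift) simp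
    also have "\<dots> = T (pe q)"
      unfolding pe_def by (subst lin_on_sum[OF T subspace_csp])
        (use w in \<open>auto simp: lin_on_scale[OF T] Tw vec.subspace_scale\<close>)
    also have "(\<Sum>k\<le>Suc ?N. vscale (coeff q k) (w k)) = pe q" by (rule peN[symmetric]) simp
    finally show ?thesis .
  qed
  obtain c where c: "(\<Sum>k\<le>d. vscale (c k) (w k)) = 0" "\<exists>k\<le>d. c k \<noteq> 0" using csp_dependent[of d w] w by blast
  define p where "p = (\<Sum>k\<le>d. monom (c k) k)"
  have cp: "coeff p k = (if k \<le> d then c k else 0)" for k by (simp add: p_def coeff_sum)
  have "p \<noteq> 0" using c(2) cp by (metis coeff_0)
  moreover have "degree p \<le> d" by (rule degree_le) (simp add: cp)
  then have "pe p = 0" using peN[of p d] c(1) by (simp add: cp)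
  ultimately show ?thesis
  proof (induction "degree p" arbitrary: p rule: less_induct)
    case less
    show ?case
    proof (cases "degree p = 0")
      case True
      then have "pe p = vscale (coeff p 0) w0" by (simp add: pe_def w_def)
      moreover have "coeff p 0 \<noteq> 0" using less.prems(1) True leading_coeff_0_iff[of p] by simp
      ultimately have False using less.prems(2) w0 by simp
      then show ?thesis ..
    next
      case False
      then obtain r where "poly p r = 0" using alg_closed_imp_poly_has_root[of p] by auto
      then obtain q where q: "p = [:- r, 1:] * q" by (auto simp: poly_eq_0_iff_dvd)
      have q0: "q \<noteq> 0" using q less.prems(1) by auto
      have "degree p = Suc (degree q)" unfolding q using q0 by (subst degree_mult_eq) auto
      show ?thesis
      proof (cases "pe q = 0")
        case True
        then show ?thesis using less.hyps[of q] q0 \<open>degree p = Suc (degree q)\<close> by simp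
      next
        case False
        have "T (pe q) = vscale r (pe q)" using less.prems(2) step[of r q] q by simp
        then show ?thesis using False pe_in by blast
      qed
    qed
  qed
qed

context abelian_category
begin

text \<open>Schur's lemma. The kernel of \<open>f\<close> is zero because \<open>S\<close> is simple, so \<open>f\<close> is a monomorphism into the simple
  object \<open>T\<close>.\<close>

lemma nonzero_simple_iso:
  assumes S: "is_simple C S" and T: "is_simple C T" and f: "f \<in> hom C S T" "f \<noteq> hzero C S T"
  shows "is_iso C S T f"
proof -
  have o [simp]: "S \<in> obj C" "T \<in> obj C" using S T by (auto simp: is_simple_def)
  obtain K i where K: "is_kernel C S T f K i" using kernel_ex[OF o f(1)] by blast
  then have k: "K \<in> obj C" "i \<in> hom C K S" "cmp C K S T f i = hzero C K T"
    and univ: "\<And>Z g. \<lbrakk>Z \<in> obj C; g \<in> hom C Z S; cmp C Z S T f g = hzero C Z T\<rbrakk> \<Longrightarrow> \<exists>!u. u \<in> hom C Z K \<and> cmp C Z K S i u = g"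
    by (auto simp: is_kernel_def)
  have "is_mono C K S i" unfolding is_mono_def
  proof (intro conjI ballI impI)
    fix Z g h assume Z: "Z \<in> obj C" "g \<in> hom C Z K" "h \<in> hom C Z K" "cmp C Z K S i g = cmp C Z K S i h"
    have "cmp C Z S T f (cmp C Z K S i g) = hzero C Z T" using Z k f by (simp flip: cmp_assoc)
    then show "g = h" using univ[of Z "cmp C Z K S i g"] Z k by auto
  qed (rule k)
  then consider "is_zero_obj C K" | "is_iso C K S i" using S k unfolding is_simple_def by blast
  then show ?thesis
  proof cases
    case 2
    then have "f = hzero C S T"
      using iso_cancel_right[OF k(1) o(1) o(2) 2 f(1) hom_facts(1)[OF o]] k by simp
    then show ?thesis using f(2) by simp
  next
    case 1
    have z: "g = hzero C Z K" if "Z \<in> obj C" "g \<in> hom C Z K" for Z g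
    proof -
      have "ident C K = hzero C K K" using 1 by (simp add: is_zero_obj_def)
      then have "cmp C Z K K (hzero C K K) g = g" using ident_left[of Z K g] that k by metis
      then show ?thesis using that k by simp
    qed
    have sep: "g = h" if Z: "Z \<in> obj C" "g \<in> hom C Z S" "h \<in> hom C Z S" "cmp C Z S T f g = cmp C Z S T f h" for Z g h
    proof -
      interpret H: vspace_on "hom C Z S" "hzero C Z S" "hadd C Z S" "hscale C Z S" using hom_vspace Z by simp
      obtain h' where h': "h' \<in> hom C Z S" "hadd C Z S h h' = hzero C Z S" using H.add_inverse Z by blast
      have "cmp C Z S T f (hadd C Z S g h') = cmp C Z S T f (hadd C Z S h h')"
        using Z h'(1) f by (simp add: cmp_add_right)
      also have "\<dots> = hzero C Z T" using Z f by (simp add: h'(2))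
      finally have "cmp C Z S T f (hadd C Z S g h') = hzero C Z T" .
      then obtain u where "u \<in> hom C Z K" "cmp C Z K S i u = hadd C Z S g h'" using univ[of Z "hadd C Z S g h'"] Z h' by auto
      then have "hadd C Z S g h' = hzero C Z S" using z[of Z u] Z k by simp
      then have "hadd C Z S h' g = hadd C Z S h' h" using h' Z H.add_commute by simp
      then show ?thesis using H.add_cancel h' Z by blast
    qed
    then have "is_mono C S T f" using f by (auto simp: is_mono_def)
    then show ?thesis using T S unfolding is_simple_def by blast
  qed
qed

end

text \<open>Composition with \<open>f\<close> is an operator on the finite dimensional space \<open>Hom(S, S)\<close> and has an eigenvector
  \<open>g \<noteq> 0\<close> with eigenvalue \<open>r\<close>. Then \<open>(f - r) g = 0\<close>, so \<open>f - r\<close> is not invertible and vanishes.\<close>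

lemma schur_scalar:
  fixes C :: "('o, 'm, 'k::alg_closed_field, 'z) lin_cat_scheme"
  assumes C: "abelian_category C" and fd: "finite_dim_homs C" and S: "is_simple C S" and f: "f \<in> hom C S S"
  shows "\<exists>c. f = hscale C S S c (ident C S)"
proof -
  interpret abelian_category C by fact
  have o [simp]: "S \<in> obj C" and nz: "ident C S \<noteq> hzero C S S" using S by (auto simp: is_simple_def is_zero_obj_def)
  obtain d cr dc where cr: "\<And>g. g \<in> hom C S S \<Longrightarrow> cr g \<in> csp {..<d} \<and> dc (cr g) = g"
    "\<And>v. v \<in> csp {..<d} \<Longrightarrow> dc v \<in> hom C S S \<and> cr (dc v) = v"
    "\<And>g h. \<lbrakk>g \<in> hom C S S; h \<in> hom C S S\<rbrakk> \<Longrightarrow> cr (hadd C S S g h) = cr g + cr h"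
    "\<And>a g. g \<in> hom C S S \<Longrightarrow> cr (hscale C S S a g) = vscale a (cr g)"
    using hom_coordinates[OF fd o o] by blast
  have cr0: "cr (hzero C S S) = 0" using cr(4)[of "hzero C S S" 0] by simp
  have inj: "g = h" if "g \<in> hom C S S" "h \<in> hom C S S" "cr g = cr h" for g h using that cr(1) by metis
  have dca: "dc (u + v) = hadd C S S (dc u) (dc v)" if "u \<in> csp {..<d}" "v \<in> csp {..<d}" for u v
  proof (rule inj)
    have "u + v \<in> csp {..<d}" by (rule vec.subspace_add[OF subspace_csp that])
    then show "dc (u + v) \<in> hom C S S" "cr (dc (u + v)) = cr (hadd C S S (dc u) (dc v))"
      using cr(2)[of "u + v"] cr(2)[of u] cr(2)[of v] cr(3)[of "dc u" "dc v"] that by simp_all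
    show "hadd C S S (dc u) (dc v) \<in> hom C S S" using cr(2) that by simp
  qed
  have dcs: "dc (vscale a u) = hscale C S S a (dc u)" if "u \<in> csp {..<d}" for a u
  proof (rule inj)
    have "vscale a u \<in> csp {..<d}" by (rule vec.subspace_scale[OF subspace_csp that])
    then show "dc (vscale a u) \<in> hom C S S" "cr (dc (vscale a u)) = cr (hscale C S S a (dc u))"
      using cr(2)[of "vscale a u"] cr(2)[of u] cr(4)[of "dc u" a] that by simp_all
    show "hscale C S S a (dc u) \<in> hom C S S" using cr(2) that by simp
  qed
  define T where "T v = cr (cmp C S S S f (dc v))" for v
  have "lin_on (csp {..<d}) (csp {..<d}) T"
    by (rule lin_onI) (use f cr in \<open>simp_all add: T_def dca dcs cmp_add_right cmp_scale_right\<close>)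
  moreover have "cr (ident C S) \<noteq> 0" using inj[of "ident C S" "hzero C S S"] cr0 nz by auto
  ultimately obtain r v where v: "v \<in> csp {..<d}" "v \<noteq> 0" "T v = vscale r v"
    using operator_eigenvector_ex[of d T "cr (ident C S)"] cr(1)[of "ident C S"] by auto
  let ?g = "dc v" and ?h = "hadd C S S f (hscale C S S (- r) (ident C S))"
  have g: "?g \<in> hom C S S" "?g \<noteq> hzero C S S" using cr(2)[OF v(1)] v(2) cr0 by auto
  interpret H: vspace_on "hom C S S" "hzero C S S" "hadd C S S" "hscale C S S" using hom_vspace by simp
  have "cmp C S S S f ?g = hscale C S S r ?g"
    by (rule inj) (use v g f cr in \<open>simp_all add: T_def\<close>)
  then have hg: "cmp C S S S ?h ?g = hzero C S S"
    using g f H.scale_add_left[of ?g r "- r"] by (simp add: cmp_add_left cmp_scale_left)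
  have h: "?h \<in> hom C S S" using f by simp
  have "?h = hzero C S S"
  proof (rule ccontr)
    assume "?h \<noteq> hzero C S S"
    then have "is_iso C S S ?h" using nonzero_simple_iso[OF S S h] by blast
    then have "?g = hzero C S S"
      using iso_cancel_left[OF o o o, of ?h ?g "hzero C S S"] g hg h by simp
    then show False using g(2) by blast
  qed
  moreover have "hadd C S S (hscale C S S r (ident C S)) (hscale C S S (- r) (ident C S)) = hzero C S S"
    using H.scale_add_left[of "ident C S" r "- r"] by simp
  ultimately have "f = hscale C S S r (ident C S)"
    using H.add_cancel[of "hscale C S S (- r) (ident C S)" f "hscale C S S r (ident C S)"] f
      H.add_commute[of f "hscale C S S (- r) (ident C S)"] H.add_commute[of "hscale C S S r (ident C S)" "hscale C S S (- r) (ident C S)"] by simp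
  then show ?thesis by blast
qed

lemma finite_representatives:
  assumes "finite R" "\<And>x y z. \<lbrakk>x \<in> R; y \<in> R; z \<in> R; E x y; E y z\<rbrakk> \<Longrightarrow> E x z" "\<And>x y. \<lbrakk>x \<in> R; y \<in> R; E x y\<rbrakk> \<Longrightarrow> E y x"
    "\<And>x. x \<in> R \<Longrightarrow> E x x"
  shows "\<exists>n S. (\<forall>i<(n::nat). S i \<in> R) \<and> (\<forall>i<n. \<forall>j<n. i \<noteq> j \<longrightarrow> \<not> E (S i) (S j)) \<and> (\<forall>x\<in>R. \<exists>i<n. E x (S i))"
  using assms
proof (induction R rule: finite_induct)
  case empty
  show ?case by (rule exI[of _ 0]) simp
next
  case (insert a F)
  have "\<exists>n S. (\<forall>i<(n::nat). S i \<in> F) \<and> (\<forall>i<n. \<forall>j<n. i \<noteq> j \<longrightarrow> \<not> E (S i) (S j)) \<and> (\<forall>x\<in>F. \<exists>i<n. E x (S i))"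
  proof (rule insert.IH)
    show "E x z" if "x \<in> F" "y \<in> F" "z \<in> F" "E x y" "E y z" for x y z
      using insert.prems(1)[of x y z] that by simp
  qed (use insert.prems(2,3) in simp_all)
  then obtain n S where S: "\<forall>i<(n::nat). S i \<in> F" "\<forall>i<n. \<forall>j<n. i \<noteq> j \<longrightarrow> \<not> E (S i) (S j)" "\<forall>x\<in>F. \<exists>i<n. E x (S i)"
    by blast
  show ?case
  proof (cases "\<exists>i<n. E a (S i)")
    case True
    then show ?thesis using S by (intro exI[of _ n] exI[of _ S]) auto
  next
    case False
    have "\<not> E (S i) a" if "i < n" for i using False insert.prems(2)[of "S i" a] S(1) that by auto
    moreover have "\<exists>i<Suc n. E x ((S(n := a)) i)" if x: "x \<in> insert a F" for x
    proof (cases "x = a")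
      case True
      then show ?thesis using insert.prems(3)[OF x] by (intro exI[of _ n]) simp
    next
      case False
      then obtain i where "i < n" "E x (S i)" using x S(3) by blast
      then show ?thesis by (intro exI[of _ i]) simp
    qed
    ultimately show ?thesis using S(1,2) False
      by (intro exI[of _ "Suc n"] exI[of _ "S(n := a)"]) (auto simp: less_Suc_eq)
  qed
qed

text \<open>Decompositions into arbitrary simple objects are replaced by decompositions into chosen representatives of
  their isomorphism classes, by composing inclusions and projections with isomorphisms.\<close>

lemma split_monoidal_ex:
  fixes C :: "('o, 'm, 'k::alg_closed_field, 'z) mon_cat_scheme"
  assumes "monoidal_category C" and ab: "abelian_category C" and ss: "semisimple C"
    and fd: "finite_dim_homs C" and fs: "finitely_many_simples C"
  shows "\<exists>n S dim cr dc. split_monoidal C n S dim cr dc"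
proof -
  interpret monoidal_category C by fact
  interpret abelian_category C by fact
  obtain R where R: "finite R" "\<And>S. S \<in> R \<Longrightarrow> is_simple C S" "\<And>X. is_simple C X \<Longrightarrow> \<exists>S\<in>R. isomorphic C X S"
    using fs unfolding finitely_many_simples_def by blast
  have Ro: "x \<in> obj C" if "x \<in> R" for x using R(2)[OF that] by (simp add: is_simple_def)
  have iso_refl: "isomorphic C x x" if "x \<in> obj C" for x
    unfolding isomorphic_def using is_isoI[of "ident C x" x x "ident C x"] that by auto
  have iso_sym: "isomorphic C y x" if "isomorphic C x y" for x y
    using that unfolding isomorphic_def is_iso_def by blast
  have iso_trans: "isomorphic C x z" if "isomorphic C x y" "isomorphic C y z" "x \<in> obj C" "y \<in> obj C" "z \<in> obj C" for x y z
    using that iso_cmp unfolding isomorphic_def by blast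
  have "\<exists>n S. (\<forall>i<(n::nat). S i \<in> R) \<and> (\<forall>i<n. \<forall>j<n. i \<noteq> j \<longrightarrow> \<not> isomorphic C (S i) (S j)) \<and> (\<forall>x\<in>R. \<exists>i<n. isomorphic C x (S i))"
    by (rule finite_representatives[OF R(1)]) (use Ro iso_refl iso_sym iso_trans in blast)+
  then obtain n :: nat and S where S0: "\<forall>i<n. S i \<in> R" "\<forall>i<n. \<forall>j<n. i \<noteq> j \<longrightarrow> \<not> isomorphic C (S i) (S j)"
    "\<forall>x\<in>R. \<exists>i<n. isomorphic C x (S i)" by (elim exE conjE)
  note S = S0[rule_format]
  have So: "S i \<in> obj C" and Ss: "is_simple C (S i)" if "i < n" for i using S(1)[OF that] R(2) Ro by auto
  have simp_iso: "\<exists>i<n. isomorphic C X (S i)" if X: "is_simple C X" for X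
  proof -
    obtain T where T: "T \<in> R" "isomorphic C X T" using R(3)[OF X] by blast
    obtain i where "i < n" "isomorphic C T (S i)" using S(3)[OF T(1)] by blast
    then show ?thesis using iso_trans[of X T "S i"] T Ro So X by (auto simp: is_simple_def)
  qed
  have dec: "\<exists>m \<sigma> i p. (\<forall>j<m. \<sigma> j < n) \<and> direct_sum C m (\<lambda>j. S (\<sigma> j)) X i p" if X: "X \<in> obj C" for X
  proof -
    obtain m T i p where T: "\<forall>j<m. is_simple C (T j)" and d: "direct_sum C m T X i p"
      using ss X unfolding semisimple_def by blast
    note dd = direct_sumD[OF d]
    have "\<exists>s f g. j < m \<longrightarrow> s < n \<and> f \<in> hom C (T j) (S s) \<and> g \<in> hom C (S s) (T j) \<and>
       cmp C (T j) (S s) (T j) g f = ident C (T j) \<and> cmp C (S s) (T j) (S s) f g = ident C (S s)" for j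
      using simp_iso[of "T j"] T unfolding isomorphic_def is_iso_def by blast
    then obtain \<sigma> f g where s: "\<And>j. j < m \<Longrightarrow> \<sigma> j < n"
      and fg: "\<And>j. j < m \<Longrightarrow> f j \<in> hom C (T j) (S (\<sigma> j))" "\<And>j. j < m \<Longrightarrow> g j \<in> hom C (S (\<sigma> j)) (T j)"
      and gf: "\<And>j. j < m \<Longrightarrow> cmp C (T j) (S (\<sigma> j)) (T j) (g j) (f j) = ident C (T j)"
      "\<And>j. j < m \<Longrightarrow> cmp C (S (\<sigma> j)) (T j) (S (\<sigma> j)) (f j) (g j) = ident C (S (\<sigma> j))" by metis
    define i' where "i' j = cmp C (S (\<sigma> j)) (T j) X (i j) (g j)" for j
    define p' where "p' j = cmp C X (T j) (S (\<sigma> j)) (f j) (p j)" for j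
    have "direct_sum C m (\<lambda>j. S (\<sigma> j)) X i' p'" unfolding direct_sum_def
    proof (intro conjI allI impI)
      fix j assume j: "j < m"
      show "S (\<sigma> j) \<in> obj C" using s[OF j] So by simp
      show "i' j \<in> hom C (S (\<sigma> j)) X" "p' j \<in> hom C X (S (\<sigma> j))"
        using j s So fg dd by (auto simp: i'_def p'_def)
      fix l assume l: "l < m"
      note [simp] = So[OF s] fg dd(1-4) j l
      have "cmp C (S (\<sigma> j)) X (S (\<sigma> l)) (p' l) (i' j)
        = cmp C (S (\<sigma> j)) (T l) (S (\<sigma> l)) (f l) (cmp C (S (\<sigma> j)) (T j) (T l) (cmp C (T j) X (T l) (p l) (i j)) (g j))"
        by (simp add: i'_def p'_def cmp_assoc)
      also have "\<dots> = (if j = l then ident C (S (\<sigma> j)) else hzero C (S (\<sigma> j)) (S (\<sigma> l)))"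
        using dd(5)[OF j l] gf[OF j] by auto
      finally show "cmp C (S (\<sigma> j)) X (S (\<sigma> l)) (p' l) (i' j) = (if j = l then ident C (S (\<sigma> j)) else hzero C (S (\<sigma> j)) (S (\<sigma> l)))" .
    next
      have "cmp C X (S (\<sigma> j)) X (i' j) (p' j) = cmp C X (T j) X (i j) (p j)" if j: "j < m" for j
      proof -
        note [simp] = So[OF s] fg dd(1-4) j
        have "cmp C X (S (\<sigma> j)) X (i' j) (p' j) = cmp C X (T j) X (i j) (cmp C X (T j) (T j) (cmp C (T j) (S (\<sigma> j)) (T j) (g j) (f j)) (p j))"
          by (simp add: i'_def p'_def cmp_assoc)
        then show ?thesis by (simp add: gf)
      qed
      then show "hom_sum C X X (\<lambda>j. cmp C X (S (\<sigma> j)) X (i' j) (p' j)) m = ident C X"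
        using dd(6) hom_sum_cong[of m "\<lambda>j. cmp C X (S (\<sigma> j)) X (i' j) (p' j)" "\<lambda>j. cmp C X (T j) X (i j) (p j)"] by simp
    qed (rule X)
    then show ?thesis using s by blast
  qed
  have "\<exists>d cr dc. X \<in> obj C \<longrightarrow> Y \<in> obj C \<longrightarrow> (\<forall>f\<in>hom C X Y. cr f \<in> csp {..<d} \<and> dc (cr f) = f) \<and> (\<forall>v\<in>csp {..<d}. dc v \<in> hom C X Y \<and> cr (dc v) = v)
    \<and> (\<forall>f\<in>hom C X Y. \<forall>g\<in>hom C X Y. cr (hadd C X Y f g) = cr f + cr g)
    \<and> (\<forall>a. \<forall>f\<in>hom C X Y. cr (hscale C X Y a f) = vscale a (cr f))" for X Y
    using hom_coordinates[OF fd, of X Y] by blast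
  then obtain dim cr dc where crd: "\<And>X Y. X \<in> obj C \<longrightarrow> Y \<in> obj C \<longrightarrow> (\<forall>f\<in>hom C X Y. cr X Y f \<in> csp {..<dim X Y} \<and> dc X Y (cr X Y f) = f)
    \<and> (\<forall>v\<in>csp {..<dim X Y}. dc X Y v \<in> hom C X Y \<and> cr X Y (dc X Y v) = v)
    \<and> (\<forall>f\<in>hom C X Y. \<forall>g\<in>hom C X Y. cr X Y (hadd C X Y f g) = cr X Y f + cr X Y g)
    \<and> (\<forall>a. \<forall>f\<in>hom C X Y. cr X Y (hscale C X Y a f) = vscale a (cr X Y f))" by metis
  have "split_monoidal C n S dim cr dc"
  proof (intro split_monoidal.intro split_monoidal_axioms.intro monoidal_category_axioms)
    show "ident C (S i) \<noteq> hzero C (S i) (S i)" if "i < n" for i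
      using Ss[OF that] by (auto simp: is_simple_def is_zero_obj_def)
    show "\<exists>c. f = hscale C (S i) (S i) c (ident C (S i))" if "i < n" "f \<in> hom C (S i) (S i)" for i f
      by (rule schur_scalar[OF ab fd Ss[OF that(1)] that(2)])
    show "f = hzero C (S i) (S j)" if "i < n" "j < n" "i \<noteq> j" "f \<in> hom C (S i) (S j)" for i j f
      using nonzero_simple_iso[OF Ss Ss, of i j f] S(2)[OF that(1-3)] that unfolding isomorphic_def by blast
    show "\<exists>X i p. direct_sum C m (\<lambda>j. S (\<sigma> j)) X i p" if "\<forall>j<m. \<sigma> j < n" for m \<sigma>
      using direct_sum_ex[of m "\<lambda>j. S (\<sigma> j)"] that So by blast
  qed (use So dec crd in auto)
  then show ?thesis by blast
qed

theorem theorem4: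
  fixes C :: "('o, 'm, 'k::alg_closed_field) mon_cat"
  assumes "monoidal_category C"
    and "abelian_category C"
    and "semisimple C"
    and "finite_dim_homs C"
    and "finitely_many_simples C"
  shows "\<exists>H :: 'k wbialg. weak_bialgebra H \<and> monoidally_equivalent C (Rep H) \<and> commutative_base H"
proof -
  obtain n S dim cr dc where "split_monoidal C n S dim cr dc" using split_monoidal_ex[OF assms] by blast
  then interpret split_monoidal C n S dim cr dc .
  show ?thesis by (rule frobenius_fibre_functor.reconstruction[OF frobenius_fibre_functor_split])
qed

end
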